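(* Let $\Lambda$ be an artin algebra and let $\mathcal{E}$ be a contravariantly finite resolving subcategory of $\mathsf{mod}\,\Lambda$. Then the following are equivalent. (1) $\mathcal{E}$ is of finite type. (2) $\mathsf{AR}(\mathcal{E}) = \mathsf{Ex}(\mathcal{E})$ holds.
   Context: All categories are additive, and all subcategories are additive, full and closed under isomorphisms. An artin algebra is an algebra over a commutative artinian local ring $R$ which is finitely generated as an $R$-module; $\mathsf{mod}\,\Lambda$ is the category of finitely generated $\Lambda$-modules. A subcategory $\mathcal{E}$ of $\mathsf{mod}\,\Lambda$ is resolving if it contains $\Lambda$, is closed under extensions, under kernels of surjections between objects of $\mathcal{E}$, and under direct summands. It is contravariantly finite if every $X \in \mathsf{mod}\,\Lambda$ has a right $\mathcal{E}$-approximation, i.e. a morphism $E_X \to X$ with $E_X\in\mathcal{E}$ through which every morphism $E\to X$ with $E \in \mathcal{E}$ factors. A resolving subcategory is regarded as an exact category whose conflations are the short exact sequences of $\mathsf{mod}\,\Lambda$ with all terms in $\mathcal{E}$; it is Krull-Schmidt here. $\mathcal{E}$ is of finite type if $\mathcal{E}=\mathsf{add}\,G$ for some $G\in\mathcal{E}$, where $\mathsf{add}\,G$ consists of all direct summands of finite direct sums of $G$; for Krull-Schmidt $\mathcal{E}$ this means that there are only finitely many indecomposable objects up to isomorphism. For a Krull-Schmidt exact category $\mathcal{E}$ with Jacobson radical $\mathcal{J}$: a morphism $g:Y\to Z$ is right almost split if $Z$ is indecomposable, $g\in\mathcal{J}$, and any $h: W\to Z$ in $\mathcal{J}$ factors through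 $g$; left almost split is the dual notion. A conflation $0\to X\xrightarrow{f}Y\xrightarrow{g}Z\to 0$ is an AR conflation if $f$ is left almost split and $g$ is right almost split. $\mathsf{K}_0(\mathcal{E},0)$ is the free abelian group on the set $\mathsf{ind}\,\mathcal{E}$ of isomorphism classes of indecomposable objects, where for $X\cong\bigoplus X_i$ with $X_i$ indecomposable one puts $[X]=\sum [X_i]$. $\mathsf{Ex}(\mathcal{E})$ (resp. $\mathsf{AR}(\mathcal{E})$) is the subgroup of $\mathsf{K}_0(\mathcal{E},0)$ generated by $[X]-[Y]+[Z]$ for all conflations (resp. all AR conflations) $0\to X\to Y\to Z\to 0$ in $\mathcal{E}$. *)

theory Defs
  imports
    "HOL-Algebra.Module"
    "HOL-Algebra.Ideal"
    "HOL-Algebra.Generated_Groups"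
    "HOL-Algebra.Free_Abelian_Groups"
begin

section \<open>Finitely generated modules over a ring\<close>

text \<open>
  The locale \<^locale>\<open>module\<close> of the library demands a commutative base ring, so left modules over an
  arbitrary ring are introduced here, on the same records. The fields for ring multiplication and
  unit of a module record carry no information.
\<close>

locale left_module = R?: ring R + M?: abelian_group M for R (structure) and M (structure) +
  assumes smult_closed [simp, intro]:
      "\<lbrakk>a \<in> carrier R; x \<in> carrier M\<rbrakk> \<Longrightarrow> a \<odot>\<^bsub>M\<^esub> x \<in> carrier M"
    and smult_l_distr:
      "\<lbrakk>a \<in> carrier R; b \<in> carrier R; x \<in> carrier M\<rbrakk> \<Longrightarrow>
      (a \<oplus> b) \<odot>\<^bsub>M\<^esub> x = a \<odot>\<^bsub>M\<^esub> x \<oplus>\<^bsub>M\<^esub> b \<odot>\<^bsub>M\<^esub> x"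
    and smult_r_distr:
      "\<lbrakk>a \<in> carrier R; x \<in> carrier M; y \<in> carrier M\<rbrakk> \<Longrightarrow>
      a \<odot>\<^bsub>M\<^esub> (x \<oplus>\<^bsub>M\<^esub> y) = a \<odot>\<^bsub>M\<^esub> x \<oplus>\<^bsub>M\<^esub> a \<odot>\<^bsub>M\<^esub> y"
    and smult_assoc1:
      "\<lbrakk>a \<in> carrier R; b \<in> carrier R; x \<in> carrier M\<rbrakk> \<Longrightarrow>
      (a \<otimes> b) \<odot>\<^bsub>M\<^esub> x = a \<odot>\<^bsub>M\<^esub> (b \<odot>\<^bsub>M\<^esub> x)"
    and smult_one [simp]:
      "x \<in> carrier M \<Longrightarrow> \<one> \<odot>\<^bsub>M\<^esub> x = x"

definition finitely_generated ::
  "('a, 'k) ring_scheme \<Rightarrow> ('a, 'b, 'l) module_scheme \<Rightarrow> bool" where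
  "finitely_generated R M \<longleftrightarrow>
    (\<exists>S. finite S \<and> S \<subseteq> carrier M \<and>
      (\<forall>N. submodule N R M \<and> S \<subseteq> N \<longrightarrow> N = carrier M))"

definition fg_mod :: "('a, 'k) ring_scheme \<Rightarrow> ('a, 'm) module set" where
  "fg_mod \<Lambda> = {M. left_module \<Lambda> M \<and> finitely_generated \<Lambda> M}"

definition mod_hom ::
  "('a, 'k) ring_scheme \<Rightarrow> ('a, 'b) module \<Rightarrow> ('a, 'c) module \<Rightarrow> ('b \<Rightarrow> 'c) set" where
  "mod_hom \<Lambda> X Y = {h \<in> hom (add_monoid X) (add_monoid Y).
     \<forall>a \<in> carrier \<Lambda>. \<forall>x \<in> carrier X. h (a \<odot>\<^bsub>X\<^esub> x) = a \<odot>\<^bsub>Y\<^esub> h x}"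

definition mod_iso ::
  "('a, 'k) ring_scheme \<Rightarrow> ('a, 'b) module \<Rightarrow> ('a, 'c) module \<Rightarrow> ('b \<Rightarrow> 'c) set" where
  "mod_iso \<Lambda> X Y = {h \<in> mod_hom \<Lambda> X Y. bij_betw h (carrier X) (carrier Y)}"

definition mod_isomorphic ::
  "('a, 'k) ring_scheme \<Rightarrow> ('a, 'b) module \<Rightarrow> ('a, 'c) module \<Rightarrow> bool" where
  "mod_isomorphic \<Lambda> X Y \<longleftrightarrow> mod_iso \<Lambda> X Y \<noteq> {}"

definition regular_module :: "('a, 'k) ring_scheme \<Rightarrow> ('a, 'a) module" where
  "regular_module \<Lambda> = \<lparr>carrier = carrier \<Lambda>, monoid.mult = mult \<Lambda>, one = one \<Lambda>,
     ring.zero = ring.zero \<Lambda>, add = add \<Lambda>, smult = mult \<Lambda>\<rparr>"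

text \<open>The (external) direct sum of a finite list of modules; the empty sum is the zero module.\<close>

definition mod_sum :: "('a, 'b) module list \<Rightarrow> ('a, 'b list) module" where
  "mod_sum Xs = \<lparr>carrier = {xs. length xs = length Xs \<and> (\<forall>i < length Xs. xs ! i \<in> carrier (Xs ! i))},
     monoid.mult = (\<lambda>_ _. undefined), one = undefined,
     ring.zero = map ring.zero Xs,
     add = (\<lambda>xs ys. map (\<lambda>i. xs ! i \<oplus>\<^bsub>Xs ! i\<^esub> ys ! i) [0..<length Xs]),
     smult = (\<lambda>a xs. map (\<lambda>i. a \<odot>\<^bsub>Xs ! i\<^esub> xs ! i) [0..<length Xs])\<rparr>"

lemma left_module_regular_module:
  assumes "ring \<Lambda>"
  shows "left_module \<Lambda> (regular_module \<Lambda>)"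
proof -
  interpret ring \<Lambda> by fact
  have "abelian_group (regular_module \<Lambda>)"
    by (rule abelian_groupI)
      (auto simp: regular_module_def a_ac intro: abelian_groupE(6)[OF is_abelian_group])
  then show ?thesis
    by (intro left_module.intro left_module_axioms.intro assms)
      (auto simp: regular_module_def l_distr r_distr m_assoc)
qed

lemma left_module_mod_sum:
  assumes "ring \<Lambda>" "\<And>X. X \<in> set Xs \<Longrightarrow> left_module \<Lambda> X"
  shows "left_module \<Lambda> (mod_sum Xs)"
proof -
  have L: "left_module \<Lambda> (Xs ! i)" if "i < length Xs" for i
    using assms(2) that by simp
  have A: "abelian_group (Xs ! i)" if "i < length Xs" for i
    using L[OF that] by (rule left_module.axioms)
  have "abelian_group (mod_sum Xs)"
  proof (rule abelian_groupI, goal_cases)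
    case (6 x)
    let ?y = "map (\<lambda>i. \<ominus>\<^bsub>Xs ! i\<^esub> (x ! i)) [0..<length Xs]"
    show ?case
      by (rule bexI[of _ ?y])
        (use 6 in \<open>auto simp: mod_sum_def A abelian_group.l_neg abelian_group.a_inv_closed
           intro: nth_equalityI\<close>)
  next
    case (4 x y)
    then show ?case by (auto simp: mod_sum_def intro!: nth_equalityI abelian_groupE(4) A)
  qed (auto simp: mod_sum_def abelian_groupE(1-3,5)[OF A] intro!: nth_equalityI)
  then show ?thesis
    by (intro left_module.intro left_module_axioms.intro assms(1))
      (auto simp: mod_sum_def left_module.smult_closed[OF L] left_module.smult_l_distr[OF L]
        left_module.smult_r_distr[OF L] left_module.smult_assoc1[OF L] left_module.smult_one[OF L]
        intro!: nth_equalityI)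
qed

definition short_exact ::
  "('a, 'k) ring_scheme \<Rightarrow> ('a, 'b) module \<Rightarrow> ('b \<Rightarrow> 'c) \<Rightarrow> ('a, 'c) module
     \<Rightarrow> ('c \<Rightarrow> 'd) \<Rightarrow> ('a, 'd) module \<Rightarrow> bool" where
  "short_exact \<Lambda> X f Y g Z \<longleftrightarrow>
     f \<in> mod_hom \<Lambda> X Y \<and> g \<in> mod_hom \<Lambda> Y Z \<and>
     inj_on f (carrier X) \<and> f ` carrier X = a_kernel Y Z g \<and> g ` carrier Y = carrier Z"


subsection \<open>Size of the universe of modules\<close>

text \<open>
  The type \<^typ>\<open>('a, 'm) module\<close> only contains modules whose elements are taken from \<^typ>\<open>'m\<close>.
  If \<^typ>\<open>'m\<close> is at least as large as \<^typ>\<open>'a list\<close>, this is no restriction: then every finitely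
  generated module, on whatever type, has an isomorphic copy in \<^const>\<open>fg_mod\<close>.
\<close>

lemma (in left_module) ex_surj_onto_submodule:
  assumes "finite S" "S \<subseteq> carrier M"
  shows "\<exists>f :: 'a list \<Rightarrow> 'c. submodule (range f) R M \<and> S \<subseteq> range f"
  using assms
proof (induction S rule: finite_induct)
  case empty
  have "submodule (range (\<lambda>_ :: 'a list. \<zero>\<^bsub>M\<^esub>)) R M"
  proof (intro submodule.intro subgroup.intro submodule_axioms.intro, goal_cases)
    case (4 x)
    then show ?case using M.add.inv_one by simp
  next
    case (5 a x)
    then have "a \<odot>\<^bsub>M\<^esub> \<zero>\<^bsub>M\<^esub> \<oplus>\<^bsub>M\<^esub> a \<odot>\<^bsub>M\<^esub> \<zero>\<^bsub>M\<^esub> = a \<odot>\<^bsub>M\<^esub> \<zero>\<^bsub>M\<^esub>"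
      using smult_r_distr[of a "\<zero>\<^bsub>M\<^esub>" "\<zero>\<^bsub>M\<^esub>"] by simp
    then have "a \<odot>\<^bsub>M\<^esub> \<zero>\<^bsub>M\<^esub> = \<zero>\<^bsub>M\<^esub>"
      using 5 M.add.l_cancel_one smult_closed M.zero_closed by metis
    with 5 show ?case by simp
  qed auto
  then show ?case by blast
next
  case (insert s S)
  then obtain f :: "'a list \<Rightarrow> 'c" where f: "submodule (range f) R M" "S \<subseteq> range f"
    by auto
  have s: "s \<in> carrier M" using insert by simp
  have sg: "subgroup (range f) (add_monoid M)" using f(1) by (rule submodule.axioms)
  have fc: "f xs \<in> carrier M" for xs
    using subgroup.subset[OF sg] by auto
  have fR: "\<exists>zs. f zs = y" if "y \<in> range f" for y
    using that by auto
  have f0: "\<exists>zs. f zs = \<zero>\<^bsub>M\<^esub>"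
    using subgroup.one_closed[OF sg] by (intro fR) simp
  have fadd: "\<exists>zs. f zs = f xs \<oplus>\<^bsub>M\<^esub> f ys" for xs ys
    using subgroup.m_closed[OF sg, of "f xs" "f ys"] by (intro fR) simp
  have fneg: "\<exists>zs. f zs = \<ominus>\<^bsub>M\<^esub> f xs" for xs
    using subgroup.m_inv_closed[OF sg, of "f xs"] by (intro fR) (simp add: a_inv_def)
  have fsm: "\<exists>zs. f zs = a \<odot>\<^bsub>M\<^esub> f xs" if "a \<in> carrier R" for a xs
    using submodule.smult_closed[OF f(1) that, of "f xs"] by (intro fR) simp
  define c where "c = (\<lambda>xs :: 'a list. if hd xs \<in> carrier R then hd xs else \<zero>)"
  define g where "g = (\<lambda>xs. f (tl xs) \<oplus>\<^bsub>M\<^esub> c xs \<odot>\<^bsub>M\<^esub> s)"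
  have cc: "c xs \<in> carrier R" for xs by (simp add: c_def)
  have gI: "f xs \<oplus>\<^bsub>M\<^esub> a \<odot>\<^bsub>M\<^esub> s \<in> range g" if "a \<in> carrier R" for a xs
    by (rule range_eqI[of _ _ "a # xs"]) (simp add: g_def c_def that)
  have zs: "\<zero> \<odot>\<^bsub>M\<^esub> x = \<zero>\<^bsub>M\<^esub>" if "x \<in> carrier M" for x
  proof -
    have "\<zero> \<odot>\<^bsub>M\<^esub> x \<oplus>\<^bsub>M\<^esub> \<zero> \<odot>\<^bsub>M\<^esub> x = \<zero> \<odot>\<^bsub>M\<^esub> x"
      using smult_l_distr[of \<zero> \<zero> x] that by simp
    then show ?thesis
      using that M.add.l_cancel_one smult_closed R.zero_closed by metis
  qed
  have neg: "\<ominus>\<^bsub>M\<^esub> x = (\<ominus> \<one>) \<odot>\<^bsub>M\<^esub> x" if "x \<in> carrier M" for x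
  proof -
    have "(\<ominus> \<one>) \<odot>\<^bsub>M\<^esub> x \<oplus>\<^bsub>M\<^esub> x = \<zero>\<^bsub>M\<^esub>"
      using smult_l_distr[of "\<ominus> \<one>" \<one> x] that zs by (simp add: R.l_neg)
    then show ?thesis using that by (metis M.minus_equality R.a_inv_closed R.one_closed smult_closed)
  qed
  have sub: "range g \<subseteq> carrier M"
    using fc cc s by (auto simp: g_def)
  have sm: "a \<odot>\<^bsub>M\<^esub> x \<in> range g" if a: "a \<in> carrier R" and "x \<in> range g" for a x
  proof -
    obtain xs where x: "x = f (tl xs) \<oplus>\<^bsub>M\<^esub> c xs \<odot>\<^bsub>M\<^esub> s" using \<open>x \<in> range g\<close> by (auto simp: g_def)
    obtain zs where "f zs = a \<odot>\<^bsub>M\<^esub> f (tl xs)" using fsm[OF a] by blast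
    then have "a \<odot>\<^bsub>M\<^esub> x = f zs \<oplus>\<^bsub>M\<^esub> (a \<otimes> c xs) \<odot>\<^bsub>M\<^esub> s"
      using x a fc cc s by (simp add: smult_r_distr smult_assoc1)
    then show ?thesis using gI a cc by simp
  qed
  have "submodule (range g) R M"
  proof (intro submodule.intro subgroup.intro submodule_axioms.intro)
    show "range g \<subseteq> carrier (add_monoid M)" using sub by simp
  next
    fix x y assume xy: "x \<in> range g" "y \<in> range g"
    then obtain xs ys where x: "x = f (tl xs) \<oplus>\<^bsub>M\<^esub> c xs \<odot>\<^bsub>M\<^esub> s"
      and y: "y = f (tl ys) \<oplus>\<^bsub>M\<^esub> c ys \<odot>\<^bsub>M\<^esub> s"
      by (auto simp: g_def)
    obtain zs where zs: "f zs = f (tl xs) \<oplus>\<^bsub>M\<^esub> f (tl ys)" using fadd by blast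
    have "x \<oplus>\<^bsub>M\<^esub> y = f zs \<oplus>\<^bsub>M\<^esub> (c xs \<oplus> c ys) \<odot>\<^bsub>M\<^esub> s"
      unfolding x y zs using fc cc s by (simp add: smult_l_distr M.a_ac)
    then show "x \<otimes>\<^bsub>add_monoid M\<^esub> y \<in> range g" using gI cc by simp
  next
    obtain zs' where "f zs' = \<zero>\<^bsub>M\<^esub>" using f0 by blast
    then show "\<one>\<^bsub>add_monoid M\<^esub> \<in> range g" using gI[of \<zero> zs'] s zs by simp
  next
    fix x assume x: "x \<in> range g"
    then have "\<ominus>\<^bsub>M\<^esub> x \<in> range g" using sm[of "\<ominus> \<one>" x] sub neg by auto
    then show "inv\<^bsub>add_monoid M\<^esub> x \<in> range g" by (simp add: a_inv_def)
  qed (use sm in auto)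
  moreover have "S \<subseteq> range g"
  proof
    fix x assume "x \<in> S"
    then obtain xs where "x = f xs" using f by auto
    then show "x \<in> range g" using gI[of \<zero> xs] s fc zs by simp
  qed
  moreover have "s \<in> range g"
    using f0 gI[of \<one>] s by (metis M.l_zero R.one_closed smult_one)
  ultimately show ?case by blast
qed

lemma ex_isomorphic_in_fg_mod:
  fixes M :: "('a, 'b) module" and \<iota> :: "'a list \<Rightarrow> 'm"
  assumes "left_module \<Lambda> M" "finitely_generated \<Lambda> M" "inj \<iota>"
  shows "\<exists>N :: ('a, 'm) module. N \<in> fg_mod \<Lambda> \<and> mod_isomorphic \<Lambda> M N"
proof -
  interpret left_module \<Lambda> M by fact
  obtain S where S: "finite S" "S \<subseteq> carrier M"
      "\<And>N. submodule N \<Lambda> M \<Longrightarrow> S \<subseteq> N \<Longrightarrow> N = carrier M"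
    using assms(2) unfolding finitely_generated_def by metis
  obtain f :: "'a list \<Rightarrow> 'b" where "submodule (range f) \<Lambda> M" "S \<subseteq> range f"
    using ex_surj_onto_submodule[OF S(1,2)] by blast
  then have f: "range f = carrier M" by (rule S(3))
  define e where "e = (\<lambda>x. \<iota> (inv_into UNIV f x))"
  define d where "d = inv_into (carrier M) e"
  have inj: "inj_on e (carrier M)"
    using f assms(3) by (auto simp: e_def inj_on_def dest!: injD) (metis f_inv_into_f f)
  have de [simp]: "d (e x) = x" if "x \<in> carrier M" for x
    using inj that by (simp add: d_def)
  define N :: "('a, 'm) module" where
    "N = \<lparr>carrier = e ` carrier M, monoid.mult = (\<lambda>_ _. undefined), one = undefined,
       ring.zero = e \<zero>\<^bsub>M\<^esub>, add = (\<lambda>x y. e (d x \<oplus>\<^bsub>M\<^esub> d y)), smult = (\<lambda>a x. e (a \<odot>\<^bsub>M\<^esub> d x))\<rparr>"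
  have N [simp]: "carrier N = e ` carrier M" "\<zero>\<^bsub>N\<^esub> = e \<zero>\<^bsub>M\<^esub>"
      "x \<oplus>\<^bsub>N\<^esub> y = e (d x \<oplus>\<^bsub>M\<^esub> d y)" "a \<odot>\<^bsub>N\<^esub> x = e (a \<odot>\<^bsub>M\<^esub> d x)" for a x y
    by (simp_all add: N_def)
  have ab: "abelian_group N"
  proof (rule abelian_groupI, goal_cases)
    case (3 x y z)
    then show ?case by (clarsimp simp: M.a_assoc)
  next
    case (4 x y)
    then show ?case by (clarsimp simp: M.a_comm)
  next
    case (6 x)
    then obtain y where "x = e y" "y \<in> carrier M" by auto
    then show ?case by (intro bexI[of _ "e (\<ominus>\<^bsub>M\<^esub> y)"]) (auto simp: M.l_neg)
  qed auto
  have lm: "left_module \<Lambda> N"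
    by (intro left_module.intro left_module_axioms.intro ab R.ring_axioms)
      (auto simp: smult_l_distr smult_r_distr smult_assoc1)
  interpret N: left_module \<Lambda> N by fact
  have "finitely_generated \<Lambda> N"
    unfolding finitely_generated_def
  proof (intro exI[of _ "e ` S"] conjI allI impI)
    show "finite (e ` S)" "e ` S \<subseteq> carrier N" using S by auto
    fix K assume K: "submodule K \<Lambda> N \<and> e ` S \<subseteq> K"
    then have sK: "subgroup K (add_monoid N)" using submodule.axioms(1) by blast
    then have KN: "K \<subseteq> e ` carrier M" using subgroup.subset[OF sK] by simp
    define L where "L = {x \<in> carrier M. e x \<in> K}"
    have "submodule L \<Lambda> M"
    proof (intro submodule.intro subgroup.intro submodule_axioms.intro)
      show "x \<otimes>\<^bsub>add_monoid M\<^esub> y \<in> L" if "x \<in> L" "y \<in> L" for x y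
        using subgroup.m_closed[OF sK, of "e x" "e y"] that by (auto simp: L_def)
      show "\<one>\<^bsub>add_monoid M\<^esub> \<in> L"
        using subgroup.one_closed[OF sK] by (auto simp: L_def)
      show "a \<odot>\<^bsub>M\<^esub> x \<in> L" if "a \<in> carrier \<Lambda>" "x \<in> L" for a x
        using submodule.smult_closed[of K \<Lambda> N a "e x"] K that by (auto simp: L_def)
      show "inv\<^bsub>add_monoid M\<^esub> x \<in> L" if "x \<in> L" for x
      proof -
        have x: "x \<in> carrier M" "e x \<in> K" using that by (auto simp: L_def)
        have "\<ominus>\<^bsub>N\<^esub> e x = e (\<ominus>\<^bsub>M\<^esub> x)"
          by (rule N.minus_equality) (use x in \<open>auto simp: M.l_neg\<close>)
        then have "e (\<ominus>\<^bsub>M\<^esub> x) \<in> K"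
          using subgroup.m_inv_closed[OF sK x(2)] by (simp add: a_inv_def)
        then have "\<ominus>\<^bsub>M\<^esub> x \<in> L" using x by (simp add: L_def)
        then show ?thesis by (simp add: a_inv_def)
      qed
    qed (auto simp: L_def)
    moreover have "S \<subseteq> L" using K S(2) by (auto simp: L_def)
    ultimately have "L = carrier M" by (rule S(3))
    then show "K = carrier N" using KN by (auto simp: L_def)
  qed
  moreover have "e \<in> mod_iso \<Lambda> M N"
    using inj by (auto simp: mod_iso_def mod_hom_def hom_def bij_betw_def)
  ultimately show ?thesis
    using lm unfolding fg_mod_def mod_isomorphic_def by blast
qed


section \<open>Artin algebras\<close>

definition artinian_ring :: "('r, 'k) ring_scheme \<Rightarrow> bool" where
  "artinian_ring R \<longleftrightarrow> ring R \<and>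
    (\<forall>I :: nat \<Rightarrow> 'r set. (\<forall>n. ideal (I n) R \<and> I (Suc n) \<subseteq> I n) \<longrightarrow> (\<exists>N. \<forall>n \<ge> N. I n = I N))"

definition local_ring :: "('r, 'k) ring_scheme \<Rightarrow> bool" where
  "local_ring R \<longleftrightarrow> cring R \<and> (\<exists>!I. maximalideal I R)"

text \<open>
  Unlike in \<^locale>\<open>algebra\<close>, the ring \<open>\<Lambda>\<close> need not be commutative; the two compatibility axioms
  express that \<open>R\<close> acts through the centre of \<open>\<Lambda>\<close>.
\<close>

locale artin_algebra = module R \<Lambda> + \<Lambda>?: ring \<Lambda> for R (structure) and \<Lambda> (structure) +
  assumes smult_mult_left:
      "\<lbrakk>r \<in> carrier R; x \<in> carrier \<Lambda>; y \<in> carrier \<Lambda>\<rbrakk> \<Longrightarrow>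
      (r \<odot>\<^bsub>\<Lambda>\<^esub> x) \<otimes>\<^bsub>\<Lambda>\<^esub> y = r \<odot>\<^bsub>\<Lambda>\<^esub> (x \<otimes>\<^bsub>\<Lambda>\<^esub> y)"
    and smult_mult_right:
      "\<lbrakk>r \<in> carrier R; x \<in> carrier \<Lambda>; y \<in> carrier \<Lambda>\<rbrakk> \<Longrightarrow>
      x \<otimes>\<^bsub>\<Lambda>\<^esub> (r \<odot>\<^bsub>\<Lambda>\<^esub> y) = r \<odot>\<^bsub>\<Lambda>\<^esub> (x \<otimes>\<^bsub>\<Lambda>\<^esub> y)"
    and artinian: "artinian_ring R"
    and local: "local_ring R"
    and finitely_generated: "finitely_generated R \<Lambda>"


section \<open>Resolving subcategories\<close>

text \<open>A full subcategory is given by its set of objects.\<close>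

definition subcategory :: "('a, 'k) ring_scheme \<Rightarrow> ('a, 'm) module set \<Rightarrow> bool" where
  "subcategory \<Lambda> \<E> \<longleftrightarrow> \<E> \<subseteq> fg_mod \<Lambda> \<and>
    (\<forall>X \<in> \<E>. \<forall>Y \<in> fg_mod \<Lambda>. mod_isomorphic \<Lambda> X Y \<longrightarrow> Y \<in> \<E>) \<and>
    (\<forall>Xs. \<forall>Y \<in> fg_mod \<Lambda>. set Xs \<subseteq> \<E> \<and> mod_isomorphic \<Lambda> Y (mod_sum Xs) \<longrightarrow> Y \<in> \<E>)"

definition resolving :: "('a, 'k) ring_scheme \<Rightarrow> ('a, 'm) module set \<Rightarrow> bool" where
  "resolving \<Lambda> \<E> \<longleftrightarrow> subcategory \<Lambda> \<E> \<and>
    (\<exists>P \<in> \<E>. mod_isomorphic \<Lambda> (regular_module \<Lambda>) P) \<and>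
    (\<forall>X \<in> \<E>. \<forall>Y \<in> fg_mod \<Lambda>. \<forall>Z \<in> \<E>. \<forall>f g. short_exact \<Lambda> X f Y g Z \<longrightarrow> Y \<in> \<E>) \<and>
    (\<forall>X \<in> fg_mod \<Lambda>. \<forall>Y \<in> \<E>. \<forall>Z \<in> \<E>. \<forall>f g. short_exact \<Lambda> X f Y g Z \<longrightarrow> X \<in> \<E>) \<and>
    (\<forall>X \<in> fg_mod \<Lambda>. \<forall>Y \<in> fg_mod \<Lambda>. \<forall>Z \<in> \<E>. mod_isomorphic \<Lambda> Z (mod_sum [X, Y]) \<longrightarrow> X \<in> \<E>)"

definition right_approximation ::
  "('a, 'k) ring_scheme \<Rightarrow> ('a, 'm) module set \<Rightarrow> ('a, 'm) module \<Rightarrow> ('m \<Rightarrow> 'm)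
     \<Rightarrow> ('a, 'm) module \<Rightarrow> bool" where
  "right_approximation \<Lambda> \<E> P p X \<longleftrightarrow> P \<in> \<E> \<and> p \<in> mod_hom \<Lambda> P X \<and>
    (\<forall>W \<in> \<E>. \<forall>h \<in> mod_hom \<Lambda> W X. \<exists>k \<in> mod_hom \<Lambda> W P. \<forall>w \<in> carrier W. h w = p (k w))"

definition contravariantly_finite :: "('a, 'k) ring_scheme \<Rightarrow> ('a, 'm) module set \<Rightarrow> bool" where
  "contravariantly_finite \<Lambda> \<E> \<longleftrightarrow>
    (\<forall>X \<in> fg_mod \<Lambda>. \<exists>P p. right_approximation \<Lambda> \<E> P p X)"

definition add_closure ::
  "('a, 'k) ring_scheme \<Rightarrow> ('a, 'm) module \<Rightarrow> ('a, 'm) module set" where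
  "add_closure \<Lambda> G = {X \<in> fg_mod \<Lambda>.
     \<exists>Y \<in> fg_mod \<Lambda>. \<exists>n. mod_isomorphic \<Lambda> (mod_sum (replicate n G)) (mod_sum [X, Y])}"

definition finite_type :: "('a, 'k) ring_scheme \<Rightarrow> ('a, 'm) module set \<Rightarrow> bool" where
  "finite_type \<Lambda> \<E> \<longleftrightarrow> (\<exists>G \<in> \<E>. \<E> = add_closure \<Lambda> G)"


section \<open>AR conflations\<close>

definition indecomposable ::
  "('a, 'k) ring_scheme \<Rightarrow> ('a, 'm) module set \<Rightarrow> ('a, 'm) module \<Rightarrow> bool" where
  "indecomposable \<Lambda> \<E> X \<longleftrightarrow> X \<in> \<E> \<and> carrier X \<noteq> {\<zero>\<^bsub>X\<^esub>} \<and>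
    (\<forall>Y \<in> \<E>. \<forall>Z \<in> \<E>. mod_isomorphic \<Lambda> X (mod_sum [Y, Z]) \<longrightarrow>
      carrier Y = {\<zero>\<^bsub>Y\<^esub>} \<or> carrier Z = {\<zero>\<^bsub>Z\<^esub>})"

text \<open>
  The Jacobson radical of the category of modules: those \<open>f\<close> for which \<open>id - g \<circ> f\<close> is invertible
  for all \<open>g\<close> in the opposite direction. Its restriction to a full subcategory is the Jacobson
  radical of that subcategory.
\<close>

definition cat_radical ::
  "('a, 'k) ring_scheme \<Rightarrow> ('a, 'm) module \<Rightarrow> ('a, 'm) module \<Rightarrow> ('m \<Rightarrow> 'm) set" where
  "cat_radical \<Lambda> X Y = {f \<in> mod_hom \<Lambda> X Y.
     \<forall>g \<in> mod_hom \<Lambda> Y X. (\<lambda>x. x \<ominus>\<^bsub>X\<^esub> g (f x)) \<in> mod_iso \<Lambda> X X}"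

definition right_almost_split ::
  "('a, 'k) ring_scheme \<Rightarrow> ('a, 'm) module set \<Rightarrow> ('a, 'm) module \<Rightarrow> ('m \<Rightarrow> 'm)
     \<Rightarrow> ('a, 'm) module \<Rightarrow> bool" where
  "right_almost_split \<Lambda> \<E> Y g Z \<longleftrightarrow>
    indecomposable \<Lambda> \<E> Z \<and> g \<in> cat_radical \<Lambda> Y Z \<and>
    (\<forall>W \<in> \<E>. \<forall>h \<in> cat_radical \<Lambda> W Z. \<exists>k \<in> mod_hom \<Lambda> W Y. \<forall>w \<in> carrier W. h w = g (k w))"

definition left_almost_split ::
  "('a, 'k) ring_scheme \<Rightarrow> ('a, 'm) module set \<Rightarrow> ('a, 'm) module \<Rightarrow> ('m \<Rightarrow> 'm)
     \<Rightarrow> ('a, 'm) module \<Rightarrow> bool" where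
  "left_almost_split \<Lambda> \<E> X f Y \<longleftrightarrow>
    indecomposable \<Lambda> \<E> X \<and> f \<in> cat_radical \<Lambda> X Y \<and>
    (\<forall>W \<in> \<E>. \<forall>h \<in> cat_radical \<Lambda> X W. \<exists>k \<in> mod_hom \<Lambda> Y W. \<forall>x \<in> carrier X. h x = k (f x))"

definition conflation ::
  "('a, 'k) ring_scheme \<Rightarrow> ('a, 'm) module set \<Rightarrow> ('a, 'm) module \<Rightarrow> ('m \<Rightarrow> 'm)
     \<Rightarrow> ('a, 'm) module \<Rightarrow> ('m \<Rightarrow> 'm) \<Rightarrow> ('a, 'm) module \<Rightarrow> bool" where
  "conflation \<Lambda> \<E> X f Y g Z \<longleftrightarrow> X \<in> \<E> \<and> Y \<in> \<E> \<and> Z \<in> \<E> \<and> short_exact \<Lambda> X f Y g Z"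

definition AR_conflation ::
  "('a, 'k) ring_scheme \<Rightarrow> ('a, 'm) module set \<Rightarrow> ('a, 'm) module \<Rightarrow> ('m \<Rightarrow> 'm)
     \<Rightarrow> ('a, 'm) module \<Rightarrow> ('m \<Rightarrow> 'm) \<Rightarrow> ('a, 'm) module \<Rightarrow> bool" where
  "AR_conflation \<Lambda> \<E> X f Y g Z \<longleftrightarrow> conflation \<Lambda> \<E> X f Y g Z \<and>
    left_almost_split \<Lambda> \<E> X f Y \<and> right_almost_split \<Lambda> \<E> Y g Z"


section \<open>Grothendieck groups\<close>

definition iso_class ::
  "('a, 'k) ring_scheme \<Rightarrow> ('a, 'm) module \<Rightarrow> ('a, 'm) module set" where
  "iso_class \<Lambda> X = {Y \<in> fg_mod \<Lambda>. mod_isomorphic \<Lambda> X Y}"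

definition ind ::
  "('a, 'k) ring_scheme \<Rightarrow> ('a, 'm) module set \<Rightarrow> ('a, 'm) module set set" where
  "ind \<Lambda> \<E> = iso_class \<Lambda> ` {X. indecomposable \<Lambda> \<E> X}"

definition K0_split ::
  "('a, 'k) ring_scheme \<Rightarrow> ('a, 'm) module set \<Rightarrow> (('a, 'm) module set \<Rightarrow>\<^sub>0 int) monoid" where
  "K0_split \<Lambda> \<E> = free_Abelian_group (ind \<Lambda> \<E>)"

text \<open>Uniqueness of the described element is the Krull-Schmidt theorem.\<close>

definition K0_class ::
  "('a, 'k) ring_scheme \<Rightarrow> ('a, 'm) module set \<Rightarrow> ('a, 'm) module
     \<Rightarrow> (('a, 'm) module set \<Rightarrow>\<^sub>0 int)" where
  "K0_class \<Lambda> \<E> X = (THE c. \<exists>Xs. (\<forall>Y \<in> set Xs. indecomposable \<Lambda> \<E> Y) \<and>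
     mod_isomorphic \<Lambda> X (mod_sum Xs) \<and> c = (\<Sum>Y\<leftarrow>Xs. frag_of (iso_class \<Lambda> Y)))"

definition Ex_group ::
  "('a, 'k) ring_scheme \<Rightarrow> ('a, 'm) module set \<Rightarrow> (('a, 'm) module set \<Rightarrow>\<^sub>0 int) set" where
  "Ex_group \<Lambda> \<E> = generate (K0_split \<Lambda> \<E>)
     {K0_class \<Lambda> \<E> X - K0_class \<Lambda> \<E> Y + K0_class \<Lambda> \<E> Z | X f Y g Z. conflation \<Lambda> \<E> X f Y g Z}"

definition AR_group ::
  "('a, 'k) ring_scheme \<Rightarrow> ('a, 'm) module set \<Rightarrow> (('a, 'm) module set \<Rightarrow>\<^sub>0 int) set" where
  "AR_group \<Lambda> \<E> = generate (K0_split \<Lambda> \<E>)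
     {K0_class \<Lambda> \<E> X - K0_class \<Lambda> \<E> Y + K0_class \<Lambda> \<E> Z | X f Y g Z. AR_conflation \<Lambda> \<E> X f Y g Z}"

end

theory Submission
  imports Defs
begin

text \<open>
  A conflation \<open>0 \<rightarrow> X \<rightarrow> Y \<rightarrow> Z \<rightarrow> 0\<close> with deflation \<open>g\<close> has a functor \<open>F\<close> attached to it, the cokernel
  \<open>F(W)\<close> of \<open>Hom(W, Y) \<rightarrow> Hom(W, Z)\<close>. All homomorphism modules have finite length over \<open>R\<close>, so
  \<open>W\<close> defines a homomorphism from the split Grothendieck group to the integers that sends \<open>[X]\<close> to
  the length of \<open>Hom(W, X)\<close>. On \<open>[X] - [Y] + [Z]\<close> its value is the length of \<open>F(W)\<close>
  (\<open>pairing_relation_eq_0_iff\<close>). For an AR conflation the functor is simple and concentrated in \<open>Z\<close>.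

  Equality implies finite type: an element of the AR group involves finitely many AR conflations, so
  its value at \<open>W\<close> vanishes for all indecomposable \<open>W\<close> outside a finite list
  (\<open>AR_group_finite_support\<close>). This is applied to the kernel of a free cover \<open>P \<rightarrow> C\<close>, where
  \<open>C \<rightarrow> S\<close> approximates a simple module \<open>S\<close>: for \<open>W\<close> outside the list every map \<open>W \<rightarrow> S\<close> factors
  through \<open>P\<close>. Simple modules are the tops of the finitely many indecomposable summands \<open>Q\<close> of
  \<open>\<Lambda>\<close>, and every \<open>W\<close> maps onto one of them. A nonzero composite \<open>W \<rightarrow> Q \<rightarrow> S\<close> is onto, \<open>Q\<close> lifts back to
  \<open>W\<close>, and by locality \<open>W\<close> is isomorphic to \<open>Q\<close>. So only finitely many indecomposables exist
  (\<open>finite_type_if_AR_eq_Ex\<close>).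

  Finite type implies equality: if \<open>\<E> = add G\<close>, then \<open>F\<close> is controlled by \<open>F(G)\<close> and has finite length
  as a functor. A simple subfunctor is generated by a map \<open>h : W \<rightarrow> Z\<close> from an indecomposable \<open>W\<close>
  (\<open>ex_simple_subfunctor\<close>). The pullback \<open>K\<close> of \<open>g\<close> and \<open>h\<close> gives two conflations
  \<open>X \<rightarrow> K \<rightarrow> W\<close> and \<open>K \<rightarrow> Y \<oplus> W \<rightarrow> Z\<close> whose relations add up to the given one; the functor of the second
  one is a proper quotient of \<open>F\<close>, and the first one has a right almost split deflation. Induction
  (\<open>relation_in_AR\<close>) reduces the claim to such conflations. They are AR conflations up to a split
  summand, which is removed by Fitting's lemma (\<open>right_almost_split_relation_in_AR\<close>), because a right
  minimal right almost split deflation has a left almost split kernel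
  (\<open>minimal_right_almost_split_AR\<close>).

  The basic tool is Fitting's lemma. It shows that an endomorphism of an indecomposable object is
  invertible as soon as it has a nonzero fixed point. This yields the description of the radical by
  split maps and the Krull-Schmidt theorem: the multiplicity of \<open>W\<close> in \<open>X\<close> can be read off from
  the length of \<open>Hom(W, X) / rad(W, X)\<close>.
\<close>

section \<open>Heights of families of sets\<close>

definition has_flag :: "'x set set \<Rightarrow> nat \<Rightarrow> bool" where
  "has_flag L n \<longleftrightarrow> (\<exists>C. (\<forall>i\<le>n. C i \<in> L) \<and> (\<forall>i<n. C i \<subset> C (Suc i)))"

definition bounded_flags :: "'x set set \<Rightarrow> bool" where
  "bounded_flags L \<longleftrightarrow> (\<exists>N. \<forall>n. has_flag L n \<longrightarrow> n \<le> N)"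

text \<open>
  The maximal length of a flag if \<open>bounded_flags L\<close> holds, and an arbitrary value otherwise.
\<close>

definition height :: "'x set set \<Rightarrow> nat" where
  "height L = (GREATEST n. has_flag L n)"

definition rank :: "'x set set \<Rightarrow> 'x set \<Rightarrow> nat" where
  "rank L A = height {B \<in> L. B \<subseteq> A}"

lemma has_flag_0: "L \<noteq> {} \<Longrightarrow> has_flag L 0"
  by (auto simp: has_flag_def)

lemma has_flag_height: "bounded_flags L \<Longrightarrow> L \<noteq> {} \<Longrightarrow> has_flag L (height L)"
  unfolding height_def bounded_flags_def
  by (metis GreatestI_nat has_flag_0)

lemma has_flag_le_height: "bounded_flags L \<Longrightarrow> has_flag L n \<Longrightarrow> n \<le> height L"
  unfolding height_def bounded_flags_def by (metis Greatest_le_nat)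

text \<open>
  Maps that keep inclusions strict carry flags to flags. Lengths in two lattices of submodules are
  compared through such maps.
\<close>

lemma has_flag_image:
  assumes "\<And>A. A \<in> L \<Longrightarrow> F A \<in> L'"
    and "\<And>A B. A \<in> L \<Longrightarrow> B \<in> L \<Longrightarrow> A \<subset> B \<Longrightarrow> F A \<subset> F B"
    and "has_flag L n"
  shows "has_flag L' n"
proof -
  obtain C where C: "\<forall>i\<le>n. C i \<in> L" "\<forall>i<n. C i \<subset> C (Suc i)"
    using assms(3) by (auto simp: has_flag_def)
  then have "\<forall>i<n. F (C i) \<subset> F (C (Suc i))"
    using assms(2) by (meson Suc_leI less_imp_le)
  then show ?thesis unfolding has_flag_def
    using C(1) assms(1) by (intro exI[of _ "\<lambda>i. F (C i)"]) auto
qed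

lemma bounded_flags_image:
  assumes "\<And>A. A \<in> L \<Longrightarrow> F A \<in> L'"
    and "\<And>A B. A \<in> L \<Longrightarrow> B \<in> L \<Longrightarrow> A \<subset> B \<Longrightarrow> F A \<subset> F B"
    and "bounded_flags L'"
  shows "bounded_flags L"
proof -
  obtain N where "\<And>n. has_flag L' n \<Longrightarrow> n \<le> N"
    using assms(3) by (auto simp: bounded_flags_def)
  with has_flag_image[of L F L', OF assms(1,2)] show ?thesis
    by (auto simp: bounded_flags_def)
qed

lemma has_flag_mono: "L \<subseteq> L' \<Longrightarrow> has_flag L n \<Longrightarrow> has_flag L' n"
  by (rule has_flag_image[of L id]) auto

lemma bounded_flags_subset: "bounded_flags L' \<Longrightarrow> L \<subseteq> L' \<Longrightarrow> bounded_flags L"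
  unfolding bounded_flags_def using has_flag_mono by blast

lemma height_mono:
  assumes "bounded_flags L'" "L \<subseteq> L'" "L \<noteq> {}"
  shows "height L \<le> height L'"
  using assms has_flag_height[OF bounded_flags_subset] has_flag_le_height has_flag_mono by meson

lemma rank_mono:
  assumes "bounded_flags L" "A \<in> L" "A \<subseteq> B"
  shows "rank L A \<le> rank L B"
  unfolding rank_def
  by (rule height_mono[OF bounded_flags_subset[OF assms(1)]]) (use assms in auto)

lemma rank_le_height:
  assumes "bounded_flags L" "A \<in> L"
  shows "rank L A \<le> height L"
  unfolding rank_def
  by (rule height_mono[OF assms(1)]) (use assms in auto)

text \<open>
  A longest flag below the smaller set can be prolonged by the larger one.
\<close>

lemma rank_strict_mono:
  assumes L: "bounded_flags L" "A \<in> L" "B \<in> L" "A \<subset> B"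
  shows "rank L A < rank L B"
proof -
  define LA where "LA = {D \<in> L. D \<subseteq> A}"
  define LB where "LB = {D \<in> L. D \<subseteq> B}"
  define m where "m = height LA"
  have bA: "bounded_flags LA" and bB: "bounded_flags LB"
    by (auto simp: LA_def LB_def intro: bounded_flags_subset[OF L(1)])
  have "A \<in> LA" using L(2) by (simp add: LA_def)
  then have "has_flag LA m" unfolding m_def using has_flag_height[OF bA] by blast
  then obtain C where C: "\<And>i. i \<le> m \<Longrightarrow> C i \<in> LA" "\<And>i. i < m \<Longrightarrow> C i \<subset> C (Suc i)"
    by (auto simp: has_flag_def)
  have "has_flag LB (Suc m)"
    unfolding has_flag_def
  proof (intro exI[of _ "\<lambda>i. if i \<le> m then C i else B"] conjI allI impI)
    fix i assume "i < Suc m"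
    then consider "i < m" | "i = m" by linarith
    then show "(if i \<le> m then C i else B) \<subset> (if Suc i \<le> m then C (Suc i) else B)"
    proof cases
      case 1
      then show ?thesis using C(2)[OF 1] by simp
    next
      case 2
      moreover have "C m \<subseteq> A" using C(1)[of m] by (simp add: LA_def)
      ultimately show ?thesis using L(4) by auto
    qed
  next
    fix i assume "i \<le> Suc m"
    show "(if i \<le> m then C i else B) \<in> LB"
      using C(1)[of i] L(3,4) by (auto simp: LA_def LB_def)
  qed
  then show ?thesis
    unfolding rank_def LA_def[symmetric] LB_def[symmetric] m_def[symmetric]
    using has_flag_le_height[OF bB] by fastforce
qed

lemma rank_eq_imp_eq:
  assumes "bounded_flags L" "A \<in> L" "B \<in> L" "A \<subseteq> B" "rank L B \<le> rank L A"
  shows "A = B"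
  using rank_strict_mono[OF assms(1-3)] assms(4,5) by (meson leD psubsetI)

lemma has_flag_singleton: "has_flag {A} n \<longleftrightarrow> n = 0"
proof
  assume "has_flag {A} n"
  then obtain C where "\<forall>i\<le>n. C i = A" "\<forall>i<n. C i \<subset> C (Suc i)"
    by (auto simp: has_flag_def)
  then show "n = 0" by (metis Suc_leI le_0_eq less_imp_le not_gr_zero psubset_eq)
qed (simp add: has_flag_0)

lemma height_singleton [simp]: "height {A} = 0"
  unfolding height_def has_flag_singleton by (rule Greatest_equality) auto

lemma bounded_flags_singleton [simp]: "bounded_flags {A}"
  unfolding bounded_flags_def has_flag_singleton by auto

lemma height_pos:
  assumes "bounded_flags L" "A \<in> L" "B \<in> L" "A \<subset> B"
  shows "height L > 0"
  using rank_strict_mono[OF assms] rank_le_height[OF assms(1,3)] by linarith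


text \<open>
  With bounded flags, the ascending and the descending chain condition both come from optimising the
  rank, which is a natural number.
\<close>

lemma ex_maximal_member:
  assumes "bounded_flags L" "K \<noteq> {}" "K \<subseteq> L"
  obtains A where "A \<in> K" "\<And>B. B \<in> K \<Longrightarrow> A \<subseteq> B \<Longrightarrow> B = A"
proof -
  obtain A where A: "A \<in> K" "\<And>B. B \<in> K \<Longrightarrow> rank L B \<le> rank L A"
    using ex_has_greatest_nat[of "\<lambda>A. A \<in> K" _ "rank L" "Suc (height L)"] assms
      rank_le_height[OF assms(1)] by (metis ex_in_conv less_Suc_eq_le subsetD)
  then have "B = A" if "B \<in> K" "A \<subseteq> B" for B
    using rank_eq_imp_eq[OF assms(1), of A B] that assms(3) by blast
  with A(1) show thesis using that by blast
qed

lemma ex_minimal_member: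
  assumes "bounded_flags L" "K \<noteq> {}" "K \<subseteq> L"
  obtains A where "A \<in> K" "\<And>B. B \<in> K \<Longrightarrow> B \<subseteq> A \<Longrightarrow> B = A"
proof -
  obtain A where A: "A \<in> K" "\<And>B. B \<in> K \<Longrightarrow> rank L A \<le> rank L B"
    using ex_has_least_nat[of "\<lambda>A. A \<in> K" _ "rank L"] assms(2) by auto
  then have "B = A" if "B \<in> K" "B \<subseteq> A" for B
    using rank_eq_imp_eq[OF assms(1), of B A] that assms(3) by blast
  with A(1) show thesis using that by blast
qed


section \<open>Submodules and homomorphisms\<close>

context left_module
begin

lemma smult_l_null [simp]: "x \<in> carrier M \<Longrightarrow> \<zero> \<odot>\<^bsub>M\<^esub> x = \<zero>\<^bsub>M\<^esub>"
  using smult_l_distr[of \<zero> \<zero> x] M.add.r_cancel_one'[of "\<zero> \<odot>\<^bsub>M\<^esub> x" "\<zero> \<odot>\<^bsub>M\<^esub> x"] by simp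

lemma smult_r_null [simp]: "a \<in> carrier R \<Longrightarrow> a \<odot>\<^bsub>M\<^esub> \<zero>\<^bsub>M\<^esub> = \<zero>\<^bsub>M\<^esub>"
  using smult_r_distr[of a "\<zero>\<^bsub>M\<^esub>" "\<zero>\<^bsub>M\<^esub>"]
    M.add.r_cancel_one'[of "a \<odot>\<^bsub>M\<^esub> \<zero>\<^bsub>M\<^esub>" "a \<odot>\<^bsub>M\<^esub> \<zero>\<^bsub>M\<^esub>"] by simp

lemma minus_eq_smult: "x \<in> carrier M \<Longrightarrow> \<ominus>\<^bsub>M\<^esub> x = (\<ominus> \<one>) \<odot>\<^bsub>M\<^esub> x"
  using smult_l_distr[of "\<ominus> \<one>" \<one> x] M.minus_equality[of "(\<ominus> \<one>) \<odot>\<^bsub>M\<^esub> x" x]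
  by (simp add: R.l_neg)

lemma smult_r_minus:
  assumes "a \<in> carrier R" "x \<in> carrier M"
  shows "a \<odot>\<^bsub>M\<^esub> (\<ominus>\<^bsub>M\<^esub> x) = \<ominus>\<^bsub>M\<^esub> (a \<odot>\<^bsub>M\<^esub> x)"
proof -
  have "a \<odot>\<^bsub>M\<^esub> (\<ominus>\<^bsub>M\<^esub> x) \<oplus>\<^bsub>M\<^esub> a \<odot>\<^bsub>M\<^esub> x = \<zero>\<^bsub>M\<^esub>"
    using assms by (simp flip: smult_r_distr add: M.l_neg)
  then show ?thesis using assms by (simp add: M.minus_equality)
qed

lemma is_submoduleI:
  assumes "N \<subseteq> carrier M" "\<zero>\<^bsub>M\<^esub> \<in> N"
    and "\<And>x y. x \<in> N \<Longrightarrow> y \<in> N \<Longrightarrow> x \<oplus>\<^bsub>M\<^esub> y \<in> N"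
    and "\<And>a x. a \<in> carrier R \<Longrightarrow> x \<in> N \<Longrightarrow> a \<odot>\<^bsub>M\<^esub> x \<in> N"
  shows "submodule N R M"
proof (intro submodule.intro subgroup.intro submodule_axioms.intro)
  fix x assume x: "x \<in> N"
  then have "\<ominus>\<^bsub>M\<^esub> x \<in> N" using assms minus_eq_smult by auto
  then show "inv\<^bsub>add_monoid M\<^esub> x \<in> N" by (simp add: a_inv_def)
qed (use assms in auto)

lemma is_submoduleD:
  assumes "submodule N R M"
  shows "N \<subseteq> carrier M" "\<zero>\<^bsub>M\<^esub> \<in> N"
    and "\<And>x y. x \<in> N \<Longrightarrow> y \<in> N \<Longrightarrow> x \<oplus>\<^bsub>M\<^esub> y \<in> N"
    and "\<And>a x. a \<in> carrier R \<Longrightarrow> x \<in> N \<Longrightarrow> a \<odot>\<^bsub>M\<^esub> x \<in> N"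
    and "\<And>x. x \<in> N \<Longrightarrow> \<ominus>\<^bsub>M\<^esub> x \<in> N"
    and "\<And>x y. x \<in> N \<Longrightarrow> y \<in> N \<Longrightarrow> x \<ominus>\<^bsub>M\<^esub> y \<in> N"
proof -
  have s: "subgroup N (add_monoid M)" using assms by (rule submodule.axioms)
  show 1: "N \<subseteq> carrier M" "\<zero>\<^bsub>M\<^esub> \<in> N"
    using subgroup.subset[OF s] subgroup.one_closed[OF s] by auto
  show 2: "\<And>x y. x \<in> N \<Longrightarrow> y \<in> N \<Longrightarrow> x \<oplus>\<^bsub>M\<^esub> y \<in> N"
    using subgroup.m_closed[OF s] by simp
  show "\<And>a x. a \<in> carrier R \<Longrightarrow> x \<in> N \<Longrightarrow> a \<odot>\<^bsub>M\<^esub> x \<in> N"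
    using submodule.smult_closed[OF assms] .
  show 3: "\<And>x. x \<in> N \<Longrightarrow> \<ominus>\<^bsub>M\<^esub> x \<in> N"
    using subgroup.m_inv_closed[OF s] by (simp add: a_inv_def)
  show "\<And>x y. x \<in> N \<Longrightarrow> y \<in> N \<Longrightarrow> x \<ominus>\<^bsub>M\<^esub> y \<in> N"
    using 2 3 unfolding a_minus_def by blast
qed

lemma submodule_carrier: "submodule (carrier M) R M"
  by (rule is_submoduleI) auto

lemma submodule_zero: "submodule {\<zero>\<^bsub>M\<^esub>} R M"
  by (rule is_submoduleI) auto

lemma submodule_Int:
  assumes "submodule N R M" "submodule N' R M"
  shows "submodule (N \<inter> N') R M"
  using is_submoduleD[OF assms(1)] is_submoduleD[OF assms(2)]
  by (intro is_submoduleI) auto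

definition sub_sum :: "'c set \<Rightarrow> 'c set \<Rightarrow> 'c set" where
  "sub_sum A B = {a \<oplus>\<^bsub>M\<^esub> b | a b. a \<in> A \<and> b \<in> B}"

lemma sub_sumI: "a \<in> A \<Longrightarrow> b \<in> B \<Longrightarrow> a \<oplus>\<^bsub>M\<^esub> b \<in> sub_sum A B"
  by (auto simp: sub_sum_def)

lemma submodule_sub_sum:
  assumes "submodule A R M" "submodule B R M"
  shows "submodule (sub_sum A B) R M"
proof (rule is_submoduleI)
  note A = is_submoduleD[OF assms(1)] and B = is_submoduleD[OF assms(2)]
  have [simp]: "x \<in> A \<Longrightarrow> x \<in> carrier M" "x \<in> B \<Longrightarrow> x \<in> carrier M" for x
    using A(1) B(1) by auto
  show "sub_sum A B \<subseteq> carrier M" by (auto simp: sub_sum_def)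
  show "\<zero>\<^bsub>M\<^esub> \<in> sub_sum A B" using sub_sumI[OF A(2) B(2)] by simp
  fix x y assume "x \<in> sub_sum A B" "y \<in> sub_sum A B"
  then obtain a b a' b' where *: "x = a \<oplus>\<^bsub>M\<^esub> b" "y = a' \<oplus>\<^bsub>M\<^esub> b'" "a \<in> A" "b \<in> B" "a' \<in> A" "b' \<in> B"
    by (auto simp: sub_sum_def)
  then have "x \<oplus>\<^bsub>M\<^esub> y = (a \<oplus>\<^bsub>M\<^esub> a') \<oplus>\<^bsub>M\<^esub> (b \<oplus>\<^bsub>M\<^esub> b')"
    by (simp add: M.a_ac)
  then show "x \<oplus>\<^bsub>M\<^esub> y \<in> sub_sum A B" using * A(3) B(3) sub_sumI by metis
next
  note A = is_submoduleD[OF assms(1)] and B = is_submoduleD[OF assms(2)]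
  fix r x assume r: "r \<in> carrier R" and "x \<in> sub_sum A B"
  then obtain a b where *: "x = a \<oplus>\<^bsub>M\<^esub> b" "a \<in> A" "b \<in> B" by (auto simp: sub_sum_def)
  then have "r \<odot>\<^bsub>M\<^esub> x = r \<odot>\<^bsub>M\<^esub> a \<oplus>\<^bsub>M\<^esub> r \<odot>\<^bsub>M\<^esub> b"
    using A(1) B(1) r by (auto simp: smult_r_distr subset_iff)
  then show "r \<odot>\<^bsub>M\<^esub> x \<in> sub_sum A B" using * A(4) B(4) r sub_sumI by metis
qed

lemma sub_sum_upper:
  assumes "submodule A R M" "submodule B R M"
  shows "A \<subseteq> sub_sum A B" "B \<subseteq> sub_sum A B"
  using is_submoduleD(1,2)[OF assms(1)] is_submoduleD(1,2)[OF assms(2)]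
    sub_sumI[of _ A "\<zero>\<^bsub>M\<^esub>" B] sub_sumI[of "\<zero>\<^bsub>M\<^esub>" A _ B] by (auto simp: subset_iff)

lemma sub_sum_least:
  assumes "submodule C R M" "A \<subseteq> C" "B \<subseteq> C"
  shows "sub_sum A B \<subseteq> C"
  using is_submoduleD(3)[OF assms(1)] assms(2,3) by (auto simp: sub_sum_def)

text \<open>
  The modular law, in the form that makes lengths additive: a strict inclusion stays strict after
  intersecting with \<open>B\<close> or after adding \<open>B\<close>.
\<close>

lemma modular_cancel:
  assumes C: "submodule C R M" "submodule C' R M" and B: "submodule B R M"
    and "C \<subseteq> C'" "C' \<inter> B \<subseteq> C" "sub_sum C' B \<subseteq> sub_sum C B"
  shows "C = C'"
proof
  show "C' \<subseteq> C"
  proof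
    fix x assume x: "x \<in> C'"
    have "x \<in> sub_sum C B" using sub_sum_upper(1)[OF C(2) B] x assms(6) by auto
    then obtain a y where *: "x = a \<oplus>\<^bsub>M\<^esub> y" "a \<in> C" "y \<in> B" by (auto simp: sub_sum_def)
    then have [simp]: "a \<in> carrier M" "y \<in> carrier M" using is_submoduleD(1)[OF C(1)] is_submoduleD(1)[OF B] by auto
    have "y = \<ominus>\<^bsub>M\<^esub> a \<oplus>\<^bsub>M\<^esub> x" using * by (simp add: M.r_neg1)
    moreover have "\<ominus>\<^bsub>M\<^esub> a \<in> C'" using is_submoduleD(5)[OF C(2)] *(2) assms(4) by blast
    ultimately have "y \<in> C'" using is_submoduleD(3)[OF C(2) _ x] by simp
    then have "y \<in> C" using *(3) assms(5) by blast
    then show "x \<in> C" using is_submoduleD(3)[OF C(1) *(2)] *(1) by simp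
  qed
qed fact

end

definition submods :: "('a, 'k) ring_scheme \<Rightarrow> ('a, 'b, 'l) module_scheme \<Rightarrow> 'b set \<Rightarrow> 'b set \<Rightarrow> 'b set set"
  where "submods R M A B = {N. submodule N R M \<and> A \<subseteq> N \<and> N \<subseteq> B}"

context left_module
begin

lemma flag_append:
  assumes "B \<subseteq> C" "A \<subseteq> B" "has_flag (submods R M A B) m" "has_flag (submods R M B C) n"
  shows "has_flag (submods R M A C) (m + n)"
proof -
  obtain F where F: "\<forall>i\<le>m. F i \<in> submods R M A B" "\<forall>i<m. F i \<subset> F (Suc i)"
    using assms(3) by (auto simp: has_flag_def)
  obtain G where G: "\<forall>i\<le>n. G i \<in> submods R M B C" "\<forall>i<n. G i \<subset> G (Suc i)"
    using assms(4) by (auto simp: has_flag_def)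
  let ?H = "\<lambda>i. if i \<le> m then F i else G (i - m)"
  show ?thesis unfolding has_flag_def
  proof (intro exI[of _ ?H] conjI allI impI)
    fix i assume "i \<le> m + n"
    then have "?H i \<in> submods R M A B \<or> ?H i \<in> submods R M B C"
      using F(1) G(1) by (simp split: if_splits)
    then show "?H i \<in> submods R M A C"
      unfolding submods_def mem_Collect_eq using assms(1,2) by (meson order_trans)
  next
    fix i assume i: "i < m + n"
    consider "i < m" | "i = m" | "i > m" by linarith
    then show "?H i \<subset> ?H (Suc i)"
    proof cases
      case 2
      have "F m \<in> submods R M A B" "G 0 \<in> submods R M B C" using F(1) G(1) by blast+
      then have "F m \<subseteq> G 0" by (auto simp: submods_def)
      moreover have "G 0 \<subset> G (Suc 0)" using G(2) i 2 by auto
      ultimately have "F m \<subset> G (Suc 0)" by blast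
      then show ?thesis using 2 by auto
    next
      case 3
      then have "i - m < n" using i by auto
      then show ?thesis using 3 G(2) by (auto simp: Suc_diff_le)
    qed (use F in auto)
  qed
qed

text \<open>
  At each step of a flag, one of the ranks of \<open>F i \<inter> B\<close> and \<open>F i + B\<close> goes up by the modular law, and
  neither goes down. Hence the length of the flag is at most the sum of the two heights.
\<close>

lemma flag_split:
  assumes B: "submodule B R M" "A \<subseteq> B" "B \<subseteq> C" "submodule C R M"
    and bd: "bounded_flags (submods R M A B)" "bounded_flags (submods R M B C)"
    and n: "has_flag (submods R M A C) n"
  shows "n \<le> height (submods R M A B) + height (submods R M B C)"
proof -
  let ?L = "submods R M A B" and ?U = "submods R M B C"
  obtain F where F: "\<And>i. i \<le> n \<Longrightarrow> F i \<in> submods R M A C" "\<And>i. i < n \<Longrightarrow> F i \<subset> F (Suc i)"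
    using n by (auto simp: has_flag_def)
  have s: "submodule (F i) R M" if "i \<le> n" for i using F(1)[OF that] by (simp add: submods_def)
  have L: "F i \<inter> B \<in> ?L" if "i \<le> n" for i
    using submodule_Int[OF s[OF that] B(1)] F(1)[OF that] B by (auto simp: submods_def)
  have U: "sub_sum (F i) B \<in> ?U" if "i \<le> n" for i
    using submodule_sub_sum[OF s[OF that] B(1)] F(1)[OF that] B(3)
      sub_sum_upper(2)[OF s[OF that] B(1)] sub_sum_least[OF B(4), of "F i" B]
    by (auto simp: submods_def)
  have "i \<le> rank ?L (F i \<inter> B) + rank ?U (sub_sum (F i) B)" if "i \<le> n" for i
    using that
  proof (induction i)
    case (Suc i)
    then have i: "i \<le> n" "i < n" by auto
    have lt: "F i \<subset> F (Suc i)" using F(2) i by auto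
    have l: "F i \<inter> B \<subseteq> F (Suc i) \<inter> B" and u: "sub_sum (F i) B \<subseteq> sub_sum (F (Suc i)) B"
      using lt by (auto simp: sub_sum_def)
    note ll = rank_mono[OF bd(1) L[OF i(1)] l] and uu = rank_mono[OF bd(2) U[OF i(1)] u]
    have "F i \<inter> B \<subset> F (Suc i) \<inter> B \<or> sub_sum (F i) B \<subset> sub_sum (F (Suc i)) B"
    proof (rule ccontr)
      assume "\<not> ?thesis"
      then have "F i = F (Suc i)"
        using l u lt by (intro modular_cancel[OF s[OF i(1)] s[OF Suc.prems] B(1)]) auto
      then show False using lt by auto
    qed
    then show ?case
      using rank_strict_mono[OF bd(1) L[OF i(1)] L[OF Suc.prems]]
        rank_strict_mono[OF bd(2) U[OF i(1)] U[OF Suc.prems]] ll uu Suc.IH[OF i(1)]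
      by linarith
  qed auto
  from this[of n] show ?thesis
    using rank_le_height[OF bd(1) L[of n]] rank_le_height[OF bd(2) U[of n]] by linarith
qed

lemma bounded_flags_trans:
  assumes B: "submodule B R M" "A \<subseteq> B" "B \<subseteq> C" "submodule C R M"
    and bd: "bounded_flags (submods R M A B)" "bounded_flags (submods R M B C)"
  shows "bounded_flags (submods R M A C)"
proof -
  have "\<forall>n. has_flag (submods R M A C) n \<longrightarrow>
      n \<le> height (submods R M A B) + height (submods R M B C)"
    using flag_split[OF assms] by blast
  then show ?thesis unfolding bounded_flags_def by (rule exI)
qed

lemma height_trans:
  assumes B: "submodule B R M" "A \<subseteq> B" "B \<subseteq> C" "submodule C R M"
    and bd: "bounded_flags (submods R M A C)"
  shows "height (submods R M A C) = height (submods R M A B) + height (submods R M B C)"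
proof (rule antisym)
  have bd': "bounded_flags (submods R M A B)" "bounded_flags (submods R M B C)"
    using B by (auto intro!: bounded_flags_subset[OF bd] simp: submods_def)
  have ne: "submods R M A C \<noteq> {}" "submods R M A B \<noteq> {}" "submods R M B C \<noteq> {}"
    using B by (auto simp: submods_def)
  show "height (submods R M A C) \<le> height (submods R M A B) + height (submods R M B C)"
    by (rule flag_split[OF B bd' has_flag_height[OF bd ne(1)]])
  show "height (submods R M A B) + height (submods R M B C) \<le> height (submods R M A C)"
    using flag_append[OF B(3,2) has_flag_height[OF bd'(1) ne(2)] has_flag_height[OF bd'(2) ne(3)]]
    by (rule has_flag_le_height[OF bd])
qed

end

lemma mod_homI:
  assumes "\<And>x. x \<in> carrier X \<Longrightarrow> h x \<in> carrier Y"
    and "\<And>x y. x \<in> carrier X \<Longrightarrow> y \<in> carrier X \<Longrightarrow> h (x \<oplus>\<^bsub>X\<^esub> y) = h x \<oplus>\<^bsub>Y\<^esub> h y"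
    and "\<And>a x. a \<in> carrier R \<Longrightarrow> x \<in> carrier X \<Longrightarrow> h (a \<odot>\<^bsub>X\<^esub> x) = a \<odot>\<^bsub>Y\<^esub> h x"
  shows "h \<in> mod_hom R X Y"
  using assms by (auto simp: mod_hom_def hom_def)

lemma mod_homD:
  assumes "h \<in> mod_hom R X Y"
  shows "\<And>x. x \<in> carrier X \<Longrightarrow> h x \<in> carrier Y"
    and "\<And>x y. x \<in> carrier X \<Longrightarrow> y \<in> carrier X \<Longrightarrow> h (x \<oplus>\<^bsub>X\<^esub> y) = h x \<oplus>\<^bsub>Y\<^esub> h y"
    and "\<And>a x. a \<in> carrier R \<Longrightarrow> x \<in> carrier X \<Longrightarrow> h (a \<odot>\<^bsub>X\<^esub> x) = a \<odot>\<^bsub>Y\<^esub> h x"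
  using assms by (auto simp: mod_hom_def hom_def)

lemma mod_hom_group:
  assumes "left_module R X" "left_module R Y" "h \<in> mod_hom R X Y"
  shows "h \<zero>\<^bsub>X\<^esub> = \<zero>\<^bsub>Y\<^esub>"
    and "\<And>x. x \<in> carrier X \<Longrightarrow> h (\<ominus>\<^bsub>X\<^esub> x) = \<ominus>\<^bsub>Y\<^esub> h x"
    and "\<And>x y. x \<in> carrier X \<Longrightarrow> y \<in> carrier X \<Longrightarrow> h (x \<ominus>\<^bsub>X\<^esub> y) = h x \<ominus>\<^bsub>Y\<^esub> h y"
proof -
  interpret X: left_module R X by fact
  interpret Y: left_module R Y by fact
  note h = mod_homD[OF assms(3)]
  show 0: "h \<zero>\<^bsub>X\<^esub> = \<zero>\<^bsub>Y\<^esub>"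
    using h(2)[of "\<zero>\<^bsub>X\<^esub>" "\<zero>\<^bsub>X\<^esub>"] h(1)[of "\<zero>\<^bsub>X\<^esub>"] Y.add.r_cancel_one' by simp
  show 1: "h (\<ominus>\<^bsub>X\<^esub> x) = \<ominus>\<^bsub>Y\<^esub> h x" if x: "x \<in> carrier X" for x
    using h(2)[of "\<ominus>\<^bsub>X\<^esub> x" x] x 0 by (intro Y.minus_equality[symmetric]) (auto simp: h(1) X.l_neg)
  show "h (x \<ominus>\<^bsub>X\<^esub> y) = h x \<ominus>\<^bsub>Y\<^esub> h y" if "x \<in> carrier X" "y \<in> carrier X" for x y
    using that 1 h(2)[of x "\<ominus>\<^bsub>X\<^esub> y"] by (simp add: a_minus_def)
qed

lemma mod_hom_comp:
  assumes "f \<in> mod_hom R X Y" "g \<in> mod_hom R Y Z"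
  shows "(\<lambda>x. g (f x)) \<in> mod_hom R X Z"
  using mod_homD[OF assms(1)] mod_homD[OF assms(2)] by (intro mod_homI) auto

lemma mod_hom_id: "(\<lambda>x. x) \<in> mod_hom R X X"
  by (rule mod_homI) auto

lemma mod_hom_cong:
  assumes "f \<in> mod_hom R X Y" "\<And>x. x \<in> carrier X \<Longrightarrow> g x = f x" "left_module R X"
  shows "g \<in> mod_hom R X Y"
proof -
  interpret X: left_module R X by fact
  show ?thesis using mod_homD[OF assms(1)] assms(2) by (intro mod_homI) auto
qed

lemma mod_hom_const_zero:
  assumes "left_module R Y"
  shows "(\<lambda>x. \<zero>\<^bsub>Y\<^esub>) \<in> mod_hom R X Y"
proof -
  interpret Y: left_module R Y by fact
  show ?thesis by (intro mod_homI) auto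
qed

lemma mod_hom_add:
  assumes "left_module R Y" "f \<in> mod_hom R X Y" "g \<in> mod_hom R X Y"
  shows "(\<lambda>x. f x \<oplus>\<^bsub>Y\<^esub> g x) \<in> mod_hom R X Y"
proof -
  interpret Y: left_module R Y by fact
  show ?thesis using mod_homD[OF assms(2)] mod_homD[OF assms(3)]
    by (intro mod_homI) (auto simp: Y.a_ac Y.smult_r_distr)
qed

lemma mod_hom_neg:
  assumes "left_module R Y" "f \<in> mod_hom R X Y"
  shows "(\<lambda>x. \<ominus>\<^bsub>Y\<^esub> f x) \<in> mod_hom R X Y"
proof -
  interpret Y: left_module R Y by fact
  show ?thesis using mod_homD[OF assms(2)]
    by (intro mod_homI) (auto simp: Y.smult_r_minus Y.minus_add)
qed

lemma mod_hom_minus: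
  assumes "left_module R Y" "f \<in> mod_hom R X Y" "g \<in> mod_hom R X Y"
  shows "(\<lambda>x. f x \<ominus>\<^bsub>Y\<^esub> g x) \<in> mod_hom R X Y"
  using mod_hom_add[OF assms(1,2) mod_hom_neg[OF assms(1,3)]] by (simp add: a_minus_def)

lemma submodule_image:
  assumes "left_module R X" "left_module R Y" "h \<in> mod_hom R X Y" "submodule N R X"
  shows "submodule (h ` N) R Y"
proof -
  interpret X: left_module R X by fact
  interpret Y: left_module R Y by fact
  note h = mod_homD[OF assms(3)] mod_hom_group(1)[OF assms(1-3)]
    and N = X.is_submoduleD[OF assms(4)]
  show ?thesis
  proof (rule Y.is_submoduleI)
    show "h ` N \<subseteq> carrier Y" using h(1) N(1) by auto
    show "\<zero>\<^bsub>Y\<^esub> \<in> h ` N" using h(4) N(2) by (metis imageI)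
    show "x \<oplus>\<^bsub>Y\<^esub> y \<in> h ` N" if "x \<in> h ` N" "y \<in> h ` N" for x y
      using that N by (auto simp: subset_iff simp flip: h(2))
    show "a \<odot>\<^bsub>Y\<^esub> x \<in> h ` N" if "a \<in> carrier R" "x \<in> h ` N" for a x
      using that N by (auto simp: subset_iff simp flip: h(3))
  qed
qed

lemma submodule_vimage:
  assumes "left_module R X" "left_module R Y" "h \<in> mod_hom R X Y" "submodule N R Y" "submodule B R X"
  shows "submodule {x \<in> B. h x \<in> N} R X"
proof -
  interpret X: left_module R X by fact
  interpret Y: left_module R Y by fact
  note h = mod_homD[OF assms(3)] mod_hom_group(1)[OF assms(1-3)]
    and N = Y.is_submoduleD[OF assms(4)] and B = X.is_submoduleD[OF assms(5)]
  show ?thesis using B N by (intro X.is_submoduleI) (auto simp: h subset_iff)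
qed

text \<open>
  The correspondence theorem for submodules. Image and preimage under \<open>h\<close> keep inclusions strict,
  since on the left all submodules contain the kernel of \<open>h\<close> on \<open>B\<close>, and on the right they lie in the
  image of \<open>B\<close>.
\<close>

lemma flags_correspond:
  assumes X: "left_module R X" and Y: "left_module R Y" and h: "h \<in> mod_hom R X Y"
    and B: "submodule B R X" and A: "submodule A R Y" "A \<subseteq> h ` B"
  shows "has_flag (submods R X {b \<in> B. h b \<in> A} B) n \<longleftrightarrow> has_flag (submods R Y A (h ` B)) n"
proof
  interpret X: left_module R X by fact
  interpret Y: left_module R Y by fact
  let ?K = "{b \<in> B. h b \<in> A}"
  note hh = mod_homD[OF h] mod_hom_group[OF X Y h] and AA = Y.is_submoduleD[OF A(1)]
    and BB = X.is_submoduleD[OF B]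
  assume "has_flag (submods R X ?K B) n"
  then show "has_flag (submods R Y A (h ` B)) n"
  proof (rule has_flag_image[of _ "(`) h", rotated 2])
    fix D assume D: "D \<in> submods R X ?K B"
    have "A \<subseteq> h ` D"
    proof
      fix a assume a: "a \<in> A"
      then obtain b where "b \<in> B" "a = h b" using A by auto
      then show "a \<in> h ` D" using D a by (auto simp: submods_def)
    qed
    then show "h ` D \<in> submods R Y A (h ` B)"
      using D submodule_image[OF X Y h] by (auto simp: submods_def)
  next
    fix D D' assume D: "D \<in> submods R X ?K B" "D' \<in> submods R X ?K B" "D \<subset> D'"
    have "h ` D \<noteq> h ` D'"
    proof
      assume eq: "h ` D = h ` D'"
      obtain x where x: "x \<in> D'" "x \<notin> D" using D by auto
      then obtain y where y: "y \<in> D" "h x = h y" using eq by (metis imageE imageI)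
      have c: "x \<in> carrier X" "y \<in> carrier X" "x \<in> B" "y \<in> B"
        using x y D BB(1) by (auto simp: submods_def)
      have "h (x \<ominus>\<^bsub>X\<^esub> y) = \<zero>\<^bsub>Y\<^esub>" using y c hh by (simp add: a_minus_def Y.r_neg)
      then have "x \<ominus>\<^bsub>X\<^esub> y \<in> ?K" using c(3,4) BB(6) AA(2) by simp
      then have "x \<ominus>\<^bsub>X\<^esub> y \<in> D" using D(1) by (auto simp: submods_def)
      moreover have "x = (x \<ominus>\<^bsub>X\<^esub> y) \<oplus>\<^bsub>X\<^esub> y" using c by (simp add: a_minus_def X.a_assoc X.l_neg)
      ultimately show False
        using x y D X.is_submoduleD(3)[of D "x \<ominus>\<^bsub>X\<^esub> y" y] by (auto simp: submods_def)
    qed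
    then show "h ` D \<subset> h ` D'" using D by auto
  qed
next
  let ?K = "{b \<in> B. h b \<in> A}"
  assume "has_flag (submods R Y A (h ` B)) n"
  then show "has_flag (submods R X ?K B) n"
  proof (rule has_flag_image[of _ "\<lambda>D. {b \<in> B. h b \<in> D}", rotated 2])
    fix D assume D: "D \<in> submods R Y A (h ` B)"
    then show "{b \<in> B. h b \<in> D} \<in> submods R X ?K B"
      using submodule_vimage[OF X Y h _ B] by (auto simp: submods_def)
  next
    fix D D' assume D: "D \<in> submods R Y A (h ` B)" "D' \<in> submods R Y A (h ` B)" "D \<subset> D'"
    then obtain y where y: "y \<in> D'" "y \<notin> D" by auto
    moreover have "D' \<subseteq> h ` B" using D(2) by (simp add: submods_def)
    ultimately obtain b where b: "b \<in> B" "y = h b" by blast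
    then show "{b \<in> B. h b \<in> D} \<subset> {b \<in> B. h b \<in> D'}"
      using y D by auto
  qed
qed

lemma
  assumes "left_module R X" "left_module R Y" "h \<in> mod_hom R X Y"
    and "submodule B R X" "submodule A R Y" "A \<subseteq> h ` B"
  shows height_correspond:
      "height (submods R X {b \<in> B. h b \<in> A} B) = height (submods R Y A (h ` B))"
    and bounded_correspond:
      "bounded_flags (submods R X {b \<in> B. h b \<in> A} B) \<longleftrightarrow> bounded_flags (submods R Y A (h ` B))"
  using flags_correspond[OF assms] by (auto simp: height_def bounded_flags_def)

section \<open>Finite length over a local artinian ring\<close>

lemma bounded_flags_pair: "bounded_flags {A, B}"
  unfolding bounded_flags_def
proof (intro exI[of _ 1] allI impI, rule ccontr)
  fix n assume "has_flag {A, B} n" "\<not> n \<le> 1"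
  then obtain C where C: "\<And>i. i \<le> n \<Longrightarrow> C i \<in> {A, B}" "\<And>i. i < n \<Longrightarrow> C i \<subset> C (Suc i)" and "n \<ge> 2"
    by (auto simp: has_flag_def)
  then have "C 0 \<in> {A, B}" "C 1 \<in> {A, B}" "C 2 \<in> {A, B}" "C 0 \<subset> C 1" "C 1 \<subset> C 2"
    using C(2)[of 0] C(2)[of 1] by (auto simp: numeral_2_eq_2)
  then show False by auto
qed

text \<open>
  Zorn's lemma supplies the maximal submodules from which the ascending chain condition is derived.
\<close>

lemma (in left_module) ex_maximal_avoiding:
  assumes N: "submodule N R M" "N \<subseteq> I" "submodule I R M" "y \<notin> N"
  obtains J where "submodule J R M" "N \<subseteq> J" "J \<subseteq> I" "y \<notin> J"
    "\<And>K. submodule K R M \<Longrightarrow> J \<subseteq> K \<Longrightarrow> K \<subseteq> I \<Longrightarrow> y \<notin> K \<Longrightarrow> K = J"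
proof -
  define \<N> where "\<N> = {K. submodule K R M \<and> N \<subseteq> K \<and> K \<subseteq> I \<and> y \<notin> K}"
  have "\<exists>J\<in>\<N>. \<forall>K\<in>\<N>. J \<subseteq> K \<longrightarrow> K = J"
  proof (rule subset_Zorn_nonempty)
    show "\<N> \<noteq> {}" using N by (auto simp: \<N>_def)
    fix C assume C: "C \<noteq> {}" "subset.chain \<N> C"
    then have CN: "C \<subseteq> \<N>" and lin: "\<And>A B. A \<in> C \<Longrightarrow> B \<in> C \<Longrightarrow> A \<subseteq> B \<or> B \<subseteq> A"
      by (auto simp: subset_chain_def)
    have s: "submodule A R M" if "A \<in> C" for A using that CN by (auto simp: \<N>_def)
    have "submodule (\<Union>C) R M"
    proof (rule is_submoduleI)
      show "\<Union>C \<subseteq> carrier M" using is_submoduleD(1)[OF s] by auto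
      show "\<zero>\<^bsub>M\<^esub> \<in> \<Union>C" using C(1) is_submoduleD(2)[OF s] by auto
      fix x z assume "x \<in> \<Union>C" "z \<in> \<Union>C"
      then obtain A B where AB: "x \<in> A" "A \<in> C" "z \<in> B" "B \<in> C" by auto
      then obtain D where "x \<in> D" "z \<in> D" "D \<in> C" using lin[of A B] by blast
      then show "x \<oplus>\<^bsub>M\<^esub> z \<in> \<Union>C" using is_submoduleD(3)[OF s, of D x z] by auto
    next
      fix a x assume "a \<in> carrier R" "x \<in> \<Union>C"
      then show "a \<odot>\<^bsub>M\<^esub> x \<in> \<Union>C" using is_submoduleD(4)[OF s] by auto
    qed
    moreover have "N \<subseteq> \<Union>C" "\<Union>C \<subseteq> I" "y \<notin> \<Union>C" using C(1) CN by (auto simp: \<N>_def)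
    ultimately show "\<Union>C \<in> \<N>" by (simp add: \<N>_def)
  qed
  then obtain J where J: "J \<in> \<N>" and max: "\<And>K. K \<in> \<N> \<Longrightarrow> J \<subseteq> K \<Longrightarrow> K = J" by blast
  show thesis
  proof (rule that)
    fix K assume K: "submodule K R M" "J \<subseteq> K" "K \<subseteq> I" "y \<notin> K"
    then have "K \<in> \<N>" using J by (auto simp: \<N>_def)
    then show "K = J" using max K(2) by blast
  qed (use J in \<open>auto simp: \<N>_def\<close>)
qed

lemma submodule_regular_iff_ideal:
  fixes R (structure)
  assumes "cring R"
  shows "submodule I R (regular_module R) \<longleftrightarrow> ideal I R"
proof -
  interpret cring R by fact
  interpret V: left_module R "regular_module R" by (rule left_module_regular_module[OF ring_axioms])
  have V [simp]: "carrier (regular_module R) = carrier R" "\<zero>\<^bsub>regular_module R\<^esub> = \<zero>"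
      "\<And>x y. x \<oplus>\<^bsub>regular_module R\<^esub> y = x \<oplus> y" "\<And>x y. x \<odot>\<^bsub>regular_module R\<^esub> y = x \<otimes> y"
      "\<And>x. \<ominus>\<^bsub>regular_module R\<^esub> x = \<ominus> x"
    by (auto simp: regular_module_def a_inv_def m_inv_def)
  show ?thesis
  proof
    assume I: "submodule I R (regular_module R)"
    note i = V.is_submoduleD[OF I, simplified]
    have "subgroup I (add_monoid R)"
      by (intro subgroup.intro) (use i in \<open>auto simp flip: a_inv_def\<close>)
    moreover have "x \<otimes> a \<in> I" if "a \<in> carrier R" "x \<in> I" for a x
      using i(4)[OF that] m_comm[of a x] that i(1) by auto
    ultimately show "ideal I R" using i(4) by (intro idealI ring_axioms) auto
  next
    assume I: "ideal I R"
    then interpret ideal I R .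
    show "submodule I R (regular_module R)"
      by (rule V.is_submoduleI) (auto simp: I_l_closed a_closed)
  qed
qed

lemma artinian_minimal_ideal:
  assumes "artinian_ring R" "K \<noteq> {}" "\<And>I. I \<in> K \<Longrightarrow> ideal I R"
  obtains I where "I \<in> K" "\<And>J. J \<in> K \<Longrightarrow> J \<subseteq> I \<Longrightarrow> J = I"
proof (rule ccontr)
  assume "\<not> thesis"
  then have "\<forall>I\<in>K. \<exists>J\<in>K. J \<subset> I" using that by blast
  then obtain f where f: "\<And>I. I \<in> K \<Longrightarrow> f I \<in> K \<and> f I \<subset> I" by metis
  obtain I0 where "I0 \<in> K" using assms(2) by blast
  define I where "I = (\<lambda>n. (f ^^ n) I0)"
  have IK: "I n \<in> K" for n by (induction n) (use f \<open>I0 \<in> K\<close> in \<open>auto simp: I_def\<close>)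
  have lt: "I (Suc n) \<subset> I n" for n using f[OF IK[of n]] by (simp add: I_def)
  obtain N where N: "\<forall>n\<ge>N. I n = I N"
    using assms(1) assms(3)[OF IK] lt unfolding artinian_ring_def by (meson psubsetE)
  have "I (Suc N) = I N" using N le_SucI[OF order_refl] by blast
  then show False using lt[of N] by blast
qed

lemma local_nonmember_Units:
  fixes R (structure)
  assumes "local_ring R" "maximalideal \<mm> R" "r \<in> carrier R" "r \<notin> \<mm>"
  shows "r \<in> Units R"
proof (rule ccontr)
  assume nu: "r \<notin> Units R"
  interpret cring R using assms(1) by (simp add: local_ring_def)
  interpret V: left_module R "regular_module R" by (rule left_module_regular_module[OF ring_axioms])
  have car [simp]: "carrier (regular_module R) = carrier R" by (simp add: regular_module_def)
  have I: "ideal (PIdl r) R" using cgenideal_ideal assms(3) by blast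
  have one: "\<one> \<notin> PIdl r"
  proof
    assume "\<one> \<in> PIdl r"
    then obtain s where "s \<in> carrier R" "\<one> = s \<otimes> r" by (auto simp: cgenideal_def)
    then show False using nu assms(3) by (auto simp: Units_def m_comm)
  qed
  obtain J where J: "submodule J R (regular_module R)" "PIdl r \<subseteq> J" "\<one> \<notin> J"
      "\<And>K. submodule K R (regular_module R) \<Longrightarrow> J \<subseteq> K \<Longrightarrow> K \<subseteq> carrier R \<Longrightarrow> \<one> \<notin> K \<Longrightarrow> K = J"
    using V.ex_maximal_avoiding[of "PIdl r" "carrier R" \<one>] I one V.submodule_carrier
      submodule_regular_iff_ideal[OF is_cring] ideal.Icarr[OF I] by (metis car subsetI)
  have "maximalideal J R"
  proof (rule maximalidealI)
    show "ideal J R" using J(1) submodule_regular_iff_ideal[OF is_cring] by simp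
    show "carrier R \<noteq> J" using J(3) by auto
    fix K assume K: "ideal K R" "J \<subseteq> K" "K \<subseteq> carrier R"
    show "K = J \<or> K = carrier R"
      using J(4)[of K] K submodule_regular_iff_ideal[OF is_cring] ideal.one_imp_carrier[OF K(1)] by blast
  qed
  then have "J = \<mm>" using assms(1,2) by (auto simp: local_ring_def)
  then show False using J(2) cgenideal_self[OF assms(3)] assms(4) by blast
qed

text \<open>
  The Hopkins-Levitzki theorem for local rings. Let \<open>I\<close> be minimal among the ideals above which flags
  are bounded. If \<open>I\<close> is not zero, then \<open>I \<noteq> \<mm> I\<close> for the maximal ideal \<open>\<mm>\<close>. An ideal \<open>J\<close> between
  \<open>\<mm> I\<close> and \<open>I\<close> that is maximal among those avoiding some \<open>y \<in> I\<close> has a simple quotient \<open>I / J\<close>,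
  so flags above \<open>J\<close> are bounded too, against the minimality of \<open>I\<close>.
\<close>

theorem artinian_local_finite_length:
  fixes R (structure)
  assumes "artinian_ring R" "local_ring R"
  shows "bounded_flags (submods R (regular_module R) {\<zero>\<^bsub>R\<^esub>} (carrier R))"
proof -
  interpret cring R using assms(2) by (simp add: local_ring_def)
  define V where "V = regular_module R"
  interpret V: left_module R V unfolding V_def by (rule left_module_regular_module[OF ring_axioms])
  have V [simp]: "carrier V = carrier R" "\<zero>\<^bsub>V\<^esub> = \<zero>" "\<And>x y. x \<oplus>\<^bsub>V\<^esub> y = x \<oplus> y"
      "\<And>x y. x \<odot>\<^bsub>V\<^esub> y = x \<otimes> y"
    by (auto simp: V_def regular_module_def)
  note sub_ideal = submodule_regular_iff_ideal[OF is_cring, folded V_def]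
  obtain \<mm> where m: "maximalideal \<mm> R" using assms(2) by (auto simp: local_ring_def)
  note unit = local_nonmember_Units[OF assms(2) m]
  have mI: "ideal \<mm> R" using m by (simp add: maximalideal_def)
  have m1: "\<one> \<notin> \<mm>"
    using m ideal.one_imp_carrier[OF mI] maximalideal.I_notcarr by blast
  have mc: "a \<in> carrier R" if "a \<in> \<mm>" for a using ideal.Icarr[OF mI that] .
  define T where "T = {I. submodule I R V \<and> bounded_flags (submods R V I (carrier R))}"
  have "submods R V (carrier R) (carrier R) \<subseteq> {carrier R}" by (auto simp: submods_def)
  then have "carrier R \<in> T"
    using V.submodule_carrier bounded_flags_subset[of "{carrier R}"] by (simp add: T_def)
  then have "T \<noteq> {}" by blast
  moreover have "ideal I R" if "I \<in> T" for I using that by (simp add: T_def sub_ideal)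
  ultimately obtain I where I: "I \<in> T" and Imin: "\<And>J. J \<in> T \<Longrightarrow> J \<subseteq> I \<Longrightarrow> J = I"
    using artinian_minimal_ideal[OF assms(1), of T] by blast
  have Is: "submodule I R V" using I by (simp add: T_def)
  note I1 = V.is_submoduleD[OF Is, simplified]
  have "I = {\<zero>}"
  proof (rule ccontr)
    assume I0: "I \<noteq> {\<zero>}"
    \<comment> \<open>Nakayama's lemma for \<open>I\<close> from the descending chain condition: a minimal \<open>J\<close> with \<open>J I \<noteq> 0\<close> is
      principal, say \<open>J = (x)\<close>, and \<open>\<mm> I = I\<close> gives \<open>a \<in> \<mm>\<close> with \<open>x a I \<noteq> 0\<close>. So \<open>(x a) = (x)\<close>,
      and \<open>x (1 - r a) = 0\<close> with \<open>1 - r a\<close> a unit.\<close>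
    have "\<exists>N y. submodule N R V \<and> (\<forall>a\<in>\<mm>. \<forall>x\<in>I. a \<otimes> x \<in> N) \<and> y \<in> I \<and> y \<notin> N"
    proof (rule ccontr)
      assume "\<not> ?thesis"
      then have Nak: "I \<subseteq> N" if "submodule N R V" "\<forall>a\<in>\<mm>. \<forall>x\<in>I. a \<otimes> x \<in> N" for N
        using that by blast
      define K where "K = {J. ideal J R \<and> (\<exists>x\<in>J. \<exists>i\<in>I. x \<otimes> i \<noteq> \<zero>)}"
      obtain i0 where "i0 \<in> I" "i0 \<noteq> \<zero>" using I0 I1(2) by blast
      then have "\<one> \<otimes> i0 \<noteq> \<zero>" using I1(1) by auto
      then have "carrier R \<in> K" using \<open>i0 \<in> I\<close> oneideal by (auto simp: K_def)
      then have "K \<noteq> {}" by blast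
      moreover have "ideal J R" if "J \<in> K" for J using that by (simp add: K_def)
      ultimately obtain J where J: "J \<in> K" "\<And>J'. J' \<in> K \<Longrightarrow> J' \<subseteq> J \<Longrightarrow> J' = J"
        using artinian_minimal_ideal[OF assms(1), of K] by blast
      then obtain x i where x: "x \<in> J" "i \<in> I" "x \<otimes> i \<noteq> \<zero>" by (auto simp: K_def)
      have Ji: "ideal J R" using J by (simp add: K_def)
      have xc: "x \<in> carrier R" using ideal.Icarr[OF Ji x(1)] .
      have ann: "submodule {r \<in> carrier R. x \<otimes> r = \<zero>} R V"
        by (rule V.is_submoduleI) (auto simp: xc r_distr m_lcomm)
      have "\<not> I \<subseteq> {r \<in> carrier R. x \<otimes> r = \<zero>}" using x by auto
      then obtain a j where aj: "a \<in> \<mm>" "j \<in> I" "x \<otimes> (a \<otimes> j) \<noteq> \<zero>"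
      proof -
        have "\<not> (\<forall>a\<in>\<mm>. \<forall>j\<in>I. a \<otimes> j \<in> {r \<in> carrier R. x \<otimes> r = \<zero>})"
          using Nak[OF ann] \<open>\<not> I \<subseteq> _\<close> by blast
        then obtain a j where "a \<in> \<mm>" "j \<in> I" "a \<otimes> j \<notin> {r \<in> carrier R. x \<otimes> r = \<zero>}" by blast
        then show thesis using that[of a j] mc[of a] I1(1) by auto
      qed
      have c: "a \<in> carrier R" "j \<in> carrier R" using aj I1(1) mc by auto
      have pid: "ideal (PIdl (x \<otimes> a)) R" using cgenideal_ideal xc c by blast
      have "PIdl (x \<otimes> a) \<in> K"
      proof -
        have "x \<otimes> a \<in> PIdl (x \<otimes> a)" using cgenideal_self xc c by blast
        moreover have "(x \<otimes> a) \<otimes> j \<noteq> \<zero>" using aj(3) xc c by (simp add: m_assoc)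
        ultimately show ?thesis using pid aj(2) unfolding K_def by blast
      qed
      moreover have "PIdl (x \<otimes> a) \<subseteq> J"
        using ideal.I_r_closed[OF Ji x(1) c(1)] cgenideal_minimal[OF Ji] by blast
      ultimately have "x \<in> PIdl (x \<otimes> a)" using J(2) x(1) by blast
      then obtain r where r: "r \<in> carrier R" "x = r \<otimes> (x \<otimes> a)" by (auto simp: cgenideal_def)
      have ra: "r \<otimes> a \<in> \<mm>" using ideal.I_l_closed[OF mI aj(1) r(1)] .
      have "\<one> \<ominus> r \<otimes> a \<notin> \<mm>"
      proof
        assume "\<one> \<ominus> r \<otimes> a \<in> \<mm>"
        then have "(\<one> \<ominus> r \<otimes> a) \<oplus> r \<otimes> a \<in> \<mm>"
          using ra mI additive_subgroup.a_closed ideal.axioms(1) by metis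
        then show False using m1 r c by (simp add: a_minus_def a_assoc l_neg)
      qed
      then have u: "\<one> \<ominus> r \<otimes> a \<in> Units R" using unit r c by simp
      have "x \<otimes> (\<one> \<ominus> r \<otimes> a) = x \<ominus> r \<otimes> (x \<otimes> a)"
        using r(1) c xc by (simp add: a_minus_def r_distr r_minus m_lcomm)
      also have "\<dots> = \<zero>" using r xc by (simp add: a_minus_def r_neg)
      finally have "x = \<zero>" using u xc Units_r_inv_ex[OF u]
        by (metis Units_closed l_null m_assoc r_one)
      then show False using x I1(1) by auto
    qed
    then obtain N y where N: "submodule N R V" "\<And>a x. a \<in> \<mm> \<Longrightarrow> x \<in> I \<Longrightarrow> a \<otimes> x \<in> N" "y \<in> I" "y \<notin> N"
      by blast
    obtain J where J: "submodule J R V" "N \<inter> I \<subseteq> J" "J \<subseteq> I" "y \<notin> J"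
        "\<And>K. submodule K R V \<Longrightarrow> J \<subseteq> K \<Longrightarrow> K \<subseteq> I \<Longrightarrow> y \<notin> K \<Longrightarrow> K = J"
      using V.ex_maximal_avoiding[OF V.submodule_Int[OF N(1) Is], of I y] N(4) Is by blast
    have "submods R V J I \<subseteq> {J, I}"
    proof
      fix K assume K: "K \<in> submods R V J I"
      then have Ks: "submodule K R V" "J \<subseteq> K" "K \<subseteq> I" by (auto simp: submods_def)
      show "K \<in> {J, I}"
      proof (cases "y \<in> K")
        case False
        then show ?thesis using J(5) Ks by blast
      next
        case True
        have "z \<in> K" if z: "z \<in> I" for z
        proof (cases "z \<in> J")
          case False
          have zc: "z \<in> carrier R" using z I1(1) by auto
          have Rz: "submodule (PIdl z) R V" using sub_ideal cgenideal_ideal[OF zc] by simp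
          have zI: "PIdl z \<subseteq> I" using cgenideal_minimal[OF _ z] Is sub_ideal by blast
          have "V.sub_sum J (PIdl z) \<noteq> J"
            using V.sub_sum_upper(2)[OF J(1) Rz] cgenideal_self[OF zc] False by blast
          then have "y \<in> V.sub_sum J (PIdl z)"
            using J(5)[OF V.submodule_sub_sum[OF J(1) Rz] V.sub_sum_upper(1)[OF J(1) Rz]
                V.sub_sum_least[OF Is J(3) zI]] by blast
          then obtain j r where jr: "y = j \<oplus> r \<otimes> z" "j \<in> J" "r \<in> carrier R"
            by (auto simp: V.sub_sum_def cgenideal_def)
          have jc: "j \<in> carrier R" using jr(2) V.is_submoduleD(1)[OF J(1)] by auto
          have "r \<notin> \<mm>"
          proof
            assume "r \<in> \<mm>"
            then have "r \<otimes> z \<in> J"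
              using N(2)[OF _ z] I1(4)[OF _ z] jr(3) J(2) by blast
            then show False using V.is_submoduleD(3)[OF J(1) jr(2)] jr(1) J(4) by simp
          qed
          then have "r \<in> Units R" using unit jr by blast
          then obtain s where s: "s \<in> carrier R" "s \<otimes> r = \<one>" using Units_l_inv_ex by blast
          have "r \<otimes> z = \<ominus> j \<oplus> y" using jr jc zc by (simp add: r_neg1)
          then have "s \<otimes> (\<ominus> j \<oplus> y) = z" using s jr zc by (simp flip: m_assoc)
          moreover have "s \<otimes> (\<ominus> j \<oplus> y) \<in> K"
          proof -
            have "(\<ominus> \<one>) \<otimes> j \<in> K"
              using V.is_submoduleD(4)[OF Ks(1), of "\<ominus> \<one>" j] jr(2) Ks(2) by auto
            then have "\<ominus> j \<in> K" using jc by (simp add: l_minus)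
            then show ?thesis
              using V.is_submoduleD(3,4)[OF Ks(1)] True s(1) by simp
          qed
          ultimately show ?thesis by simp
        qed (use Ks in auto)
        then show ?thesis using Ks by blast
      qed
    qed
    then have "bounded_flags (submods R V J I)"
      using bounded_flags_subset[OF bounded_flags_pair] by blast
    then have "J \<in> T"
      using V.bounded_flags_trans[OF Is J(3), of "carrier R"] I I1(1) J(1) V.submodule_carrier
      by (simp add: T_def)
    then show False using Imin[of J] J(3,4) N(3) by blast
  qed
  then show ?thesis using I by (simp add: T_def V_def)
qed

text \<open>
  A submodule between \<open>N\<close> and \<open>N + h(U)\<close> is determined by its preimage in \<open>U\<close>. This is the step that
  bounds the flags of a finitely generated module, one generator at a time.
\<close>

lemma bounded_flags_add_image:
  assumes U: "left_module R U" and V: "left_module R V" and h: "h \<in> mod_hom R U V"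
    and N: "submodule N R V" "submodule A R V" "A \<subseteq> N"
    and bd: "bounded_flags (submods R U {\<zero>\<^bsub>U\<^esub>} (carrier U))" "bounded_flags (submods R V A N)"
  shows "bounded_flags (submods R V A (left_module.sub_sum V N (h ` carrier U)))"
proof -
  interpret U: left_module R U by fact
  interpret V: left_module R V by fact
  note hh = mod_homD[OF h] mod_hom_group[OF U V h]
  have hU: "submodule (h ` carrier U) R V" by (rule submodule_image[OF U V h U.submodule_carrier])
  let ?S = "V.sub_sum N (h ` carrier U)"
  have S: "submodule ?S R V" by (rule V.submodule_sub_sum[OF N(1) hU])
  have "bounded_flags (submods R V N ?S)"
  proof (rule bounded_flags_image[OF _ _ bd(1), of _ "\<lambda>D. {u \<in> carrier U. h u \<in> D}"])
    fix D assume D: "D \<in> submods R V N ?S"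
    then show "{u \<in> carrier U. h u \<in> D} \<in> submods R U {\<zero>\<^bsub>U\<^esub>} (carrier U)"
      using submodule_vimage[OF U V h _ U.submodule_carrier] hh(4) V.is_submoduleD(2)[of D]
      by (auto simp: submods_def)
  next
    fix D D' assume D: "D \<in> submods R V N ?S" "D' \<in> submods R V N ?S" "D \<subset> D'"
    then have s: "submodule D R V" "submodule D' R V" "N \<subseteq> D" "N \<subseteq> D'" "D' \<subseteq> ?S"
      by (auto simp: submods_def)
    obtain z where z: "z \<in> D'" "z \<notin> D" using D by auto
    then have "z \<in> ?S" using s by blast
    then obtain n u where nu: "z = n \<oplus>\<^bsub>V\<^esub> h u" "n \<in> N" "u \<in> carrier U" by (auto simp: V.sub_sum_def)
    have nc: "n \<in> carrier V" using nu V.is_submoduleD(1)[OF N(1)] by auto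
    have "h u = \<ominus>\<^bsub>V\<^esub> n \<oplus>\<^bsub>V\<^esub> z" using nu nc hh by (simp add: V.r_neg1)
    moreover have "\<ominus>\<^bsub>V\<^esub> n \<in> D'" using V.is_submoduleD(5)[OF s(2)] nu s by blast
    ultimately have "h u \<in> D'" using V.is_submoduleD(3)[OF s(2) _ z(1)] by simp
    moreover have "h u \<notin> D" using V.is_submoduleD(3)[OF s(1), of n "h u"] nu s z by blast
    ultimately show "{u \<in> carrier U. h u \<in> D} \<subset> {u \<in> carrier U. h u \<in> D'}"
      using nu(3) D(3) by blast
  qed
  then show ?thesis
    by (rule V.bounded_flags_trans[OF N(1) N(3) V.sub_sum_upper(1)[OF N(1) hU] S bd(2)])
qed

text \<open>
  A maximal one among the submodules spanned by finite sets contains every element.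
\<close>

lemma (in left_module) finitely_generated_if_bounded:
  assumes bd: "bounded_flags (submods R M {\<zero>\<^bsub>M\<^esub>} (carrier M))"
  shows "finitely_generated R M"
proof -
  define span where "span = (\<lambda>S. \<Inter>{N. submodule N R M \<and> S \<subseteq> N})"
  have sp: "submodule (span S) R M" if "S \<subseteq> carrier M" for S
  proof (rule is_submoduleI)
    show "span S \<subseteq> carrier M" using submodule_carrier that by (auto simp: span_def)
  qed (auto simp: span_def is_submoduleD)
  define K where "K = {span S | S. finite S \<and> S \<subseteq> carrier M}"
  have "K \<noteq> {}" by (auto simp: K_def)
  moreover have "K \<subseteq> submods R M {\<zero>\<^bsub>M\<^esub>} (carrier M)"
  proof
    fix A assume "A \<in> K"
    then obtain S where S: "S \<subseteq> carrier M" "A = span S" by (auto simp: K_def)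
    then show "A \<in> submods R M {\<zero>\<^bsub>M\<^esub>} (carrier M)"
      using sp[OF S(1)] is_submoduleD(1,2)[OF sp[OF S(1)]] by (simp add: submods_def)
  qed
  ultimately obtain A where A: "A \<in> K" "\<And>B. B \<in> K \<Longrightarrow> A \<subseteq> B \<Longrightarrow> B = A"
    using ex_maximal_member[OF bd] by blast
  then obtain S where S: "finite S" "S \<subseteq> carrier M" "A = span S" by (auto simp: K_def)
  show ?thesis unfolding finitely_generated_def
  proof (intro exI[of _ S] conjI S allI impI)
    fix N assume N: "submodule N R M \<and> S \<subseteq> N"
    have "x \<in> N" if x: "x \<in> carrier M" for x
    proof -
      have "span (insert x S) \<in> K" using S x by (auto simp: K_def)
      moreover have "A \<subseteq> span (insert x S)" using S(3) by (auto simp: span_def)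
      ultimately have "span (insert x S) = A" using A(2) by blast
      then have "x \<in> A" by (auto simp: span_def)
      then show "x \<in> N" using S(3) N by (auto simp: span_def)
    qed
    then show "N = carrier M" using N is_submoduleD(1) by blast
  qed
qed

section \<open>Modules over an artin algebra\<close>

lemma finitely_generatedE:
  assumes "finitely_generated R M"
  obtains S where "finite S" "S \<subseteq> carrier M"
    "\<And>N. submodule N R M \<Longrightarrow> S \<subseteq> N \<Longrightarrow> N = carrier M"
  using assms unfolding finitely_generated_def by metis

text \<open>
  With a plain module record for \<open>\<Lambda>\<close>, homomorphisms into \<open>\<Lambda>\<close> as an \<open>R\<close>-module are instances of
  \<open>mod_hom\<close>.
\<close>

locale artin_algebra_modules = artin_algebra R \<Lambda>
  for R :: "('r, 'k) ring_scheme" (structure) and \<Lambda> :: "('r, 'a) module" (structure)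
begin

lemma R_ring: "ring R" by (rule R.ring_axioms)

lemma Lambda_ring: "ring \<Lambda>" by (rule \<Lambda>.ring_axioms)

lemma left_module_Lambda: "left_module R \<Lambda>"
  by (intro left_module.intro left_module_axioms.intro R_ring M.abelian_group_axioms)
    (auto simp: smult_l_distr smult_r_distr smult_assoc1)

definition structure_map :: "'r \<Rightarrow> 'a" where
  "structure_map r = r \<odot>\<^bsub>\<Lambda>\<^esub> \<one>\<^bsub>\<Lambda>\<^esub>"

lemma structure_map:
  shows "r \<in> carrier R \<Longrightarrow> structure_map r \<in> carrier \<Lambda>"
    and "r \<in> carrier R \<Longrightarrow> s \<in> carrier R \<Longrightarrow>
      structure_map (r \<oplus> s) = structure_map r \<oplus>\<^bsub>\<Lambda>\<^esub> structure_map s"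
    and "r \<in> carrier R \<Longrightarrow> s \<in> carrier R \<Longrightarrow>
      structure_map (r \<otimes> s) = structure_map r \<otimes>\<^bsub>\<Lambda>\<^esub> structure_map s"
    and "structure_map \<one> = \<one>\<^bsub>\<Lambda>\<^esub>"
    and "r \<in> carrier R \<Longrightarrow> a \<in> carrier \<Lambda> \<Longrightarrow> structure_map r \<otimes>\<^bsub>\<Lambda>\<^esub> a = r \<odot>\<^bsub>\<Lambda>\<^esub> a"
    and "r \<in> carrier R \<Longrightarrow> a \<in> carrier \<Lambda> \<Longrightarrow> a \<otimes>\<^bsub>\<Lambda>\<^esub> structure_map r = r \<odot>\<^bsub>\<Lambda>\<^esub> a"
proof -
  show c: "r \<in> carrier R \<Longrightarrow> structure_map r \<in> carrier \<Lambda>" for r by (simp add: structure_map_def)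
  show l: "r \<in> carrier R \<Longrightarrow> a \<in> carrier \<Lambda> \<Longrightarrow> structure_map r \<otimes>\<^bsub>\<Lambda>\<^esub> a = r \<odot>\<^bsub>\<Lambda>\<^esub> a" for r a
    by (simp add: structure_map_def smult_mult_left)
  show "r \<in> carrier R \<Longrightarrow> a \<in> carrier \<Lambda> \<Longrightarrow> a \<otimes>\<^bsub>\<Lambda>\<^esub> structure_map r = r \<odot>\<^bsub>\<Lambda>\<^esub> a"
    by (simp add: structure_map_def smult_mult_right)
  show "r \<in> carrier R \<Longrightarrow> s \<in> carrier R \<Longrightarrow>
      structure_map (r \<otimes> s) = structure_map r \<otimes>\<^bsub>\<Lambda>\<^esub> structure_map s"
    using l[of r "structure_map s"] c by (simp add: structure_map_def smult_assoc1)
qed (auto simp: structure_map_def smult_l_distr)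

text \<open>
  Restriction of scalars along the central homomorphism \<open>structure_map\<close> from \<open>R\<close> to \<open>\<Lambda>\<close>.
\<close>

definition scalars :: "('a, 'm) module \<Rightarrow> ('r, 'm) module" where
  "scalars X = \<lparr>carrier = carrier X, monoid.mult = (\<lambda>_ _. undefined), one = undefined,
     ring.zero = ring.zero X, add = add X, smult = (\<lambda>r x. structure_map r \<odot>\<^bsub>X\<^esub> x)\<rparr>"

lemma scalars_simps [simp]:
  "carrier (scalars X) = carrier X" "\<zero>\<^bsub>scalars X\<^esub> = \<zero>\<^bsub>X\<^esub>"
  "x \<oplus>\<^bsub>scalars X\<^esub> y = x \<oplus>\<^bsub>X\<^esub> y" "r \<odot>\<^bsub>scalars X\<^esub> x = structure_map r \<odot>\<^bsub>X\<^esub> x"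
  by (simp_all add: scalars_def)

lemma left_module_scalars:
  assumes "left_module \<Lambda> X"
  shows "left_module R (scalars X)"
proof -
  interpret X: left_module \<Lambda> X by fact
  have "abelian_group (scalars X)"
    by (rule abelian_groupI) (auto simp: X.a_ac intro: abelian_groupE(6)[OF X.abelian_group_axioms])
  then show ?thesis
    by (intro left_module.intro left_module_axioms.intro R_ring)
      (auto simp: structure_map(1-4) X.smult_l_distr X.smult_r_distr X.smult_assoc1)
qed

lemma submodule_scalars:
  assumes "left_module \<Lambda> X" "submodule N \<Lambda> X"
  shows "submodule N R (scalars X)"
proof -
  interpret X: left_module \<Lambda> X by fact
  interpret S: left_module R "scalars X" by (rule left_module_scalars[OF assms(1)])
  show ?thesis
    by (rule S.is_submoduleI) (use X.is_submoduleD[OF assms(2)] in \<open>auto simp: structure_map(1)\<close>)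
qed

lemma finite_length_Lambda: "bounded_flags (submods R \<Lambda> {\<zero>\<^bsub>\<Lambda>\<^esub>} (carrier \<Lambda>))"
proof -
  interpret L: left_module R \<Lambda> by (rule left_module_Lambda)
  have Rlm: "left_module R (regular_module R)" by (rule left_module_regular_module[OF R_ring])
  have R: "bounded_flags (submods R (regular_module R) {\<zero>\<^bsub>regular_module R\<^esub>} (carrier (regular_module R)))"
    using artinian_local_finite_length[OF artinian local] by (simp add: regular_module_def)
  obtain S where S: "finite S" "S \<subseteq> carrier \<Lambda>"
      "\<And>N. submodule N R \<Lambda> \<Longrightarrow> S \<subseteq> N \<Longrightarrow> N = carrier \<Lambda>"
    using finitely_generated by (rule finitely_generatedE) (rule that; assumption)
  have "\<exists>N. submodule N R \<Lambda> \<and> S \<subseteq> N \<and> bounded_flags (submods R \<Lambda> {\<zero>\<^bsub>\<Lambda>\<^esub>} N)"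
    using S(1,2)
  proof (induction S rule: finite_induct)
    case empty
    have "submods R \<Lambda> {\<zero>\<^bsub>\<Lambda>\<^esub>} {\<zero>\<^bsub>\<Lambda>\<^esub>} \<subseteq> {{\<zero>\<^bsub>\<Lambda>\<^esub>}}" by (auto simp: submods_def)
    then show ?case using L.submodule_zero bounded_flags_subset[OF bounded_flags_singleton] by blast
  next
    case (insert t T)
    then obtain N where N: "submodule N R \<Lambda>" "T \<subseteq> N" "bounded_flags (submods R \<Lambda> {\<zero>\<^bsub>\<Lambda>\<^esub>} N)"
      by auto
    have t: "t \<in> carrier \<Lambda>" using insert by auto
    have h: "(\<lambda>r. r \<odot>\<^bsub>\<Lambda>\<^esub> t) \<in> mod_hom R (regular_module R) \<Lambda>"
      by (rule mod_homI) (auto simp: regular_module_def t smult_l_distr smult_assoc1)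
    let ?I = "(\<lambda>r. r \<odot>\<^bsub>\<Lambda>\<^esub> t) ` carrier (regular_module R)"
    have I: "submodule ?I R \<Lambda>"
      by (rule submodule_image[OF Rlm left_module_Lambda h left_module.submodule_carrier[OF Rlm]])
    have z: "{\<zero>\<^bsub>\<Lambda>\<^esub>} \<subseteq> N" using L.is_submoduleD(2)[OF N(1)] by simp
    have "t \<in> ?I" using t by (auto simp: regular_module_def intro!: image_eqI[of _ _ \<one>])
    then have "insert t T \<subseteq> L.sub_sum N ?I"
      using L.sub_sum_upper[OF N(1) I] N(2) by blast
    then show ?case
      using bounded_flags_add_image[OF Rlm left_module_Lambda h N(1) L.submodule_zero z R N(3)]
        L.submodule_sub_sum[OF N(1) I] by blast
  qed
  then show ?thesis using S(3) by blast
qed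

text \<open>
  The module is built up by adding the images of the maps \<open>a \<mapsto> a t\<close> for the generators \<open>t\<close>, and
  these are quotients of \<open>\<Lambda>\<close>. The intermediate modules are kept \<open>\<Lambda>\<close>-submodules, because only such a
  submodule is everything once it contains the generators.
\<close>

lemma finite_length_scalars:
  assumes "X \<in> fg_mod \<Lambda>"
  shows "bounded_flags (submods R (scalars X) {\<zero>\<^bsub>X\<^esub>} (carrier X))"
proof -
  have X: "left_module \<Lambda> X" and fg: "finitely_generated \<Lambda> X" using assms by (auto simp: fg_mod_def)
  interpret X: left_module \<Lambda> X by (rule X)
  interpret S: left_module R "scalars X" by (rule left_module_scalars[OF X])
  have ss: "S.sub_sum = X.sub_sum" by (auto simp: S.sub_sum_def X.sub_sum_def fun_eq_iff)
  have Llm: "left_module \<Lambda> (regular_module \<Lambda>)" by (rule left_module_regular_module[OF Lambda_ring])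
  obtain S where S: "finite S" "S \<subseteq> carrier X"
      "\<And>N. submodule N \<Lambda> X \<Longrightarrow> S \<subseteq> N \<Longrightarrow> N = carrier X"
    using fg by (rule finitely_generatedE) (rule that; assumption)
  have "\<exists>N. submodule N \<Lambda> X \<and> S \<subseteq> N \<and> bounded_flags (submods R (scalars X) {\<zero>\<^bsub>X\<^esub>} N)"
    using S(1,2)
  proof (induction S rule: finite_induct)
    case empty
    have "submods R (scalars X) {\<zero>\<^bsub>X\<^esub>} {\<zero>\<^bsub>X\<^esub>} \<subseteq> {{\<zero>\<^bsub>X\<^esub>}}" by (auto simp: submods_def)
    then show ?case using X.submodule_zero bounded_flags_subset[OF bounded_flags_singleton] by blast
  next
    case (insert t T)
    then obtain N where N: "submodule N \<Lambda> X" "T \<subseteq> N" "bounded_flags (submods R (scalars X) {\<zero>\<^bsub>X\<^esub>} N)"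
      by auto
    have t: "t \<in> carrier X" using insert by auto
    have h: "(\<lambda>a. a \<odot>\<^bsub>X\<^esub> t) \<in> mod_hom R \<Lambda> (scalars X)"
      by (rule mod_homI)
        (auto simp: t X.smult_l_distr X.smult_assoc1 structure_map(1) simp flip: structure_map(5))
    have h': "(\<lambda>a. a \<odot>\<^bsub>X\<^esub> t) \<in> mod_hom \<Lambda> (regular_module \<Lambda>) X"
      by (rule mod_homI) (auto simp: regular_module_def t X.smult_l_distr X.smult_assoc1)
    let ?I = "(\<lambda>a. a \<odot>\<^bsub>X\<^esub> t) ` carrier \<Lambda>"
    have I: "submodule ?I \<Lambda> X"
      using submodule_image[OF Llm X h' left_module.submodule_carrier[OF Llm]]
      by (simp add: regular_module_def)
    have z: "{\<zero>\<^bsub>scalars X\<^esub>} \<subseteq> N" using X.is_submoduleD(2)[OF N(1)] by simp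
    have "t \<in> ?I" using t by (auto intro!: image_eqI[of _ _ "\<one>\<^bsub>\<Lambda>\<^esub>"])
    then have "insert t T \<subseteq> X.sub_sum N ?I"
      using X.sub_sum_upper[OF N(1) I] N(2) by blast
    moreover have "bounded_flags (submods R (scalars X) {\<zero>\<^bsub>X\<^esub>} (X.sub_sum N ?I))"
      using bounded_flags_add_image[OF left_module_Lambda left_module_scalars[OF X] h
          submodule_scalars[OF X N(1)] S.submodule_zero z finite_length_Lambda] N(3)
      by (simp add: ss)
    ultimately show ?case using X.submodule_sub_sum[OF N(1) I] by blast
  qed
  then show ?thesis using S(3) by blast
qed

lemma finite_length:
  assumes "X \<in> fg_mod \<Lambda>"
  shows "bounded_flags (submods \<Lambda> X {\<zero>\<^bsub>X\<^esub>} (carrier X))"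
  using assms submodule_scalars[of X]
  by (intro bounded_flags_subset[OF finite_length_scalars[OF assms]])
    (auto simp: submods_def fg_mod_def)

lemma fg_modD: "X \<in> fg_mod \<Lambda> \<Longrightarrow> left_module \<Lambda> X"
  by (simp add: fg_mod_def)

lemma fg_mod_if_bounded:
  assumes "left_module \<Lambda> X" "bounded_flags (submods \<Lambda> X {\<zero>\<^bsub>X\<^esub>} (carrier X))"
  shows "X \<in> fg_mod \<Lambda>"
  using left_module.finitely_generated_if_bounded[OF assms] assms(1) by (simp add: fg_mod_def)


section \<open>Homomorphism modules\<close>

text \<open>
  Extensional functions represent each homomorphism exactly once, so equality in this module is
  equality of homomorphisms.
\<close>

definition hom_module :: "('a, 'w) module \<Rightarrow> ('a, 'x) module \<Rightarrow> ('r, 'w \<Rightarrow> 'x) module" where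
  "hom_module W X = \<lparr>carrier = mod_hom \<Lambda> W X \<inter> extensional (carrier W),
     monoid.mult = (\<lambda>_ _. undefined), one = undefined,
     ring.zero = restrict (\<lambda>_. \<zero>\<^bsub>X\<^esub>) (carrier W),
     add = (\<lambda>f g. restrict (\<lambda>w. f w \<oplus>\<^bsub>X\<^esub> g w) (carrier W)),
     smult = (\<lambda>r f. restrict (\<lambda>w. structure_map r \<odot>\<^bsub>X\<^esub> f w) (carrier W))\<rparr>"

lemma hom_module_simps:
  "carrier (hom_module W X) = mod_hom \<Lambda> W X \<inter> extensional (carrier W)"
  "\<zero>\<^bsub>hom_module W X\<^esub> = restrict (\<lambda>_. \<zero>\<^bsub>X\<^esub>) (carrier W)"
  "f \<oplus>\<^bsub>hom_module W X\<^esub> g = restrict (\<lambda>w. f w \<oplus>\<^bsub>X\<^esub> g w) (carrier W)"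
  "r \<odot>\<^bsub>hom_module W X\<^esub> f = restrict (\<lambda>w. structure_map r \<odot>\<^bsub>X\<^esub> f w) (carrier W)"
  by (simp_all add: hom_module_def)

lemma restrict_mod_hom:
  assumes "left_module \<Lambda> W" "f \<in> mod_hom \<Lambda> W X"
  shows "restrict f (carrier W) \<in> mod_hom \<Lambda> W X"
    "restrict f (carrier W) \<in> carrier (hom_module W X)"
  using mod_hom_cong[OF assms(2) _ assms(1), of "restrict f (carrier W)"]
  by (auto simp: hom_module_simps)

lemma mod_hom_central:
  assumes "left_module \<Lambda> X" "f \<in> mod_hom \<Lambda> W X" "r \<in> carrier R"
  shows "(\<lambda>w. structure_map r \<odot>\<^bsub>X\<^esub> f w) \<in> mod_hom \<Lambda> W X"
proof -
  interpret X: left_module \<Lambda> X by fact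
  show ?thesis
    using assms(3) mod_homD[OF assms(2)]
    by (intro mod_homI) (auto simp: structure_map X.smult_r_distr simp flip: X.smult_assoc1)
qed

lemma left_module_hom_module:
  assumes W: "left_module \<Lambda> W" and X: "left_module \<Lambda> X"
  shows "left_module R (hom_module W X)"
proof -
  interpret W: left_module \<Lambda> W by (rule W)
  interpret X: left_module \<Lambda> X by (rule X)
  let ?H = "hom_module W X"
  have c: "f w \<in> carrier X" if "f \<in> carrier ?H" "w \<in> carrier W" for f w
    using that mod_homD(1) by (fastforce simp: hom_module_simps)
  have H: "f \<in> mod_hom \<Lambda> W X" if "f \<in> carrier ?H" for f
    using that by (auto simp: hom_module_simps)
  have eqI: "f = g" if "f \<in> extensional (carrier W)" "g \<in> extensional (carrier W)"
      "\<And>w. w \<in> carrier W \<Longrightarrow> f w = g w" for f g :: "_ \<Rightarrow> _"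
    using that by (rule extensionalityI)
  have ext: "f \<in> carrier ?H \<Longrightarrow> f \<in> extensional (carrier W)" for f
    by (simp add: hom_module_simps)
  have add: "f \<oplus>\<^bsub>?H\<^esub> g \<in> carrier ?H" if "f \<in> carrier ?H" "g \<in> carrier ?H" for f g
    using restrict_mod_hom(2)[OF W mod_hom_add[OF X H[OF that(1)] H[OF that(2)]]]
    by (simp only: hom_module_simps(3))
  have zero: "\<zero>\<^bsub>?H\<^esub> \<in> carrier ?H"
    using restrict_mod_hom(2)[OF W mod_hom_const_zero[OF X]] by (simp only: hom_module_simps(2))
  have smult: "r \<odot>\<^bsub>?H\<^esub> f \<in> carrier ?H" if "r \<in> carrier R" "f \<in> carrier ?H" for r f
    using restrict_mod_hom(2)[OF W mod_hom_central[OF X H[OF that(2)] that(1)]]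
    by (simp only: hom_module_simps(4))
  have "abelian_group ?H"
  proof (rule abelian_groupI, goal_cases)
    case (1 x y) then show ?case by (rule add)
  next
    case 2 then show ?case by (rule zero)
  next
    case (3 x y z)
    then show ?case
      by (intro eqI) (auto simp: hom_module_simps(2-) c X.a_assoc)
  next
    case (4 x y)
    then show ?case
      by (intro eqI) (auto simp: hom_module_simps(2-) c X.a_comm)
  next
    case (5 x)
    then show ?case
      by (intro eqI) (auto simp: hom_module_simps(2-) c ext)
  next
    case (6 x)
    have "restrict (\<lambda>w. \<ominus>\<^bsub>X\<^esub> x w) (carrier W) \<in> carrier ?H"
      by (rule restrict_mod_hom(2)[OF W mod_hom_neg[OF X H[OF 6]]])
    moreover have "restrict (\<lambda>w. \<ominus>\<^bsub>X\<^esub> x w) (carrier W) \<oplus>\<^bsub>?H\<^esub> x = \<zero>\<^bsub>?H\<^esub>"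
      by (intro eqI) (auto simp: hom_module_simps(2-) c 6 X.l_neg)
    ultimately show ?case by blast
  qed
  then show ?thesis
  proof (intro left_module.intro left_module_axioms.intro R_ring, goal_cases)
    case (2 a x) then show ?case by (intro smult)
  next
    case (3 a b x)
    then show ?case
      by (intro eqI) (auto simp: hom_module_simps(2-) c structure_map(1-4) X.smult_l_distr)
  next
    case (4 a x y)
    then show ?case
      by (intro eqI) (auto simp: hom_module_simps(2-) c structure_map(1-4) X.smult_r_distr)
  next
    case (5 a b x)
    then show ?case
      by (intro eqI) (auto simp: hom_module_simps(2-) c structure_map(1-4) X.smult_assoc1)
  next
    case (6 x)
    then show ?case
      by (intro eqI) (auto simp: hom_module_simps(2-) c structure_map(1-4) ext)
  qed
qed

lemma mod_hom_eval:
  assumes "w \<in> carrier W"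
  shows "(\<lambda>h. h w) \<in> mod_hom R (hom_module W X) (scalars X)"
  using assms mod_homD(1) by (intro mod_homI) (fastforce simp: hom_module_simps)+

lemma mod_hom_postcomp:
  assumes W: "left_module \<Lambda> W" and f: "f \<in> mod_hom \<Lambda> X Y"
  shows "(\<lambda>h. restrict (\<lambda>w. f (h w)) (carrier W)) \<in> mod_hom R (hom_module W X) (hom_module W Y)"
proof -
  interpret W: left_module \<Lambda> W by (rule W)
  note ff = mod_homD[OF f]
  have c: "h w \<in> carrier X" if "h \<in> carrier (hom_module W X)" "w \<in> carrier W" for h w
    using that mod_homD(1) by (fastforce simp: hom_module_simps)
  show ?thesis
  proof (rule mod_homI, goal_cases)
    case (1 x)
    then have "x \<in> mod_hom \<Lambda> W X" by (simp add: hom_module_simps)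
    then show ?case using restrict_mod_hom(2)[OF W mod_hom_comp[OF _ f]] by blast
  next
    case (2 x y)
    then show ?case by (intro extensionalityI) (auto simp: hom_module_simps(2-) c ff)
  next
    case (3 a x)
    then show ?case by (intro extensionalityI) (auto simp: hom_module_simps(2-) c ff structure_map(1-4))
  qed
qed

text \<open>
  A homomorphism that vanishes on a finite generating set is zero. Evaluation at \<open>s\<close> embeds the
  homomorphisms that vanish on \<open>S\<close>, modulo those that also vanish at \<open>s\<close>, into \<open>X\<close>, which has finite
  length.
\<close>

lemma finite_length_hom_module:
  assumes W: "W \<in> fg_mod \<Lambda>" and X: "X \<in> fg_mod \<Lambda>"
  shows "bounded_flags (submods R (hom_module W X) {\<zero>\<^bsub>hom_module W X\<^esub>} (carrier (hom_module W X)))"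
proof -
  let ?H = "hom_module W X"
  interpret W: left_module \<Lambda> W by (rule fg_modD[OF W])
  interpret X: left_module \<Lambda> X by (rule fg_modD[OF X])
  interpret SX: left_module R "scalars X" by (rule left_module_scalars[OF X.left_module_axioms])
  interpret H: left_module R ?H by (rule left_module_hom_module[OF W.left_module_axioms X.left_module_axioms])
  have "finitely_generated \<Lambda> W" using W by (simp add: fg_mod_def)
  then obtain S where S: "finite S" "S \<subseteq> carrier W"
      "\<And>N. submodule N \<Lambda> W \<Longrightarrow> S \<subseteq> N \<Longrightarrow> N = carrier W"
    by (rule finitely_generatedE) (rule that; assumption)
  define V where "V = (\<lambda>S. {h \<in> carrier ?H. \<forall>s\<in>S. h s = \<zero>\<^bsub>X\<^esub>})"
  have V: "submodule (V S) R ?H" if "S \<subseteq> carrier W" for S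
  proof (rule H.is_submoduleI)
    show "V S \<subseteq> carrier ?H" by (auto simp: V_def)
    show "\<zero>\<^bsub>?H\<^esub> \<in> V S" using that H.zero_closed by (auto simp: V_def) (auto simp: hom_module_simps)
    show "x \<oplus>\<^bsub>?H\<^esub> y \<in> V S" if "x \<in> V S" "y \<in> V S" for x y
      using that \<open>S \<subseteq> carrier W\<close> H.a_closed[of x y]
      by (auto simp: V_def) (auto simp: hom_module_simps(3))
    show "a \<odot>\<^bsub>?H\<^esub> x \<in> V S" if "a \<in> carrier R" "x \<in> V S" for a x
      using that \<open>S \<subseteq> carrier W\<close> H.smult_closed[of a x]
      by (auto simp: V_def) (auto simp: hom_module_simps(4) structure_map)
  qed
  have "bounded_flags (submods R ?H (V S) (carrier ?H))"
    using S(1,2)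
  proof (induction S rule: finite_induct)
    case empty
    have "submods R ?H (V {}) (carrier ?H) \<subseteq> {carrier ?H}" by (auto simp: submods_def V_def)
    then show ?case by (rule bounded_flags_subset[OF bounded_flags_singleton])
  next
    case (insert s S)
    have s: "s \<in> carrier W" "S \<subseteq> carrier W" using insert by auto
    note ev = mod_hom_eval[OF s(1), of X]
    have "{b \<in> V S. b s \<in> {\<zero>\<^bsub>scalars X\<^esub>}} = V (insert s S)" by (auto simp: V_def)
    moreover have zs: "{\<zero>\<^bsub>scalars X\<^esub>} \<subseteq> (\<lambda>h. h s) ` V S"
      using SX.is_submoduleD(2)[OF submodule_image[OF H.left_module_axioms SX.left_module_axioms ev V[OF s(2)]]]
      by simp
    moreover have "bounded_flags (submods R (scalars X) {\<zero>\<^bsub>scalars X\<^esub>} ((\<lambda>h. h s) ` V S))"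
    proof (rule bounded_flags_subset[OF finite_length_scalars[OF X]])
      have "(\<lambda>h. h s) ` V S \<subseteq> carrier X" using mod_homD(1)[OF ev] by (auto simp: V_def)
      then show "submods R (scalars X) {\<zero>\<^bsub>scalars X\<^esub>} ((\<lambda>h. h s) ` V S)
          \<subseteq> submods R (scalars X) {\<zero>\<^bsub>X\<^esub>} (carrier X)"
        by (auto simp: submods_def)
    qed
    ultimately have "bounded_flags (submods R ?H (V (insert s S)) (V S))"
      using bounded_correspond[OF H.left_module_axioms SX.left_module_axioms ev V[OF s(2)] SX.submodule_zero zs]
      by simp
    moreover have "V (insert s S) \<subseteq> V S" "V S \<subseteq> carrier ?H" by (auto simp: V_def)
    ultimately show ?case
      using H.bounded_flags_trans[OF V[OF s(2)] _ _ H.submodule_carrier] insert.IH[OF s(2)] by blast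
  qed
  moreover have "V S = {\<zero>\<^bsub>?H\<^esub>}"
  proof (rule antisym)
    show "V S \<subseteq> {\<zero>\<^bsub>?H\<^esub>}"
    proof
      fix h assume h: "h \<in> V S"
      then have hh: "h \<in> mod_hom \<Lambda> W X" "h \<in> extensional (carrier W)"
        by (auto simp: V_def hom_module_simps)
      have "{w \<in> carrier W. h w \<in> {\<zero>\<^bsub>X\<^esub>}} = carrier W"
        by (rule S(3)[OF submodule_vimage[OF W.left_module_axioms X.left_module_axioms hh(1)
                X.submodule_zero W.submodule_carrier]])
          (use S(2) h in \<open>auto simp: V_def\<close>)
      then show "h \<in> {\<zero>\<^bsub>?H\<^esub>}"
        using hh(2) by (auto simp: hom_module_simps intro!: extensionalityI)
    qed
    show "{\<zero>\<^bsub>?H\<^esub>} \<subseteq> V S" using H.is_submoduleD(2)[OF V[OF S(2)]] by simp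
  qed
  ultimately show ?thesis by simp
qed

end

section \<open>Isomorphisms, factorisations, quotients\<close>

lemma (in left_module) minus_eq_zeroD:
  assumes "x \<in> carrier M" "y \<in> carrier M" "x \<ominus>\<^bsub>M\<^esub> y = \<zero>\<^bsub>M\<^esub>"
  shows "x = y"
proof -
  have "x = (x \<ominus>\<^bsub>M\<^esub> y) \<oplus>\<^bsub>M\<^esub> y" using assms(1,2) by (simp add: a_minus_def M.a_assoc M.l_neg)
  then show ?thesis using assms by simp
qed

lemma mod_hom_injI:
  assumes "left_module R X" "left_module R Y" "h \<in> mod_hom R X Y"
    and "\<And>x. x \<in> carrier X \<Longrightarrow> h x = \<zero>\<^bsub>Y\<^esub> \<Longrightarrow> x = \<zero>\<^bsub>X\<^esub>"
  shows "inj_on h (carrier X)"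
proof (rule inj_onI)
  interpret X: left_module R X by fact
  interpret Y: left_module R Y by fact
  fix x y assume xy: "x \<in> carrier X" "y \<in> carrier X" "h x = h y"
  have "h (x \<ominus>\<^bsub>X\<^esub> y) = \<zero>\<^bsub>Y\<^esub>"
    using xy mod_hom_group(3)[OF assms(1-3)] mod_homD(1)[OF assms(3)]
    by (simp add: a_minus_def Y.r_neg)
  then have "x \<ominus>\<^bsub>X\<^esub> y = \<zero>\<^bsub>X\<^esub>" using assms(4) xy by simp
  then show "x = y" using xy X.minus_eq_zeroD by blast
qed

lemma mod_hom_eq_zero_inj:
  assumes "left_module R X" "left_module R Y" "h \<in> mod_hom R X Y" "inj_on h (carrier X)"
    and "x \<in> carrier X" "h x = \<zero>\<^bsub>Y\<^esub>"
  shows "x = \<zero>\<^bsub>X\<^esub>"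
proof -
  interpret X: left_module R X by fact
  show ?thesis
    using inj_onD[OF assms(4), of x "\<zero>\<^bsub>X\<^esub>"] assms(5,6) mod_hom_group(1)[OF assms(1-3)] by simp
qed

lemma factor_through_inj:
  assumes A: "left_module R A" and f: "f \<in> mod_hom R A B" "inj_on f (carrier A)"
    and T: "left_module R T" and h: "h \<in> mod_hom R T B" "h ` carrier T \<subseteq> f ` carrier A"
  obtains k where "k \<in> mod_hom R T A" "\<And>t. t \<in> carrier T \<Longrightarrow> f (k t) = h t"
proof -
  interpret A: left_module R A by fact
  interpret T: left_module R T by fact
  define k where "k = (\<lambda>t. inv_into (carrier A) f (h t))"
  have k: "k t \<in> carrier A" "f (k t) = h t" if "t \<in> carrier T" for t
    using h(2) that by (auto simp: k_def image_subset_iff intro: inv_into_into f_inv_into_f)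
  note ff = mod_homD[OF f(1)] and hh = mod_homD[OF h(1)]
  have "k \<in> mod_hom R T A"
  proof (rule mod_homI)
    fix x y assume "x \<in> carrier T" "y \<in> carrier T"
    then show "k (x \<oplus>\<^bsub>T\<^esub> y) = k x \<oplus>\<^bsub>A\<^esub> k y"
      by (intro inj_onD[OF f(2)]) (auto simp: k ff hh)
  next
    fix a x assume "a \<in> carrier R" "x \<in> carrier T"
    then show "k (a \<odot>\<^bsub>T\<^esub> x) = a \<odot>\<^bsub>A\<^esub> k x"
      by (intro inj_onD[OF f(2)]) (auto simp: k ff hh)
  qed (simp add: k)
  then show thesis using that k by blast
qed

lemma factor_through_surj:
  assumes D: "left_module R D" and U: "left_module R U"
    and p: "p \<in> mod_hom R D U" "p ` carrier D = carrier U"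
    and T: "left_module R T" and h: "h \<in> mod_hom R D T"
    and ker: "\<And>d. d \<in> carrier D \<Longrightarrow> p d = \<zero>\<^bsub>U\<^esub> \<Longrightarrow> h d = \<zero>\<^bsub>T\<^esub>"
  obtains k where "k \<in> mod_hom R U T" "\<And>d. d \<in> carrier D \<Longrightarrow> k (p d) = h d"
proof -
  interpret D: left_module R D by fact
  interpret U: left_module R U by fact
  interpret T: left_module R T by fact
  note pp = mod_homD[OF p(1)] mod_hom_group[OF D U p(1)]
    and hh = mod_homD[OF h(1)] mod_hom_group[OF D T h]
  have wd: "h d = h d'" if d: "d \<in> carrier D" "d' \<in> carrier D" "p d = p d'" for d d'
  proof -
    have "p (d \<ominus>\<^bsub>D\<^esub> d') = \<zero>\<^bsub>U\<^esub>" using d by (simp add: pp a_minus_def U.r_neg)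
    then have "h (d \<ominus>\<^bsub>D\<^esub> d') = \<zero>\<^bsub>T\<^esub>" using ker d by simp
    then have "h d \<ominus>\<^bsub>T\<^esub> h d' = \<zero>\<^bsub>T\<^esub>" using d by (simp add: hh)
    then show ?thesis using d hh(1) T.minus_eq_zeroD by blast
  qed
  define k where "k = (\<lambda>u. h (inv_into (carrier D) p u))"
  have k: "k (p d) = h d" if "d \<in> carrier D" for d
    unfolding k_def
    by (rule wd) (use that in \<open>auto intro: inv_into_into f_inv_into_f\<close>)
  have ex: "\<exists>d. d \<in> carrier D \<and> u = p d" if "u \<in> carrier U" for u using p(2) that by (metis imageE)
  have "k \<in> mod_hom R U T"
  proof (rule mod_homI)
    show "k u \<in> carrier T" if "u \<in> carrier U" for u using ex[OF that] k hh(1) by auto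
    fix x y assume "x \<in> carrier U" "y \<in> carrier U"
    then obtain d d' where "d \<in> carrier D" "x = p d" "d' \<in> carrier D" "y = p d'" using ex by metis
    then show "k (x \<oplus>\<^bsub>U\<^esub> y) = k x \<oplus>\<^bsub>T\<^esub> k y"
      using k hh(2) k[of "d \<oplus>\<^bsub>D\<^esub> d'"] by (simp add: pp)
  next
    fix a x assume "a \<in> carrier R" "x \<in> carrier U"
    then obtain d where "d \<in> carrier D" "x = p d" "a \<in> carrier R" using ex by metis
    then show "k (a \<odot>\<^bsub>U\<^esub> x) = a \<odot>\<^bsub>T\<^esub> k x"
      using k hh(3) k[of "a \<odot>\<^bsub>D\<^esub> d"] by (simp add: pp)
  qed
  then show thesis using that k by blast
qed

lemma mod_isoI:
  assumes "f \<in> mod_hom R X Y" "g \<in> mod_hom R Y X"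
    and "\<And>x. x \<in> carrier X \<Longrightarrow> g (f x) = x" "\<And>y. y \<in> carrier Y \<Longrightarrow> f (g y) = y"
  shows "f \<in> mod_iso R X Y"
  using assms mod_homD(1)[OF assms(1)] mod_homD(1)[OF assms(2)]
  by (auto simp: mod_iso_def intro!: bij_betw_byWitness[where f' = g])

lemma mod_isoE:
  assumes "left_module R X" "left_module R Y" "f \<in> mod_iso R X Y"
  obtains g where "f \<in> mod_hom R X Y" "g \<in> mod_hom R Y X"
    "\<And>x. x \<in> carrier X \<Longrightarrow> g (f x) = x" "\<And>y. y \<in> carrier Y \<Longrightarrow> f (g y) = y"
proof -
  have f: "f \<in> mod_hom R X Y" "inj_on f (carrier X)" "f ` carrier X = carrier Y"
    using assms(3) by (auto simp: mod_iso_def bij_betw_def)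
  obtain g where g: "g \<in> mod_hom R Y X" "\<And>y. y \<in> carrier Y \<Longrightarrow> f (g y) = y"
    using factor_through_inj[OF assms(1) f(1,2) assms(2) mod_hom_id] f(3) by auto
  have "g (f x) = x" if "x \<in> carrier X" for x
    by (rule inj_onD[OF f(2)]) (use that g mod_homD(1)[OF f(1)] mod_homD(1)[OF g(1)] in auto)
  then show thesis using that f(1) g by blast
qed

lemma mod_isomorphic_refl: "mod_isomorphic R X X"
  using mod_isoI[OF mod_hom_id mod_hom_id, of X R] by (auto simp: mod_isomorphic_def)

lemma mod_isomorphic_sym:
  assumes "left_module R X" "left_module R Y" "mod_isomorphic R X Y"
  shows "mod_isomorphic R Y X"
proof -
  obtain f where "f \<in> mod_iso R X Y" using assms(3) by (auto simp: mod_isomorphic_def)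
  then obtain g where "f \<in> mod_hom R X Y" "g \<in> mod_hom R Y X"
    "\<And>x. x \<in> carrier X \<Longrightarrow> g (f x) = x" "\<And>y. y \<in> carrier Y \<Longrightarrow> f (g y) = y"
    using mod_isoE[OF assms(1,2)] by metis
  then have "g \<in> mod_iso R Y X" by (intro mod_isoI[of g R Y X f])
  then show ?thesis by (auto simp: mod_isomorphic_def)
qed

lemma mod_isomorphic_trans:
  assumes "mod_isomorphic R X Y" "mod_isomorphic R Y Z"
  shows "mod_isomorphic R X Z"
proof -
  obtain f g where fg: "f \<in> mod_iso R X Y" "g \<in> mod_iso R Y Z"
    using assms by (auto simp: mod_isomorphic_def)
  then have "(\<lambda>x. g (f x)) \<in> mod_hom R X Z" by (auto simp: mod_iso_def intro: mod_hom_comp)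
  moreover have "bij_betw (g \<circ> f) (carrier X) (carrier Z)"
    using fg by (auto simp: mod_iso_def intro: bij_betw_trans)
  ultimately show ?thesis by (auto simp: mod_isomorphic_def mod_iso_def comp_def)
qed

definition submod :: "('a, 'b) module \<Rightarrow> 'b set \<Rightarrow> ('a, 'b) module" where
  "submod X N = X\<lparr>carrier := N\<rparr>"

lemma submod_simps [simp]:
  "carrier (submod X N) = N" "\<zero>\<^bsub>submod X N\<^esub> = \<zero>\<^bsub>X\<^esub>" "x \<oplus>\<^bsub>submod X N\<^esub> y = x \<oplus>\<^bsub>X\<^esub> y"
  "a \<odot>\<^bsub>submod X N\<^esub> x = a \<odot>\<^bsub>X\<^esub> x"
  by (simp_all add: submod_def)

lemma left_module_submod:
  assumes "left_module R X" "submodule N R X"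
  shows "left_module R (submod X N)"
proof -
  interpret X: left_module R X by fact
  note N = X.is_submoduleD[OF assms(2)]
  have c: "x \<in> carrier X" if "x \<in> N" for x using that N(1) by auto
  have "abelian_group (submod X N)"
  proof (rule abelian_groupI, goal_cases)
    case (6 x)
    then show ?case using N(5) c by (auto intro!: bexI[of _ "\<ominus>\<^bsub>X\<^esub> x"] simp: X.l_neg)
  qed (auto simp: N c X.a_ac)
  then show ?thesis
    by (intro left_module.intro left_module_axioms.intro X.R.ring_axioms)
      (auto simp: N c X.smult_l_distr X.smult_r_distr X.smult_assoc1)
qed

lemma submod_incl: "submodule N R X \<Longrightarrow> (\<lambda>x. x) \<in> mod_hom R (submod X N) X"
  using submodule.axioms(1) subgroup.subset by (intro mod_homI) fastforce+

lemma mod_hom_into_submod: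
  "h \<in> mod_hom R T X \<Longrightarrow> h ` carrier T \<subseteq> N \<Longrightarrow> h \<in> mod_hom R T (submod X N)"
  by (intro mod_homI) (auto simp: mod_homD)

lemma fg_mod_surj:
  assumes X: "X \<in> fg_mod R" and Y: "left_module R Y"
    and f: "f \<in> mod_hom R X Y" "f ` carrier X = carrier Y"
  shows "Y \<in> fg_mod R"
proof -
  have Xl: "left_module R X" and fg: "finitely_generated R X" using X by (auto simp: fg_mod_def)
  obtain S where S: "finite S" "S \<subseteq> carrier X"
      "\<And>N. submodule N R X \<Longrightarrow> S \<subseteq> N \<Longrightarrow> N = carrier X"
    using fg by (rule finitely_generatedE) (rule that; assumption)
  have "N = carrier Y" if N: "submodule N R Y" "f ` S \<subseteq> N" for N
  proof -
    have "{x \<in> carrier X. f x \<in> N} = carrier X"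
      by (rule S(3)[OF submodule_vimage[OF Xl Y f(1) N(1) left_module.submodule_carrier[OF Xl]]])
        (use S(2) N in auto)
    then have "f ` carrier X \<subseteq> N" by blast
    then have "carrier Y \<subseteq> N" using f(2) by simp
    then show ?thesis using left_module.is_submoduleD(1)[OF Y N(1)] by blast
  qed
  moreover have "finite (f ` S)" "f ` S \<subseteq> carrier Y" using S(1,2) f(2) by auto
  ultimately show ?thesis using Y unfolding fg_mod_def finitely_generated_def by blast
qed

text \<open>
  The quotient is realised on a system of representatives, so that it lives on the same type.
\<close>

lemma ex_quotient:
  fixes D :: "('a, 'b) module"
  assumes D: "D \<in> fg_mod R" and N: "submodule N R D"
  obtains U :: "('a, 'b) module" and p where "U \<in> fg_mod R" "p \<in> mod_hom R D U"
    "p ` carrier D = carrier U" "\<And>d. d \<in> carrier D \<Longrightarrow> p d = \<zero>\<^bsub>U\<^esub> \<longleftrightarrow> d \<in> N"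
proof -
  have Dl: "left_module R D" using D by (simp add: fg_mod_def)
  interpret D: left_module R D by (rule Dl)
  note NN = D.is_submoduleD[OF N]
  \<comment> \<open>A representative of the coset of \<open>x\<close> that depends on the coset alone, by \<open>ceq\<close> below.\<close>
  define c where "c = (\<lambda>x. SOME y. y \<in> carrier D \<and> x \<ominus>\<^bsub>D\<^esub> y \<in> N)"
  have c: "c x \<in> carrier D" "x \<ominus>\<^bsub>D\<^esub> c x \<in> N" if "x \<in> carrier D" for x
  proof -
    have "\<exists>y. y \<in> carrier D \<and> x \<ominus>\<^bsub>D\<^esub> y \<in> N"
      by (rule exI[of _ x]) (use that NN(2) in \<open>simp add: a_minus_def D.r_neg\<close>)
    from someI_ex[OF this] show "c x \<in> carrier D" "x \<ominus>\<^bsub>D\<^esub> c x \<in> N" by (auto simp: c_def)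
  qed
  have ceq: "c x = c y" if "x \<in> carrier D" "y \<in> carrier D" "x \<ominus>\<^bsub>D\<^esub> y \<in> N" for x y
  proof -
    have "x \<ominus>\<^bsub>D\<^esub> z \<in> N \<longleftrightarrow> y \<ominus>\<^bsub>D\<^esub> z \<in> N" if z: "z \<in> carrier D" for z
    proof
      assume "y \<ominus>\<^bsub>D\<^esub> z \<in> N"
      moreover have "x \<ominus>\<^bsub>D\<^esub> z = (x \<ominus>\<^bsub>D\<^esub> y) \<oplus>\<^bsub>D\<^esub> (y \<ominus>\<^bsub>D\<^esub> z)"
        using \<open>x \<in> carrier D\<close> \<open>y \<in> carrier D\<close> z by (simp add: a_minus_def D.a_assoc D.r_neg1)
      ultimately show "x \<ominus>\<^bsub>D\<^esub> z \<in> N" using NN(3) \<open>x \<ominus>\<^bsub>D\<^esub> y \<in> N\<close> by simp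
    next
      assume "x \<ominus>\<^bsub>D\<^esub> z \<in> N"
      moreover have "y \<ominus>\<^bsub>D\<^esub> z = \<ominus>\<^bsub>D\<^esub> (x \<ominus>\<^bsub>D\<^esub> y) \<oplus>\<^bsub>D\<^esub> (x \<ominus>\<^bsub>D\<^esub> z)"
        using \<open>x \<in> carrier D\<close> \<open>y \<in> carrier D\<close> z
        by (simp add: a_minus_def D.minus_add D.a_ac D.r_neg1 D.r_neg2)
      ultimately show "y \<ominus>\<^bsub>D\<^esub> z \<in> N" using NN(3,5) \<open>x \<ominus>\<^bsub>D\<^esub> y \<in> N\<close> by simp
    qed
    then show ?thesis unfolding c_def by (metis (lifting))
  qed
  define U :: "('a, 'b) module" where
    "U = \<lparr>carrier = c ` carrier D, monoid.mult = (\<lambda>_ _. undefined), one = undefined,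
       ring.zero = c \<zero>\<^bsub>D\<^esub>, add = (\<lambda>x y. c (x \<oplus>\<^bsub>D\<^esub> y)), smult = (\<lambda>a x. c (a \<odot>\<^bsub>D\<^esub> x))\<rparr>"
  have U: "carrier U = c ` carrier D" "\<zero>\<^bsub>U\<^esub> = c \<zero>\<^bsub>D\<^esub>"
      "x \<oplus>\<^bsub>U\<^esub> y = c (x \<oplus>\<^bsub>D\<^esub> y)" "a \<odot>\<^bsub>U\<^esub> x = c (a \<odot>\<^bsub>D\<^esub> x)" for a x y
    by (simp_all add: U_def)
  have cadd: "c (c x \<oplus>\<^bsub>D\<^esub> c y) = c (x \<oplus>\<^bsub>D\<^esub> y)" if xy: "x \<in> carrier D" "y \<in> carrier D" for x y
  proof (rule ceq[symmetric])
    have "(x \<oplus>\<^bsub>D\<^esub> y) \<ominus>\<^bsub>D\<^esub> (c x \<oplus>\<^bsub>D\<^esub> c y) = (x \<ominus>\<^bsub>D\<^esub> c x) \<oplus>\<^bsub>D\<^esub> (y \<ominus>\<^bsub>D\<^esub> c y)"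
      using xy c by (simp add: a_minus_def D.minus_add D.a_ac)
    then show "(x \<oplus>\<^bsub>D\<^esub> y) \<ominus>\<^bsub>D\<^esub> (c x \<oplus>\<^bsub>D\<^esub> c y) \<in> N" using NN(3) c(2) xy by simp
  qed (use xy c in auto)
  have csm: "c (a \<odot>\<^bsub>D\<^esub> c x) = c (a \<odot>\<^bsub>D\<^esub> x)" if xy: "x \<in> carrier D" "a \<in> carrier R" for x a
  proof (rule ceq[symmetric])
    have "a \<odot>\<^bsub>D\<^esub> x \<ominus>\<^bsub>D\<^esub> a \<odot>\<^bsub>D\<^esub> c x = a \<odot>\<^bsub>D\<^esub> (x \<ominus>\<^bsub>D\<^esub> c x)"
      using xy c by (simp add: a_minus_def D.smult_r_distr D.smult_r_minus)
    then show "a \<odot>\<^bsub>D\<^esub> x \<ominus>\<^bsub>D\<^esub> a \<odot>\<^bsub>D\<^esub> c x \<in> N" using NN(4) c(2) xy by simp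
  qed (use xy c in auto)
  have cadd1: "c (c x \<oplus>\<^bsub>D\<^esub> y) = c (x \<oplus>\<^bsub>D\<^esub> y)" "c (y \<oplus>\<^bsub>D\<^esub> c x) = c (y \<oplus>\<^bsub>D\<^esub> x)"
    if xy: "x \<in> carrier D" "y \<in> carrier D" for x y
  proof -
    have "c (c x) = c x" using cadd[of x "\<zero>\<^bsub>D\<^esub>"] csm[of x "\<one>\<^bsub>R\<^esub>"] xy c by simp
    then show "c (c x \<oplus>\<^bsub>D\<^esub> y) = c (x \<oplus>\<^bsub>D\<^esub> y)" "c (y \<oplus>\<^bsub>D\<^esub> c x) = c (y \<oplus>\<^bsub>D\<^esub> x)"
      using cadd[of x y] cadd[of "c x" y] cadd[of y x] cadd[of y "c x"] xy c by auto
  qed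
  have cc: "c (c x) = c x" if "x \<in> carrier D" for x
    using cadd1(1)[of x "\<zero>\<^bsub>D\<^esub>"] that c by simp
  have csm2: "c (a \<odot>\<^bsub>D\<^esub> (b \<odot>\<^bsub>D\<^esub> c x)) = c (a \<odot>\<^bsub>D\<^esub> (b \<odot>\<^bsub>D\<^esub> x))"
    if "x \<in> carrier D" "a \<in> carrier R" "b \<in> carrier R" for a b x
    using csm[of "b \<odot>\<^bsub>D\<^esub> c x" a] csm[of "b \<odot>\<^bsub>D\<^esub> x" a] csm[of x b] that c by simp
  have csma: "c (a \<odot>\<^bsub>D\<^esub> c x \<oplus>\<^bsub>D\<^esub> b \<odot>\<^bsub>D\<^esub> c x) = c (a \<odot>\<^bsub>D\<^esub> x \<oplus>\<^bsub>D\<^esub> b \<odot>\<^bsub>D\<^esub> x)"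
    if "x \<in> carrier D" "a \<in> carrier R" "b \<in> carrier R" for a b x
    using cadd[of "a \<odot>\<^bsub>D\<^esub> c x" "b \<odot>\<^bsub>D\<^esub> c x"] cadd[of "a \<odot>\<^bsub>D\<^esub> x" "b \<odot>\<^bsub>D\<^esub> x"]
      csm[of x a] csm[of x b] that c by simp
  have ab: "abelian_group U"
  proof (rule abelian_groupI, goal_cases)
    case (3 x y z)
    then show ?case by (auto simp: U cadd1 c D.a_assoc)
  next
    case (4 x y)
    then show ?case by (auto simp: U cadd c D.a_comm)
  next
    case (6 x)
    then obtain d where "d \<in> carrier D" "x = c d" by (auto simp: U)
    then show ?case
      by (intro bexI[of _ "c (\<ominus>\<^bsub>D\<^esub> d)"]) (auto simp: U cadd D.l_neg)
  qed (auto simp: U cadd1 c)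
  have Ul: "left_module R U"
    by (intro left_module.intro left_module_axioms.intro ab D.R.ring_axioms)
      (auto simp: U c cc csm2 csma cadd cadd1 csm D.smult_l_distr D.smult_r_distr D.smult_assoc1)
  have ch: "c \<in> mod_hom R D U" by (rule mod_homI) (auto simp: U cadd csm)
  have ck: "c d = \<zero>\<^bsub>U\<^esub> \<longleftrightarrow> d \<in> N" if d: "d \<in> carrier D" for d
  proof
    assume "d \<in> N"
    then have "c d = c \<zero>\<^bsub>D\<^esub>" by (intro ceq) (use d NN(2,6) in auto)
    then show "c d = \<zero>\<^bsub>U\<^esub>" by (simp add: U)
  next
    assume "c d = \<zero>\<^bsub>U\<^esub>"
    then have "c d = c \<zero>\<^bsub>D\<^esub>" by (simp add: U)
    then have "c d \<in> N"
      using NN(5)[OF c(2)[of "\<zero>\<^bsub>D\<^esub>"]] c(1)[of "\<zero>\<^bsub>D\<^esub>"] by (simp add: a_minus_def)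
    from NN(3)[OF c(2)[OF d] this] have "(d \<ominus>\<^bsub>D\<^esub> c d) \<oplus>\<^bsub>D\<^esub> c d \<in> N" .
    then show "d \<in> N" using d c by (simp add: a_minus_def D.a_assoc D.l_neg)
  qed
  have "U \<in> fg_mod R" by (rule fg_mod_surj[OF D Ul ch]) (simp add: U)
  then show thesis using that[OF _ ch _ ck] U(1) by blast
qed


section \<open>Direct sums\<close>

text \<open>
  Direct sums are described by their injections and projections; the list model \<open>mod_sum\<close> enters
  through \<open>bisum_iff_isomorphic\<close> and \<open>bisum_Cons\<close>. The three modules may live on different types, since
  \<open>mod_sum\<close> changes the type.
\<close>

definition bisum :: "('a, 'k) ring_scheme \<Rightarrow> ('a, 'd) module \<Rightarrow> ('a, 'x) module \<Rightarrow> ('a, 'y) module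
    \<Rightarrow> ('x \<Rightarrow> 'd) \<Rightarrow> ('y \<Rightarrow> 'd) \<Rightarrow> ('d \<Rightarrow> 'x) \<Rightarrow> ('d \<Rightarrow> 'y) \<Rightarrow> bool" where
  "bisum R D X Y i j p q \<longleftrightarrow>
     i \<in> mod_hom R X D \<and> j \<in> mod_hom R Y D \<and> p \<in> mod_hom R D X \<and> q \<in> mod_hom R D Y \<and>
     (\<forall>x \<in> carrier X. p (i x) = x \<and> q (i x) = \<zero>\<^bsub>Y\<^esub>) \<and>
     (\<forall>y \<in> carrier Y. p (j y) = \<zero>\<^bsub>X\<^esub> \<and> q (j y) = y) \<and>
     (\<forall>d \<in> carrier D. i (p d) \<oplus>\<^bsub>D\<^esub> j (q d) = d)"

lemma bisumD:
  assumes "bisum R D X Y i j p q"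
  shows "i \<in> mod_hom R X D" "j \<in> mod_hom R Y D" "p \<in> mod_hom R D X" "q \<in> mod_hom R D Y"
    and "\<And>x. x \<in> carrier X \<Longrightarrow> p (i x) = x" "\<And>x. x \<in> carrier X \<Longrightarrow> q (i x) = \<zero>\<^bsub>Y\<^esub>"
    and "\<And>y. y \<in> carrier Y \<Longrightarrow> p (j y) = \<zero>\<^bsub>X\<^esub>" "\<And>y. y \<in> carrier Y \<Longrightarrow> q (j y) = y"
    and "\<And>d. d \<in> carrier D \<Longrightarrow> i (p d) \<oplus>\<^bsub>D\<^esub> j (q d) = d"
  using assms by (auto simp: bisum_def)

lemma bisum_Cons:
  assumes "left_module R X" "\<And>Y. Y \<in> set Xs \<Longrightarrow> left_module R Y"
  shows "bisum R (mod_sum (X # Xs)) X (mod_sum Xs)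
    (\<lambda>x. x # map ring.zero Xs) (\<lambda>xs. \<zero>\<^bsub>X\<^esub> # xs) hd tl"
proof -
  interpret X: left_module R X by fact
  interpret S: left_module R "mod_sum Xs"
    using left_module_mod_sum[of R Xs] assms X.R.ring_axioms by blast
  have S: "carrier (mod_sum Xs) = {xs. length xs = length Xs \<and> (\<forall>i < length Xs. xs ! i \<in> carrier (Xs ! i))}"
      "\<zero>\<^bsub>mod_sum Xs\<^esub> = map ring.zero Xs"
      "xs \<oplus>\<^bsub>mod_sum Xs\<^esub> ys = map (\<lambda>i. xs ! i \<oplus>\<^bsub>Xs ! i\<^esub> ys ! i) [0..<length Xs]"
      "a \<odot>\<^bsub>mod_sum Xs\<^esub> xs = map (\<lambda>i. a \<odot>\<^bsub>Xs ! i\<^esub> xs ! i) [0..<length Xs]" for xs ys a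
    by (simp_all add: mod_sum_def)
  have T: "x # xs \<in> carrier (mod_sum (X # Xs)) \<longleftrightarrow> x \<in> carrier X \<and> xs \<in> carrier (mod_sum Xs)"
      "(x # xs) \<oplus>\<^bsub>mod_sum (X # Xs)\<^esub> (y # ys) = (x \<oplus>\<^bsub>X\<^esub> y) # (xs \<oplus>\<^bsub>mod_sum Xs\<^esub> ys)"
      "a \<odot>\<^bsub>mod_sum (X # Xs)\<^esub> (x # xs) = (a \<odot>\<^bsub>X\<^esub> x) # (a \<odot>\<^bsub>mod_sum Xs\<^esub> xs)" for x xs y ys a
    by (auto simp: mod_sum_def All_less_Suc2 map_upt_Suc simp del: upt_Suc)
  have E: "\<exists>x xs. l = x # xs \<and> x \<in> carrier X \<and> xs \<in> carrier (mod_sum Xs)"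
    if "l \<in> carrier (mod_sum (X # Xs))" for l
    using that by (cases l) (simp add: mod_sum_def, simp add: T)
  note z = S.zero_closed[unfolded S(2)] S.l_zero[unfolded S(2)] S.r_zero[unfolded S(2)]
    S.smult_r_null[unfolded S(2)]
  show ?thesis unfolding bisum_def
  proof (intro conjI ballI mod_homI)
    show "hd (x \<oplus>\<^bsub>mod_sum (X # Xs)\<^esub> y) = hd x \<oplus>\<^bsub>X\<^esub> hd y"
      if "x \<in> carrier (mod_sum (X # Xs))" "y \<in> carrier (mod_sum (X # Xs))" for x y
      using E[OF that(1)] E[OF that(2)] by (auto simp: T)
    show "tl (x \<oplus>\<^bsub>mod_sum (X # Xs)\<^esub> y) = tl x \<oplus>\<^bsub>mod_sum Xs\<^esub> tl y"
      if "x \<in> carrier (mod_sum (X # Xs))" "y \<in> carrier (mod_sum (X # Xs))" for x y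
      using E[OF that(1)] E[OF that(2)] by (auto simp: T)
    show "hd (a \<odot>\<^bsub>mod_sum (X # Xs)\<^esub> x) = a \<odot>\<^bsub>X\<^esub> hd x"
      if "x \<in> carrier (mod_sum (X # Xs))" for x a
      using E[OF that(1)] by (auto simp: T)
    show "tl (a \<odot>\<^bsub>mod_sum (X # Xs)\<^esub> x) = a \<odot>\<^bsub>mod_sum Xs\<^esub> tl x"
      if "x \<in> carrier (mod_sum (X # Xs))" for x a
      using E[OF that(1)] by (auto simp: T)
    show "(hd d # map ring.zero Xs) \<oplus>\<^bsub>mod_sum (X # Xs)\<^esub> (\<zero>\<^bsub>X\<^esub> # tl d) = d"
      if "d \<in> carrier (mod_sum (X # Xs))" for d
      using E[OF that] by (auto simp: T z)
    show "hd x \<in> carrier X" if "x \<in> carrier (mod_sum (X # Xs))" for x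
      using E[OF that(1)] by auto
    show "tl x \<in> carrier (mod_sum Xs)" if "x \<in> carrier (mod_sum (X # Xs))" for x
      using E[OF that(1)] by auto
  qed (auto simp: T z S(2))
qed

lemma bisum_unique:
  assumes "bisum R D X Y i j p q" "left_module R D" "left_module R X" "left_module R Y"
    and "bisum R D' X Y i' j' p' q'" "left_module R D'"
  shows "mod_isomorphic R D D'"
proof -
  interpret D: left_module R D by fact
  interpret D': left_module R D' by fact
  interpret X: left_module R X by fact
  interpret Y: left_module R Y by fact
  note b = bisumD[OF assms(1)] and b' = bisumD[OF assms(5)]
  have [simp]: "p d \<in> carrier X" "q d \<in> carrier Y" if "d \<in> carrier D" for d
    using that mod_homD(1)[OF b(3)] mod_homD(1)[OF b(4)] by auto
  have [simp]: "p' d \<in> carrier X" "q' d \<in> carrier Y" if "d \<in> carrier D'" for d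
    using that mod_homD(1)[OF b'(3)] mod_homD(1)[OF b'(4)] by auto
  have [simp]: "i x \<in> carrier D" "i' x \<in> carrier D'" if "x \<in> carrier X" for x
    using that mod_homD(1)[OF b(1)] mod_homD(1)[OF b'(1)] by auto
  have [simp]: "j x \<in> carrier D" "j' x \<in> carrier D'" if "x \<in> carrier Y" for x
    using that mod_homD(1)[OF b(2)] mod_homD(1)[OF b'(2)] by auto
  let ?f = "\<lambda>d. i' (p d) \<oplus>\<^bsub>D'\<^esub> j' (q d)" and ?g = "\<lambda>d. i (p' d) \<oplus>\<^bsub>D\<^esub> j (q' d)"
  have "?f \<in> mod_hom R D D'"
    by (intro mod_hom_add assms mod_hom_comp[OF b(3) b'(1)] mod_hom_comp[OF b(4) b'(2)])
  moreover have "?g \<in> mod_hom R D' D"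
    by (intro mod_hom_add assms mod_hom_comp[OF b'(3) b(1)] mod_hom_comp[OF b'(4) b(2)])
  ultimately have "?f \<in> mod_iso R D D'"
    by (rule mod_isoI)
      (auto simp: mod_homD(2)[OF b(3)] mod_homD(2)[OF b(4)] mod_homD(2)[OF b'(3)] mod_homD(2)[OF b'(4)]
        b(5-) b'(5-))
  then show ?thesis by (auto simp: mod_isomorphic_def)
qed

lemma bisum_iso:
  assumes b: "bisum R D X Y i j p q" and D: "f \<in> mod_hom R D' D" "g \<in> mod_hom R D D'"
    "\<And>d. d \<in> carrier D' \<Longrightarrow> g (f d) = d" "\<And>d. d \<in> carrier D \<Longrightarrow> f (g d) = d"
  shows "bisum R D' X Y (\<lambda>x. g (i x)) (\<lambda>y. g (j y)) (\<lambda>d. p (f d)) (\<lambda>d. q (f d))"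
proof -
  note b' = bisumD[OF b]
  have "g (i (p (f d))) \<oplus>\<^bsub>D'\<^esub> g (j (q (f d))) = d" if "d \<in> carrier D'" for d
    using b'(9)[of "f d"] that D mod_homD(1)[OF D(1)] mod_homD(2)[OF D(2), of "i (p (f d))" "j (q (f d))"]
      mod_homD(1)[OF b'(1)] mod_homD(1)[OF b'(2)] mod_homD(1)[OF b'(3)] mod_homD(1)[OF b'(4)]
    by simp
  then show ?thesis unfolding bisum_def
    using b' D mod_homD(1)[OF b'(1)] mod_homD(1)[OF b'(2)]
    by (auto intro: mod_hom_comp)
qed

lemma bisum_iso_right:
  assumes b: "bisum R D X Y i j p q" and Y: "left_module R Y" "left_module R Y'"
    and fg: "f \<in> mod_hom R Y Y'" "g \<in> mod_hom R Y' Y"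
    "\<And>d. d \<in> carrier Y \<Longrightarrow> g (f d) = d" "\<And>d. d \<in> carrier Y' \<Longrightarrow> f (g d) = d"
  shows "bisum R D X Y' i (\<lambda>y. j (g y)) p (\<lambda>d. f (q d))"
  unfolding bisum_def
  using bisumD[OF b] fg mod_homD(1)[OF fg(1)] mod_homD(1)[OF fg(2)] mod_hom_group(1)[OF Y fg(1)]
    mod_homD(1)[OF bisumD(4)[OF b]]
  by (auto intro: mod_hom_comp[OF fg(2)] mod_hom_comp[OF _ fg(1)])

lemma mod_sum_Nil: "carrier (mod_sum []) = {[]}" "\<zero>\<^bsub>mod_sum []\<^esub> = []"
  by (auto simp: mod_sum_def)

lemma mod_isomorphic_Nil_iff:
  fixes D :: "('a, 'd) module"
  assumes "left_module R D"
  shows "mod_isomorphic R D (mod_sum ([] :: ('a, 'e) module list)) \<longleftrightarrow> carrier D = {\<zero>\<^bsub>D\<^esub>}"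
    (is "mod_isomorphic R D ?Z \<longleftrightarrow> _")
proof
  interpret D: left_module R D by fact
  interpret Z: left_module R ?Z using left_module_mod_sum[of R "[]"] D.R.ring_axioms by simp
  {
    assume "mod_isomorphic R D ?Z"
    then obtain f where f: "f \<in> mod_hom R D ?Z" "inj_on f (carrier D)"
      by (auto simp: mod_isomorphic_def mod_iso_def bij_betw_def)
    have "d = \<zero>\<^bsub>D\<^esub>" if "d \<in> carrier D" for d
      by (rule inj_onD[OF f(2)])
        (use mod_homD(1)[OF f(1), of d] mod_homD(1)[OF f(1), of "\<zero>\<^bsub>D\<^esub>"] that in \<open>auto simp: mod_sum_Nil\<close>)
    then show "carrier D = {\<zero>\<^bsub>D\<^esub>}" by auto
  }
  assume D0: "carrier D = {\<zero>\<^bsub>D\<^esub>}"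
  have "(\<lambda>_. \<zero>\<^bsub>?Z\<^esub>) \<in> mod_iso R D ?Z"
    by (rule mod_isoI[where g = "\<lambda>_. \<zero>\<^bsub>D\<^esub>"])
      (use mod_hom_const_zero[OF Z.left_module_axioms] in
        \<open>auto intro: mod_hom_const_zero D.left_module_axioms simp: D0 mod_sum_Nil\<close>)
  then show "mod_isomorphic R D ?Z" by (auto simp: mod_isomorphic_def)
qed

lemma bisum_mod_sum2:
  assumes "left_module R X" "left_module R Y"
  obtains i j p q where "bisum R (mod_sum [X, Y]) X Y i j p q"
proof -
  interpret X: left_module R X by fact
  interpret Y: left_module R Y by fact
  have lY: "left_module R (mod_sum [Y])" "left_module R (mod_sum [])"
    using left_module_mod_sum[of R "[Y]"] left_module_mod_sum[of R "[]"] assms X.R.ring_axioms by auto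
  note b1 = bisum_Cons[OF assms(1), of "[Y]"] and b2 = bisum_Cons[OF assms(2), of "[]"]
  have b2': "bisum R (mod_sum [Y]) Y (mod_sum []) (\<lambda>x. x # map ring.zero []) (\<lambda>xs. \<zero>\<^bsub>Y\<^esub> # xs) hd tl"
    using b2 by simp
  note b = bisumD[OF b2']
  have Z: "x \<in> carrier (mod_sum []) \<Longrightarrow> x = []" for x by (simp add: mod_sum_Nil)
  have "(\<lambda>x. x # map ring.zero []) (hd d) = d" if d: "d \<in> carrier (mod_sum [Y])" for d
    using d by (auto simp: mod_sum_def length_Suc_conv)
  then show thesis
    using that[OF bisum_iso_right[OF b1 lY(1) assms(2) b(3) b(1)]] b(5) assms by simp
qed

lemma bisum_iff_isomorphic:
  assumes "left_module R D" "left_module R X" "left_module R Y"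
  shows "mod_isomorphic R D (mod_sum [X, Y]) \<longleftrightarrow> (\<exists>i j p q. bisum R D X Y i j p q)"
proof
  have S: "left_module R (mod_sum [X, Y])"
    using left_module_mod_sum[of R "[X, Y]"] assms left_module.axioms(1) by auto
  obtain i j p q where b: "bisum R (mod_sum [X, Y]) X Y i j p q"
    using bisum_mod_sum2[OF assms(2,3)] by blast
  {
    assume "mod_isomorphic R D (mod_sum [X, Y])"
    then obtain f where "f \<in> mod_iso R D (mod_sum [X, Y])" by (auto simp: mod_isomorphic_def)
    then obtain g where "f \<in> mod_hom R D (mod_sum [X, Y])" "g \<in> mod_hom R (mod_sum [X, Y]) D"
      "\<And>x. x \<in> carrier D \<Longrightarrow> g (f x) = x" "\<And>y. y \<in> carrier (mod_sum [X, Y]) \<Longrightarrow> f (g y) = y"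
      using mod_isoE[OF assms(1) S] by metis
    from bisum_iso[OF b this] show "\<exists>i j p q. bisum R D X Y i j p q" by blast
  }
  assume "\<exists>i j p q. bisum R D X Y i j p q"
  then show "mod_isomorphic R D (mod_sum [X, Y])"
    using bisum_unique[OF _ assms(1-3) b S] by blast
qed

lemma bisum_commute:
  assumes "left_module R D" "bisum R D X Y i j p q"
  shows "bisum R D Y X j i q p"
proof -
  interpret D: left_module R D by fact
  note b = bisumD[OF assms(2)]
  show ?thesis unfolding bisum_def
    using b D.a_comm mod_homD(1)[OF b(1)] mod_homD(1)[OF b(2)] mod_homD(1)[OF b(3)] mod_homD(1)[OF b(4)]
    by auto
qed

lemma fg_mod_bisum:
  assumes X: "X \<in> fg_mod R" and Y: "Y \<in> fg_mod R" and D: "left_module R D"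
    and b: "bisum R D X Y i j p q"
  shows "D \<in> fg_mod R"
proof -
  have Xl: "left_module R X" "finitely_generated R X" and Yl: "left_module R Y" "finitely_generated R Y"
    using X Y by (auto simp: fg_mod_def)
  note bb = bisumD[OF b]
  obtain S where S: "finite S" "S \<subseteq> carrier X"
      "\<And>N. submodule N R X \<Longrightarrow> S \<subseteq> N \<Longrightarrow> N = carrier X"
    using Xl(2) by (rule finitely_generatedE) (rule that; assumption)
  obtain T where T: "finite T" "T \<subseteq> carrier Y"
      "\<And>N. submodule N R Y \<Longrightarrow> T \<subseteq> N \<Longrightarrow> N = carrier Y"
    using Yl(2) by (rule finitely_generatedE) (rule that; assumption)
  have "N = carrier D" if N: "submodule N R D" "i ` S \<union> j ` T \<subseteq> N" for N
  proof -
    have "{x \<in> carrier X. i x \<in> N} = carrier X"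
      by (rule S(3)[OF submodule_vimage[OF Xl(1) D bb(1) N(1) left_module.submodule_carrier[OF Xl(1)]]])
        (use S(2) N in auto)
    moreover have "{x \<in> carrier Y. j x \<in> N} = carrier Y"
      by (rule T(3)[OF submodule_vimage[OF Yl(1) D bb(2) N(1) left_module.submodule_carrier[OF Yl(1)]]])
        (use T(2) N in auto)
    ultimately have "d \<in> N" if "d \<in> carrier D" for d
      using bb(9)[OF that] left_module.is_submoduleD(3)[OF D N(1)]
        mod_homD(1)[OF bb(3) that] mod_homD(1)[OF bb(4) that] by fastforce
    then show ?thesis using left_module.is_submoduleD(1)[OF D N(1)] by blast
  qed
  moreover have "i ` S \<union> j ` T \<subseteq> carrier D"
    using S(2) T(2) mod_homD(1)[OF bb(1)] mod_homD(1)[OF bb(2)] by auto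
  ultimately have "finitely_generated R D"
    using S(1) T(1) unfolding finitely_generated_def by (intro exI[of _ "i ` S \<union> j ` T"]) auto
  then show ?thesis using D by (simp add: fg_mod_def)
qed

lemma fg_mod_mod_sum:
  fixes Xs :: "('a, 'c) module list"
  assumes "ring R" "\<And>X. X \<in> set Xs \<Longrightarrow> X \<in> fg_mod R"
  shows "mod_sum Xs \<in> fg_mod R"
  using assms(2)
proof (induction Xs)
  case Nil
  let ?Z = "mod_sum [] :: ('a, 'c list) module"
  have l: "left_module R ?Z" using left_module_mod_sum[of R "[]"] assms(1) by simp
  have "N = carrier ?Z" if "submodule N R ?Z" for N
    using left_module.is_submoduleD(1,2)[OF l that] by (auto simp: mod_sum_Nil)
  then have "finitely_generated R ?Z"
    unfolding finitely_generated_def by (intro exI[of _ "{}"]) auto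
  then show ?case using l by (simp add: fg_mod_def)
next
  case (Cons X Xs)
  have l: "\<And>Y. Y \<in> set (X # Xs) \<Longrightarrow> left_module R Y" using Cons(2) by (auto simp: fg_mod_def)
  have "left_module R (mod_sum (X # Xs))" using left_module_mod_sum[of R "X # Xs"] assms(1) l by blast
  then show ?case
    using fg_mod_bisum[OF _ _ _ bisum_Cons[of R X Xs]] Cons l by auto
qed

text \<open>
  The complement of a retract is the kernel of the retraction.
\<close>

lemma bisum_retract:
  assumes X: "left_module R X" and S: "left_module R S"
    and s: "s \<in> mod_hom R X S" and t: "t \<in> mod_hom R S X" and ts: "\<And>x. x \<in> carrier X \<Longrightarrow> t (s x) = x"
  shows "submodule {d \<in> carrier S. t d = \<zero>\<^bsub>X\<^esub>} R S"
    and "bisum R S X (submod S {d \<in> carrier S. t d = \<zero>\<^bsub>X\<^esub>}) s (\<lambda>d. d) t (\<lambda>d. d \<ominus>\<^bsub>S\<^esub> s (t d))"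
proof -
  interpret X: left_module R X by fact
  interpret S: left_module R S by fact
  note ss = mod_homD[OF s] mod_hom_group[OF X S s] and tt = mod_homD[OF t] mod_hom_group[OF S X t]
  let ?K = "{d \<in> carrier S. t d = \<zero>\<^bsub>X\<^esub>}"
  show K: "submodule ?K R S"
    using submodule_vimage[OF S X t X.submodule_zero S.submodule_carrier] by simp
  have "(\<lambda>d. d \<ominus>\<^bsub>S\<^esub> s (t d)) \<in> mod_hom R S (submod S ?K)"
    by (intro mod_hom_into_submod mod_hom_minus[OF S mod_hom_id mod_hom_comp[OF t s]])
      (auto simp: ss tt ts a_minus_def X.r_neg)
  then show "bisum R S X (submod S ?K) s (\<lambda>d. d) t (\<lambda>d. d \<ominus>\<^bsub>S\<^esub> s (t d))"
    unfolding bisum_def using s t submod_incl[OF K]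
    by (auto simp: ts ss tt a_minus_def S.r_neg S.a_lcomm[of "s _"] S.add.inv_one[folded a_inv_def])
qed


context artin_algebra_modules
begin

lemma fg_mod_submod:
  assumes X: "X \<in> fg_mod \<Lambda>" and N: "submodule N \<Lambda> X"
  shows "submod X N \<in> fg_mod \<Lambda>"
proof (rule fg_mod_if_bounded)
  interpret X: left_module \<Lambda> X by (rule fg_modD[OF X])
  show l: "left_module \<Lambda> (submod X N)" by (rule left_module_submod[OF X.left_module_axioms N])
  interpret S: left_module \<Lambda> "submod X N" by (rule l)
  have "submodule K \<Lambda> X" if "submodule K \<Lambda> (submod X N)" for K
    by (rule X.is_submoduleI)
      (use S.is_submoduleD[OF that] X.is_submoduleD(1)[OF N] in auto)
  then show "bounded_flags (submods \<Lambda> (submod X N) {\<zero>\<^bsub>submod X N\<^esub>} (carrier (submod X N)))"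
    using X.is_submoduleD(1)[OF N]
    by (intro bounded_flags_subset[OF finite_length[OF X]]) (auto simp: submods_def)
qed

definition len :: "('a, 'm) module \<Rightarrow> nat" where
  "len X = height (submods \<Lambda> X {\<zero>\<^bsub>X\<^esub>} (carrier X))"

lemma submodule_iff_submods:
  assumes "left_module \<Lambda> X"
  shows "N \<in> submods \<Lambda> X {\<zero>\<^bsub>X\<^esub>} (carrier X) \<longleftrightarrow> submodule N \<Lambda> X"
  using left_module.is_submoduleD(1,2)[OF assms] by (auto simp: submods_def)

section \<open>Fitting's lemma and the radical\<close>

lemma endo_pow: "\<phi> \<in> mod_hom \<Lambda> X X \<Longrightarrow> (\<phi> ^^ n) \<in> mod_hom \<Lambda> X X"
proof (induction n)
  case 0
  show ?case using mod_hom_id by (simp add: id_def)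
next
  case (Suc n)
  then show ?case using mod_hom_comp[of "\<phi> ^^ n" \<Lambda> X X \<phi> X] by (simp add: comp_def)
qed

text \<open>
  Fitting's lemma. Images of powers of \<open>\<phi>\<close> decrease and kernels increase, so both are stationary from
  some power \<open>\<psi>\<close> on. Then \<open>\<psi>\<close> is bijective on its image, and inverting it there turns \<open>\<psi>\<close> into a
  retraction onto the image with the same kernel.
\<close>

lemma fitting:
  assumes X: "X \<in> fg_mod \<Lambda>" and \<phi>: "\<phi> \<in> mod_hom \<Lambda> X X"
  obtains n B N p q where "n > 0" "B = (\<phi> ^^ n) ` carrier X" "N = {x \<in> carrier X. (\<phi> ^^ n) x = \<zero>\<^bsub>X\<^esub>}"
    "submodule B \<Lambda> X" "submodule N \<Lambda> X" "bisum \<Lambda> X (submod X B) (submod X N) (\<lambda>x. x) (\<lambda>x. x) p q"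
proof -
  have Xl: "left_module \<Lambda> X" by (rule fg_modD[OF X])
  interpret X: left_module \<Lambda> X by (rule Xl)
  note fl = finite_length[OF X]
  define im where "im = (\<lambda>n. (\<phi> ^^ n) ` carrier X)"
  define ker where "ker = (\<lambda>n. {x \<in> carrier X. (\<phi> ^^ n) x = \<zero>\<^bsub>X\<^esub>})"
  have im_sub: "submodule (im n) \<Lambda> X" for n
    unfolding im_def by (rule submodule_image[OF Xl Xl endo_pow[OF \<phi>] X.submodule_carrier])
  have ker_sub: "submodule (ker n) \<Lambda> X" for n
    using submodule_vimage[OF Xl Xl endo_pow[OF \<phi>] X.submodule_zero X.submodule_carrier]
    by (simp add: ker_def)
  have pc: "(\<phi> ^^ n) x \<in> carrier X" if "x \<in> carrier X" for n x
    using mod_homD(1)[OF endo_pow[OF \<phi>] that] .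
  have padd: "(\<phi> ^^ (m + n)) x = (\<phi> ^^ m) ((\<phi> ^^ n) x)" for m n x by (simp add: funpow_add)
  have imle: "im (m + n) \<subseteq> im m" for m n using pc padd by (auto simp: im_def)
  have kerle: "ker n \<subseteq> ker (m + n)" for m n
    using padd mod_hom_group(1)[OF Xl Xl endo_pow[OF \<phi>]] by (auto simp: ker_def)
  have sub: "range im \<subseteq> submods \<Lambda> X {\<zero>\<^bsub>X\<^esub>} (carrier X)" using im_sub by (auto simp: submodule_iff_submods[OF Xl])
  have ne: "range im \<noteq> {}" by blast
  obtain A where A: "A \<in> range im" "\<And>B. B \<in> range im \<Longrightarrow> B \<subseteq> A \<Longrightarrow> B = A"
    by (rule ex_minimal_member[OF fl ne sub]) (rule that; assumption)
  then obtain m where m: "A = im m" by blast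
  have stab_im: "im (m + k) = im m" for k
    using A(2)[of "im (m + k)"] imle[of m k] m by blast
  have sub: "range ker \<subseteq> submods \<Lambda> X {\<zero>\<^bsub>X\<^esub>} (carrier X)" using ker_sub by (auto simp: submodule_iff_submods[OF Xl])
  have ne: "range ker \<noteq> {}" by blast
  obtain C where C: "C \<in> range ker" "\<And>B. B \<in> range ker \<Longrightarrow> C \<subseteq> B \<Longrightarrow> B = C"
    by (rule ex_maximal_member[OF fl ne sub]) (rule that; assumption)
  then obtain l where l: "C = ker l" by blast
  have stab_ker: "ker (k + l) = ker l" for k
    using C(2)[of "ker (k + l)"] kerle[of l k] l by blast
  \<comment> \<open>Beyond \<open>m\<close> the images and beyond \<open>l\<close> the kernels are stationary.\<close>
  define n where "n = Suc (m + l)"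
  define \<psi> where "\<psi> = \<phi> ^^ n"
  define B where "B = im n"
  have psi: "\<psi> \<in> mod_hom \<Lambda> X X" unfolding \<psi>_def by (rule endo_pow[OF \<phi>])
  have nn: "n = m + Suc l" "n + n = m + (Suc l + n)" "n = Suc m + l" "n + n = (n + Suc m) + l"
    by (auto simp: n_def)
  have "im (n + n) = im n" using stab_im nn(1,2) by metis
  then have "(\<lambda>x. \<psi> (\<psi> x)) ` carrier X = \<psi> ` carrier X"
    unfolding \<psi>_def im_def using padd[of n n] by (simp add: fun_eq_iff)
  then have imB: "\<psi> ` B = B" unfolding B_def im_def \<psi>_def[symmetric] by (metis image_image)
  have kk: "ker (n + n) = ker n" using stab_ker nn(3,4) by metis
  have BX: "B \<subseteq> carrier X" using X.is_submoduleD(1)[OF im_sub] by (simp add: B_def)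
  have Bl: "left_module \<Lambda> (submod X B)" using left_module_submod[OF Xl im_sub] by (simp add: B_def)
  have psiB: "\<psi> \<in> mod_hom \<Lambda> (submod X B) X"
    using mod_hom_comp[OF submod_incl[of B \<Lambda> X] psi] im_sub by (simp add: B_def)
  have inj: "inj_on \<psi> (carrier (submod X B))"
  proof (rule mod_hom_injI[OF Bl Xl psiB])
    fix x assume x: "x \<in> carrier (submod X B)" "\<psi> x = \<zero>\<^bsub>X\<^esub>"
    then obtain y where y: "y \<in> carrier X" "x = \<psi> y" by (auto simp: B_def im_def \<psi>_def)
    then have "y \<in> ker (n + n)" using x padd[of n n y] by (simp add: \<psi>_def ker_def)
    then have "y \<in> ker n" using kk by blast
    then show "x = \<zero>\<^bsub>submod X B\<^esub>" using y by (simp add: \<psi>_def ker_def)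
  qed
  have "\<psi> ` carrier X \<subseteq> \<psi> ` carrier (submod X B)" using imB by (simp add: B_def im_def \<psi>_def)
  then obtain t where t: "t \<in> mod_hom \<Lambda> X (submod X B)" "\<And>x. x \<in> carrier X \<Longrightarrow> \<psi> (t x) = \<psi> x"
    using factor_through_inj[OF Bl psiB inj Xl psi] by metis
  have tB: "t x = x" if "x \<in> carrier (submod X B)" for x
  proof (rule inj_onD[OF inj])
    show "\<psi> (t x) = \<psi> x" using t(2) that BX by auto
    show "t x \<in> carrier (submod X B)" using mod_homD(1)[OF t(1)] that BX by auto
  qed fact
  note incl = submod_incl[of B \<Lambda> X]
  note r = bisum_retract[OF Bl Xl incl t(1) tB]
  have "{d \<in> carrier X. t d = \<zero>\<^bsub>submod X B\<^esub>} = ker n"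
  proof -
    have "t d = \<zero>\<^bsub>X\<^esub> \<longleftrightarrow> \<psi> d = \<zero>\<^bsub>X\<^esub>" if d: "d \<in> carrier X" for d
    proof
      assume "t d = \<zero>\<^bsub>X\<^esub>"
      then show "\<psi> d = \<zero>\<^bsub>X\<^esub>" using t(2)[OF d] mod_hom_group(1)[OF Xl Xl psi] by simp
    next
      assume "\<psi> d = \<zero>\<^bsub>X\<^esub>"
      then show "t d = \<zero>\<^bsub>X\<^esub>"
        using mod_hom_eq_zero_inj[OF Bl Xl psiB inj mod_homD(1)[OF t(1) d]] t(2)[OF d] by simp
    qed
    then show ?thesis by (auto simp: \<psi>_def ker_def)
  qed
  then have "bisum \<Lambda> X (submod X B) (submod X (ker n)) (\<lambda>x. x) (\<lambda>x. x) t (\<lambda>d. d \<ominus>\<^bsub>X\<^esub> t d)"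
    using r(2) im_sub by (simp add: B_def)
  moreover have "n > 0" by (simp add: n_def)
  ultimately show thesis using that[of n B "ker n"] im_sub[of n] ker_sub[of n] by (simp add: B_def im_def ker_def)
qed

text \<open>
  The kernel summand in Fitting's lemma is zero, so the image of a power of \<open>\<phi>\<close> is everything.
\<close>

lemma inj_endo_iso:
  assumes X: "X \<in> fg_mod \<Lambda>" and \<phi>: "\<phi> \<in> mod_hom \<Lambda> X X"
    and inj: "\<And>x. x \<in> carrier X \<Longrightarrow> \<phi> x = \<zero>\<^bsub>X\<^esub> \<Longrightarrow> x = \<zero>\<^bsub>X\<^esub>"
  shows "\<phi> \<in> mod_iso \<Lambda> X X"
proof -
  have Xl: "left_module \<Lambda> X" by (rule fg_modD[OF X])
  interpret X: left_module \<Lambda> X by (rule Xl)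
  obtain n B N p q where F: "n > 0" "B = (\<phi> ^^ n) ` carrier X" "N = {x \<in> carrier X. (\<phi> ^^ n) x = \<zero>\<^bsub>X\<^esub>}"
    "bisum \<Lambda> X (submod X B) (submod X N) (\<lambda>x. x) (\<lambda>x. x) p q"
    by (rule fitting[OF X \<phi>]) (rule that; assumption)
  have pc: "(\<phi> ^^ n) x \<in> carrier X" if "x \<in> carrier X" for n x
    using mod_homD(1)[OF endo_pow[OF \<phi>] that] .
  have k: "(\<phi> ^^ n) x = \<zero>\<^bsub>X\<^esub> \<Longrightarrow> x = \<zero>\<^bsub>X\<^esub>" if "x \<in> carrier X" for n x
  proof (induction n)
    case (Suc n)
    then show ?case using inj[OF pc[OF that]] by simp
  qed simp
  note b = bisumD[OF F(4)]
  have "x \<in> \<phi> ` carrier X" if x: "x \<in> carrier X" for x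
  proof -
    have "q x \<in> N" using mod_homD(1)[OF b(4) x] by simp
    then have "q x = \<zero>\<^bsub>X\<^esub>" using k F(3) by blast
    then have "x = p x" using b(9)[OF x] mod_homD(1)[OF b(3) x] F(2) pc by auto
    then have "x \<in> B" using mod_homD(1)[OF b(3) x] by simp
    then obtain y where y: "y \<in> carrier X" "x = (\<phi> ^^ n) y" using F(2) by blast
    obtain m where "n = Suc m" using F(1) by (cases n) auto
    then show ?thesis using y pc[OF y(1), of m] by auto
  qed
  then have "\<phi> ` carrier X = carrier X" using mod_homD(1)[OF \<phi>] by auto
  then show ?thesis
    using \<phi> mod_hom_injI[OF Xl Xl \<phi> inj] by (auto simp: mod_iso_def bij_betw_def)
qed

text \<open>
  Injective endomorphisms are invertible, so \<open>1 - g f\<close> is invertible if and only if \<open>g f\<close> fixes no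
  nonzero element. In this form the two-sidedness of the radical becomes evident: \<open>f\<close> and \<open>g\<close>
  exchange the fixed points of \<open>g f\<close> and \<open>f g\<close>.
\<close>

lemma cat_radical_iff:
  assumes X: "X \<in> fg_mod \<Lambda>" and Y: "Y \<in> fg_mod \<Lambda>" and f: "f \<in> mod_hom \<Lambda> X Y"
  shows "f \<in> cat_radical \<Lambda> X Y \<longleftrightarrow>
    (\<forall>g \<in> mod_hom \<Lambda> Y X. \<forall>x \<in> carrier X. g (f x) = x \<longrightarrow> x = \<zero>\<^bsub>X\<^esub>)"
proof -
  have Xl: "left_module \<Lambda> X" by (rule fg_modD[OF X])
  interpret X: left_module \<Lambda> X by (rule Xl)
  have "(\<lambda>x. x \<ominus>\<^bsub>X\<^esub> g (f x)) \<in> mod_iso \<Lambda> X X \<longleftrightarrow> (\<forall>x \<in> carrier X. g (f x) = x \<longrightarrow> x = \<zero>\<^bsub>X\<^esub>)"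
    if g: "g \<in> mod_hom \<Lambda> Y X" for g
  proof -
    have h: "(\<lambda>x. x \<ominus>\<^bsub>X\<^esub> g (f x)) \<in> mod_hom \<Lambda> X X"
      by (rule mod_hom_minus[OF Xl mod_hom_id mod_hom_comp[OF f g]])
    have gf: "g (f x) \<in> carrier X" if "x \<in> carrier X" for x
      using mod_homD(1)[OF g mod_homD(1)[OF f that]] .
    have e: "x \<ominus>\<^bsub>X\<^esub> g (f x) = \<zero>\<^bsub>X\<^esub> \<longleftrightarrow> g (f x) = x" if x: "x \<in> carrier X" for x
      using X.minus_eq_zeroD[OF x gf[OF x]] x by (auto simp: a_minus_def X.r_neg)
    show ?thesis
    proof
      assume "(\<lambda>x. x \<ominus>\<^bsub>X\<^esub> g (f x)) \<in> mod_iso \<Lambda> X X"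
      then have "inj_on (\<lambda>x. x \<ominus>\<^bsub>X\<^esub> g (f x)) (carrier X)" by (simp add: mod_iso_def bij_betw_def)
      then show "\<forall>x \<in> carrier X. g (f x) = x \<longrightarrow> x = \<zero>\<^bsub>X\<^esub>"
        using mod_hom_eq_zero_inj[OF Xl Xl h] e by blast
    next
      assume "\<forall>x \<in> carrier X. g (f x) = x \<longrightarrow> x = \<zero>\<^bsub>X\<^esub>"
      then show "(\<lambda>x. x \<ominus>\<^bsub>X\<^esub> g (f x)) \<in> mod_iso \<Lambda> X X"
        using inj_endo_iso[OF X h] e by blast
    qed
  qed
  then show ?thesis using f by (auto simp: cat_radical_def)
qed

lemma cat_radical_iff':
  assumes X: "X \<in> fg_mod \<Lambda>" and Y: "Y \<in> fg_mod \<Lambda>" and f: "f \<in> mod_hom \<Lambda> X Y"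
  shows "f \<in> cat_radical \<Lambda> X Y \<longleftrightarrow>
    (\<forall>g \<in> mod_hom \<Lambda> Y X. \<forall>y \<in> carrier Y. f (g y) = y \<longrightarrow> y = \<zero>\<^bsub>Y\<^esub>)"
proof -
  have l: "left_module \<Lambda> X" "left_module \<Lambda> Y" using fg_modD X Y by auto
  note fc = mod_homD(1)[OF f] and f0 = mod_hom_group(1)[OF l f]
  show ?thesis
    unfolding cat_radical_iff[OF assms]
  proof (intro iffI ballI impI)
    fix g y
    assume *: "\<forall>g \<in> mod_hom \<Lambda> Y X. \<forall>x \<in> carrier X. g (f x) = x \<longrightarrow> x = \<zero>\<^bsub>X\<^esub>"
      and g: "g \<in> mod_hom \<Lambda> Y X" and y: "y \<in> carrier Y" "f (g y) = y"
    have "g y = \<zero>\<^bsub>X\<^esub>" using * g mod_homD(1)[OF g y(1)] y(2) by metis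
    then show "y = \<zero>\<^bsub>Y\<^esub>" using y(2) f0 by simp
  next
    fix g x
    assume *: "\<forall>g \<in> mod_hom \<Lambda> Y X. \<forall>y \<in> carrier Y. f (g y) = y \<longrightarrow> y = \<zero>\<^bsub>Y\<^esub>"
      and g: "g \<in> mod_hom \<Lambda> Y X" and x: "x \<in> carrier X" "g (f x) = x"
    have "f x = \<zero>\<^bsub>Y\<^esub>" using * g fc[OF x(1)] x(2) by metis
    then show "x = \<zero>\<^bsub>X\<^esub>" using x(2) mod_hom_group(1)[OF l(2,1) g] by simp
  qed
qed

end

section \<open>Lengths along exact sequences\<close>

lemma height_exact:
  assumes X: "left_module R X" and Y: "left_module R Y" and Z: "left_module R Z"
    and f: "f \<in> mod_hom R X Y" "inj_on f (carrier X)"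
    and g: "g \<in> mod_hom R Y Z" and ex: "f ` carrier X = {y \<in> carrier Y. g y = \<zero>\<^bsub>Z\<^esub>}"
    and bd: "bounded_flags (submods R Y {\<zero>\<^bsub>Y\<^esub>} (carrier Y))"
  shows "height (submods R Y {\<zero>\<^bsub>Y\<^esub>} (carrier Y)) =
    height (submods R X {\<zero>\<^bsub>X\<^esub>} (carrier X)) + height (submods R Z {\<zero>\<^bsub>Z\<^esub>} (g ` carrier Y))"
proof -
  interpret X: left_module R X by (rule X)
  interpret Y: left_module R Y by (rule Y)
  interpret Z: left_module R Z by (rule Z)
  have s: "submodule (f ` carrier X) R Y" by (rule submodule_image[OF X Y f(1) X.submodule_carrier])
  have zf: "{\<zero>\<^bsub>Y\<^esub>} \<subseteq> f ` carrier X" using Y.is_submoduleD(2)[OF s] by simp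
  have zg: "{\<zero>\<^bsub>Z\<^esub>} \<subseteq> g ` carrier Y"
    using Z.is_submoduleD(2)[OF submodule_image[OF Y Z g Y.submodule_carrier]] by simp
  have k: "{x \<in> carrier X. f x \<in> {\<zero>\<^bsub>Y\<^esub>}} = {\<zero>\<^bsub>X\<^esub>}"
    using mod_hom_eq_zero_inj[OF X Y f] mod_hom_group(1)[OF X Y f(1)] by auto
  have "height (submods R Y {\<zero>\<^bsub>Y\<^esub>} (carrier Y)) =
      height (submods R Y {\<zero>\<^bsub>Y\<^esub>} (f ` carrier X)) + height (submods R Y (f ` carrier X) (carrier Y))"
    by (rule Y.height_trans[OF s zf Y.is_submoduleD(1)[OF s] Y.submodule_carrier bd])
  also have "height (submods R Y {\<zero>\<^bsub>Y\<^esub>} (f ` carrier X)) = height (submods R X {\<zero>\<^bsub>X\<^esub>} (carrier X))"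
    using height_correspond[OF X Y f(1) X.submodule_carrier Y.submodule_zero zf] k by simp
  also have "height (submods R Y (f ` carrier X) (carrier Y)) = height (submods R Z {\<zero>\<^bsub>Z\<^esub>} (g ` carrier Y))"
    using height_correspond[OF Y Z g Y.submodule_carrier Z.submodule_zero zg] ex by simp
  finally show ?thesis .
qed

lemma bisum_exact:
  assumes "left_module R D" "left_module R X" "left_module R Y" "bisum R D X Y i j p q"
  shows "inj_on i (carrier X)" "i ` carrier X = {d \<in> carrier D. q d = \<zero>\<^bsub>Y\<^esub>}" "q ` carrier D = carrier Y"
proof -
  interpret D: left_module R D by fact
  note b = bisumD[OF assms(4)]
  show "inj_on i (carrier X)" using b(5) by (rule inj_on_inverseI)
  have "d = i (p d)" if "d \<in> carrier D" "q d = \<zero>\<^bsub>Y\<^esub>" for d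
    using b(9)[OF that(1)] that mod_hom_group(1)[OF assms(3,1) b(2)] mod_homD(1)[OF b(1)] mod_homD(1)[OF b(3)]
    by simp
  then have "{d \<in> carrier D. q d = \<zero>\<^bsub>Y\<^esub>} \<subseteq> i ` carrier X"
    using mod_homD(1)[OF b(3)] by blast
  then show "i ` carrier X = {d \<in> carrier D. q d = \<zero>\<^bsub>Y\<^esub>}"
    using b(6) mod_homD(1)[OF b(1)] by blast
  show "q ` carrier D = carrier Y"
    using b(8) mod_homD(1)[OF b(2)] mod_homD(1)[OF b(4)] by (auto intro!: image_eqI[of _ q "j _"])
qed

context artin_algebra_modules
begin

lemma len_bisum:
  assumes "D \<in> fg_mod \<Lambda>" "left_module \<Lambda> X" "left_module \<Lambda> Y" "bisum \<Lambda> D X Y i j p q"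
  shows "len D = len X + len Y"
  using height_exact[OF assms(2) fg_modD[OF assms(1)] assms(3) bisumD(1)[OF assms(4)] _ bisumD(4)[OF assms(4)]
      _ finite_length[OF assms(1)]] bisum_exact[OF fg_modD[OF assms(1)] assms(2-4)]
  by (simp add: len_def)

lemma len_pos:
  assumes "X \<in> fg_mod \<Lambda>" "carrier X \<noteq> {\<zero>\<^bsub>X\<^esub>}"
  shows "len X > 0"
  unfolding len_def
proof (rule height_pos[OF finite_length[OF assms(1)]])
  interpret X: left_module \<Lambda> X by (rule fg_modD[OF assms(1)])
  show "{\<zero>\<^bsub>X\<^esub>} \<in> submods \<Lambda> X {\<zero>\<^bsub>X\<^esub>} (carrier X)" "carrier X \<in> submods \<Lambda> X {\<zero>\<^bsub>X\<^esub>} (carrier X)"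
    using X.submodule_zero X.submodule_carrier by (auto simp: submods_def)
  show "{\<zero>\<^bsub>X\<^esub>} \<subset> carrier X" using assms(2) by auto
qed

lemma cat_radical_hom: "f \<in> cat_radical \<Lambda> X Y \<Longrightarrow> f \<in> mod_hom \<Lambda> X Y"
  by (simp add: cat_radical_def)

lemma cat_radical_postcomp:
  assumes "X \<in> fg_mod \<Lambda>" "Y \<in> fg_mod \<Lambda>" "Z \<in> fg_mod \<Lambda>"
    and f: "f \<in> cat_radical \<Lambda> X Y" and g: "g \<in> mod_hom \<Lambda> Y Z"
  shows "(\<lambda>x. g (f x)) \<in> cat_radical \<Lambda> X Z"
proof -
  note fh = cat_radical_hom[OF f]
  have "x = \<zero>\<^bsub>X\<^esub>" if "k \<in> mod_hom \<Lambda> Z X" "x \<in> carrier X" "k (g (f x)) = x" for k x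
    using bspec[OF f[unfolded cat_radical_iff[OF assms(1,2) fh]] mod_hom_comp[OF g that(1)]] that(2,3)
    by simp
  then show ?thesis
    unfolding cat_radical_iff[OF assms(1,3) mod_hom_comp[OF fh g]] by blast
qed

lemma cat_radical_precomp:
  assumes "X \<in> fg_mod \<Lambda>" "Y \<in> fg_mod \<Lambda>" "Z \<in> fg_mod \<Lambda>"
    and f: "f \<in> mod_hom \<Lambda> X Y" and g: "g \<in> cat_radical \<Lambda> Y Z"
  shows "(\<lambda>x. g (f x)) \<in> cat_radical \<Lambda> X Z"
proof -
  note gh = cat_radical_hom[OF g]
  have "z = \<zero>\<^bsub>Z\<^esub>" if "k \<in> mod_hom \<Lambda> Z X" "z \<in> carrier Z" "g (f (k z)) = z" for k z
    using bspec[OF g[unfolded cat_radical_iff'[OF assms(2,3) gh]] mod_hom_comp[OF that(1) f]] that(2,3)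
    by simp
  then show ?thesis
    unfolding cat_radical_iff'[OF assms(1,3) mod_hom_comp[OF f gh]] by blast
qed

lemma cat_radical_cong:
  assumes X: "X \<in> fg_mod \<Lambda>" and Y: "Y \<in> fg_mod \<Lambda>"
    and f: "f \<in> cat_radical \<Lambda> X Y" and fg: "\<And>x. x \<in> carrier X \<Longrightarrow> g x = f x"
  shows "g \<in> cat_radical \<Lambda> X Y"
proof -
  have g: "g \<in> mod_hom \<Lambda> X Y" by (rule mod_hom_cong[OF cat_radical_hom[OF f] fg fg_modD[OF X]])
  show ?thesis
    using f fg unfolding cat_radical_iff[OF X Y g] cat_radical_iff[OF X Y cat_radical_hom[OF f]] by simp
qed

end

section \<open>Resolving subcategories\<close>

locale resolving_category = artin_algebra_modules R \<Lambda>
  for R :: "('r, 'k) ring_scheme" (structure) and \<Lambda> :: "('r, 'a) module" (structure) +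
  fixes \<iota> :: "'a list \<Rightarrow> 'm" and \<E> :: "('a, 'm) module set"
  assumes inj_iota: "inj \<iota>" and res: "resolving \<Lambda> \<E>"
begin

lemma subcat: "subcategory \<Lambda> \<E>"
  using res unfolding resolving_def by blast

lemma E_fg: "X \<in> \<E> \<Longrightarrow> X \<in> fg_mod \<Lambda>"
  using subcat unfolding subcategory_def by blast

lemma E_lm: "X \<in> \<E> \<Longrightarrow> left_module \<Lambda> X"
  using E_fg fg_modD by blast

lemma E_sum: "set Xs \<subseteq> \<E> \<Longrightarrow> Y \<in> fg_mod \<Lambda> \<Longrightarrow> mod_isomorphic \<Lambda> Y (mod_sum Xs) \<Longrightarrow> Y \<in> \<E>"
  using subcat unfolding subcategory_def by blast

lemma E_ext: "X \<in> \<E> \<Longrightarrow> Z \<in> \<E> \<Longrightarrow> Y \<in> fg_mod \<Lambda> \<Longrightarrow> short_exact \<Lambda> X f Y g Z \<Longrightarrow> Y \<in> \<E>"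
  using res unfolding resolving_def by blast

lemma E_ker: "Y \<in> \<E> \<Longrightarrow> Z \<in> \<E> \<Longrightarrow> X \<in> fg_mod \<Lambda> \<Longrightarrow> short_exact \<Lambda> X f Y g Z \<Longrightarrow> X \<in> \<E>"
  using res unfolding resolving_def by blast

lemma E_summand:
  fixes Y :: "('a, 'm) module"
  assumes "Z \<in> \<E>" "X \<in> fg_mod \<Lambda>" "Y \<in> fg_mod \<Lambda>" "bisum \<Lambda> Z X Y i j p q"
  shows "X \<in> \<E>"
proof -
  have "mod_isomorphic \<Lambda> Z (mod_sum [X, Y])"
    using bisum_iff_isomorphic[of \<Lambda> Z X Y] assms E_lm fg_modD by blast
  then show ?thesis using res assms unfolding resolving_def by blast
qed

lemma E_bisum:
  assumes "X \<in> \<E>" "Y \<in> \<E>" "D \<in> fg_mod \<Lambda>" "bisum \<Lambda> D X Y i j p q"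
  shows "D \<in> \<E>"
proof -
  have "mod_isomorphic \<Lambda> D (mod_sum [X, Y])"
    using bisum_iff_isomorphic[of \<Lambda> D X Y] assms E_lm fg_modD by blast
  then show ?thesis using E_sum[of "[X, Y]" D] assms by simp
qed

text \<open>
  The injection \<open>\<iota>\<close> brings direct sums, which live on lists, back to the type of the objects of \<open>\<E>\<close>.
\<close>

lemma ex_copy:
  fixes M :: "('a, 'b) module"
  assumes "M \<in> fg_mod \<Lambda>"
  obtains N :: "('a, 'm) module" where "N \<in> fg_mod \<Lambda>" "mod_isomorphic \<Lambda> M N"
  using ex_isomorphic_in_fg_mod[of \<Lambda> M \<iota>] assms inj_iota by (auto simp: fg_mod_def)

lemma ex_copy_maps:
  fixes M :: "('a, 'b) module"
  assumes "M \<in> fg_mod \<Lambda>"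
  obtains N :: "('a, 'm) module" and f g where "N \<in> fg_mod \<Lambda>" "f \<in> mod_hom \<Lambda> M N" "g \<in> mod_hom \<Lambda> N M"
    "\<And>x. x \<in> carrier M \<Longrightarrow> g (f x) = x" "\<And>x. x \<in> carrier N \<Longrightarrow> f (g x) = x"
proof -
  obtain N :: "('a, 'm) module" where N: "N \<in> fg_mod \<Lambda>" "mod_isomorphic \<Lambda> M N"
    by (rule ex_copy[OF assms])
  then obtain f where "f \<in> mod_iso \<Lambda> M N" by (auto simp: mod_isomorphic_def)
  then show thesis
    by (rule mod_isoE[OF fg_modD[OF assms] fg_modD[OF N(1)]]) (rule that[OF N(1)]; assumption)
qed

lemma ex_bisum:
  fixes X :: "('a, 'b) module" and Y :: "('a, 'b) module"
  assumes "X \<in> fg_mod \<Lambda>" "Y \<in> fg_mod \<Lambda>"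
  obtains D :: "('a, 'm) module" and i j p q where "D \<in> fg_mod \<Lambda>" "bisum \<Lambda> D X Y i j p q"
proof -
  have S: "mod_sum [X, Y] \<in> fg_mod \<Lambda>" by (rule fg_mod_mod_sum[OF Lambda_ring]) (use assms in auto)
  obtain D :: "('a, 'm) module" and f g where D: "D \<in> fg_mod \<Lambda>"
    "f \<in> mod_hom \<Lambda> (mod_sum [X, Y]) D" "g \<in> mod_hom \<Lambda> D (mod_sum [X, Y])"
    "\<And>x. x \<in> carrier (mod_sum [X, Y]) \<Longrightarrow> g (f x) = x" "\<And>x. x \<in> carrier D \<Longrightarrow> f (g x) = x"
    by (rule ex_copy_maps[OF S]) (rule that; assumption)
  obtain i j p q where b: "bisum \<Lambda> (mod_sum [X, Y]) X Y i j p q"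
    by (rule bisum_mod_sum2[OF fg_modD[OF assms(1)] fg_modD[OF assms(2)]])
  show thesis using that[OF D(1) bisum_iso[OF b D(3,2,5,4)]] .
qed

lemma iso_ConsE:
  fixes X :: "('a, 'm) module"
  assumes X: "X \<in> fg_mod \<Lambda>" and Y: "Y \<in> fg_mod \<Lambda>" "\<And>Z. Z \<in> set Ys \<Longrightarrow> Z \<in> fg_mod \<Lambda>"
    and iso: "mod_isomorphic \<Lambda> X (mod_sum (Y # Ys))"
  obtains X' :: "('a, 'm) module" and i j p q
  where "X' \<in> fg_mod \<Lambda>" "bisum \<Lambda> X Y X' i j p q" "mod_isomorphic \<Lambda> X' (mod_sum Ys)"
proof -
  have S: "mod_sum Ys \<in> fg_mod \<Lambda>" "mod_sum (Y # Ys) \<in> fg_mod \<Lambda>"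
    by (rule fg_mod_mod_sum[OF Lambda_ring]; use Y in auto)+
  obtain f where f: "f \<in> mod_iso \<Lambda> X (mod_sum (Y # Ys))" using iso by (auto simp: mod_isomorphic_def)
  obtain g where fg: "f \<in> mod_hom \<Lambda> X (mod_sum (Y # Ys))" "g \<in> mod_hom \<Lambda> (mod_sum (Y # Ys)) X"
      "\<And>x. x \<in> carrier X \<Longrightarrow> g (f x) = x" "\<And>y. y \<in> carrier (mod_sum (Y # Ys)) \<Longrightarrow> f (g y) = y"
    by (rule mod_isoE[OF fg_modD[OF X] fg_modD[OF S(2)] f]) (rule that; assumption)
  have b: "bisum \<Lambda> (mod_sum (Y # Ys)) Y (mod_sum Ys) (\<lambda>x. x # map ring.zero Ys) (\<lambda>xs. \<zero>\<^bsub>Y\<^esub> # xs) hd tl"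
    by (rule bisum_Cons) (use Y fg_modD in auto)
  obtain X' :: "('a, 'm) module" and u v where X': "X' \<in> fg_mod \<Lambda>"
    "u \<in> mod_hom \<Lambda> (mod_sum Ys) X'" "v \<in> mod_hom \<Lambda> X' (mod_sum Ys)"
    "\<And>x. x \<in> carrier (mod_sum Ys) \<Longrightarrow> v (u x) = x" "\<And>x. x \<in> carrier X' \<Longrightarrow> u (v x) = x"
    by (rule ex_copy_maps[OF S(1)]) (rule that; assumption)
  have "v \<in> mod_iso \<Lambda> X' (mod_sum Ys)" by (rule mod_isoI[OF X'(3,2,5,4)])
  then have iso': "mod_isomorphic \<Lambda> X' (mod_sum Ys)" by (auto simp: mod_isomorphic_def)
  show thesis
    by (rule that[OF X'(1) bisum_iso_right[OF bisum_iso[OF b fg] fg_modD[OF S(1)] fg_modD[OF X'(1)] X'(2-)] iso'])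
qed

lemma iso_ConsI:
  fixes X :: "('a, 'b) module" and X' :: "('a, 'c) module"
  assumes X: "left_module \<Lambda> X" "left_module \<Lambda> X'" and Y: "left_module \<Lambda> Y"
      "\<And>Z. Z \<in> set Ys \<Longrightarrow> left_module \<Lambda> Z"
    and b: "bisum \<Lambda> X Y X' i j p q" and iso: "mod_isomorphic \<Lambda> X' (mod_sum Ys)"
  shows "mod_isomorphic \<Lambda> X (mod_sum (Y # Ys))"
proof -
  have S: "left_module \<Lambda> (mod_sum Ys)" "left_module \<Lambda> (mod_sum (Y # Ys))"
    by (rule left_module_mod_sum[OF Lambda_ring]; use Y in auto)+
  obtain f where f: "f \<in> mod_iso \<Lambda> X' (mod_sum Ys)" using iso by (auto simp: mod_isomorphic_def)
  obtain g where fg: "f \<in> mod_hom \<Lambda> X' (mod_sum Ys)" "g \<in> mod_hom \<Lambda> (mod_sum Ys) X'"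
      "\<And>x. x \<in> carrier X' \<Longrightarrow> g (f x) = x" "\<And>y. y \<in> carrier (mod_sum Ys) \<Longrightarrow> f (g y) = y"
    by (rule mod_isoE[OF X(2) S(1) f]) (rule that; assumption)
  show ?thesis
    by (rule bisum_unique[OF bisum_iso_right[OF b X(2) S(1) fg] X(1) Y(1) S(1) bisum_Cons S(2)])
      (use Y in auto)
qed

text \<open>
  Applied to the lengths of homomorphism modules and to the lengths modulo the radical.
\<close>

lemma additive_mod_sum:
  fixes a :: "('a, 'm) module \<Rightarrow> 'x :: comm_monoid_add"
  assumes zero: "\<And>X. X \<in> fg_mod \<Lambda> \<Longrightarrow> carrier X = {\<zero>\<^bsub>X\<^esub>} \<Longrightarrow> a X = 0"
    and add: "\<And>D X Y i j p q. D \<in> fg_mod \<Lambda> \<Longrightarrow> X \<in> fg_mod \<Lambda> \<Longrightarrow> Y \<in> fg_mod \<Lambda> \<Longrightarrow>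
      bisum \<Lambda> D X Y i j p q \<Longrightarrow> a D = a X + a Y"
    and X: "X \<in> fg_mod \<Lambda>" "\<And>Y. Y \<in> set Ys \<Longrightarrow> Y \<in> fg_mod \<Lambda>" "mod_isomorphic \<Lambda> X (mod_sum Ys)"
  shows "a X = (\<Sum>Y\<leftarrow>Ys. a Y)"
  using X
proof (induction Ys arbitrary: X)
  case Nil
  then show ?case using zero mod_isomorphic_Nil_iff[OF fg_modD] by auto
next
  case (Cons Y Ys)
  have Y: "Y \<in> fg_mod \<Lambda>" "\<And>Z. Z \<in> set Ys \<Longrightarrow> Z \<in> fg_mod \<Lambda>" using Cons.prems by auto
  obtain X' :: "('a, 'm) module" and i j p q
    where X': "X' \<in> fg_mod \<Lambda>" "bisum \<Lambda> X Y X' i j p q" "mod_isomorphic \<Lambda> X' (mod_sum Ys)"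
    by (rule iso_ConsE[OF Cons.prems(1) Y Cons.prems(3)]) ((rule that; assumption) | assumption)+
  show ?case using add[OF Cons.prems(1) Y(1) X'(1,2)] Cons.IH[OF X'(1) Y(2) X'(3)] by simp
qed

lemma ex_zero_module:
  obtains Z where "Z \<in> \<E>" "carrier Z = {\<zero>\<^bsub>Z\<^esub>}"
proof -
  have S: "mod_sum ([] :: ('a, 'm) module list) \<in> fg_mod \<Lambda>"
    by (rule fg_mod_mod_sum[OF Lambda_ring]) simp
  obtain Z :: "('a, 'm) module" where Z: "Z \<in> fg_mod \<Lambda>" "mod_isomorphic \<Lambda> (mod_sum ([] :: ('a, 'm) module list)) Z"
    by (rule ex_copy[OF S])
  have iso: "mod_isomorphic \<Lambda> Z (mod_sum ([] :: ('a, 'm) module list))"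
    by (rule mod_isomorphic_sym[OF fg_modD[OF S] fg_modD[OF Z(1)] Z(2)])
  then have "Z \<in> \<E>" using E_sum[of "[]" Z] Z(1) by simp
  moreover have "carrier Z = {\<zero>\<^bsub>Z\<^esub>}" using iso mod_isomorphic_Nil_iff[OF fg_modD[OF Z(1)]] by blast
  ultimately show thesis by (rule that)
qed

lemma bisum_zero_right:
  assumes "left_module \<Lambda> X" "left_module \<Lambda> Z" "carrier Z = {\<zero>\<^bsub>Z\<^esub>}" "left_module \<Lambda> Y"
    and fg: "f \<in> mod_hom \<Lambda> X Y" "g \<in> mod_hom \<Lambda> Y X"
      "\<And>x. x \<in> carrier X \<Longrightarrow> g (f x) = x" "\<And>y. y \<in> carrier Y \<Longrightarrow> f (g y) = y"
  shows "bisum \<Lambda> X Y Z g (\<lambda>_. \<zero>\<^bsub>X\<^esub>) f (\<lambda>_. \<zero>\<^bsub>Z\<^esub>)"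
proof -
  interpret X: left_module \<Lambda> X by fact
  show ?thesis
    unfolding bisum_def
    using fg mod_hom_const_zero[OF assms(1)] mod_hom_const_zero[OF assms(2)] assms(3)
      mod_hom_group(1)[OF assms(1,4) fg(1)] mod_homD(1)[OF fg(1)] mod_homD(1)[OF fg(2)] by auto
qed

text \<open>
  A module is the direct sum of any isomorphic copy and a zero module.
\<close>

lemma additive_iso:
  fixes a :: "('a, 'm) module \<Rightarrow> 'x :: comm_monoid_add"
  assumes zero: "\<And>X. X \<in> fg_mod \<Lambda> \<Longrightarrow> carrier X = {\<zero>\<^bsub>X\<^esub>} \<Longrightarrow> a X = 0"
    and add: "\<And>D X Y i j p q. D \<in> fg_mod \<Lambda> \<Longrightarrow> X \<in> fg_mod \<Lambda> \<Longrightarrow> Y \<in> fg_mod \<Lambda> \<Longrightarrow>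
      bisum \<Lambda> D X Y i j p q \<Longrightarrow> a D = a X + a Y"
    and X: "X \<in> fg_mod \<Lambda>" "Y \<in> fg_mod \<Lambda>" "mod_isomorphic \<Lambda> X Y"
  shows "a X = a Y"
proof -
  obtain Z where Z: "Z \<in> \<E>" "carrier Z = {\<zero>\<^bsub>Z\<^esub>}" by (rule ex_zero_module)
  obtain f where f: "f \<in> mod_iso \<Lambda> X Y" using X(3) by (auto simp: mod_isomorphic_def)
  obtain g where fg: "f \<in> mod_hom \<Lambda> X Y" "g \<in> mod_hom \<Lambda> Y X"
      "\<And>x. x \<in> carrier X \<Longrightarrow> g (f x) = x" "\<And>y. y \<in> carrier Y \<Longrightarrow> f (g y) = y"
    by (rule mod_isoE[OF fg_modD[OF X(1)] fg_modD[OF X(2)] f]) (rule that; assumption)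
  from add[OF X(1,2) E_fg[OF Z(1)]
      bisum_zero_right[OF fg_modD[OF X(1)] E_lm[OF Z(1)] Z(2) fg_modD[OF X(2)] fg]]
  show ?thesis using zero[OF E_fg[OF Z(1)] Z(2)] by simp
qed


section \<open>Indecomposable objects\<close>

abbreviation indec :: "('a, 'm) module \<Rightarrow> bool" where
  "indec \<equiv> indecomposable \<Lambda> \<E>"

lemma indecD:
  assumes "indec X"
  shows "X \<in> \<E>" "X \<in> fg_mod \<Lambda>" "left_module \<Lambda> X" "carrier X \<noteq> {\<zero>\<^bsub>X\<^esub>}"
  using assms E_fg E_lm by (auto simp: indecomposable_def)

lemma ex_nonzero_element:
  assumes "left_module \<Lambda> X" "carrier X \<noteq> {\<zero>\<^bsub>X\<^esub>}"
  obtains x where "x \<in> carrier X" "x \<noteq> \<zero>\<^bsub>X\<^esub>"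
proof -
  interpret X: left_module \<Lambda> X by fact
  show thesis using assms(2) X.zero_closed that by blast
qed

lemma indec_bisum:
  fixes X Y :: "('a, 'm) module"
  assumes W: "indec W" and XY: "X \<in> fg_mod \<Lambda>" "Y \<in> fg_mod \<Lambda>" "bisum \<Lambda> W X Y i j p q"
  shows "carrier X = {\<zero>\<^bsub>X\<^esub>} \<or> carrier Y = {\<zero>\<^bsub>Y\<^esub>}"
proof -
  note w = indecD[OF W]
  have "X \<in> \<E>" "Y \<in> \<E>"
    using E_summand[OF w(1) XY] E_summand[OF w(1) XY(2,1) bisum_commute[OF w(3) XY(3)]] by auto
  moreover have "mod_isomorphic \<Lambda> W (mod_sum [X, Y])"
    using bisum_iff_isomorphic[OF w(3) fg_modD[OF XY(1)] fg_modD[OF XY(2)]] XY(3) by blast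
  ultimately show ?thesis using W unfolding indecomposable_def by blast
qed

text \<open>
  In Fitting's decomposition the kernel is nonzero when \<open>\<phi>\<close> is not injective, so the image vanishes.
\<close>

lemma indec_endo_nilpotent:
  assumes W: "indec W" and \<phi>: "\<phi> \<in> mod_hom \<Lambda> W W" "\<phi> \<notin> mod_iso \<Lambda> W W"
  obtains n where "\<And>x. x \<in> carrier W \<Longrightarrow> (\<phi> ^^ n) x = \<zero>\<^bsub>W\<^esub>"
proof -
  note w = indecD[OF W]
  obtain n B N p q where F: "n > 0" "B = (\<phi> ^^ n) ` carrier W" "N = {x \<in> carrier W. (\<phi> ^^ n) x = \<zero>\<^bsub>W\<^esub>}"
    "submodule B \<Lambda> W" "submodule N \<Lambda> W"
    "bisum \<Lambda> W (submod W B) (submod W N) (\<lambda>x. x) (\<lambda>x. x) p q"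
    by (rule fitting[OF w(2) \<phi>(1)]) (rule that; assumption)
  have "B = {\<zero>\<^bsub>W\<^esub>} \<or> N = {\<zero>\<^bsub>W\<^esub>}"
    using indec_bisum[OF W fg_mod_submod[OF w(2) F(4)] fg_mod_submod[OF w(2) F(5)] F(6)] by simp
  moreover have "N \<noteq> {\<zero>\<^bsub>W\<^esub>}"
  proof
    assume N: "N = {\<zero>\<^bsub>W\<^esub>}"
    have "x = \<zero>\<^bsub>W\<^esub>" if x: "x \<in> carrier W" "\<phi> x = \<zero>\<^bsub>W\<^esub>" for x
    proof -
      obtain m where m: "n = Suc m" using F(1) by (cases n) auto
      have "(\<phi> ^^ n) x = (\<phi> ^^ m) (\<phi> x)" by (simp add: m funpow_swap1)
      also have "\<dots> = \<zero>\<^bsub>W\<^esub>"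
        using x(2) mod_hom_group(1)[OF w(3,3) endo_pow[OF \<phi>(1)]] by simp
      finally have "x \<in> N" using x(1) F(3) by simp
      then show ?thesis using N by simp
    qed
    then show False using inj_endo_iso[OF w(2) \<phi>(1)] \<phi>(2) by blast
  qed
  ultimately have "(\<phi> ^^ n) x = \<zero>\<^bsub>W\<^esub>" if "x \<in> carrier W" for x using F(2) that by blast
  then show thesis by (rule that)
qed

text \<open>
  This is how the locality of the endomorphism ring enters: a nilpotent endomorphism fixes only zero.
\<close>

lemma indec_endo_fixed_point:
  assumes W: "indec W" and \<phi>: "\<phi> \<in> mod_hom \<Lambda> W W" and z: "z \<in> carrier W" "\<phi> z = z" "z \<noteq> \<zero>\<^bsub>W\<^esub>"
  shows "\<phi> \<in> mod_iso \<Lambda> W W"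
proof (rule ccontr)
  assume "\<phi> \<notin> mod_iso \<Lambda> W W"
  then obtain n where n: "\<And>x. x \<in> carrier W \<Longrightarrow> (\<phi> ^^ n) x = \<zero>\<^bsub>W\<^esub>"
    by (rule indec_endo_nilpotent[OF W \<phi>]) (rule that; assumption)
  have "(\<phi> ^^ k) z = z" for k by (induction k) (auto simp: z(2))
  then show False using n[OF z(1)] z(3) by simp
qed

text \<open>
  If \<open>f g\<close> fixes a nonzero element, then \<open>f g\<close> is invertible and \<open>g (f g)\<^sup>-\<^sup>1\<close> is a section of \<open>f\<close>.
\<close>

lemma cat_radical_indec_target:
  assumes Z: "indec Z" and W: "W \<in> fg_mod \<Lambda>" and f: "f \<in> mod_hom \<Lambda> W Z"
  shows "f \<in> cat_radical \<Lambda> W Z \<longleftrightarrow> \<not> (\<exists>g \<in> mod_hom \<Lambda> Z W. \<forall>z \<in> carrier Z. f (g z) = z)"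
proof
  note z = indecD[OF Z]
  assume r: "f \<in> cat_radical \<Lambda> W Z"
  obtain y where y: "y \<in> carrier Z" "y \<noteq> \<zero>\<^bsub>Z\<^esub>" by (rule ex_nonzero_element[OF z(3,4)])
  show "\<not> (\<exists>g \<in> mod_hom \<Lambda> Z W. \<forall>z \<in> carrier Z. f (g z) = z)"
    using r[unfolded cat_radical_iff'[OF W z(2) f]] y by blast
next
  note z = indecD[OF Z]
  assume no: "\<not> (\<exists>g \<in> mod_hom \<Lambda> Z W. \<forall>z \<in> carrier Z. f (g z) = z)"
  show "f \<in> cat_radical \<Lambda> W Z"
    unfolding cat_radical_iff'[OF W z(2) f]
  proof (intro ballI impI, rule ccontr)
    fix g y assume g: "g \<in> mod_hom \<Lambda> Z W" and y: "y \<in> carrier Z" "f (g y) = y" "y \<noteq> \<zero>\<^bsub>Z\<^esub>"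
    have "(\<lambda>z. f (g z)) \<in> mod_iso \<Lambda> Z Z"
      by (rule indec_endo_fixed_point[OF Z mod_hom_comp[OF g f] y])
    then obtain k where k: "k \<in> mod_hom \<Lambda> Z Z" "\<And>y. y \<in> carrier Z \<Longrightarrow> f (g (k y)) = y"
      by (rule mod_isoE[OF z(3,3)]) (rule that; assumption)
    then have "\<exists>g \<in> mod_hom \<Lambda> Z W. \<forall>z \<in> carrier Z. f (g z) = z"
      by (intro bexI[OF _ mod_hom_comp[OF k(1) g]] ballI)
    then show False using no by contradiction
  qed
qed

lemma cat_radical_indec_source:
  assumes X: "indec X" and Y: "Y \<in> fg_mod \<Lambda>" and f: "f \<in> mod_hom \<Lambda> X Y"
  shows "f \<in> cat_radical \<Lambda> X Y \<longleftrightarrow> \<not> (\<exists>g \<in> mod_hom \<Lambda> Y X. \<forall>x \<in> carrier X. g (f x) = x)"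
proof
  note x = indecD[OF X]
  assume r: "f \<in> cat_radical \<Lambda> X Y"
  obtain y where y: "y \<in> carrier X" "y \<noteq> \<zero>\<^bsub>X\<^esub>" by (rule ex_nonzero_element[OF x(3,4)])
  show "\<not> (\<exists>g \<in> mod_hom \<Lambda> Y X. \<forall>x \<in> carrier X. g (f x) = x)"
    using r[unfolded cat_radical_iff[OF x(2) Y f]] y by blast
next
  note x = indecD[OF X]
  assume no: "\<not> (\<exists>g \<in> mod_hom \<Lambda> Y X. \<forall>x \<in> carrier X. g (f x) = x)"
  show "f \<in> cat_radical \<Lambda> X Y"
    unfolding cat_radical_iff[OF x(2) Y f]
  proof (intro ballI impI, rule ccontr)
    fix g y assume g: "g \<in> mod_hom \<Lambda> Y X" and y: "y \<in> carrier X" "g (f y) = y" "y \<noteq> \<zero>\<^bsub>X\<^esub>"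
    have "(\<lambda>z. g (f z)) \<in> mod_iso \<Lambda> X X"
      by (rule indec_endo_fixed_point[OF X mod_hom_comp[OF f g] y])
    then obtain k where k: "k \<in> mod_hom \<Lambda> X X" "\<And>y. y \<in> carrier X \<Longrightarrow> k (g (f y)) = y"
      by (rule mod_isoE[OF x(3,3)]) (rule that; assumption)
    then have "\<exists>g \<in> mod_hom \<Lambda> Y X. \<forall>x \<in> carrier X. g (f x) = x"
      by (intro bexI[OF _ mod_hom_comp[OF g k(1)]] ballI)
    then show False using no by contradiction
  qed
qed

lemma indec_split_epi_iso:
  assumes W: "indec W" and Z: "Z \<in> fg_mod \<Lambda>" "carrier Z \<noteq> {\<zero>\<^bsub>Z\<^esub>}"
    and f: "f \<in> mod_hom \<Lambda> W Z" and g: "g \<in> mod_hom \<Lambda> Z W" "\<And>z. z \<in> carrier Z \<Longrightarrow> f (g z) = z"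
  shows "f \<in> mod_iso \<Lambda> W Z"
proof -
  note w = indecD[OF W] and zl = fg_modD[OF Z(1)]
  obtain z where z: "z \<in> carrier Z" "z \<noteq> \<zero>\<^bsub>Z\<^esub>" by (rule ex_nonzero_element[OF zl Z(2)])
  have "g z \<noteq> \<zero>\<^bsub>W\<^esub>" using g(2)[OF z(1)] z(2) mod_hom_group(1)[OF w(3) zl f] by auto
  then have "(\<lambda>w. g (f w)) \<in> mod_iso \<Lambda> W W"
    using indec_endo_fixed_point[OF W mod_hom_comp[OF f g(1)] mod_homD(1)[OF g(1) z(1)]] g(2)[OF z(1)] by simp
  then have "inj_on f (carrier W)"
    by (auto simp: mod_iso_def bij_betw_def inj_on_def)
  moreover have "f ` carrier W = carrier Z"
    using mod_homD(1)[OF f] mod_homD(1)[OF g(1)] g(2) by force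
  ultimately show ?thesis using f by (simp add: mod_iso_def bij_betw_def)
qed

lemma ex_indec_summand:
  assumes "X \<in> \<E>" "carrier X \<noteq> {\<zero>\<^bsub>X\<^esub>}"
  shows "\<exists>Y s t. indec Y \<and> s \<in> mod_hom \<Lambda> Y X \<and> t \<in> mod_hom \<Lambda> X Y \<and> (\<forall>y \<in> carrier Y. t (s y) = y)"
  using assms
proof (induction "len X" arbitrary: X rule: less_induct)
  case less
  show ?case
  proof (cases "indec X")
    case True
    then show ?thesis using mod_hom_id by blast
  next
    case False
    then obtain A B where AB: "A \<in> \<E>" "B \<in> \<E>" "mod_isomorphic \<Lambda> X (mod_sum [A, B])"
      "carrier A \<noteq> {\<zero>\<^bsub>A\<^esub>}" "carrier B \<noteq> {\<zero>\<^bsub>B\<^esub>}"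
      using less.prems unfolding indecomposable_def by blast
    obtain i j p q where b: "bisum \<Lambda> X A B i j p q"
      using bisum_iff_isomorphic[OF E_lm[OF less.prems(1)] E_lm[OF AB(1)] E_lm[OF AB(2)]] AB(3) by blast
    have "len A < len X"
      using len_bisum[OF E_fg[OF less.prems(1)] E_lm[OF AB(1)] E_lm[OF AB(2)] b] len_pos[OF E_fg[OF AB(2)] AB(5)]
      by simp
    from less.hyps[OF this AB(1,4)] obtain Y s t where Y: "indec Y" "s \<in> mod_hom \<Lambda> Y A"
      "t \<in> mod_hom \<Lambda> A Y" "\<forall>y \<in> carrier Y. t (s y) = y" by blast
    note bb = bisumD[OF b]
    have "\<forall>y \<in> carrier Y. t (p (i (s y))) = y" using Y bb(5) mod_homD(1)[OF Y(2)] by simp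
    then show ?thesis
      by (intro exI[of _ Y] exI[of _ "\<lambda>x. i (s x)"] exI[of _ "\<lambda>x. t (p x)"] conjI
          Y(1) mod_hom_comp[OF Y(2) bb(1)] mod_hom_comp[OF bb(3) Y(3)])
  qed
qed

theorem ex_decomposition:
  assumes "X \<in> \<E>"
  obtains Xs where "\<And>Y. Y \<in> set Xs \<Longrightarrow> indec Y" "mod_isomorphic \<Lambda> X (mod_sum Xs)"
proof -
  have "\<exists>Xs. (\<forall>Y \<in> set Xs. indec Y) \<and> mod_isomorphic \<Lambda> X (mod_sum Xs)"
    using assms
  proof (induction "len X" arbitrary: X rule: less_induct)
    case less
    note xl = E_lm[OF less.prems]
    show ?case
    proof (cases "carrier X = {\<zero>\<^bsub>X\<^esub>}")
      case True
      then show ?thesis using mod_isomorphic_Nil_iff[OF xl] by (intro exI[of _ "[]"]) auto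
    next
      case False
      then obtain Y s t where Y: "indec Y" "s \<in> mod_hom \<Lambda> Y X" "t \<in> mod_hom \<Lambda> X Y"
        "\<And>y. y \<in> carrier Y \<Longrightarrow> t (s y) = y"
        using ex_indec_summand[OF less.prems] by blast
      note y = indecD[OF Y(1)]
      define K where "K = submod X {d \<in> carrier X. t d = \<zero>\<^bsub>Y\<^esub>}"
      note r = bisum_retract[OF y(3) xl Y(2,3,4), folded K_def]
      have K: "K \<in> fg_mod \<Lambda>" unfolding K_def by (rule fg_mod_submod[OF E_fg[OF less.prems] r(1)])
      have KE: "K \<in> \<E>" by (rule E_summand[OF less.prems K y(2) bisum_commute[OF xl r(2)]])
      have "len K < len X"
        using len_bisum[OF E_fg[OF less.prems] y(3) fg_modD[OF K] r(2)] len_pos[OF y(2,4)] by simp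
      from less.hyps[OF this KE] obtain Ys where
        Ys: "\<forall>Z \<in> set Ys. indec Z" "mod_isomorphic \<Lambda> K (mod_sum Ys)" by blast
      have "mod_isomorphic \<Lambda> X (mod_sum (Y # Ys))"
        by (rule iso_ConsI[OF xl fg_modD[OF K] y(3) _ r(2) Ys(2)]) (use Ys(1) indecD(3) in blast)
      then show ?thesis using Ys(1) Y(1) by (intro exI[of _ "Y # Ys"]) auto
    qed
  qed
  then show thesis using that by blast
qed

end

context artin_algebra_modules
begin

section \<open>Lengths of homomorphism modules\<close>

definition homlen :: "('a, 'w) module \<Rightarrow> ('a, 'x) module \<Rightarrow> nat" where
  "homlen W X = height (submods R (hom_module W X) {\<zero>\<^bsub>hom_module W X\<^esub>} (carrier (hom_module W X)))"

abbreviation post :: "('a, 'w) module \<Rightarrow> ('x \<Rightarrow> 'y) \<Rightarrow> ('w \<Rightarrow> 'x) \<Rightarrow> 'w \<Rightarrow> 'y" where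
  "post W f \<equiv> \<lambda>h. restrict (\<lambda>w. f (h w)) (carrier W)"

lemma hom_moduleD:
  assumes "h \<in> carrier (hom_module W X)"
  shows "h \<in> mod_hom \<Lambda> W X" "h \<in> extensional (carrier W)" "\<And>w. w \<in> carrier W \<Longrightarrow> h w \<in> carrier X"
  using assms mod_homD(1) by (auto simp: hom_module_simps)

lemma post_closed:
  "left_module \<Lambda> W \<Longrightarrow> f \<in> mod_hom \<Lambda> X Y \<Longrightarrow> h \<in> carrier (hom_module W X) \<Longrightarrow>
    post W f h \<in> carrier (hom_module W Y)"
  using mod_homD(1)[OF mod_hom_postcomp] by blast

lemma post_post:
  assumes "h \<in> carrier (hom_module W X)" "\<And>x. x \<in> carrier X \<Longrightarrow> g (f x) = x"
  shows "post W g (post W f h) = h"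
  using hom_moduleD[OF assms(1)] assms(2) by (intro extensionalityI[of _ "carrier W"]) auto

lemma image_post:
  assumes W: "left_module \<Lambda> W" and f: "f \<in> mod_hom \<Lambda> X Y" and g: "g \<in> mod_hom \<Lambda> Y X"
    and gf: "\<And>x. x \<in> carrier X \<Longrightarrow> g (f x) = x"
  shows "post W g ` carrier (hom_module W Y) = carrier (hom_module W X)"
proof (intro equalityI subsetI)
  fix k assume k: "k \<in> carrier (hom_module W X)"
  have "post W g (post W f k) = k" by (rule post_post[of k W X g f, OF k gf])
  then show "k \<in> post W g ` carrier (hom_module W Y)" using post_closed[OF W f k] by (metis imageI)
qed (use post_closed[OF W g] in blast)

text \<open>
  Left exactness of \<open>Hom(W, -)\<close>, with the cokernel on the right accounted for by the length of the
  image.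
\<close>

lemma homlen_exact:
  assumes W: "W \<in> fg_mod \<Lambda>" and XYZ: "X \<in> fg_mod \<Lambda>" "Y \<in> fg_mod \<Lambda>" "Z \<in> fg_mod \<Lambda>"
    and f: "f \<in> mod_hom \<Lambda> X Y" "inj_on f (carrier X)" and g: "g \<in> mod_hom \<Lambda> Y Z"
    and ex: "f ` carrier X = {y \<in> carrier Y. g y = \<zero>\<^bsub>Z\<^esub>}"
  shows "homlen W Y = homlen W X +
    height (submods R (hom_module W Z) {\<zero>\<^bsub>hom_module W Z\<^esub>} (post W g ` carrier (hom_module W Y)))"
  unfolding homlen_def
proof (rule height_exact[OF _ _ _ mod_hom_postcomp[OF _ f(1)] _ mod_hom_postcomp[OF _ g] _
      finite_length_hom_module[OF W XYZ(2)]])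
  note l = fg_modD[OF W] fg_modD[OF XYZ(1)] fg_modD[OF XYZ(2)] fg_modD[OF XYZ(3)]
  interpret W: left_module \<Lambda> W by (rule l)
  show "left_module R (hom_module W X)" "left_module R (hom_module W Y)" "left_module R (hom_module W Z)"
    "left_module \<Lambda> W" "left_module \<Lambda> W"
    using left_module_hom_module l by auto
  show "inj_on (post W f) (carrier (hom_module W X))"
  proof (rule inj_onI)
    fix h k assume hk: "h \<in> carrier (hom_module W X)" "k \<in> carrier (hom_module W X)" "post W f h = post W f k"
    note h = hom_moduleD[OF hk(1)] and k = hom_moduleD[OF hk(2)]
    show "h = k"
    proof (rule extensionalityI[OF h(2) k(2)])
      fix w assume w: "w \<in> carrier W"
      then have "f (h w) = f (k w)" using fun_cong[OF hk(3), of w] by simp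
      then show "h w = k w" using inj_onD[OF f(2)] h(3) k(3) w by blast
    qed
  qed
  show "post W f ` carrier (hom_module W X) =
      {y \<in> carrier (hom_module W Y). post W g y = \<zero>\<^bsub>hom_module W Z\<^esub>}"
  proof (intro equalityI subsetI)
    fix y assume "y \<in> post W f ` carrier (hom_module W X)"
    then obtain h where h: "h \<in> carrier (hom_module W X)" "y = post W f h" by blast
    have "g (f x) = \<zero>\<^bsub>Z\<^esub>" if "x \<in> carrier X" for x using ex that by blast
    then have "post W g y = \<zero>\<^bsub>hom_module W Z\<^esub>"
      unfolding h(2) hom_module_simps(2)
      by (intro extensionalityI[of _ "carrier W"]) (auto simp: hom_moduleD(3)[OF h(1)])
    then show "y \<in> {y \<in> carrier (hom_module W Y). post W g y = \<zero>\<^bsub>hom_module W Z\<^esub>}"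
      using post_closed[OF l(1) f(1) h(1)] h(2) by blast
  next
    fix y assume "y \<in> {y \<in> carrier (hom_module W Y). post W g y = \<zero>\<^bsub>hom_module W Z\<^esub>}"
    then have y: "y \<in> carrier (hom_module W Y)" "post W g y = \<zero>\<^bsub>hom_module W Z\<^esub>" by auto
    have "g (y w) = \<zero>\<^bsub>Z\<^esub>" if "w \<in> carrier W" for w
      using fun_cong[OF y(2), of w] that by (simp add: hom_module_simps)
    then have "y ` carrier W \<subseteq> f ` carrier X" using ex hom_moduleD(3)[OF y(1)] by blast
    then obtain k where k: "k \<in> mod_hom \<Lambda> W X" "\<And>t. t \<in> carrier W \<Longrightarrow> f (k t) = y t"
      by (rule factor_through_inj[OF l(2) f l(1) hom_moduleD(1)[OF y(1)]]) (rule that; assumption)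
    have "post W f (restrict k (carrier W)) = y"
      by (rule extensionalityI[of _ "carrier W"]) (auto simp: k(2) hom_moduleD(2)[OF y(1)])
    then show "y \<in> post W f ` carrier (hom_module W X)"
      using restrict_mod_hom(2)[OF l(1) k(1)] by blast
  qed
qed

lemma homlen_bisum:
  assumes W: "W \<in> fg_mod \<Lambda>" and D: "D \<in> fg_mod \<Lambda>" "X \<in> fg_mod \<Lambda>" "Y \<in> fg_mod \<Lambda>"
    and b: "bisum \<Lambda> D X Y i j p q"
  shows "homlen W D = homlen W X + homlen W Y"
proof -
  note bb = bisumD[OF b] and l = fg_modD[OF D(1)] fg_modD[OF D(2)] fg_modD[OF D(3)] fg_modD[OF W]
  note e = bisum_exact[OF l(1-3) b]
  have "post W q ` carrier (hom_module W D) = carrier (hom_module W Y)"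
    by (rule image_post[OF l(4) bb(2,4,8)])
  then show ?thesis
    using homlen_exact[OF W D(2,1,3) bb(1) e(1) bb(4) e(2)] by (simp add: homlen_def)
qed

lemma bisum_zero:
  assumes "left_module \<Lambda> Z" "carrier Z = {\<zero>\<^bsub>Z\<^esub>}"
  shows "bisum \<Lambda> Z Z Z (\<lambda>z. z) (\<lambda>z. z) (\<lambda>z. z) (\<lambda>z. z)"
proof -
  interpret Z: left_module \<Lambda> Z by fact
  show ?thesis using assms(2) by (auto simp: bisum_def mod_hom_id)
qed

end

context resolving_category
begin

section \<open>Lengths of homomorphisms modulo the radical\<close>

text \<open>
  If \<open>k (f + g) = 1\<close>, then \<open>k f\<close> is not invertible because \<open>f\<close> has no retraction, so it kills some
  nonzero \<open>x\<close>. This \<open>x\<close> is fixed by \<open>k g\<close>, against \<open>g\<close> being radical.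
\<close>

lemma radical_sum:
  assumes W: "indec W" and X: "X \<in> fg_mod \<Lambda>"
    and f: "f \<in> cat_radical \<Lambda> W X" and g: "g \<in> cat_radical \<Lambda> W X"
  shows "(\<lambda>w. f w \<oplus>\<^bsub>X\<^esub> g w) \<in> cat_radical \<Lambda> W X"
proof -
  note w = indecD[OF W] and xl = fg_modD[OF X]
  interpret W: left_module \<Lambda> W by (rule w)
  note fh = cat_radical_hom[OF f] and gh = cat_radical_hom[OF g]
  have h: "(\<lambda>w. f w \<oplus>\<^bsub>X\<^esub> g w) \<in> mod_hom \<Lambda> W X" by (rule mod_hom_add[OF xl fh gh])
  show ?thesis
    unfolding cat_radical_indec_source[OF W X h]
  proof
    assume "\<exists>k\<in>mod_hom \<Lambda> X W. \<forall>x\<in>carrier W. k (f x \<oplus>\<^bsub>X\<^esub> g x) = x"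
    then obtain k where k: "k \<in> mod_hom \<Lambda> X W" "\<And>x. x \<in> carrier W \<Longrightarrow> k (f x \<oplus>\<^bsub>X\<^esub> g x) = x" by blast
    have ks: "k (f x) \<oplus>\<^bsub>W\<^esub> k (g x) = x" if "x \<in> carrier W" for x
      using k(2)[OF that] mod_homD(2)[OF k(1) mod_homD(1)[OF fh that] mod_homD(1)[OF gh that]] by simp
    have "(\<lambda>x. k (f x)) \<notin> mod_iso \<Lambda> W W"
    proof
      assume "(\<lambda>x. k (f x)) \<in> mod_iso \<Lambda> W W"
      then obtain u where u: "u \<in> mod_hom \<Lambda> W W" "\<And>x. x \<in> carrier W \<Longrightarrow> u (k (f x)) = x"
        by (rule mod_isoE[OF w(3,3)]) (rule that; assumption)
      have "\<exists>g\<in>mod_hom \<Lambda> X W. \<forall>x\<in>carrier W. g (f x) = x"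
        by (intro bexI[OF _ mod_hom_comp[OF k(1) u(1)]] ballI u(2))
      then show False using f[unfolded cat_radical_indec_source[OF W X fh]] by contradiction
    qed
    then obtain x where x: "x \<in> carrier W" "k (f x) = \<zero>\<^bsub>W\<^esub>" "x \<noteq> \<zero>\<^bsub>W\<^esub>"
      using inj_endo_iso[OF w(2) mod_hom_comp[OF fh k(1)]] by blast
    have "k (g x) = x" using ks[OF x(1)] x(2) mod_homD(1)[OF k(1) mod_homD(1)[OF gh x(1)]] by simp
    then show False
      using bspec[OF g[unfolded cat_radical_iff[OF w(2) X gh]] k(1)] x by blast
  qed
qed

definition radical_homs :: "('a, 'm) module \<Rightarrow> ('a, 'm) module \<Rightarrow> ('m \<Rightarrow> 'm) set" where
  "radical_homs W X = {h \<in> carrier (hom_module W X). h \<in> cat_radical \<Lambda> W X}"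

lemma radical_homs_post:
  assumes "W \<in> fg_mod \<Lambda>" "X \<in> fg_mod \<Lambda>" "Y \<in> fg_mod \<Lambda>" "f \<in> mod_hom \<Lambda> X Y" "h \<in> radical_homs W X"
  shows "post W f h \<in> radical_homs W Y"
  using cat_radical_cong[OF assms(1,3) cat_radical_postcomp[OF assms(1-3) _ assms(4), of h], of "post W f h"]
    post_closed[OF fg_modD[OF assms(1)] assms(4), of h] assms(5)
  by (auto simp: radical_homs_def)

lemma submodule_radical_homs:
  assumes W: "indec W" and X: "X \<in> fg_mod \<Lambda>"
  shows "submodule (radical_homs W X) R (hom_module W X)"
proof -
  note w = indecD[OF W] and xl = fg_modD[OF X]
  interpret W: left_module \<Lambda> W by (rule w)
  interpret X: left_module \<Lambda> X by (rule xl)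
  interpret H: left_module R "hom_module W X" by (rule left_module_hom_module[OF w(3) xl])
  show ?thesis
  proof (rule H.is_submoduleI)
    show "radical_homs W X \<subseteq> carrier (hom_module W X)" by (auto simp: radical_homs_def)
    have z: "\<zero>\<^bsub>hom_module W X\<^esub> \<in> mod_hom \<Lambda> W X" using hom_moduleD(1)[OF H.zero_closed] .
    have "\<zero>\<^bsub>hom_module W X\<^esub> \<in> cat_radical \<Lambda> W X"
      unfolding cat_radical_iff[OF w(2) X z]
      by (auto simp: hom_module_simps(2) mod_hom_group(1)[OF xl w(3)])
    then show "\<zero>\<^bsub>hom_module W X\<^esub> \<in> radical_homs W X" by (simp add: radical_homs_def)
  next
    fix f g assume fg: "f \<in> radical_homs W X" "g \<in> radical_homs W X"
    then have "(\<lambda>w. f w \<oplus>\<^bsub>X\<^esub> g w) \<in> cat_radical \<Lambda> W X"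
      by (intro radical_sum[OF W X]) (auto simp: radical_homs_def)
    then have "f \<oplus>\<^bsub>hom_module W X\<^esub> g \<in> cat_radical \<Lambda> W X"
      by (rule cat_radical_cong[OF w(2) X]) (simp add: hom_module_simps(3))
    then show "f \<oplus>\<^bsub>hom_module W X\<^esub> g \<in> radical_homs W X"
      using fg by (auto simp: radical_homs_def intro: H.a_closed)
  next
    fix r f assume r: "r \<in> carrier R" and f: "f \<in> radical_homs W X"
    have "(\<lambda>w. structure_map r \<odot>\<^bsub>X\<^esub> f w) \<in> cat_radical \<Lambda> W X"
      by (rule cat_radical_postcomp[OF w(2) X X _ mod_hom_central[OF xl mod_hom_id r]])
        (use f in \<open>simp add: radical_homs_def\<close>)
    then have "r \<odot>\<^bsub>hom_module W X\<^esub> f \<in> cat_radical \<Lambda> W X"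
      by (rule cat_radical_cong[OF w(2) X]) (simp add: hom_module_simps(4))
    then show "r \<odot>\<^bsub>hom_module W X\<^esub> f \<in> radical_homs W X"
      using f r H.smult_closed by (simp add: radical_homs_def)
  qed
qed

text \<open>
  The length of \<open>Hom(W, X) / rad(W, X)\<close>. For indecomposable \<open>W\<close> it is the multiplicity of \<open>W\<close> as a
  summand of \<open>X\<close> times the length of \<open>End(W) / rad(W, W)\<close>, and so proves the multiplicity to be an
  invariant of \<open>X\<close>.
\<close>

definition mult :: "('a, 'm) module \<Rightarrow> ('a, 'm) module \<Rightarrow> nat" where
  "mult W X = height (submods R (hom_module W X) (radical_homs W X) (carrier (hom_module W X)))"

lemma bounded_radical_homs:
  assumes W: "indec W" and X: "X \<in> fg_mod \<Lambda>"
  shows "bounded_flags (submods R (hom_module W X) (radical_homs W X) (carrier (hom_module W X)))"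
proof (rule bounded_flags_subset[OF finite_length_hom_module[OF indecD(2)[OF W] X]])
  show "submods R (hom_module W X) (radical_homs W X) (carrier (hom_module W X))
      \<subseteq> submods R (hom_module W X) {\<zero>\<^bsub>hom_module W X\<^esub>} (carrier (hom_module W X))"
    using left_module.is_submoduleD(2)[OF left_module_hom_module[OF indecD(3)[OF W] fg_modD[OF X]]]
    by (auto simp: submods_def)
qed

text \<open>
  The homomorphisms into \<open>D\<close> whose component in \<open>Y\<close> is radical form a submodule \<open>B\<close>. Projecting to
  the components identifies \<open>Hom(W, D) / B\<close> with \<open>Hom(W, Y) / rad(W, Y)\<close> and \<open>B / rad(W, D)\<close> with
  \<open>Hom(W, X) / rad(W, X)\<close>.
\<close>

lemma mult_bisum:
  assumes W: "indec W" and D: "D \<in> fg_mod \<Lambda>" "X \<in> fg_mod \<Lambda>" "Y \<in> fg_mod \<Lambda>"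
    and b: "bisum \<Lambda> D X Y i j p q"
  shows "mult W D = mult W X + mult W Y"
proof -
  note bb = bisumD[OF b] and w = indecD[OF W]
    and l = fg_modD[OF D(1)] fg_modD[OF D(2)] fg_modD[OF D(3)]
  note HD = left_module_hom_module[OF w(3) l(1)] and HX = left_module_hom_module[OF w(3) l(2)]
    and HY = left_module_hom_module[OF w(3) l(3)]
  interpret HD: left_module R "hom_module W D" by (rule HD)
  interpret HX: left_module R "hom_module W X" by (rule HX)
  interpret HY: left_module R "hom_module W Y" by (rule HY)
  note rD = submodule_radical_homs[OF W D(1)] and rX = submodule_radical_homs[OF W D(2)]
    and rY = submodule_radical_homs[OF W D(3)]
  note P = mod_hom_postcomp[OF w(3) bb(3)] and Q = mod_hom_postcomp[OF w(3) bb(4)]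
  define B where "B = {h \<in> carrier (hom_module W D). post W q h \<in> radical_homs W Y}"
  have B: "submodule B R (hom_module W D)"
    unfolding B_def by (rule submodule_vimage[OF HD HY Q rY HD.submodule_carrier])
  have rB: "radical_homs W D \<subseteq> B"
    using radical_homs_post[OF w(2) D(1,3) bb(4)] by (auto simp: B_def radical_homs_def)
  have Qi: "post W q (post W i k) = \<zero>\<^bsub>hom_module W Y\<^esub>" if "k \<in> carrier (hom_module W X)" for k
    unfolding hom_module_simps(2)
    by (rule extensionalityI[of _ "carrier W"]) (auto simp: bb(6) hom_moduleD(3)[OF that])
  have PB: "post W p ` B = carrier (hom_module W X)"
  proof (intro equalityI subsetI)
    fix k assume k: "k \<in> carrier (hom_module W X)"
    have "post W i k \<in> B"
      unfolding B_def using post_closed[OF w(3) bb(1) k] Qi[OF k] HY.is_submoduleD(2)[OF rY] by simp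
    moreover have "post W p (post W i k) = k" by (rule post_post[of k W X p i, OF k bb(5)])
    ultimately show "k \<in> post W p ` B" by (metis imageI)
  qed (use post_closed[OF w(3) bb(3)] in \<open>auto simp: B_def\<close>)
  have QB: "post W q ` carrier (hom_module W D) = carrier (hom_module W Y)"
    by (rule image_post[OF w(3) bb(2,4,8)])
  have rad: "{h \<in> B. post W p h \<in> radical_homs W X} = radical_homs W D"
  proof (intro equalityI subsetI)
    fix h assume "h \<in> {h \<in> B. post W p h \<in> radical_homs W X}"
    then have h: "h \<in> carrier (hom_module W D)" "post W p h \<in> radical_homs W X" "post W q h \<in> radical_homs W Y"
      by (auto simp: B_def)
    have "post W i (post W p h) \<oplus>\<^bsub>hom_module W D\<^esub> post W j (post W q h) = h"
      unfolding hom_module_simps(3)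
      by (rule extensionalityI[of _ "carrier W"]) (auto simp: hom_moduleD(2,3)[OF h(1)] bb(9))
    then show "h \<in> radical_homs W D"
      using HD.is_submoduleD(3)[OF rD radical_homs_post[OF w(2) D(2,1) bb(1) h(2)]
          radical_homs_post[OF w(2) D(3,1) bb(2) h(3)]] by simp
  qed (use rB radical_homs_post[OF w(2) D(1,2) bb(3)] in auto)
  have "mult W D = height (submods R (hom_module W D) (radical_homs W D) B)
      + height (submods R (hom_module W D) B (carrier (hom_module W D)))"
    unfolding mult_def
    by (rule HD.height_trans[OF B rB HD.is_submoduleD(1)[OF B] HD.submodule_carrier
          bounded_radical_homs[OF W D(1)]])
  also have "height (submods R (hom_module W D) (radical_homs W D) B) = mult W X"
    using height_correspond[OF HD HX P B rX] HX.is_submoduleD(1)[OF rX]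
    unfolding PB rad by (simp add: mult_def)
  also have "height (submods R (hom_module W D) B (carrier (hom_module W D))) = mult W Y"
    using height_correspond[OF HD HY Q HD.submodule_carrier rY] HY.is_submoduleD(1)[OF rY]
    unfolding QB by (simp add: mult_def B_def)
  finally show ?thesis .
qed

lemma additive_zero:
  fixes a :: "('a, 'm) module \<Rightarrow> nat"
  assumes add: "\<And>D X Y i j p q. D \<in> fg_mod \<Lambda> \<Longrightarrow> X \<in> fg_mod \<Lambda> \<Longrightarrow> Y \<in> fg_mod \<Lambda> \<Longrightarrow>
      bisum \<Lambda> D X Y i j p q \<Longrightarrow> a D = a X + a Y"
    and X: "X \<in> fg_mod \<Lambda>" "carrier X = {\<zero>\<^bsub>X\<^esub>}"
  shows "a X = 0"
  using add[OF X(1,1,1) bisum_zero[OF fg_modD[OF X(1)] X(2)]] by simp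

lemma mult_zero:
  assumes "indec W" "X \<in> fg_mod \<Lambda>" "carrier X = {\<zero>\<^bsub>X\<^esub>}"
  shows "mult W X = 0"
  by (rule additive_zero[of "mult W", OF mult_bisum[OF assms(1)] assms(2,3)])

lemma mult_iso:
  assumes "indec W" "X \<in> fg_mod \<Lambda>" "Y \<in> fg_mod \<Lambda>" "mod_isomorphic \<Lambda> X Y"
  shows "mult W X = mult W Y"
  by (rule additive_iso[of "mult W", OF mult_zero[OF assms(1)] mult_bisum[OF assms(1)] assms(2-4)])

lemma homlen_zero:
  fixes X :: "('a, 'm) module"
  assumes "W \<in> fg_mod \<Lambda>" "X \<in> fg_mod \<Lambda>" "carrier X = {\<zero>\<^bsub>X\<^esub>}"
  shows "homlen W X = 0"
  by (rule additive_zero[of "homlen W", OF homlen_bisum[OF assms(1)] assms(2,3)])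

lemma homlen_iso:
  fixes X Y :: "('a, 'm) module"
  assumes "W \<in> fg_mod \<Lambda>" "X \<in> fg_mod \<Lambda>" "Y \<in> fg_mod \<Lambda>" "mod_isomorphic \<Lambda> X Y"
  shows "homlen W X = homlen W Y"
  by (rule additive_iso[of "homlen W", OF homlen_zero[OF assms(1)] homlen_bisum[OF assms(1)] assms(2-4)])

text \<open>
  A section of \<open>h\<close> would make \<open>h\<close> an isomorphism, as \<open>W\<close> is indecomposable.
\<close>

lemma noniso_radical:
  assumes W: "indec W" and X: "indec X" and no: "\<not> mod_isomorphic \<Lambda> W X" and h: "h \<in> mod_hom \<Lambda> W X"
  shows "h \<in> cat_radical \<Lambda> W X"
  unfolding cat_radical_indec_target[OF X indecD(2)[OF W] h]
proof
  assume "\<exists>g\<in>mod_hom \<Lambda> X W. \<forall>z\<in>carrier X. h (g z) = z"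
  then obtain g where "g \<in> mod_hom \<Lambda> X W" "\<And>z. z \<in> carrier X \<Longrightarrow> h (g z) = z" by blast
  then have "h \<in> mod_iso \<Lambda> W X" by (rule indec_split_epi_iso[OF W indecD(2,4)[OF X] h])
  then show False using no by (auto simp: mod_isomorphic_def)
qed

lemma mult_indec_noniso:
  assumes W: "indec W" and X: "indec X" and no: "\<not> mod_isomorphic \<Lambda> W X"
  shows "mult W X = 0"
proof -
  note w = indecD[OF W] and x = indecD[OF X]
  have "radical_homs W X = carrier (hom_module W X)"
    using noniso_radical[OF W X no] hom_moduleD(1) by (auto simp: radical_homs_def)
  moreover have "submods R (hom_module W X) (carrier (hom_module W X)) (carrier (hom_module W X))
      = {carrier (hom_module W X)}"
    using left_module.submodule_carrier[OF left_module_hom_module[OF w(3) x(3)]] by (auto simp: submods_def)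
  ultimately show ?thesis by (simp add: mult_def)
qed

lemma mult_self_pos:
  assumes W: "indec W"
  shows "mult W W > 0"
  unfolding mult_def
proof (rule height_pos[OF bounded_radical_homs[OF W indecD(2)[OF W]]])
  note w = indecD[OF W]
  let ?H = "hom_module W W"
  have s: "submodule (radical_homs W W) R ?H" by (rule submodule_radical_homs[OF W w(2)])
  have sub: "radical_homs W W \<subseteq> carrier ?H" by (auto simp: radical_homs_def)
  show "radical_homs W W \<in> submods R ?H (radical_homs W W) (carrier ?H)"
    "carrier ?H \<in> submods R ?H (radical_homs W W) (carrier ?H)"
    using s sub left_module.submodule_carrier[OF left_module_hom_module[OF w(3,3)]]
    by (auto simp: submods_def)
  let ?i = "restrict (\<lambda>x. x) (carrier W)"
  have i: "?i \<in> carrier ?H" by (rule restrict_mod_hom(2)[OF w(3) mod_hom_id])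
  obtain x where x: "x \<in> carrier W" "x \<noteq> \<zero>\<^bsub>W\<^esub>" by (rule ex_nonzero_element[OF w(3,4)])
  have "?i \<notin> cat_radical \<Lambda> W W"
    unfolding cat_radical_iff[OF w(2,2) hom_moduleD(1)[OF i]]
    using x mod_hom_id[of \<Lambda> W] by (auto intro!: bexI[of _ "\<lambda>x. x"])
  then show "radical_homs W W \<subset> carrier ?H" using i sub by (auto simp: radical_homs_def)
qed


section \<open>The Krull-Schmidt theorem and the split Grothendieck group\<close>

lemma iso_class_eq_iff:
  assumes "X \<in> fg_mod \<Lambda>" "Y \<in> fg_mod \<Lambda>"
  shows "iso_class \<Lambda> X = iso_class \<Lambda> Y \<longleftrightarrow> mod_isomorphic \<Lambda> X Y"
proof
  assume "iso_class \<Lambda> X = iso_class \<Lambda> Y"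
  moreover have "Y \<in> iso_class \<Lambda> Y" using assms mod_isomorphic_refl by (auto simp: iso_class_def)
  ultimately show "mod_isomorphic \<Lambda> X Y" by (auto simp: iso_class_def)
next
  assume i: "mod_isomorphic \<Lambda> X Y"
  note i' = mod_isomorphic_sym[OF fg_modD[OF assms(1)] fg_modD[OF assms(2)] i]
  show "iso_class \<Lambda> X = iso_class \<Lambda> Y"
    unfolding iso_class_def using mod_isomorphic_trans[OF i] mod_isomorphic_trans[OF i'] by blast
qed

definition class_sum :: "('a, 'm) module list \<Rightarrow> (('a, 'm) module set \<Rightarrow>\<^sub>0 int)" where
  "class_sum Xs = (\<Sum>Y\<leftarrow>Xs. frag_of (iso_class \<Lambda> Y))"

lemma class_sum_simps: "class_sum [] = 0" "class_sum (X # Xs) = frag_of (iso_class \<Lambda> X) + class_sum Xs"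
  by (simp_all add: class_sum_def)

lemma keys_class_sum: "\<forall>Y \<in> set Xs. indec Y \<Longrightarrow> Poly_Mapping.keys (class_sum Xs) \<subseteq> ind \<Lambda> \<E>"
proof (induction Xs)
  case (Cons X Xs)
  then show ?case
    using Poly_Mapping.keys_add[of "frag_of (iso_class \<Lambda> X)" "class_sum Xs"]
    by (auto simp: class_sum_simps ind_def)
qed (simp add: class_sum_simps)

lemma lookup_class_sum:
  assumes W: "indec W" and Xs: "\<forall>Y \<in> set Xs. indec Y"
  shows "int (mult W W) * Poly_Mapping.lookup (class_sum Xs) (iso_class \<Lambda> W) = int (\<Sum>Y\<leftarrow>Xs. mult W Y)"
  using Xs
proof (induction Xs)
  case (Cons X Xs)
  then have X: "indec X" by simp
  have "int (mult W X) = int (mult W W) * Poly_Mapping.lookup (frag_of (iso_class \<Lambda> X)) (iso_class \<Lambda> W)"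
  proof (cases "mod_isomorphic \<Lambda> W X")
    case True
    then show ?thesis
      using mult_iso[OF W indecD(2)[OF W] indecD(2)[OF X]] iso_class_eq_iff[OF indecD(2)[OF W] indecD(2)[OF X]]
      by simp
  next
    case False
    then show ?thesis
      using mult_indec_noniso[OF W X] iso_class_eq_iff[OF indecD(2)[OF W] indecD(2)[OF X]]
      by auto
  qed
  then show ?case using Cons by (simp add: class_sum_simps lookup_add distrib_left)
qed (simp add: class_sum_simps)

lemma frag_eqI:
  assumes "Poly_Mapping.keys c \<subseteq> ind \<Lambda> \<E>" "Poly_Mapping.keys d \<subseteq> ind \<Lambda> \<E>"
    and "\<And>W. indec W \<Longrightarrow> Poly_Mapping.lookup c (iso_class \<Lambda> W) = Poly_Mapping.lookup d (iso_class \<Lambda> W)"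
  shows "c = d"
proof (rule poly_mapping_eqI)
  fix k
  show "Poly_Mapping.lookup c k = Poly_Mapping.lookup d k"
  proof (cases "k \<in> ind \<Lambda> \<E>")
    case True
    then show ?thesis using assms(3) by (auto simp: ind_def)
  next
    case False
    then have "k \<notin> Poly_Mapping.keys c" "k \<notin> Poly_Mapping.keys d" using assms(1,2) by blast+
    then show ?thesis by (simp add: in_keys_iff)
  qed
qed

lemma mult_mod_sum:
  assumes "indec W" "X \<in> fg_mod \<Lambda>" "\<forall>Y \<in> set Xs. indec Y" "mod_isomorphic \<Lambda> X (mod_sum Xs)"
  shows "mult W X = (\<Sum>Y\<leftarrow>Xs. mult W Y)"
  by (rule additive_mod_sum[of "mult W", OF mult_zero[OF assms(1)] mult_bisum[OF assms(1)] assms(2) _ assms(4)])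
    (assumption | metis assms(3) indecD(2))+

text \<open>
  The Krull-Schmidt theorem: two decompositions have the same coefficients, because each coefficient
  times \<open>mult W W > 0\<close> equals \<open>mult W X\<close>.
\<close>

lemma K0_class_eq:
  assumes X: "X \<in> \<E>" and Xs: "\<forall>Y \<in> set Xs. indec Y" "mod_isomorphic \<Lambda> X (mod_sum Xs)"
  shows "K0_class \<Lambda> \<E> X = class_sum Xs"
  unfolding K0_class_def
proof (rule the_equality)
  show "\<exists>Ys. (\<forall>Y\<in>set Ys. indec Y) \<and> mod_isomorphic \<Lambda> X (mod_sum Ys) \<and>
      class_sum Xs = (\<Sum>Y\<leftarrow>Ys. frag_of (iso_class \<Lambda> Y))"
    using Xs by (auto simp: class_sum_def)
next
  fix c assume "\<exists>Ys. (\<forall>Y\<in>set Ys. indec Y) \<and> mod_isomorphic \<Lambda> X (mod_sum Ys) \<and>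
      c = (\<Sum>Y\<leftarrow>Ys. frag_of (iso_class \<Lambda> Y))"
  then obtain Ys where Ys: "\<forall>Y\<in>set Ys. indec Y" "mod_isomorphic \<Lambda> X (mod_sum Ys)" "c = class_sum Ys"
    by (auto simp: class_sum_def)
  show "c = class_sum Xs"
  proof (rule frag_eqI)
    fix W assume W: "indec W"
    have "int (mult W W) * Poly_Mapping.lookup c (iso_class \<Lambda> W) =
        int (mult W W) * Poly_Mapping.lookup (class_sum Xs) (iso_class \<Lambda> W)"
      unfolding Ys(3) lookup_class_sum[OF W Ys(1)] lookup_class_sum[OF W Xs(1)]
      using mult_mod_sum[OF W E_fg[OF X] Ys(1,2)] mult_mod_sum[OF W E_fg[OF X] Xs] by simp
    then show "Poly_Mapping.lookup c (iso_class \<Lambda> W) = Poly_Mapping.lookup (class_sum Xs) (iso_class \<Lambda> W)"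
      using mult_self_pos[OF W] by simp
  qed (use keys_class_sum Ys Xs in auto)
qed

lemma K0_class:
  assumes "X \<in> \<E>"
  shows keys_K0_class: "Poly_Mapping.keys (K0_class \<Lambda> \<E> X) \<subseteq> ind \<Lambda> \<E>"
    and lookup_K0_class: "\<And>W. indec W \<Longrightarrow>
      int (mult W W) * Poly_Mapping.lookup (K0_class \<Lambda> \<E> X) (iso_class \<Lambda> W) = int (mult W X)"
proof -
  obtain Xs where Xs: "\<And>Y. Y \<in> set Xs \<Longrightarrow> indec Y" "mod_isomorphic \<Lambda> X (mod_sum Xs)"
    by (rule ex_decomposition[OF assms]) (rule that; assumption)
  then have Xs': "\<forall>Y\<in>set Xs. indec Y" by blast
  note e = K0_class_eq[OF assms Xs' Xs(2)]
  show "Poly_Mapping.keys (K0_class \<Lambda> \<E> X) \<subseteq> ind \<Lambda> \<E>"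
    unfolding e by (rule keys_class_sum[OF Xs'])
  show "int (mult W W) * Poly_Mapping.lookup (K0_class \<Lambda> \<E> X) (iso_class \<Lambda> W) = int (mult W X)"
    if "indec W" for W
    unfolding e lookup_class_sum[OF that Xs'] mult_mod_sum[OF that E_fg[OF assms] Xs' Xs(2)] ..
qed

lemma K0_class_bisum:
  assumes D: "D \<in> \<E>" "X \<in> \<E>" "Y \<in> \<E>" and b: "bisum \<Lambda> D X Y i j p q"
  shows "K0_class \<Lambda> \<E> D = K0_class \<Lambda> \<E> X + K0_class \<Lambda> \<E> Y"
proof (rule frag_eqI)
  show "Poly_Mapping.keys (K0_class \<Lambda> \<E> X + K0_class \<Lambda> \<E> Y) \<subseteq> ind \<Lambda> \<E>"
    using keys_K0_class D Poly_Mapping.keys_add[of "K0_class \<Lambda> \<E> X" "K0_class \<Lambda> \<E> Y"] by blast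
  fix W assume W: "indec W"
  have "int (mult W W) * Poly_Mapping.lookup (K0_class \<Lambda> \<E> D) (iso_class \<Lambda> W) =
      int (mult W W) * Poly_Mapping.lookup (K0_class \<Lambda> \<E> X + K0_class \<Lambda> \<E> Y) (iso_class \<Lambda> W)"
    using mult_bisum[OF W E_fg[OF D(1)] E_fg[OF D(2)] E_fg[OF D(3)] b]
    by (simp add: lookup_add distrib_left lookup_K0_class[OF _ W] D)
  then show "Poly_Mapping.lookup (K0_class \<Lambda> \<E> D) (iso_class \<Lambda> W) =
      Poly_Mapping.lookup (K0_class \<Lambda> \<E> X + K0_class \<Lambda> \<E> Y) (iso_class \<Lambda> W)"
    using mult_self_pos[OF W] by simp
qed (use keys_K0_class D in blast)

section \<open>Pairing with the lengths of homomorphism modules\<close>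

text \<open>
  The homomorphism from the split Grothendieck group to the integers with \<open>[X] \<mapsto> length of Hom(W, X)\<close>.
  The integers appear as the free abelian group on one generator, which is where \<open>frag_extend\<close> takes
  its values.
\<close>

definition pairing :: "('a, 'm) module \<Rightarrow> (('a, 'm) module set \<Rightarrow>\<^sub>0 int) \<Rightarrow> int" where
  "pairing W c = Poly_Mapping.lookup
     (frag_extend (\<lambda>C. frag_cmul (int (homlen W (SOME X. X \<in> C))) (frag_of ())) c) ()"

lemma pairing_0: "pairing W 0 = 0"
  and pairing_add: "pairing W (c + d) = pairing W c + pairing W d"
  and pairing_diff: "pairing W (c - d) = pairing W c - pairing W d"
  and pairing_minus: "pairing W (- c) = - pairing W c"
  by (simp_all add: pairing_def frag_extend_add frag_extend_diff frag_extend_minus lookup_add lookup_minus)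

lemma pairing_K0_class:
  assumes W: "W \<in> fg_mod \<Lambda>" and X: "X \<in> \<E>"
  shows "pairing W (K0_class \<Lambda> \<E> X) = int (homlen W X)"
proof -
  obtain Xs where Xs: "\<And>Y. Y \<in> set Xs \<Longrightarrow> indec Y" "mod_isomorphic \<Lambda> X (mod_sum Xs)"
    by (rule ex_decomposition[OF X]) (rule that; assumption)
  have "pairing W (class_sum Xs) = int (\<Sum>Y\<leftarrow>Xs. homlen W Y)"
    using Xs(1)
  proof (induction Xs)
    case (Cons Y Ys)
    have Y: "Y \<in> fg_mod \<Lambda>" using Cons.prems indecD(2) by auto
    define Z where "Z = (SOME Z. Z \<in> iso_class \<Lambda> Y)"
    have "Y \<in> iso_class \<Lambda> Y" using Y mod_isomorphic_refl by (auto simp: iso_class_def)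
    then have "Z \<in> iso_class \<Lambda> Y" unfolding Z_def by (rule someI)
    then have "homlen W Y = homlen W Z" using homlen_iso[OF W Y] by (auto simp: iso_class_def)
    then have "pairing W (frag_of (iso_class \<Lambda> Y)) = int (homlen W Y)"
      by (simp add: pairing_def Z_def)
    then show ?case using Cons by (simp add: class_sum_simps pairing_add)
  qed (simp add: class_sum_simps pairing_0)
  also have "(\<Sum>Y\<leftarrow>Xs. homlen W Y) = homlen W X"
    by (rule additive_mod_sum[of "homlen W", OF homlen_zero[OF W] homlen_bisum[OF W] E_fg[OF X] _ Xs(2), symmetric])
      (assumption | metis Xs(1) indecD(2))+
  finally show ?thesis using K0_class_eq[OF X _ Xs(2)] Xs(1) by simp
qed

end

context artin_algebra_modules
begin

section \<open>Retracts and simple quotients\<close>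

definition retract :: "('a, 'x) module \<Rightarrow> ('a, 'y) module \<Rightarrow> bool" where
  "retract X S \<longleftrightarrow> (\<exists>s t. s \<in> mod_hom \<Lambda> X S \<and> t \<in> mod_hom \<Lambda> S X \<and> (\<forall>x \<in> carrier X. t (s x) = x))"

lemma retractI:
  assumes "s \<in> mod_hom \<Lambda> X S" "t \<in> mod_hom \<Lambda> S X" "\<And>x. x \<in> carrier X \<Longrightarrow> t (s x) = x"
  shows "retract X S"
  using assms unfolding retract_def by blast

lemma retractE:
  assumes "retract X S"
  obtains s t where "s \<in> mod_hom \<Lambda> X S" "t \<in> mod_hom \<Lambda> S X" "\<And>x. x \<in> carrier X \<Longrightarrow> t (s x) = x"
  using assms unfolding retract_def by blast

lemma retract_trans:
  assumes "retract X Y" "retract Y Z"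
  shows "retract X Z"
proof -
  obtain s t where st: "s \<in> mod_hom \<Lambda> X Y" "t \<in> mod_hom \<Lambda> Y X" "\<And>x. x \<in> carrier X \<Longrightarrow> t (s x) = x"
    by (rule retractE[OF assms(1)]) (rule that; assumption)
  obtain u v where uv: "u \<in> mod_hom \<Lambda> Y Z" "v \<in> mod_hom \<Lambda> Z Y" "\<And>x. x \<in> carrier Y \<Longrightarrow> v (u x) = x"
    by (rule retractE[OF assms(2)]) (rule that; assumption)
  show ?thesis
    by (rule retractI[OF mod_hom_comp[OF st(1) uv(1)] mod_hom_comp[OF uv(2) st(2)]])
      (simp add: st(3) uv(3) mod_homD(1)[OF st(1)])
qed

lemma retract_iso:
  assumes "left_module \<Lambda> X" "left_module \<Lambda> Y" "mod_isomorphic \<Lambda> X Y"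
  shows "retract X Y"
proof -
  obtain f where f: "f \<in> mod_iso \<Lambda> X Y" using assms(3) by (auto simp: mod_isomorphic_def)
  obtain g where "f \<in> mod_hom \<Lambda> X Y" "g \<in> mod_hom \<Lambda> Y X" "\<And>x. x \<in> carrier X \<Longrightarrow> g (f x) = x"
    by (rule mod_isoE[OF assms(1,2) f]) (rule that; assumption)
  then show ?thesis by (rule retractI)
qed

lemma regular_simps:
  "carrier (regular_module \<Lambda>) = carrier \<Lambda>" "\<zero>\<^bsub>regular_module \<Lambda>\<^esub> = \<zero>\<^bsub>\<Lambda>\<^esub>"
  "x \<oplus>\<^bsub>regular_module \<Lambda>\<^esub> y = x \<oplus>\<^bsub>\<Lambda>\<^esub> y" "a \<odot>\<^bsub>regular_module \<Lambda>\<^esub> x = a \<otimes>\<^bsub>\<Lambda>\<^esub> x"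
  by (simp_all add: regular_module_def)

lemma mod_hom_regular:
  assumes "left_module \<Lambda> X" "x \<in> carrier X"
  shows "(\<lambda>a. a \<odot>\<^bsub>X\<^esub> x) \<in> mod_hom \<Lambda> (regular_module \<Lambda>) X"
proof -
  interpret X: left_module \<Lambda> X by fact
  show ?thesis using assms(2)
    by (intro mod_homI) (auto simp: regular_simps X.smult_l_distr X.smult_assoc1)
qed

text \<open>
  Retracts of the regular module are projective: on \<open>\<Lambda>\<close> itself a lift is prescribed by a preimage of
  the image of \<open>1\<close>.
\<close>

lemma lift_from_retract_of_regular:
  assumes Q: "retract Q (regular_module \<Lambda>)" and Y: "left_module \<Lambda> Y"
    and e: "e \<in> mod_hom \<Lambda> Y Z" "e ` carrier Y = carrier Z" and f: "f \<in> mod_hom \<Lambda> Q Z"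
  obtains k where "k \<in> mod_hom \<Lambda> Q Y" "\<And>x. x \<in> carrier Q \<Longrightarrow> e (k x) = f x"
proof -
  obtain s t where st: "s \<in> mod_hom \<Lambda> Q (regular_module \<Lambda>)" "t \<in> mod_hom \<Lambda> (regular_module \<Lambda>) Q"
      "\<And>x. x \<in> carrier Q \<Longrightarrow> t (s x) = x"
    by (rule retractE[OF Q]) (rule that; assumption)
  note ft = mod_hom_comp[OF st(2) f]
  have one: "\<one>\<^bsub>\<Lambda>\<^esub> \<in> carrier (regular_module \<Lambda>)" by (simp add: regular_simps)
  then have "f (t \<one>\<^bsub>\<Lambda>\<^esub>) \<in> carrier Z" using mod_homD(1)[OF ft] by blast
  then obtain y where y: "y \<in> carrier Y" "e y = f (t \<one>\<^bsub>\<Lambda>\<^esub>)" using e(2) by (metis imageE)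
  note m = mod_hom_regular[OF Y y(1)]
  have "e (a \<odot>\<^bsub>Y\<^esub> y) = f (t a)" if a: "a \<in> carrier \<Lambda>" for a
  proof -
    have "e (a \<odot>\<^bsub>Y\<^esub> y) = a \<odot>\<^bsub>Z\<^esub> f (t \<one>\<^bsub>\<Lambda>\<^esub>)" using mod_homD(3)[OF e(1) a y(1)] y(2) by simp
    also have "\<dots> = f (t (a \<odot>\<^bsub>regular_module \<Lambda>\<^esub> \<one>\<^bsub>\<Lambda>\<^esub>))" using mod_homD(3)[OF ft a one] by simp
    finally show ?thesis using a by (simp add: regular_simps)
  qed
  then have "e (s x \<odot>\<^bsub>Y\<^esub> y) = f x" if "x \<in> carrier Q" for x
    using mod_homD(1)[OF st(1) that] st(3)[OF that] by (simp add: regular_simps)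
  then show thesis using that[OF mod_hom_comp[OF st(1) m]] by blast
qed

definition simple_module :: "('a, 'x) module \<Rightarrow> bool" where
  "simple_module S \<longleftrightarrow> carrier S \<noteq> {\<zero>\<^bsub>S\<^esub>} \<and>
     (\<forall>N. submodule N \<Lambda> S \<longrightarrow> N = {\<zero>\<^bsub>S\<^esub>} \<or> N = carrier S)"

lemma simple_hom_surj:
  assumes "left_module \<Lambda> X" "left_module \<Lambda> S" "simple_module S" "h \<in> mod_hom \<Lambda> X S"
    and "x \<in> carrier X" "h x \<noteq> \<zero>\<^bsub>S\<^esub>"
  shows "h ` carrier X = carrier S"
  using submodule_image[OF assms(1,2,4) left_module.submodule_carrier[OF assms(1)]] assms(3,5,6)
  unfolding simple_module_def by blast

text \<open>
  A maximal proper submodule exists by finite length.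
\<close>

lemma ex_simple_quotient:
  fixes W :: "('a, 'm) module"
  assumes W: "W \<in> fg_mod \<Lambda>" and W0: "carrier W \<noteq> {\<zero>\<^bsub>W\<^esub>}"
  obtains S :: "('a, 'm) module" and p where "S \<in> fg_mod \<Lambda>" "simple_module S"
    "p \<in> mod_hom \<Lambda> W S" "p ` carrier W = carrier S"
proof -
  have wl: "left_module \<Lambda> W" by (rule fg_modD[OF W])
  interpret W: left_module \<Lambda> W by (rule wl)
  define K where "K = {N. submodule N \<Lambda> W \<and> N \<noteq> carrier W}"
  have ne: "K \<noteq> {}" using W.submodule_zero W0 by (auto simp: K_def)
  have sub: "K \<subseteq> submods \<Lambda> W {\<zero>\<^bsub>W\<^esub>} (carrier W)" by (auto simp: K_def submodule_iff_submods[OF wl])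
  obtain N where N: "N \<in> K" and max: "\<And>B. B \<in> K \<Longrightarrow> N \<subseteq> B \<Longrightarrow> B = N"
    by (rule ex_maximal_member[OF finite_length[OF W] ne sub]) (rule that; assumption)
  have Ns: "submodule N \<Lambda> W" and Nne: "N \<noteq> carrier W" using N by (auto simp: K_def)
  obtain S :: "('a, 'm) module" and p where S: "S \<in> fg_mod \<Lambda>" "p \<in> mod_hom \<Lambda> W S"
    "p ` carrier W = carrier S" and ker: "\<And>d. d \<in> carrier W \<Longrightarrow> p d = \<zero>\<^bsub>S\<^esub> \<longleftrightarrow> d \<in> N"
    by (rule ex_quotient[OF W Ns]) (rule that; assumption)
  interpret S: left_module \<Lambda> S by (rule fg_modD[OF S(1)])
  have "L = {\<zero>\<^bsub>S\<^esub>} \<or> L = carrier S" if L: "submodule L \<Lambda> S" for L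
  proof -
    define M where "M = {w \<in> carrier W. p w \<in> L}"
    have M: "submodule M \<Lambda> W" unfolding M_def
      by (rule submodule_vimage[OF wl S.left_module_axioms S(2) L W.submodule_carrier])
    have NM: "N \<subseteq> M"
    proof
      fix x assume x: "x \<in> N"
      then have "x \<in> carrier W" using W.is_submoduleD(1)[OF Ns] by blast
      moreover from this have "p x = \<zero>\<^bsub>S\<^esub>" using ker x by blast
      ultimately show "x \<in> M" using S.is_submoduleD(2)[OF L] by (simp add: M_def)
    qed
    have pM: "L = p ` M"
    proof
      show "L \<subseteq> p ` M"
      proof
        fix y assume y: "y \<in> L"
        then have "y \<in> p ` carrier W" using S.is_submoduleD(1)[OF L] S(3) by blast
        then show "y \<in> p ` M" using y by (auto simp: M_def)
      qed
    qed (auto simp: M_def)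
    show ?thesis
    proof (cases "M = carrier W")
      case True
      then show ?thesis using pM S(3) by simp
    next
      case False
      then have "M = N" using max[of M] M NM by (simp add: K_def)
      then have "L \<subseteq> {\<zero>\<^bsub>S\<^esub>}" using pM ker W.is_submoduleD(1)[OF Ns] by blast
      then show ?thesis using S.is_submoduleD(2)[OF L] by blast
    qed
  qed
  moreover have "carrier S \<noteq> {\<zero>\<^bsub>S\<^esub>}"
  proof
    assume z: "carrier S = {\<zero>\<^bsub>S\<^esub>}"
    have "d \<in> N" if "d \<in> carrier W" for d using ker[OF that] mod_homD(1)[OF S(2) that] z by simp
    then show False using Nne W.is_submoduleD(1)[OF Ns] by blast
  qed
  ultimately have "simple_module S" by (simp add: simple_module_def)
  then show thesis by (rule that[OF S(1) _ S(2,3)])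
qed

end

context resolving_category
begin

text \<open>
  The element \<open>d\<close> is the sum of its components \<open>s (t d)\<close>, so a map that does not kill \<open>d\<close> does not kill
  all of them.
\<close>

lemma component_detects:
  fixes P :: "('a, 'm) module"
  assumes "P \<in> fg_mod \<Lambda>" "\<And>X. X \<in> set Xs \<Longrightarrow> X \<in> fg_mod \<Lambda>" "mod_isomorphic \<Lambda> P (mod_sum Xs)"
    and "left_module \<Lambda> S" "b \<in> mod_hom \<Lambda> P S" "d \<in> carrier P" "b d \<noteq> \<zero>\<^bsub>S\<^esub>"
  shows "\<exists>X \<in> set Xs. \<exists>s t. s \<in> mod_hom \<Lambda> X P \<and> t \<in> mod_hom \<Lambda> P X \<and> (\<forall>x \<in> carrier X. t (s x) = x) \<and>
    b (s (t d)) \<noteq> \<zero>\<^bsub>S\<^esub>"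
  using assms
proof (induction Xs arbitrary: P b d)
  case Nil
  then have "carrier P = {\<zero>\<^bsub>P\<^esub>}" using mod_isomorphic_Nil_iff[OF fg_modD] by blast
  then show ?case using Nil mod_hom_group(1)[OF fg_modD[OF Nil(1)] Nil(4,5)] by auto
next
  case (Cons Y Ys)
  have Y: "Y \<in> fg_mod \<Lambda>" "\<And>Z. Z \<in> set Ys \<Longrightarrow> Z \<in> fg_mod \<Lambda>" using Cons.prems(2) by auto
  obtain X' :: "('a, 'm) module" and i j p q
    where X': "X' \<in> fg_mod \<Lambda>" "bisum \<Lambda> P Y X' i j p q" "mod_isomorphic \<Lambda> X' (mod_sum Ys)"
    by (rule iso_ConsE[OF Cons.prems(1) Y Cons.prems(3)]) ((rule that; assumption) | assumption)+
  interpret S: left_module \<Lambda> S by (rule Cons.prems(4))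
  note b = bisumD[OF X'(2)] and d = Cons.prems(6)
  have pc: "p d \<in> carrier Y" "q d \<in> carrier X'" using mod_homD(1)[OF b(3) d] mod_homD(1)[OF b(4) d] by auto
  have sum: "b (i (p d)) \<oplus>\<^bsub>S\<^esub> b (j (q d)) = b d"
    using mod_homD(2)[OF Cons.prems(5) mod_homD(1)[OF b(1) pc(1)] mod_homD(1)[OF b(2) pc(2)]] b(9)[OF d] by simp
  show ?case
  proof (cases "b (i (p d)) = \<zero>\<^bsub>S\<^esub>")
    case False
    then show ?thesis using b(1,3,5) by (intro bexI[of _ Y] exI[of _ i] exI[of _ p]) auto
  next
    case True
    have "b (j (q d)) \<in> carrier S"
      using mod_homD(1)[OF Cons.prems(5) mod_homD(1)[OF b(2) pc(2)]] .
    then have "b (j (q d)) \<noteq> \<zero>\<^bsub>S\<^esub>" using sum True Cons.prems(7) by simp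
    from Cons.IH[OF X'(1) Y(2) X'(3) Cons.prems(4) mod_hom_comp[OF b(2) Cons.prems(5)] pc(2) this]
    obtain X s t where X: "X \<in> set Ys" "s \<in> mod_hom \<Lambda> X X'" "t \<in> mod_hom \<Lambda> X' X"
      "\<forall>x \<in> carrier X. t (s x) = x" "b (j (s (t (q d)))) \<noteq> \<zero>\<^bsub>S\<^esub>" by blast
    have "\<forall>x \<in> carrier X. t (q (j (s x))) = x" using X(4) b(8) mod_homD(1)[OF X(2)] by simp
    then show ?thesis
      using X(1,5) mod_hom_comp[OF X(2) b(2)] mod_hom_comp[OF b(4) X(3)]
      by (intro bexI[of _ X] exI[of _ "\<lambda>x. j (s x)"] exI[of _ "\<lambda>x. t (q x)"]) auto
  qed
qed

lemma retract_of_member: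
  fixes P :: "('a, 'm) module"
  assumes "P \<in> fg_mod \<Lambda>" "\<And>X. X \<in> set Xs \<Longrightarrow> X \<in> fg_mod \<Lambda>" "mod_isomorphic \<Lambda> P (mod_sum Xs)"
    and "X \<in> set Xs"
  shows "retract X P"
  using assms
proof (induction Xs arbitrary: P)
  case (Cons Y Ys)
  have Y: "Y \<in> fg_mod \<Lambda>" "\<And>Z. Z \<in> set Ys \<Longrightarrow> Z \<in> fg_mod \<Lambda>" using Cons.prems(2) by auto
  obtain X' :: "('a, 'm) module" and i j p q
    where X': "X' \<in> fg_mod \<Lambda>" "bisum \<Lambda> P Y X' i j p q" "mod_isomorphic \<Lambda> X' (mod_sum Ys)"
    by (rule iso_ConsE[OF Cons.prems(1) Y Cons.prems(3)]) ((rule that; assumption) | assumption)+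
  note b = bisumD[OF X'(2)]
  have "retract Y P" by (rule retractI[OF b(1,3,5)])
  moreover have "retract X' P" by (rule retractI[OF b(2,4,8)])
  ultimately show ?case
    using Cons.prems(4) Cons.IH[OF X'(1) Y(2) X'(3)] retract_trans by auto
qed simp

section \<open>Finite type from finitely many indecomposables\<close>

lemma retract_of_power:
  fixes X G :: "('a, 'm) module" and Xs :: "('a, 'm) module list"
  assumes G: "G \<in> fg_mod \<Lambda>" and "X \<in> fg_mod \<Lambda>" "\<And>Y. Y \<in> set Xs \<Longrightarrow> Y \<in> fg_mod \<Lambda> \<and> retract Y G"
    "mod_isomorphic \<Lambda> X (mod_sum Xs)"
  shows "retract X (mod_sum (replicate (length Xs) G))"
  using assms(2-)
proof (induction Xs arbitrary: X)
  case Nil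
  then show ?case
    using retract_iso[OF fg_modD[OF Nil(1)] left_module_mod_sum[OF Lambda_ring, of "[] :: ('a, 'm) module list"]] by simp
next
  case (Cons Y Ys)
  have Y: "Y \<in> fg_mod \<Lambda>" "\<And>Z. Z \<in> set Ys \<Longrightarrow> Z \<in> fg_mod \<Lambda>" using Cons.prems(2) by auto
  obtain X' :: "('a, 'm) module" and i j p q
    where X': "X' \<in> fg_mod \<Lambda>" "bisum \<Lambda> X Y X' i j p q" "mod_isomorphic \<Lambda> X' (mod_sum Ys)"
    by (rule iso_ConsE[OF Cons.prems(1) Y Cons.prems(3)]) ((rule that; assumption) | assumption)+
  define S where "S = mod_sum (replicate (length Ys) G)"
  define S' where "S' = mod_sum (replicate (length (Y # Ys)) G)"
  have Sl: "left_module \<Lambda> S" "left_module \<Lambda> S'"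
    using left_module_mod_sum[OF Lambda_ring, of "replicate (length Ys) G"]
      left_module_mod_sum[OF Lambda_ring, of "replicate (length (Y # Ys)) G"] fg_modD[OF G] by (auto simp: S_def S'_def)
  have r: "retract X' S" using Cons.IH[OF X'(1) _ X'(3)] Cons.prems(2) by (auto simp: S_def)
  have rY: "retract Y G" using Cons.prems(2) by simp
  obtain s t where st: "s \<in> mod_hom \<Lambda> X' S" "t \<in> mod_hom \<Lambda> S X'" "\<And>x. x \<in> carrier X' \<Longrightarrow> t (s x) = x"
    by (rule retractE[OF r]) (rule that; assumption)
  obtain u v where uv: "u \<in> mod_hom \<Lambda> Y G" "v \<in> mod_hom \<Lambda> G Y" "\<And>x. x \<in> carrier Y \<Longrightarrow> v (u x) = x"
    by (rule retractE[OF rY]) (rule that; assumption)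
  have "\<exists>i' j' p' q'. bisum \<Lambda> S' G S i' j' p' q'"
    using bisum_Cons[OF fg_modD[OF G], of "replicate (length Ys) G"] fg_modD[OF G] by (auto simp: S_def S'_def)
  then obtain i' j' p' q' where b': "bisum \<Lambda> S' G S i' j' p' q'" by blast
  interpret X: left_module \<Lambda> X by (rule fg_modD[OF Cons.prems(1)])
  interpret T: left_module \<Lambda> S' by (rule Sl(2))
  interpret S1: left_module \<Lambda> S by (rule Sl(1))
  interpret G: left_module \<Lambda> G by (rule fg_modD[OF G])
  note b = bisumD[OF X'(2)] and bb = bisumD[OF b']
  note [simp] = mod_homD(1)[OF b(1)] mod_homD(1)[OF b(2)] mod_homD(1)[OF b(3)] mod_homD(1)[OF b(4)]
    mod_homD(1)[OF bb(1)] mod_homD(1)[OF bb(2)] mod_homD(1)[OF bb(3)] mod_homD(1)[OF bb(4)]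
    mod_homD(1)[OF st(1)] mod_homD(1)[OF st(2)] mod_homD(1)[OF uv(1)] mod_homD(1)[OF uv(2)]
  have "retract X S'"
  proof (rule retractI)
    show "(\<lambda>x. i' (u (p x)) \<oplus>\<^bsub>S'\<^esub> j' (s (q x))) \<in> mod_hom \<Lambda> X S'"
      by (rule mod_hom_add[OF Sl(2) mod_hom_comp[OF mod_hom_comp[OF b(3) uv(1)] bb(1)]
            mod_hom_comp[OF mod_hom_comp[OF b(4) st(1)] bb(2)]])
    show "(\<lambda>x. i (v (p' x)) \<oplus>\<^bsub>X\<^esub> j (t (q' x))) \<in> mod_hom \<Lambda> S' X"
      by (rule mod_hom_add[OF X.left_module_axioms mod_hom_comp[OF mod_hom_comp[OF bb(3) uv(2)] b(1)]
            mod_hom_comp[OF mod_hom_comp[OF bb(4) st(2)] b(2)]])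
    fix x assume x: "x \<in> carrier X"
    show "i (v (p' (i' (u (p x)) \<oplus>\<^bsub>S'\<^esub> j' (s (q x))))) \<oplus>\<^bsub>X\<^esub>
        j (t (q' (i' (u (p x)) \<oplus>\<^bsub>S'\<^esub> j' (s (q x))))) = x"
      using x by (simp add: mod_homD(2)[OF bb(3)] mod_homD(2)[OF bb(4)] bb(5-8) st(3) uv(3) b(9))
  qed
  then show ?case by (simp only: S'_def)
qed

text \<open>
  The generator is the direct sum of the representatives in \<open>T\<close>.
\<close>

lemma finite_type_if_finitely_many_indec:
  assumes T: "finite T" "\<And>Z. Z \<in> T \<Longrightarrow> indec Z"
    and cov: "\<And>W. indec W \<Longrightarrow> \<exists>Z \<in> T. mod_isomorphic \<Lambda> W Z"
  shows "finite_type \<Lambda> \<E>"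
proof -
  obtain Ts where Ts: "set Ts = T" using finite_list[OF T(1)] by blast
  have TsE: "set Ts \<subseteq> \<E>" using Ts T(2) indecD(1) by blast
  have Tsf: "Z \<in> set Ts \<Longrightarrow> Z \<in> fg_mod \<Lambda>" for Z using TsE E_fg by blast
  have S: "mod_sum Ts \<in> fg_mod \<Lambda>" by (rule fg_mod_mod_sum[OF Lambda_ring Tsf])
  obtain G :: "('a, 'm) module" where G: "G \<in> fg_mod \<Lambda>" "mod_isomorphic \<Lambda> (mod_sum Ts) G"
    by (rule ex_copy[OF S])
  have iso: "mod_isomorphic \<Lambda> G (mod_sum Ts)"
    by (rule mod_isomorphic_sym[OF fg_modD[OF S] fg_modD[OF G(1)] G(2)])
  have GE: "G \<in> \<E>" by (rule E_sum[OF TsE G(1) iso])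
  have P: "mod_sum (replicate n G) \<in> fg_mod \<Lambda>" for n
    by (rule fg_mod_mod_sum[OF Lambda_ring]) (use G(1) in auto)
  have "X \<in> add_closure \<Lambda> G" if X: "X \<in> \<E>" for X
  proof -
    obtain Xs where Xs: "\<And>Y. Y \<in> set Xs \<Longrightarrow> indec Y" "mod_isomorphic \<Lambda> X (mod_sum Xs)"
      by (rule ex_decomposition[OF X]) (rule that; assumption)
    have "Y \<in> fg_mod \<Lambda> \<and> retract Y G" if Y: "Y \<in> set Xs" for Y
    proof -
      note y = Xs(1)[OF Y]
      obtain Z where Z: "Z \<in> T" "mod_isomorphic \<Lambda> Y Z" using cov[OF y] by blast
      have "retract Z G" by (rule retract_of_member[OF G(1) Tsf iso]) (use Z Ts in auto)
      then show ?thesis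
        using retract_trans[OF retract_iso[OF indecD(3)[OF y] indecD(3)[OF T(2)[OF Z(1)]] Z(2)]] indecD(2)[OF y]
        by blast
    qed
    then have r: "retract X (mod_sum (replicate (length Xs) G))"
      by (rule retract_of_power[OF G(1) E_fg[OF X] _ Xs(2)])
    let ?P = "mod_sum (replicate (length Xs) G)"
    obtain s t where st: "s \<in> mod_hom \<Lambda> X ?P" "t \<in> mod_hom \<Lambda> ?P X" "\<And>x. x \<in> carrier X \<Longrightarrow> t (s x) = x"
      by (rule retractE[OF r]) (rule that; assumption)
    define K where "K = submod ?P {d \<in> carrier ?P. t d = \<zero>\<^bsub>X\<^esub>}"
    note br = bisum_retract[OF E_lm[OF X] fg_modD[OF P] st, folded K_def]
    have K: "K \<in> fg_mod \<Lambda>" unfolding K_def by (rule fg_mod_submod[OF P br(1)])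
    obtain K' :: "('a, 'm) module" and f g where K': "K' \<in> fg_mod \<Lambda>"
      "f \<in> mod_hom \<Lambda> K K'" "g \<in> mod_hom \<Lambda> K' K"
      "\<And>x. x \<in> carrier K \<Longrightarrow> g (f x) = x" "\<And>x. x \<in> carrier K' \<Longrightarrow> f (g x) = x"
      by (rule ex_copy_maps[OF K]) (rule that; assumption)
    have "mod_isomorphic \<Lambda> ?P (mod_sum [X, K'])"
      using bisum_iff_isomorphic[OF fg_modD[OF P] E_lm[OF X] fg_modD[OF K'(1)]]
        bisum_iso_right[OF br(2) fg_modD[OF K] fg_modD[OF K'(1)] K'(2-)] by blast
    then show ?thesis unfolding add_closure_def using E_fg[OF X] K'(1) by blast
  qed
  moreover have "X \<in> \<E>" if X: "X \<in> add_closure \<Lambda> G" for X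
  proof -
    obtain Y :: "('a, 'm) module" and n where Y: "X \<in> fg_mod \<Lambda>" "Y \<in> fg_mod \<Lambda>"
      "mod_isomorphic \<Lambda> (mod_sum (replicate n G)) (mod_sum [X, Y])"
      using X by (auto simp: add_closure_def)
    obtain D :: "('a, 'm) module" where D: "D \<in> fg_mod \<Lambda>" "mod_isomorphic \<Lambda> (mod_sum (replicate n G)) D"
      by (rule ex_copy[OF P])
    note iso' = mod_isomorphic_sym[OF fg_modD[OF P] fg_modD[OF D(1)] D(2)]
    have DE: "D \<in> \<E>" by (rule E_sum[OF _ D(1) iso']) (use GE in auto)
    obtain i j p q where "bisum \<Lambda> D X Y i j p q"
      using bisum_iff_isomorphic[OF fg_modD[OF D(1)] fg_modD[OF Y(1)] fg_modD[OF Y(2)]]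
        mod_isomorphic_trans[OF iso' Y(3)] by blast
    then show ?thesis by (rule E_summand[OF DE Y(1,2)])
  qed
  ultimately show ?thesis using GE unfolding finite_type_def by blast
qed

section \<open>The pairing detects which maps lift along a conflation\<close>

lemma conflationD:
  assumes "conflation \<Lambda> \<E> X f Y g Z"
  shows "X \<in> \<E>" "Y \<in> \<E>" "Z \<in> \<E>" "f \<in> mod_hom \<Lambda> X Y" "g \<in> mod_hom \<Lambda> Y Z" "inj_on f (carrier X)"
    "f ` carrier X = {y \<in> carrier Y. g y = \<zero>\<^bsub>Z\<^esub>}" "g ` carrier Y = carrier Z"
  using assms by (auto simp: conflation_def short_exact_def a_kernel_def')

lemma conflationI:
  assumes "X \<in> \<E>" "Y \<in> \<E>" "Z \<in> \<E>" "f \<in> mod_hom \<Lambda> X Y" "g \<in> mod_hom \<Lambda> Y Z" "inj_on f (carrier X)"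
    "f ` carrier X = {y \<in> carrier Y. g y = \<zero>\<^bsub>Z\<^esub>}" "g ` carrier Y = carrier Z"
  shows "conflation \<Lambda> \<E> X f Y g Z"
  using assms by (auto simp: conflation_def short_exact_def a_kernel_def')

abbreviation relation :: "('a, 'm) module \<Rightarrow> ('a, 'm) module \<Rightarrow> ('a, 'm) module \<Rightarrow> (('a, 'm) module set \<Rightarrow>\<^sub>0 int)"
  where "relation X Y Z \<equiv> K0_class \<Lambda> \<E> X - K0_class \<Lambda> \<E> Y + K0_class \<Lambda> \<E> Z"

text \<open>
  The value of the pairing is the length of the cokernel of \<open>Hom(W, Y) \<rightarrow> Hom(W, Z)\<close>, the difference
  between the rank of all homomorphisms and the rank of those that factor through \<open>g\<close>.
\<close>

lemma pairing_relation_eq_0_iff: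
  assumes c: "conflation \<Lambda> \<E> X f Y g Z" and W: "W \<in> fg_mod \<Lambda>"
  shows "pairing W (relation X Y Z) = 0 \<longleftrightarrow>
    (\<forall>h \<in> mod_hom \<Lambda> W Z. \<exists>k \<in> mod_hom \<Lambda> W Y. \<forall>w \<in> carrier W. h w = g (k w))"
proof -
  note d = conflationD[OF c]
  note wl = fg_modD[OF W]
  interpret W: left_module \<Lambda> W by (rule wl)
  let ?H = "hom_module W Z" and ?I = "post W g ` carrier (hom_module W Y)"
  interpret H: left_module R ?H by (rule left_module_hom_module[OF wl E_lm[OF d(3)]])
  let ?L = "submods R ?H {\<zero>\<^bsub>?H\<^esub>} (carrier ?H)"
  have bd: "bounded_flags ?L" by (rule finite_length_hom_module[OF W E_fg[OF d(3)]])
  have I: "submodule ?I R ?H"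
    by (rule submodule_image[OF left_module_hom_module[OF wl E_lm[OF d(2)]] H.left_module_axioms
          mod_hom_postcomp[OF wl d(5)] left_module.submodule_carrier[OF left_module_hom_module[OF wl E_lm[OF d(2)]]]])
  have IL: "?I \<in> ?L" "carrier ?H \<in> ?L"
    using H.is_submoduleD(1,2)[OF I] I H.submodule_carrier by (auto simp: submods_def)
  have sub: "submods R ?H {\<zero>\<^bsub>?H\<^esub>} ?I = {B \<in> ?L. B \<subseteq> ?I}" "?L = {B \<in> ?L. B \<subseteq> carrier ?H}"
    using H.is_submoduleD(1)[OF I] by (auto simp: submods_def)
  have "pairing W (relation X Y Z) = int (homlen W X) - int (homlen W Y) + int (homlen W Z)"
    by (simp only: pairing_add pairing_diff pairing_K0_class[OF W] d)
  also have "\<dots> = int (rank ?L (carrier ?H)) - int (rank ?L ?I)"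
    using homlen_exact[OF W E_fg[OF d(1)] E_fg[OF d(2)] E_fg[OF d(3)] d(4,6,5,7)] sub
    by (simp add: rank_def homlen_def)
  finally have p: "pairing W (relation X Y Z) = int (rank ?L (carrier ?H)) - int (rank ?L ?I)" .
  have "pairing W (relation X Y Z) = 0 \<longleftrightarrow> ?I = carrier ?H"
  proof
    assume "pairing W (relation X Y Z) = 0"
    then show "?I = carrier ?H"
      using p rank_eq_imp_eq[OF bd IL H.is_submoduleD(1)[OF I]] by simp
  qed (use p in simp)
  also have "\<dots> \<longleftrightarrow> (\<forall>h \<in> mod_hom \<Lambda> W Z. \<exists>k \<in> mod_hom \<Lambda> W Y. \<forall>w \<in> carrier W. h w = g (k w))"
  proof
    assume eq: "?I = carrier ?H"
    show "\<forall>h \<in> mod_hom \<Lambda> W Z. \<exists>k \<in> mod_hom \<Lambda> W Y. \<forall>w \<in> carrier W. h w = g (k w)"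
    proof
      fix h assume "h \<in> mod_hom \<Lambda> W Z"
      then have "restrict h (carrier W) \<in> ?I" using restrict_mod_hom(2)[OF wl] eq by blast
      then obtain k where k: "k \<in> carrier (hom_module W Y)" "restrict h (carrier W) = post W g k" by blast
      have "h w = g (k w)" if "w \<in> carrier W" for w using fun_cong[OF k(2), of w] that by simp
      then show "\<exists>k \<in> mod_hom \<Lambda> W Y. \<forall>w \<in> carrier W. h w = g (k w)" using hom_moduleD(1)[OF k(1)] by blast
    qed
  next
    assume *: "\<forall>h \<in> mod_hom \<Lambda> W Z. \<exists>k \<in> mod_hom \<Lambda> W Y. \<forall>w \<in> carrier W. h w = g (k w)"
    show "?I = carrier ?H"
    proof
      show "carrier ?H \<subseteq> ?I"
      proof
        fix h assume h: "h \<in> carrier ?H"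
        obtain k where k: "k \<in> mod_hom \<Lambda> W Y" "\<And>w. w \<in> carrier W \<Longrightarrow> h w = g (k w)"
          using * hom_moduleD(1)[OF h] by blast
        have "post W g (restrict k (carrier W)) = h"
          by (rule extensionalityI[of _ "carrier W"]) (auto simp: k(2) hom_moduleD(2)[OF h])
        then show "h \<in> ?I" using restrict_mod_hom(2)[OF wl k(1)] by blast
      qed
    qed (rule H.is_submoduleD(1)[OF I])
  qed
  finally show ?thesis .
qed

lemma pairing_AR_relation:
  assumes c: "AR_conflation \<Lambda> \<E> X f Y g Z" and W: "indec W" and no: "\<not> mod_isomorphic \<Lambda> W Z"
  shows "pairing W (relation X Y Z) = 0"
proof -
  have r: "right_almost_split \<Lambda> \<E> Y g Z" and c': "conflation \<Lambda> \<E> X f Y g Z"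
    using c by (auto simp: AR_conflation_def)
  have Z: "indec Z" using r by (simp add: right_almost_split_def)
  show ?thesis
    unfolding pairing_relation_eq_0_iff[OF c' indecD(2)[OF W]]
    using noniso_radical[OF W Z no] r indecD(1)[OF W] unfolding right_almost_split_def by blast
qed

lemma keys_relation:
  assumes "conflation \<Lambda> \<E> X f Y g Z"
  shows "Poly_Mapping.keys (relation X Y Z) \<subseteq> ind \<Lambda> \<E>"
proof -
  note d = conflationD(1-3)[OF assms]
  show ?thesis
    using keys_K0_class[OF d(1)] keys_K0_class[OF d(2)] keys_K0_class[OF d(3)]
      Poly_Mapping.keys_add[of "K0_class \<Lambda> \<E> X - K0_class \<Lambda> \<E> Y" "K0_class \<Lambda> \<E> Z"]
      Poly_Mapping.keys_diff[of "K0_class \<Lambda> \<E> X" "K0_class \<Lambda> \<E> Y"] by blast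
qed

text \<open>
  Each generator of the AR group pairs to zero with all \<open>W\<close> except the end term of its AR conflation,
  and an element of the group involves finitely many generators.
\<close>

lemma AR_group_finite_support:
  assumes "c \<in> AR_group \<Lambda> \<E>"
  shows "\<exists>T. finite T \<and> (\<forall>Z \<in> T. indec Z) \<and>
    (\<forall>W. indec W \<longrightarrow> (\<forall>Z \<in> T. \<not> mod_isomorphic \<Lambda> W Z) \<longrightarrow> pairing W c = 0)"
  using assms unfolding AR_group_def
proof (induction rule: generate.induct)
  case one
  then show ?case by (intro exI[of _ "{}"]) (simp add: K0_split_def pairing_0)
next
  case (incl h)
  then obtain X f Y g Z where h: "AR_conflation \<Lambda> \<E> X f Y g Z" "h = relation X Y Z" by blast
  then have "indec Z" by (simp add: AR_conflation_def right_almost_split_def)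
  then show ?case using pairing_AR_relation[OF h(1)] h(2) by (intro exI[of _ "{Z}"]) simp
next
  case (inv h)
  then obtain X f Y g Z where h: "AR_conflation \<Lambda> \<E> X f Y g Z" "h = relation X Y Z" by blast
  then have Z: "indec Z" by (simp add: AR_conflation_def right_almost_split_def)
  have "conflation \<Lambda> \<E> X f Y g Z" using h(1) by (simp add: AR_conflation_def)
  then have "Poly_Mapping.keys h \<subseteq> ind \<Lambda> \<E>" unfolding h(2) by (rule keys_relation)
  then have "inv\<^bsub>K0_split \<Lambda> \<E>\<^esub> h = - h" by (simp add: K0_split_def)
  then have "pairing W (inv\<^bsub>K0_split \<Lambda> \<E>\<^esub> h) = - pairing W (relation X Y Z)" for W
    by (simp only: h(2) pairing_minus)
  then show ?case using pairing_AR_relation[OF h(1)] Z by (intro exI[of _ "{Z}"]) simp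
next
  case (eng h1 h2)
  then obtain T1 T2 where "finite T1" "\<forall>Z \<in> T1. indec Z"
    "\<forall>W. indec W \<longrightarrow> (\<forall>Z \<in> T1. \<not> mod_isomorphic \<Lambda> W Z) \<longrightarrow> pairing W h1 = 0"
    "finite T2" "\<forall>Z \<in> T2. indec Z"
    "\<forall>W. indec W \<longrightarrow> (\<forall>Z \<in> T2. \<not> mod_isomorphic \<Lambda> W Z) \<longrightarrow> pairing W h2 = 0" by blast
  then show ?case by (intro exI[of _ "T1 \<union> T2"]) (auto simp: K0_split_def pairing_add)
qed


section \<open>Equality of the two groups forces finite type\<close>

text \<open>
  If \<open>t\<close> were not invertible, it would be nilpotent, and \<open>b = b t\<^sup>n = 0\<close>.
\<close>

lemma indec_lift_iso:
  assumes Q: "indec Q" and t: "t \<in> mod_hom \<Lambda> Q Q" and S: "left_module \<Lambda> S" and b: "b \<in> mod_hom \<Lambda> Q S"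
    and bt: "\<And>x. x \<in> carrier Q \<Longrightarrow> b (t x) = b x" and x: "x \<in> carrier Q" "b x \<noteq> \<zero>\<^bsub>S\<^esub>"
  shows "t \<in> mod_iso \<Lambda> Q Q"
proof (rule ccontr)
  note q = indecD[OF Q]
  assume "t \<notin> mod_iso \<Lambda> Q Q"
  then obtain n where n: "\<And>x. x \<in> carrier Q \<Longrightarrow> (t ^^ n) x = \<zero>\<^bsub>Q\<^esub>"
    by (rule indec_endo_nilpotent[OF Q t]) (rule that; assumption)
  have "b ((t ^^ k) x) = b x" for k
  proof (induction k)
    case (Suc k)
    then show ?case using bt[OF mod_homD(1)[OF endo_pow[OF t] x(1)], of k] by simp
  qed simp
  then show False using n[OF x(1)] x(2) mod_hom_group(1)[OF q(3) S b] by metis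
qed

text \<open>
  An indecomposable projective has a unique simple quotient. If \<open>ker u\<close> were not contained in \<open>ker p\<close>,
  then \<open>p\<close> would map \<open>ker u\<close> onto \<open>S\<close>. Lifting \<open>p\<close> along this surjection gives \<open>t : Q \<rightarrow> ker u\<close> with
  \<open>p t = p\<close>. So \<open>t\<close> is invertible as an endomorphism of \<open>Q\<close>, hence \<open>ker u = Q\<close>, but \<open>u\<close> is not zero.
\<close>

lemma top_of_indec_projective:
  fixes Q S S' :: "('a, 'm) module"
  assumes Q: "indec Q" "retract Q (regular_module \<Lambda>)"
    and S: "S \<in> fg_mod \<Lambda>" "simple_module S" and p: "p \<in> mod_hom \<Lambda> Q S" "p ` carrier Q = carrier S"
    and S': "left_module \<Lambda> S'" and u: "u \<in> mod_hom \<Lambda> Q S'" "x0 \<in> carrier Q" "u x0 \<noteq> \<zero>\<^bsub>S'\<^esub>"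
    and x: "x \<in> carrier Q" "u x = \<zero>\<^bsub>S'\<^esub>"
  shows "p x = \<zero>\<^bsub>S\<^esub>"
proof (rule ccontr)
  assume px: "p x \<noteq> \<zero>\<^bsub>S\<^esub>"
  note q = indecD[OF Q(1)] and sl = fg_modD[OF S(1)]
  interpret Q: left_module \<Lambda> Q by (rule q)
  interpret S': left_module \<Lambda> S' by (rule S')
  define N where "N = {y \<in> carrier Q. u y = \<zero>\<^bsub>S'\<^esub>}"
  have N: "submodule N \<Lambda> Q"
    using submodule_vimage[OF q(3) S' u(1) S'.submodule_zero Q.submodule_carrier] by (simp add: N_def)
  define K where "K = submod Q N"
  have Kl: "left_module \<Lambda> K" unfolding K_def by (rule left_module_submod[OF q(3) N])
  have incl: "(\<lambda>y. y) \<in> mod_hom \<Lambda> K Q" unfolding K_def by (rule submod_incl[OF N])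
  have pK: "p \<in> mod_hom \<Lambda> K S" using mod_hom_comp[OF incl p(1)] by simp
  have "p ` carrier K = carrier S"
    by (rule simple_hom_surj[OF Kl sl S(2) pK _ px]) (use x in \<open>simp add: K_def N_def\<close>)
  then obtain t where t: "t \<in> mod_hom \<Lambda> Q K" "\<And>x. x \<in> carrier Q \<Longrightarrow> p (t x) = p x"
    by (rule lift_from_retract_of_regular[OF Q(2) Kl pK _ p(1)]) (rule that; assumption)
  have tQ: "t \<in> mod_hom \<Lambda> Q Q" using mod_hom_comp[OF t(1) incl] by simp
  have "t \<in> mod_iso \<Lambda> Q Q" by (rule indec_lift_iso[OF Q(1) tQ sl p(1) t(2) x(1) px])
  then have "t ` carrier Q = carrier Q" by (simp add: mod_iso_def bij_betw_def)
  then obtain y where "y \<in> carrier Q" "x0 = t y" using u(2) by (metis imageE)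
  then have "x0 \<in> carrier K" using mod_homD(1)[OF t(1)] by simp
  then show False using u(3) by (simp add: K_def N_def)
qed

text \<open>
  One copy of \<open>L\<close> is added for each generator of \<open>C\<close>, mapping the unit to that generator.
\<close>

lemma free_cover:
  assumes L: "L \<in> \<E>" "mod_isomorphic \<Lambda> (regular_module \<Lambda>) L" and C: "C \<in> \<E>"
  obtains P n \<pi> where "P \<in> \<E>" "mod_isomorphic \<Lambda> P (mod_sum (replicate n L))"
    "\<pi> \<in> mod_hom \<Lambda> P C" "\<pi> ` carrier P = carrier C"
proof -
  note cl = E_lm[OF C]
  have rl: "left_module \<Lambda> (regular_module \<Lambda>)" by (rule left_module_regular_module[OF Lambda_ring])
  interpret C: left_module \<Lambda> C by (rule cl)
  obtain u where "u \<in> mod_iso \<Lambda> (regular_module \<Lambda>) L" using L(2) by (auto simp: mod_isomorphic_def)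
  then obtain v where v: "u \<in> mod_hom \<Lambda> (regular_module \<Lambda>) L" "v \<in> mod_hom \<Lambda> L (regular_module \<Lambda>)"
    "\<And>x. x \<in> carrier (regular_module \<Lambda>) \<Longrightarrow> v (u x) = x"
    by (rule mod_isoE[OF rl E_lm[OF L(1)]]) (rule that; assumption)
  have "finitely_generated \<Lambda> C" using E_fg[OF C] by (simp add: fg_mod_def)
  then obtain S where S: "finite S" "S \<subseteq> carrier C"
      "\<And>N. submodule N \<Lambda> C \<Longrightarrow> S \<subseteq> N \<Longrightarrow> N = carrier C"
    by (rule finitely_generatedE) (rule that; assumption)
  have "\<exists>P n \<pi>. P \<in> \<E> \<and> mod_isomorphic \<Lambda> P (mod_sum (replicate n L)) \<and> \<pi> \<in> mod_hom \<Lambda> P C \<and>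
      S \<subseteq> \<pi> ` carrier P"
    using S(1,2)
  proof (induction S rule: finite_induct)
    case empty
    obtain Z where Z: "Z \<in> \<E>" "carrier Z = {\<zero>\<^bsub>Z\<^esub>}" by (rule ex_zero_module)
    have "mod_isomorphic \<Lambda> Z (mod_sum (replicate 0 L))"
      using mod_isomorphic_Nil_iff[OF E_lm[OF Z(1)]] Z(2) by simp
    then show ?case using Z(1) mod_hom_const_zero[OF cl] by blast
  next
    case (insert s S)
    then obtain P n \<pi> where P: "P \<in> \<E>" "mod_isomorphic \<Lambda> P (mod_sum (replicate n L))" "\<pi> \<in> mod_hom \<Lambda> P C"
      "S \<subseteq> \<pi> ` carrier P" by auto
    have s: "s \<in> carrier C" using insert by simp
    obtain D :: "('a, 'm) module" and i j p q where D: "D \<in> fg_mod \<Lambda>" "bisum \<Lambda> D L P i j p q"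
      by (rule ex_bisum[OF E_fg[OF L(1)] E_fg[OF P(1)]])
    note b = bisumD[OF D(2)]
    have DE: "D \<in> \<E>" by (rule E_bisum[OF L(1) P(1) D])
    have iso: "mod_isomorphic \<Lambda> D (mod_sum (replicate (Suc n) L))"
      using iso_ConsI[OF fg_modD[OF D(1)] E_lm[OF P(1)] E_lm[OF L(1)] _ D(2) P(2)] E_lm[OF L(1)] by simp
    define \<rho> where "\<rho> = (\<lambda>d. v (p d) \<odot>\<^bsub>C\<^esub> s \<oplus>\<^bsub>C\<^esub> \<pi> (q d))"
    have \<rho>: "\<rho> \<in> mod_hom \<Lambda> D C" unfolding \<rho>_def
      by (rule mod_hom_add[OF cl mod_hom_comp[OF mod_hom_comp[OF b(3) v(2)] mod_hom_regular[OF cl s]]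
            mod_hom_comp[OF b(4) P(3)]])
    have one: "\<one>\<^bsub>\<Lambda>\<^esub> \<in> carrier (regular_module \<Lambda>)" by (simp add: regular_simps)
    have u1: "u \<one>\<^bsub>\<Lambda>\<^esub> \<in> carrier L" by (rule mod_homD(1)[OF v(1) one])
    have "\<rho> (i (u \<one>\<^bsub>\<Lambda>\<^esub>)) = s"
      unfolding \<rho>_def using u1 b(5,6) v(3)[OF one] s mod_hom_group(1)[OF E_lm[OF P(1)] cl P(3)] by simp
    then have "s \<in> \<rho> ` carrier D" using mod_homD(1)[OF b(1) u1] by (metis imageI)
    moreover have "S \<subseteq> \<rho> ` carrier D"
    proof
      fix y assume "y \<in> S"
      then obtain x where x: "x \<in> carrier P" "y = \<pi> x" using P(4) by blast
      have "v \<zero>\<^bsub>L\<^esub> = \<zero>\<^bsub>\<Lambda>\<^esub>" using mod_hom_group(1)[OF E_lm[OF L(1)] rl v(2)] by (simp add: regular_simps)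
      then have "\<rho> (j x) = y"
        unfolding \<rho>_def using x b(7,8) s mod_homD(1)[OF P(3)] by simp
      then show "y \<in> \<rho> ` carrier D" using mod_homD(1)[OF b(2) x(1)] by (metis imageI)
    qed
    ultimately show ?case using DE iso \<rho> by blast
  qed
  then obtain P n \<pi> where P: "P \<in> \<E>" "mod_isomorphic \<Lambda> P (mod_sum (replicate n L))" "\<pi> \<in> mod_hom \<Lambda> P C"
      "S \<subseteq> \<pi> ` carrier P" by blast
  have "\<pi> ` carrier P = carrier C"
    by (rule S(3)[OF submodule_image[OF E_lm[OF P(1)] cl P(3) left_module.submodule_carrier[OF E_lm[OF P(1)]]] P(4)])
  then show thesis using that P by blast
qed

lemma kernel_conflation:
  assumes Y: "Y \<in> \<E>" and Z: "Z \<in> \<E>" and g: "g \<in> mod_hom \<Lambda> Y Z" "g ` carrier Y = carrier Z"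
  shows "conflation \<Lambda> \<E> (submod Y {y \<in> carrier Y. g y = \<zero>\<^bsub>Z\<^esub>}) (\<lambda>y. y) Y g Z"
proof -
  interpret Y: left_module \<Lambda> Y by (rule E_lm[OF Y])
  interpret Z: left_module \<Lambda> Z by (rule E_lm[OF Z])
  let ?N = "{y \<in> carrier Y. g y = \<zero>\<^bsub>Z\<^esub>}"
  have N: "submodule ?N \<Lambda> Y"
    using submodule_vimage[OF Y.left_module_axioms Z.left_module_axioms g(1) Z.submodule_zero Y.submodule_carrier]
    by simp
  have f: "submod Y ?N \<in> fg_mod \<Lambda>" by (rule fg_mod_submod[OF E_fg[OF Y] N])
  have "short_exact \<Lambda> (submod Y ?N) (\<lambda>y. y) Y g Z"
    using g submod_incl[OF N] by (auto simp: short_exact_def a_kernel_def')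
  then show ?thesis using E_ker[OF Y Z f] Y Z unfolding conflation_def by blast
qed

lemma relation_in_Ex:
  assumes "conflation \<Lambda> \<E> X f Y g Z"
  shows "relation X Y Z \<in> Ex_group \<Lambda> \<E>"
  unfolding Ex_group_def by (rule generate.incl) (use assms in blast)

text \<open>
  Let \<open>C \<rightarrow> S\<close> be a right approximation and \<open>P \<rightarrow> C\<close> a free cover. The relation of the conflation
  ending in \<open>P \<rightarrow> C\<close> lies in the AR group, so its pairing with \<open>W\<close> vanishes outside a finite set
  \<open>T\<close>. For such \<open>W\<close> every map to \<open>S\<close> factors through \<open>C\<close> by the approximation property and then
  through \<open>P\<close>. The map \<open>b\<close> is the composite \<open>P \<rightarrow> C \<rightarrow> S\<close>.
\<close>

lemma finite_support_for_simple:
  fixes S :: "('a, 'm) module"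
  assumes eq: "AR_group \<Lambda> \<E> = Ex_group \<Lambda> \<E>" and cf: "contravariantly_finite \<Lambda> \<E>"
    and L: "L \<in> \<E>" "mod_isomorphic \<Lambda> (regular_module \<Lambda>) L" and S: "S \<in> fg_mod \<Lambda>"
  shows "\<exists>T P n b. finite T \<and> (\<forall>Z \<in> T. indec Z) \<and> P \<in> \<E> \<and> mod_isomorphic \<Lambda> P (mod_sum (replicate n L)) \<and>
    b \<in> mod_hom \<Lambda> P S \<and> (\<forall>W. indec W \<longrightarrow> (\<forall>Z \<in> T. \<not> mod_isomorphic \<Lambda> W Z) \<longrightarrow>
      (\<forall>v \<in> mod_hom \<Lambda> W S. \<exists>l \<in> mod_hom \<Lambda> W P. \<forall>w \<in> carrier W. v w = b (l w)))"
proof -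
  obtain C c where "right_approximation \<Lambda> \<E> C c S"
    using cf S unfolding contravariantly_finite_def by blast
  then have C: "C \<in> \<E>" "c \<in> mod_hom \<Lambda> C S" and
    appr: "\<And>W h. W \<in> \<E> \<Longrightarrow> h \<in> mod_hom \<Lambda> W S \<Longrightarrow> \<exists>k \<in> mod_hom \<Lambda> W C. \<forall>w \<in> carrier W. h w = c (k w)"
    unfolding right_approximation_def by blast+
  obtain P n \<pi> where P: "P \<in> \<E>" "mod_isomorphic \<Lambda> P (mod_sum (replicate n L))"
    "\<pi> \<in> mod_hom \<Lambda> P C" "\<pi> ` carrier P = carrier C"
    by (rule free_cover[OF L C(1)])
  note cfl = kernel_conflation[OF P(1) C(1) P(3,4)]
  let ?X = "submod P {y \<in> carrier P. \<pi> y = \<zero>\<^bsub>C\<^esub>}"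
  have "relation ?X P C \<in> AR_group \<Lambda> \<E>" unfolding eq by (rule relation_in_Ex[OF cfl])
  then obtain T where T: "finite T" "\<forall>Z \<in> T. indec Z"
    "\<And>W. indec W \<Longrightarrow> \<forall>Z \<in> T. \<not> mod_isomorphic \<Lambda> W Z \<Longrightarrow> pairing W (relation ?X P C) = 0"
    using AR_group_finite_support[of "relation ?X P C"] by blast
  have "\<exists>l \<in> mod_hom \<Lambda> W P. \<forall>w \<in> carrier W. v w = c (\<pi> (l w))"
    if W: "indec W" "\<forall>Z \<in> T. \<not> mod_isomorphic \<Lambda> W Z" and v: "v \<in> mod_hom \<Lambda> W S" for W v
  proof -
    obtain k where k: "k \<in> mod_hom \<Lambda> W C" "\<forall>w \<in> carrier W. v w = c (k w)"
      using appr[OF indecD(1)[OF W(1)] v] by blast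
    obtain l where "l \<in> mod_hom \<Lambda> W P" "\<forall>w \<in> carrier W. k w = \<pi> (l w)"
      using T(3)[OF W, unfolded pairing_relation_eq_0_iff[OF cfl indecD(2)[OF W(1)]]] k(1) by blast
    then show ?thesis using k(2) by (intro bexI[of _ l]) auto
  qed
  then show ?thesis
    by (intro exI[of _ T] exI[of _ P] exI[of _ n] exI[of _ "\<lambda>x. c (\<pi> x)"])
      (simp add: T P mod_hom_comp[OF P(3) C(2)])
qed

text \<open>
  The indecomposables are exhausted by the summands \<open>Q\<close> of \<open>\<Lambda>\<close> and the exceptional sets \<open>T Q\<close> that
  belong to the simple quotients of these \<open>Q\<close>. An indecomposable \<open>W\<close> has a simple quotient, which is
  the top \<open>S\<close> of one of the \<open>Q\<close>. Outside \<open>T Q\<close> the surjection \<open>W \<rightarrow> S\<close> factors through a free module,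
  so some component \<open>W \<rightarrow> Q2 \<rightarrow> S\<close> of it is nonzero. Lifting \<open>Q2 \<rightarrow> S\<close> back along \<open>W \<rightarrow> S\<close> shows that
  \<open>W \<rightarrow> Q2\<close> is a split epimorphism, hence an isomorphism.
\<close>

theorem finite_type_if_AR_eq_Ex:
  assumes eq: "AR_group \<Lambda> \<E> = Ex_group \<Lambda> \<E>" and cf: "contravariantly_finite \<Lambda> \<E>"
  shows "finite_type \<Lambda> \<E>"
proof -
  have rl: "left_module \<Lambda> (regular_module \<Lambda>)" by (rule left_module_regular_module[OF Lambda_ring])
  obtain L where L: "L \<in> \<E>" "mod_isomorphic \<Lambda> (regular_module \<Lambda>) L"
    using res unfolding resolving_def by blast
  note Ll = E_lm[OF L(1)]
  obtain u where u: "u \<in> mod_iso \<Lambda> (regular_module \<Lambda>) L" using L(2) by (auto simp: mod_isomorphic_def)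
  obtain u' where u': "u \<in> mod_hom \<Lambda> (regular_module \<Lambda>) L" "u' \<in> mod_hom \<Lambda> L (regular_module \<Lambda>)"
    "\<And>x. x \<in> carrier (regular_module \<Lambda>) \<Longrightarrow> u' (u x) = x"
    by (rule mod_isoE[OF rl Ll u]) (rule that; assumption)
  have Lr: "retract L (regular_module \<Lambda>)"
    by (rule retract_iso[OF Ll rl mod_isomorphic_sym[OF rl Ll L(2)]])
  obtain Qs where Qs: "\<And>Q. Q \<in> set Qs \<Longrightarrow> indec Q" and LQ: "mod_isomorphic \<Lambda> L (mod_sum Qs)"
    by (rule ex_decomposition[OF L(1)]) (rule that; assumption)
  have Qf: "Q \<in> fg_mod \<Lambda>" if "Q \<in> set Qs" for Q using indecD(2)[OF Qs[OF that]] .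
  have Qr: "retract Q (regular_module \<Lambda>)" if "Q \<in> set Qs" for Q
    by (rule retract_trans[OF retract_of_member[OF E_fg[OF L(1)] Qf LQ that] Lr])
  \<comment> \<open>All data attached to a summand \<open>Q\<close> of \<open>\<Lambda>\<close>: a simple quotient \<open>p : Q \<rightarrow> S\<close> and the outcome of
    \<open>finite_support_for_simple\<close> for \<open>S\<close>.\<close>
  define test where "test = (\<lambda>(Q :: ('a, 'm) module) (S :: ('a, 'm) module) p T P n b.
      S \<in> fg_mod \<Lambda> \<and> simple_module S \<and> p \<in> mod_hom \<Lambda> Q S \<and> p ` carrier Q = carrier S \<and>
      finite T \<and> (\<forall>Z \<in> T. indec Z) \<and> P \<in> \<E> \<and> mod_isomorphic \<Lambda> P (mod_sum (replicate n L)) \<and>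
      b \<in> mod_hom \<Lambda> P S \<and> (\<forall>W. indec W \<longrightarrow> (\<forall>Z \<in> T. \<not> mod_isomorphic \<Lambda> W Z) \<longrightarrow>
        (\<forall>v \<in> mod_hom \<Lambda> W S. \<exists>l \<in> mod_hom \<Lambda> W P. \<forall>w \<in> carrier W. v w = b (l w))))"
  have ex_test: "\<exists>S p T P n b. test Q S p T P n b" if Q: "Q \<in> set Qs" for Q
  proof -
    obtain S :: "('a, 'm) module" and p where S: "S \<in> fg_mod \<Lambda>" "simple_module S"
      "p \<in> mod_hom \<Lambda> Q S" "p ` carrier Q = carrier S"
      by (rule ex_simple_quotient[OF Qf[OF Q] indecD(4)[OF Qs[OF Q]]])
    from finite_support_for_simple[OF eq cf L S(1)] obtain T P n b where
      "finite T \<and> (\<forall>Z \<in> T. indec Z) \<and> P \<in> \<E> \<and> mod_isomorphic \<Lambda> P (mod_sum (replicate n L)) \<and>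
      b \<in> mod_hom \<Lambda> P S \<and> (\<forall>W. indec W \<longrightarrow> (\<forall>Z \<in> T. \<not> mod_isomorphic \<Lambda> W Z) \<longrightarrow>
        (\<forall>v \<in> mod_hom \<Lambda> W S. \<exists>l \<in> mod_hom \<Lambda> W P. \<forall>w \<in> carrier W. v w = b (l w)))"
      by (elim exE)
    then have "test Q S p T P n b" unfolding test_def using S by (intro conjI) simp_all
    then show ?thesis by (intro exI)
  qed
  define good where "good = (\<lambda>Q T. \<exists>S p P n b. test Q S p T P n b)"
  have "\<forall>Q \<in> set Qs. \<exists>T. good Q T"
  proof
    fix Q assume Q: "Q \<in> set Qs"
    from ex_test[OF Q] obtain S p T P n b where "test Q S p T P n b" by (elim exE)
    then have "good Q T" unfolding good_def by (intro exI)
    then show "\<exists>T. good Q T" by (rule exI)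
  qed
  then have "\<exists>T. \<forall>Q \<in> set Qs. good Q (T Q)" by (rule bchoice)
  then obtain T where T: "\<And>Q. Q \<in> set Qs \<Longrightarrow> good Q (T Q)" by blast
  define U where "U = set Qs \<union> (\<Union>Q \<in> set Qs. T Q)"
  have TT: "finite (T Q)" "\<forall>Z \<in> T Q. indec Z" if "Q \<in> set Qs" for Q
    using T[OF that] by (auto simp: good_def test_def)
  show ?thesis
  proof (rule finite_type_if_finitely_many_indec)
    show "finite U" using TT(1) by (simp add: U_def)
    show "indec Z" if "Z \<in> U" for Z using that TT(2) Qs by (auto simp: U_def)
    fix W assume W: "indec W"
    note w = indecD[OF W]
    interpret W: left_module \<Lambda> W by (rule w)
    show "\<exists>Z \<in> U. mod_isomorphic \<Lambda> W Z"
    proof (rule ccontr)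
      assume no: "\<not> (\<exists>Z \<in> U. mod_isomorphic \<Lambda> W Z)"
      obtain S' :: "('a, 'm) module" and p' where S': "S' \<in> fg_mod \<Lambda>" "simple_module S'"
        "p' \<in> mod_hom \<Lambda> W S'" "p' ` carrier W = carrier S'"
        by (rule ex_simple_quotient[OF w(2,4)])
      note sl' = fg_modD[OF S'(1)]
      interpret S': left_module \<Lambda> S' by (rule sl')
      obtain s where s: "s \<in> carrier S'" "s \<noteq> \<zero>\<^bsub>S'\<^esub>"
        using S'(2) ex_nonzero_element[OF sl'] unfolding simple_module_def by blast
      have f: "(\<lambda>x. u' x \<odot>\<^bsub>S'\<^esub> s) \<in> mod_hom \<Lambda> L S'"
        by (rule mod_hom_comp[OF u'(2) mod_hom_regular[OF sl' s(1)]])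
      have one: "\<one>\<^bsub>\<Lambda>\<^esub> \<in> carrier (regular_module \<Lambda>)" by (simp add: regular_simps)
      have u1: "u \<one>\<^bsub>\<Lambda>\<^esub> \<in> carrier L" by (rule mod_homD(1)[OF u'(1) one])
      have f1: "u' (u \<one>\<^bsub>\<Lambda>\<^esub>) \<odot>\<^bsub>S'\<^esub> s \<noteq> \<zero>\<^bsub>S'\<^esub>" using s u'(3)[OF one] by simp
      from component_detects[OF E_fg[OF L(1)] Qf LQ sl' f u1 f1]
      obtain Q s1 t1 where Q: "Q \<in> set Qs" "s1 \<in> mod_hom \<Lambda> Q L" "t1 \<in> mod_hom \<Lambda> L Q"
        "u' (s1 (t1 (u \<one>\<^bsub>\<Lambda>\<^esub>))) \<odot>\<^bsub>S'\<^esub> s \<noteq> \<zero>\<^bsub>S'\<^esub>" by blast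
      define r where "r = (\<lambda>x. u' (s1 x) \<odot>\<^bsub>S'\<^esub> s)"
      have r: "r \<in> mod_hom \<Lambda> Q S'" unfolding r_def by (rule mod_hom_comp[OF Q(2) f])
      have r0: "t1 (u \<one>\<^bsub>\<Lambda>\<^esub>) \<in> carrier Q" "r (t1 (u \<one>\<^bsub>\<Lambda>\<^esub>)) \<noteq> \<zero>\<^bsub>S'\<^esub>"
        using mod_homD(1)[OF Q(3) u1] Q(4) by (auto simp: r_def)
      note ql = indecD(3)[OF Qs[OF Q(1)]]
      have rsurj: "r ` carrier Q = carrier S'" by (rule simple_hom_surj[OF ql sl' S'(2) r r0])
      from T[OF Q(1)] obtain S p P n b where D: "test Q S p (T Q) P n b" unfolding good_def by (elim exE)
      have S: "S \<in> fg_mod \<Lambda>" "simple_module S" "p \<in> mod_hom \<Lambda> Q S" "p ` carrier Q = carrier S"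
        and P: "P \<in> \<E>" "mod_isomorphic \<Lambda> P (mod_sum (replicate n L))" "b \<in> mod_hom \<Lambda> P S"
        and D': "indec W \<longrightarrow> (\<forall>Z \<in> T Q. \<not> mod_isomorphic \<Lambda> W Z) \<longrightarrow>
          (\<forall>v \<in> mod_hom \<Lambda> W S. \<exists>l \<in> mod_hom \<Lambda> W P. \<forall>w \<in> carrier W. v w = b (l w))"
        using D unfolding test_def by simp_all
      note sl = fg_modD[OF S(1)]
      have "\<forall>Z \<in> T Q. \<not> mod_isomorphic \<Lambda> W Z" using no Q(1) by (auto simp: U_def)
      then have lift: "\<exists>l \<in> mod_hom \<Lambda> W P. \<forall>w \<in> carrier W. v w = b (l w)" if "v \<in> mod_hom \<Lambda> W S" for v
        using D' W that by blast
      have ker: "p x = \<zero>\<^bsub>S\<^esub>" if "x \<in> carrier Q" "r x = \<zero>\<^bsub>S'\<^esub>" for x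
        by (rule top_of_indec_projective[OF Qs[OF Q(1)] Qr[OF Q(1)] S sl' r r0 that])
      \<comment> \<open>\<open>S'\<close> and \<open>S\<close> are both simple quotients of \<open>Q\<close>, so \<open>W \<rightarrow> S'\<close> continues to \<open>S\<close>.\<close>
      obtain h where h: "h \<in> mod_hom \<Lambda> S' S" "\<And>d. d \<in> carrier Q \<Longrightarrow> h (r d) = p d"
        by (rule factor_through_surj[OF ql sl' r rsurj sl S(3) ker]) (rule that; assumption | assumption)+
      obtain y where y: "y \<in> carrier S" "y \<noteq> \<zero>\<^bsub>S\<^esub>"
        using S(2) ex_nonzero_element[OF sl] unfolding simple_module_def by blast
      then have "y \<in> p ` carrier Q" using S(4) by simp
      then obtain x where x: "x \<in> carrier Q" "p x = y" by blast
      have "r x \<in> p' ` carrier W" using mod_homD(1)[OF r x(1)] S'(4) by simp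
      then obtain w0 where w0: "w0 \<in> carrier W" "p' w0 = r x" by force
      obtain l where l: "l \<in> mod_hom \<Lambda> W P" "\<forall>w \<in> carrier W. h (p' w) = b (l w)"
        using lift[OF mod_hom_comp[OF S'(3) h(1)]] by blast
      have bl: "b (l w0) \<noteq> \<zero>\<^bsub>S\<^esub>" using l(2) w0 h(2)[OF x(1)] x(2) y(2) by auto
      have Lf: "X \<in> fg_mod \<Lambda>" if "X \<in> set (replicate n L)" for X using that E_fg[OF L(1)] by auto
      from component_detects[OF E_fg[OF P(1)] Lf P(2) sl P(3) mod_homD(1)[OF l(1) w0(1)] bl]
      obtain s2 t2 where st2: "s2 \<in> mod_hom \<Lambda> L P" "t2 \<in> mod_hom \<Lambda> P L" "b (s2 (t2 (l w0))) \<noteq> \<zero>\<^bsub>S\<^esub>"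
        by auto
      from component_detects[OF E_fg[OF L(1)] Qf LQ sl mod_hom_comp[OF st2(1) P(3)]
          mod_homD(1)[OF st2(2) mod_homD(1)[OF l(1) w0(1)]] st2(3)]
      obtain Q2 s3 t3 where Q2: "Q2 \<in> set Qs" "s3 \<in> mod_hom \<Lambda> Q2 L" "t3 \<in> mod_hom \<Lambda> L Q2"
        "b (s2 (s3 (t3 (t2 (l w0))))) \<noteq> \<zero>\<^bsub>S\<^esub>" by blast
      define a where "a = (\<lambda>w. t3 (t2 (l w)))"
      define b' where "b' = (\<lambda>x. b (s2 (s3 x)))"
      have a: "a \<in> mod_hom \<Lambda> W Q2" unfolding a_def
        by (rule mod_hom_comp[OF mod_hom_comp[OF l(1) st2(2)] Q2(3)])
      have b': "b' \<in> mod_hom \<Lambda> Q2 S" unfolding b'_def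
        by (rule mod_hom_comp[OF mod_hom_comp[OF Q2(2) st2(1)] P(3)])
      have ba0: "b' (a w0) \<noteq> \<zero>\<^bsub>S\<^esub>" using Q2(4) by (simp add: a_def b'_def)
      note ba = mod_hom_comp[OF a b']
      have basurj: "(\<lambda>w. b' (a w)) ` carrier W = carrier S"
        by (rule simple_hom_surj[OF w(3) sl S(2) ba w0(1) ba0])
      obtain m where m: "m \<in> mod_hom \<Lambda> Q2 W" "\<And>x. x \<in> carrier Q2 \<Longrightarrow> b' (a (m x)) = b' x"
        by (rule lift_from_retract_of_regular[OF Qr[OF Q2(1)] w(3) ba basurj b']) (rule that; assumption)
      note q2 = indecD[OF Qs[OF Q2(1)]]
      have am: "(\<lambda>x. a (m x)) \<in> mod_iso \<Lambda> Q2 Q2"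
        by (rule indec_lift_iso[OF Qs[OF Q2(1)] mod_hom_comp[OF m(1) a] sl b' m(2) mod_homD(1)[OF a w0(1)] ba0])
      obtain k where k: "k \<in> mod_hom \<Lambda> Q2 Q2" "\<And>x. x \<in> carrier Q2 \<Longrightarrow> a (m (k x)) = x"
        by (rule mod_isoE[OF q2(3,3) am]) (rule that; assumption)
      have "a \<in> mod_iso \<Lambda> W Q2"
        by (rule indec_split_epi_iso[OF W q2(2,4) a mod_hom_comp[OF k(1) m(1)] k(2)])
      then show False using no Q2(1) by (auto simp: U_def mod_isomorphic_def)
    qed
  qed
qed


section \<open>Almost split conflations\<close>

lemma split_epi_bisum:
  assumes c: "conflation \<Lambda> \<E> X f Y g Z" and s: "s \<in> mod_hom \<Lambda> Z Y" "\<And>z. z \<in> carrier Z \<Longrightarrow> g (s z) = z"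
  obtains r where "bisum \<Lambda> Y X Z f s r g"
proof -
  note d = conflationD[OF c]
  note xl = E_lm[OF d(1)] and yl = E_lm[OF d(2)] and zl = E_lm[OF d(3)]
  interpret Y: left_module \<Lambda> Y by (rule yl)
  interpret Z: left_module \<Lambda> Z by (rule zl)
  note gg = mod_homD[OF d(5)] mod_hom_group[OF yl zl d(5)] and ss = mod_homD[OF s(1)] and ff = mod_homD[OF d(4)]
  have e: "(\<lambda>y. y \<ominus>\<^bsub>Y\<^esub> s (g y)) \<in> mod_hom \<Lambda> Y Y"
    by (rule mod_hom_minus[OF yl mod_hom_id mod_hom_comp[OF d(5) s(1)]])
  have "(\<lambda>y. y \<ominus>\<^bsub>Y\<^esub> s (g y)) ` carrier Y \<subseteq> f ` carrier X"
    unfolding d(7) using mod_homD(1)[OF e] by (auto simp: gg ss s(2) a_minus_def Z.r_neg)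
  then obtain r where r: "r \<in> mod_hom \<Lambda> Y X" "\<And>y. y \<in> carrier Y \<Longrightarrow> f (r y) = y \<ominus>\<^bsub>Y\<^esub> s (g y)"
    by (rule factor_through_inj[OF xl d(4,6) yl e]) (rule that; assumption)
  have gf: "g (f x) = \<zero>\<^bsub>Z\<^esub>" if "x \<in> carrier X" for x using d(7) that by blast
  have rf: "r (f x) = x" if x: "x \<in> carrier X" for x
  proof (rule inj_onD[OF d(6)])
    show "f (r (f x)) = f x"
      using r(2)[OF ff(1)[OF x]] gf[OF x] mod_hom_group(1)[OF zl yl s(1)] ff(1)[OF x]
        Y.add.inv_one[folded a_inv_def] by (simp add: a_minus_def)
  qed (use x mod_homD(1)[OF r(1)] ff(1) in auto)
  have rs: "r (s z) = \<zero>\<^bsub>X\<^esub>" if z: "z \<in> carrier Z" for z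
  proof (rule mod_hom_eq_zero_inj[OF xl yl d(4,6)])
    show "f (r (s z)) = \<zero>\<^bsub>Y\<^esub>" using r(2)[OF ss(1)[OF z]] s(2)[OF z] ss(1)[OF z] by (simp add: a_minus_def Y.r_neg)
  qed (use z mod_homD(1)[OF r(1)] ss(1) in auto)
  have "f (r y) \<oplus>\<^bsub>Y\<^esub> s (g y) = y" if y: "y \<in> carrier Y" for y
    using r(2)[OF y] y ss(1)[OF gg(1)[OF y]] by (simp add: a_minus_def Y.a_assoc Y.l_neg)
  then have "bisum \<Lambda> Y X Z f s r g"
    unfolding bisum_def using d(4,5) s r(1) gf rf rs by simp
  then show thesis by (rule that)
qed

lemma split_mono_section:
  assumes c: "conflation \<Lambda> \<E> X f Y g Z" and r: "r \<in> mod_hom \<Lambda> Y X" "\<And>x. x \<in> carrier X \<Longrightarrow> r (f x) = x"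
  obtains s where "s \<in> mod_hom \<Lambda> Z Y" "\<And>z. z \<in> carrier Z \<Longrightarrow> g (s z) = z"
proof -
  note d = conflationD[OF c]
  note xl = E_lm[OF d(1)] and yl = E_lm[OF d(2)] and zl = E_lm[OF d(3)]
  interpret Y: left_module \<Lambda> Y by (rule yl)
  interpret Z: left_module \<Lambda> Z by (rule zl)
  note gg = mod_homD[OF d(5)] mod_hom_group[OF yl zl d(5)] and rr = mod_homD[OF r(1)] and ff = mod_homD[OF d(4)]
  have e: "(\<lambda>y. y \<ominus>\<^bsub>Y\<^esub> f (r y)) \<in> mod_hom \<Lambda> Y Y"
    by (rule mod_hom_minus[OF yl mod_hom_id mod_hom_comp[OF r(1) d(4)]])
  have k: "y \<ominus>\<^bsub>Y\<^esub> f (r y) = \<zero>\<^bsub>Y\<^esub>" if y: "y \<in> carrier Y" "g y = \<zero>\<^bsub>Z\<^esub>" for y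
  proof -
    have "y \<in> f ` carrier X" using d(7) y by blast
    then obtain x where x: "x \<in> carrier X" "y = f x" by blast
    show ?thesis using x ff(1)[OF x(1)] r(2)[OF x(1)] by (simp add: a_minus_def Y.r_neg)
  qed
  obtain s where s: "s \<in> mod_hom \<Lambda> Z Y" "\<And>y. y \<in> carrier Y \<Longrightarrow> s (g y) = y \<ominus>\<^bsub>Y\<^esub> f (r y)"
    by (rule factor_through_surj[OF yl zl d(5,8) yl e k]) (rule that; assumption | assumption)+
  have gf: "g (f x) = \<zero>\<^bsub>Z\<^esub>" if "x \<in> carrier X" for x using d(7) that by blast
  have "g (s z) = z" if z: "z \<in> carrier Z" for z
  proof -
    have "z \<in> g ` carrier Y" using d(8) z by simp
    then obtain y where y: "y \<in> carrier Y" "z = g y" by blast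
    have "g (s (g y)) = g y \<ominus>\<^bsub>Z\<^esub> g (f (r y))"
      using s(2)[OF y(1)] gg(6)[OF y(1) ff(1)[OF rr(1)[OF y(1)]]] by simp
    also have "\<dots> = g y"
      using gf[OF rr(1)[OF y(1)]] gg(1)[OF y(1)] Z.add.inv_one[folded a_inv_def] by (simp add: a_minus_def)
    finally show ?thesis using y(2) by simp
  qed
  then show thesis by (rule that[OF s(1)])
qed

lemma right_almost_split_no_section:
  assumes r: "right_almost_split \<Lambda> \<E> K g W" and K: "K \<in> \<E>"
    and s: "s \<in> mod_hom \<Lambda> W K" "\<And>w. w \<in> carrier W \<Longrightarrow> g (s w) = w"
  shows False
proof -
  have W: "indec W" and g: "g \<in> cat_radical \<Lambda> K W" using r by (auto simp: right_almost_split_def)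
  show False using g[unfolded cat_radical_indec_target[OF W E_fg[OF K] cat_radical_hom[OF g]]] s by blast
qed

lemma right_almost_splitD:
  assumes r: "right_almost_split \<Lambda> \<E> K g W" and V: "V \<in> \<E>" and h: "h \<in> cat_radical \<Lambda> V W"
  obtains k where "k \<in> mod_hom \<Lambda> V K" "\<And>v. v \<in> carrier V \<Longrightarrow> h v = g (k v)"
  using r V h unfolding right_almost_split_def by blast

text \<open>
  The pushout of the conflation along \<open>h\<close> is a conflation \<open>V \<rightarrow> U \<rightarrow> W\<close>, because \<open>\<E>\<close> is closed under
  extensions. If it splits, \<open>h\<close> factors through \<open>f\<close>. Otherwise \<open>e : U \<rightarrow> W\<close> is radical and factors
  through \<open>g\<close>, which gives a map of conflations back to \<open>X \<rightarrow> K \<rightarrow> W\<close>. The composite endomorphism of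
  \<open>K\<close> lies over \<open>W\<close>, so it is injective by the minimality assumption \<open>min\<close>; then so is the
  composite \<open>X \<rightarrow> V \<rightarrow> X\<close>, and \<open>h\<close> has a retraction.
\<close>

lemma pushout_factor:
  assumes c: "conflation \<Lambda> \<E> X f K g W" and ras: "right_almost_split \<Lambda> \<E> K g W"
    and min: "\<And>\<beta> x. \<beta> \<in> mod_hom \<Lambda> K K \<Longrightarrow> \<forall>y \<in> carrier K. g (\<beta> y) = g y \<Longrightarrow> x \<in> carrier K \<Longrightarrow>
        \<beta> x = \<zero>\<^bsub>K\<^esub> \<Longrightarrow> x = \<zero>\<^bsub>K\<^esub>"
    and V: "V \<in> \<E>" and h: "h \<in> mod_hom \<Lambda> X V"
  shows "(\<exists>k \<in> mod_hom \<Lambda> K V. \<forall>x \<in> carrier X. h x = k (f x)) \<or>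
    (\<exists>k \<in> mod_hom \<Lambda> V X. \<forall>x \<in> carrier X. k (h x) = x)"
proof -
  note d = conflationD[OF c]
  note xl = E_lm[OF d(1)] and kl = E_lm[OF d(2)] and wl = E_lm[OF d(3)] and vl = E_lm[OF V]
  have W: "indec W" using ras by (simp add: right_almost_split_def)
  interpret X: left_module \<Lambda> X by (rule xl)
  interpret K: left_module \<Lambda> K by (rule kl)
  interpret W: left_module \<Lambda> W by (rule wl)
  interpret V: left_module \<Lambda> V by (rule vl)
  obtain D :: "('a, 'm) module" and i j p q where D: "D \<in> fg_mod \<Lambda>" "bisum \<Lambda> D V K i j p q"
    by (rule ex_bisum[OF E_fg[OF V] E_fg[OF d(2)]])
  note dl = fg_modD[OF D(1)]
  interpret D: left_module \<Lambda> D by (rule dl)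
  note b = bisumD[OF D(2)]
  note hh = mod_homD[OF h] mod_hom_group[OF xl vl h] and ff = mod_homD[OF d(4)] mod_hom_group[OF xl kl d(4)]
    and gg = mod_homD[OF d(5)] mod_hom_group[OF kl wl d(5)]
    and ii = mod_homD[OF b(1)] mod_hom_group[OF vl dl b(1)]
    and jj = mod_homD[OF b(2)] mod_hom_group[OF kl dl b(2)]
    and pp = mod_homD[OF b(3)] mod_hom_group[OF dl vl b(3)]
    and qq = mod_homD[OF b(4)] mod_hom_group[OF dl kl b(4)]
  have gf: "g (f x) = \<zero>\<^bsub>W\<^esub>" if "x \<in> carrier X" for x using d(7) that by blast
  \<comment> \<open>The pushout is the cokernel of \<open>(h, - f) : X \<rightarrow> V \<oplus> K\<close>.\<close>
  define \<delta> where "\<delta> = (\<lambda>x. i (h x) \<ominus>\<^bsub>D\<^esub> j (f x))"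
  have \<delta>: "\<delta> \<in> mod_hom \<Lambda> X D"
    unfolding \<delta>_def by (rule mod_hom_minus[OF dl mod_hom_comp[OF h b(1)] mod_hom_comp[OF d(4) b(2)]])
  have q\<delta>: "q (\<delta> x) = \<ominus>\<^bsub>K\<^esub> f x" if x: "x \<in> carrier X" for x
    unfolding \<delta>_def using x by (simp add: qq ii jj hh ff b(6,8) a_minus_def)
  define N where "N = \<delta> ` carrier X"
  have N: "submodule N \<Lambda> D" unfolding N_def by (rule submodule_image[OF xl dl \<delta> X.submodule_carrier])
  obtain U :: "('a, 'm) module" and \<pi> where U: "U \<in> fg_mod \<Lambda>" "\<pi> \<in> mod_hom \<Lambda> D U" "\<pi> ` carrier D = carrier U"
    and ker: "\<And>d. d \<in> carrier D \<Longrightarrow> \<pi> d = \<zero>\<^bsub>U\<^esub> \<longleftrightarrow> d \<in> N"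
    by (rule ex_quotient[OF D(1) N]) (rule that; assumption)
  note ul = fg_modD[OF U(1)]
  interpret U: left_module \<Lambda> U by (rule ul)
  note \<pi>\<pi> = mod_homD[OF U(2)] mod_hom_group[OF dl ul U(2)]
  have glue: "\<pi> (i (h x)) = \<pi> (j (f x))" if x: "x \<in> carrier X" for x
  proof (rule U.minus_eq_zeroD)
    have "\<pi> (\<delta> x) = \<zero>\<^bsub>U\<^esub>" using ker[OF mod_homD(1)[OF \<delta> x]] x by (simp add: N_def)
    then show "\<pi> (i (h x)) \<ominus>\<^bsub>U\<^esub> \<pi> (j (f x)) = \<zero>\<^bsub>U\<^esub>"
      unfolding \<delta>_def using x by (simp add: \<pi>\<pi> ii jj hh ff)
  qed (use x in \<open>auto simp: \<pi>\<pi> ii jj hh ff\<close>)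
  have gq: "(\<lambda>x. g (q x)) \<in> mod_hom \<Lambda> D W" by (rule mod_hom_comp[OF b(4) d(5)])
  have gqN: "g (q x) = \<zero>\<^bsub>W\<^esub>" if x: "x \<in> carrier D" "\<pi> x = \<zero>\<^bsub>U\<^esub>" for x
  proof -
    obtain y where y: "y \<in> carrier X" "x = \<delta> y" using ker[OF x(1)] x(2) by (auto simp: N_def)
    show ?thesis
      using q\<delta>[OF y(1)] y gg(5)[OF ff(1)[OF y(1)]] gf[OF y(1)] W.add.inv_one[folded a_inv_def] by simp
  qed
  obtain e where e: "e \<in> mod_hom \<Lambda> U W" "\<And>x. x \<in> carrier D \<Longrightarrow> e (\<pi> x) = g (q x)"
    by (rule factor_through_surj[OF dl ul U(2,3) wl gq gqN]) (rule that; assumption | assumption)+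
  define v where "v = (\<lambda>x. \<pi> (i x))"
  have v: "v \<in> mod_hom \<Lambda> V U" unfolding v_def by (rule mod_hom_comp[OF b(1) U(2)])
  have vinj: "inj_on v (carrier V)"
  proof (rule mod_hom_injI[OF vl ul v])
    fix y assume y: "y \<in> carrier V" "v y = \<zero>\<^bsub>U\<^esub>"
    then obtain x where x: "x \<in> carrier X" "i y = \<delta> x" using ker[of "i y"] ii(1) by (auto simp: v_def N_def)
    have "\<ominus>\<^bsub>K\<^esub> f x = \<zero>\<^bsub>K\<^esub>" using q\<delta>[OF x(1)] x(2) b(6)[OF y(1)] by simp
    then have "f x = \<zero>\<^bsub>K\<^esub>" using ff(1)[OF x(1)] K.minus_minus K.add.inv_one[folded a_inv_def] by metis
    then have "x = \<zero>\<^bsub>X\<^esub>" using mod_hom_eq_zero_inj[OF xl kl d(4,6) x(1)] by blast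
    then have "i y = \<zero>\<^bsub>D\<^esub>" using x(2) mod_hom_group(1)[OF xl dl \<delta>] by simp
    then show "y = \<zero>\<^bsub>V\<^esub>" using b(5)[OF y(1)] pp(4) by simp
  qed
  have vker: "v ` carrier V = {y \<in> carrier U. e y = \<zero>\<^bsub>W\<^esub>}"
  proof (intro equalityI subsetI)
    fix y assume "y \<in> v ` carrier V"
    then obtain x where x: "x \<in> carrier V" "y = v x" by blast
    have "e y = \<zero>\<^bsub>W\<^esub>" unfolding x(2) v_def using e(2)[OF ii(1)[OF x(1)]] b(6)[OF x(1)] gg(4) by simp
    then show "y \<in> {y \<in> carrier U. e y = \<zero>\<^bsub>W\<^esub>}" using x mod_homD(1)[OF v] by simp
  next
    fix y assume "y \<in> {y \<in> carrier U. e y = \<zero>\<^bsub>W\<^esub>}"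
    then have y: "y \<in> carrier U" "e y = \<zero>\<^bsub>W\<^esub>" by auto
    then have "y \<in> \<pi> ` carrier D" using U(3) by simp
    then obtain x where x: "x \<in> carrier D" "y = \<pi> x" by blast
    have "g (q x) = \<zero>\<^bsub>W\<^esub>" using e(2)[OF x(1)] x(2) y(2) by simp
    then have "q x \<in> f ` carrier X" unfolding d(7) using qq(1)[OF x(1)] by simp
    then obtain z where z: "z \<in> carrier X" "q x = f z" by blast
    have "\<pi> x = \<pi> (i (p x)) \<oplus>\<^bsub>U\<^esub> \<pi> (j (f z))"
      using \<pi>\<pi>(2)[OF ii(1)[OF pp(1)[OF x(1)]] jj(1)[OF qq(1)[OF x(1)]]] b(9)[OF x(1)] z(2) by simp
    also have "\<dots> = v (p x \<oplus>\<^bsub>V\<^esub> h z)"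
      unfolding v_def glue[OF z(1), symmetric] using x(1) z(1) by (simp add: \<pi>\<pi> ii pp hh)
    finally show "y \<in> v ` carrier V" using x pp(1) hh(1)[OF z(1)] by simp
  qed
  have esurj: "e ` carrier U = carrier W"
  proof
    show "carrier W \<subseteq> e ` carrier U"
    proof
      fix w assume "w \<in> carrier W"
      then obtain k where k: "k \<in> carrier K" "w = g k" using d(8) by (metis imageE)
      have "e (\<pi> (j k)) = w" using e(2)[OF jj(1)[OF k(1)]] b(8)[OF k(1)] k(2) by simp
      then show "w \<in> e ` carrier U" using \<pi>\<pi>(1)[OF jj(1)[OF k(1)]] by (metis imageI)
    qed
  qed (use mod_homD(1)[OF e(1)] in auto)
  have "short_exact \<Lambda> V v U e W"
    using v e(1) vinj vker esurj by (simp add: short_exact_def a_kernel_def')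
  then have UE: "U \<in> \<E>" by (rule E_ext[OF V d(3) U(1)])
  have cU: "conflation \<Lambda> \<E> V v U e W" by (rule conflationI[OF V UE d(3) v e(1) vinj vker esurj])
  show ?thesis
  proof (cases "e \<in> cat_radical \<Lambda> U W")
    case False
    then obtain s where s: "s \<in> mod_hom \<Lambda> W U" "\<And>z. z \<in> carrier W \<Longrightarrow> e (s z) = z"
      using cat_radical_indec_target[OF W U(1) e(1)] by blast
    obtain r where r: "bisum \<Lambda> U V W v s r e" by (rule split_epi_bisum[OF cU s])
    note rr = bisumD(3,5)[OF r]
    have "h x = r (\<pi> (j (f x)))" if "x \<in> carrier X" for x
      using rr(2)[OF hh(1)[OF that]] glue[OF that] by (simp add: v_def)
    then show ?thesis
      by (intro disjI1 bexI[OF _ mod_hom_comp[OF mod_hom_comp[OF b(2) U(2)] rr(1)]] ballI)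
  next
    case True
    then obtain m where m: "m \<in> mod_hom \<Lambda> U K" "\<And>u. u \<in> carrier U \<Longrightarrow> e u = g (m u)"
      by (rule right_almost_splitD[OF ras UE]) (rule that; assumption)
    \<comment> \<open>The composite \<open>K \<rightarrow> U \<rightarrow> K\<close>; on the kernels it induces \<open>X \<rightarrow> V \<rightarrow> X\<close>, which is \<open>\<theta> h\<close>.\<close>
    define \<beta> where "\<beta> = (\<lambda>x. m (\<pi> (j x)))"
    have \<beta>: "\<beta> \<in> mod_hom \<Lambda> K K" unfolding \<beta>_def by (rule mod_hom_comp[OF mod_hom_comp[OF b(2) U(2)] m(1)])
    have g\<beta>: "\<forall>y \<in> carrier K. g (\<beta> y) = g y"
      unfolding \<beta>_def using m(2)[OF \<pi>\<pi>(1)[OF jj(1)]] e(2)[OF jj(1)] b(8) by simp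
    note mv = mod_hom_comp[OF v m(1)]
    have "(\<lambda>x. m (v x)) ` carrier V \<subseteq> f ` carrier X"
    proof
      fix y assume "y \<in> (\<lambda>x. m (v x)) ` carrier V"
      then obtain x where x: "x \<in> carrier V" "y = m (v x)" by blast
      have "v x \<in> {y \<in> carrier U. e y = \<zero>\<^bsub>W\<^esub>}" using vker x(1) by blast
      then have "g y = \<zero>\<^bsub>W\<^esub>" using m(2)[of "v x"] x(2) by auto
      then show "y \<in> f ` carrier X" unfolding d(7) using mod_homD(1)[OF mv x(1)] x(2) by simp
    qed
    then obtain \<theta> where \<theta>: "\<theta> \<in> mod_hom \<Lambda> V X" "\<And>x. x \<in> carrier V \<Longrightarrow> f (\<theta> x) = m (v x)"
      by (rule factor_through_inj[OF xl d(4,6) vl mv]) (rule that; assumption)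
    note \<theta>h = mod_hom_comp[OF h \<theta>(1)]
    have "x = \<zero>\<^bsub>X\<^esub>" if x: "x \<in> carrier X" "\<theta> (h x) = \<zero>\<^bsub>X\<^esub>" for x
    proof -
      have "m (v (h x)) = \<zero>\<^bsub>K\<^esub>" using \<theta>(2)[OF hh(1)[OF x(1)]] x(2) ff(4) by simp
      then have "\<beta> (f x) = \<zero>\<^bsub>K\<^esub>" using glue[OF x(1)] by (simp add: \<beta>_def v_def)
      then have "f x = \<zero>\<^bsub>K\<^esub>" by (rule min[OF \<beta> g\<beta> ff(1)[OF x(1)]])
      then show ?thesis by (rule mod_hom_eq_zero_inj[OF xl kl d(4,6) x(1)])
    qed
    then have "(\<lambda>x. \<theta> (h x)) \<in> mod_iso \<Lambda> X X" by (rule inj_endo_iso[OF E_fg[OF d(1)] \<theta>h])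
    then obtain \<kappa> where \<kappa>: "\<kappa> \<in> mod_hom \<Lambda> X X" "\<And>x. x \<in> carrier X \<Longrightarrow> \<kappa> (\<theta> (h x)) = x"
      by (rule mod_isoE[OF xl xl]) (rule that; assumption)
    then show ?thesis by (intro disjI2 bexI[OF _ mod_hom_comp[OF \<theta>(1) \<kappa>(1)]] ballI)
  qed
qed

text \<open>
  By \<open>pushout_factor\<close> a map out of \<open>X\<close> into \<open>\<E>\<close> without retraction factors through \<open>f\<close>. If \<open>X\<close>
  decomposed properly, this would apply to both projections and so to the identity of \<open>X\<close>, and the
  conflation would split. Thus \<open>X\<close> is indecomposable, and for indecomposable \<open>X\<close> the radical maps are
  those without retraction.
\<close>

lemma minimal_right_almost_split_AR:
  assumes c: "conflation \<Lambda> \<E> X f K g W" and ras: "right_almost_split \<Lambda> \<E> K g W"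
    and min: "\<And>\<beta> x. \<beta> \<in> mod_hom \<Lambda> K K \<Longrightarrow> \<forall>y \<in> carrier K. g (\<beta> y) = g y \<Longrightarrow> x \<in> carrier K \<Longrightarrow>
        \<beta> x = \<zero>\<^bsub>K\<^esub> \<Longrightarrow> x = \<zero>\<^bsub>K\<^esub>"
  shows "AR_conflation \<Lambda> \<E> X f K g W"
proof -
  note d = conflationD[OF c]
  note xl = E_lm[OF d(1)] and kl = E_lm[OF d(2)] and wl = E_lm[OF d(3)]
  interpret X: left_module \<Lambda> X by (rule xl)
  have factor: "(\<exists>k \<in> mod_hom \<Lambda> K V. \<forall>x \<in> carrier X. h x = k (f x)) \<or>
      (\<exists>k \<in> mod_hom \<Lambda> V X. \<forall>x \<in> carrier X. k (h x) = x)"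
    if "V \<in> \<E>" "h \<in> mod_hom \<Lambda> X V" for V h
    by (rule pushout_factor[OF c ras _ that]) (rule min; assumption)
  have no_ret: False if r: "r \<in> mod_hom \<Lambda> K X" "\<And>x. x \<in> carrier X \<Longrightarrow> r (f x) = x" for r
  proof -
    obtain s where s: "s \<in> mod_hom \<Lambda> W K" "\<And>z. z \<in> carrier W \<Longrightarrow> g (s z) = z"
      by (rule split_mono_section[OF c r]) (rule that; assumption | assumption)+
    show False by (rule right_almost_split_no_section[OF ras d(2) s])
  qed
  have X0: "carrier X \<noteq> {\<zero>\<^bsub>X\<^esub>}"
  proof
    assume "carrier X = {\<zero>\<^bsub>X\<^esub>}"
    then show False using no_ret[OF mod_hom_const_zero[OF xl]] by simp
  qed
  have "carrier Y = {\<zero>\<^bsub>Y\<^esub>} \<or> carrier Z = {\<zero>\<^bsub>Z\<^esub>}"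
    if Y: "Y \<in> \<E>" and Z: "Z \<in> \<E>" and iso: "mod_isomorphic \<Lambda> X (mod_sum [Y, Z])" for Y Z
  proof (rule ccontr)
    assume "\<not> ?thesis"
    then have nz: "carrier Y \<noteq> {\<zero>\<^bsub>Y\<^esub>}" "carrier Z \<noteq> {\<zero>\<^bsub>Z\<^esub>}" by auto
    note yl = E_lm[OF Y] and zl = E_lm[OF Z]
    obtain i j p q where b: "bisum \<Lambda> X Y Z i j p q"
      using bisum_iff_isomorphic[OF xl yl zl] iso by blast
    have fac: "\<exists>k \<in> mod_hom \<Lambda> K V. \<forall>x \<in> carrier X. h x = k (f x)"
      if b: "bisum \<Lambda> X V V' i j h q" and V: "V \<in> \<E>" "V' \<in> \<E>" "carrier V' \<noteq> {\<zero>\<^bsub>V'\<^esub>}" for V V' i j h q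
    proof (rule ccontr)
      note bb = bisumD[OF b]
      assume "\<not> ?thesis"
      then obtain k where k: "k \<in> mod_hom \<Lambda> V X" "\<forall>x \<in> carrier X. k (h x) = x"
        using factor[OF V(1) bb(3)] by blast
      obtain z where z: "z \<in> carrier V'" "z \<noteq> \<zero>\<^bsub>V'\<^esub>" by (rule ex_nonzero_element[OF E_lm[OF V(2)] V(3)])
      have jz: "j z \<in> carrier X" by (rule mod_homD(1)[OF bb(2) z(1)])
      have "j z = k \<zero>\<^bsub>V\<^esub>" using k(2) jz bb(7)[OF z(1)] by metis
      then have "j z = \<zero>\<^bsub>X\<^esub>" using mod_hom_group(1)[OF E_lm[OF V(1)] xl k(1)] by simp
      then show False using bb(8)[OF z(1)] z(2) mod_hom_group(1)[OF xl E_lm[OF V(2)] bb(4)] by simp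
    qed
    obtain p' where p': "p' \<in> mod_hom \<Lambda> K Y" "\<forall>x \<in> carrier X. p x = p' (f x)"
      using fac[OF b Y Z nz(2)] by blast
    obtain q' where q': "q' \<in> mod_hom \<Lambda> K Z" "\<forall>x \<in> carrier X. q x = q' (f x)"
      using fac[OF bisum_commute[OF xl b] Z Y nz(1)] by blast
    note bb = bisumD[OF b]
    show False
    proof (rule no_ret)
      show "(\<lambda>k. i (p' k) \<oplus>\<^bsub>X\<^esub> j (q' k)) \<in> mod_hom \<Lambda> K X"
        by (rule mod_hom_add[OF xl mod_hom_comp[OF p'(1) bb(1)] mod_hom_comp[OF q'(1) bb(2)]])
      show "i (p' (f x)) \<oplus>\<^bsub>X\<^esub> j (q' (f x)) = x" if "x \<in> carrier X" for x
        using bb(9)[OF that] p'(2) q'(2) that by simp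
    qed
  qed
  then have X: "indec X" using d(1) X0 unfolding indecomposable_def by blast
  have fr: "f \<in> cat_radical \<Lambda> X K"
    unfolding cat_radical_indec_source[OF X E_fg[OF d(2)] d(4)] using no_ret by blast
  have "\<exists>k \<in> mod_hom \<Lambda> K V. \<forall>x \<in> carrier X. h x = k (f x)" if V: "V \<in> \<E>" and h: "h \<in> cat_radical \<Lambda> X V" for V h
  proof -
    note hh = cat_radical_hom[OF h]
    have "\<not> (\<exists>k \<in> mod_hom \<Lambda> V X. \<forall>x \<in> carrier X. k (h x) = x)"
      using h[unfolded cat_radical_indec_source[OF X E_fg[OF V] hh]] .
    then show ?thesis using factor[OF V hh] by blast
  qed
  then have "left_almost_split \<Lambda> \<E> X f K" using X fr unfolding left_almost_split_def by blast
  then show ?thesis using c ras unfolding AR_conflation_def by blast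
qed

lemma AR_group_add:
  "a \<in> AR_group \<Lambda> \<E> \<Longrightarrow> b \<in> AR_group \<Lambda> \<E> \<Longrightarrow> a + b \<in> AR_group \<Lambda> \<E>"
  unfolding AR_group_def using generate.eng[of a "K0_split \<Lambda> \<E>" _ b] by (simp add: K0_split_def)

lemma AR_group_zero: "0 \<in> AR_group \<Lambda> \<E>"
  unfolding AR_group_def using generate.one[of "K0_split \<Lambda> \<E>"] by (simp add: K0_split_def)

text \<open>
  Induction on the length of \<open>K\<close>. If \<open>g\<close> is right minimal, the conflation is an AR conflation.
  Otherwise \<open>g \<beta> = g\<close> for an endomorphism \<open>\<beta>\<close> of \<open>K\<close> that is not injective, and Fitting's lemma splits
  \<open>K\<close> into the image \<open>B\<close> and the kernel \<open>N\<close> of a power of \<open>\<beta>\<close>. Since \<open>g\<close> kills \<open>N\<close>, the module \<open>X\<close>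
  is the direct sum of \<open>N\<close> and the kernel \<open>A\<close> of \<open>g\<close> on \<open>B\<close>. The class of \<open>N\<close> cancels from the relation,
  and \<open>B \<rightarrow> W\<close> is again right almost split.
\<close>

lemma right_almost_split_relation_in_AR:
  assumes "conflation \<Lambda> \<E> X f K g W" "right_almost_split \<Lambda> \<E> K g W"
  shows "relation X K W \<in> AR_group \<Lambda> \<E>"
  using assms
proof (induction "len K" arbitrary: X f K g rule: less_induct)
  case less
  note c = less.prems(1) and ras = less.prems(2)
  note d = conflationD[OF c]
  note xl = E_lm[OF d(1)] and kl = E_lm[OF d(2)] and wl = E_lm[OF d(3)]
  interpret X: left_module \<Lambda> X by (rule xl)
  interpret K: left_module \<Lambda> K by (rule kl)
  interpret W: left_module \<Lambda> W by (rule wl)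
  have W: "indec W" and gr: "g \<in> cat_radical \<Lambda> K W" using ras by (auto simp: right_almost_split_def)
  show ?case
  proof (cases "\<exists>\<beta> z. \<beta> \<in> mod_hom \<Lambda> K K \<and> (\<forall>y \<in> carrier K. g (\<beta> y) = g y) \<and> z \<in> carrier K \<and>
      \<beta> z = \<zero>\<^bsub>K\<^esub> \<and> z \<noteq> \<zero>\<^bsub>K\<^esub>")
    case False
    then have "AR_conflation \<Lambda> \<E> X f K g W"
      by (intro minimal_right_almost_split_AR[OF c ras]) blast
    then show ?thesis unfolding AR_group_def by (intro generate.incl) blast
  next
    case True
    then obtain \<beta> z where \<beta>: "\<beta> \<in> mod_hom \<Lambda> K K" "\<And>y. y \<in> carrier K \<Longrightarrow> g (\<beta> y) = g y"
      and z: "z \<in> carrier K" "\<beta> z = \<zero>\<^bsub>K\<^esub>" "z \<noteq> \<zero>\<^bsub>K\<^esub>" by blast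
    obtain n B N p q where F: "n > 0" "B = (\<beta> ^^ n) ` carrier K" "N = {x \<in> carrier K. (\<beta> ^^ n) x = \<zero>\<^bsub>K\<^esub>}"
      "submodule B \<Lambda> K" "submodule N \<Lambda> K" "bisum \<Lambda> K (submod K B) (submod K N) (\<lambda>x. x) (\<lambda>x. x) p q"
      by (rule fitting[OF E_fg[OF d(2)] \<beta>(1)]) (rule that; assumption)
    have pow: "(\<beta> ^^ k) x \<in> carrier K" if "x \<in> carrier K" for k x
      using mod_homD(1)[OF endo_pow[OF \<beta>(1)] that] .
    have gpow: "g ((\<beta> ^^ k) x) = g x" if "x \<in> carrier K" for k x
      by (induction k) (simp_all add: \<beta>(2) pow that)
    have gN: "g x = \<zero>\<^bsub>W\<^esub>" if "x \<in> N" for x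
      using that gpow[of x n] F(3) mod_hom_group(1)[OF kl wl d(5)] by simp
    obtain m where m: "n = Suc m" using F(1) by (cases n) auto
    have "(\<beta> ^^ n) z = \<zero>\<^bsub>K\<^esub>"
      using z(2) mod_hom_group(1)[OF kl kl endo_pow[OF \<beta>(1)], of m] by (simp add: m funpow_swap1)
    then have zN: "z \<in> N" using F(3) z(1) by simp
    define KB where "KB = submod K B"
    define KN where "KN = submod K N"
    note b = bisumD[OF F(6), folded KB_def KN_def]
    have fg: "KB \<in> fg_mod \<Lambda>" "KN \<in> fg_mod \<Lambda>"
      unfolding KB_def KN_def by (rule fg_mod_submod[OF E_fg[OF d(2)]]; fact)+
    have bis: "bisum \<Lambda> K KB KN (\<lambda>x. x) (\<lambda>x. x) p q" using F(6) by (simp add: KB_def KN_def)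
    have BE: "KB \<in> \<E>" and NE: "KN \<in> \<E>"
      by (rule E_summand[OF d(2) fg bis], rule E_summand[OF d(2) fg(2,1) bisum_commute[OF kl bis]])
    note bl = E_lm[OF BE] and nl = E_lm[OF NE]
    have cB: "x \<in> carrier KB \<longleftrightarrow> x \<in> B" "x \<in> carrier KN \<longleftrightarrow> x \<in> N" for x by (simp_all add: KB_def KN_def)
    have BK: "x \<in> carrier K" if "x \<in> B \<or> x \<in> N" for x
      using that K.is_submoduleD(1)[OF F(4)] K.is_submoduleD(1)[OF F(5)] by blast
    have gB: "g \<in> mod_hom \<Lambda> KB W" using mod_hom_comp[OF b(1) d(5)] by simp
    have gsurj: "g ` carrier KB = carrier W"
    proof
      show "carrier W \<subseteq> g ` carrier KB"
      proof
        fix w assume "w \<in> carrier W"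
        then obtain x where x: "x \<in> carrier K" "w = g x" using d(8) by (metis imageE)
        then have "w = g ((\<beta> ^^ n) x)" "(\<beta> ^^ n) x \<in> carrier KB" using gpow F(2) cB by auto
        then show "w \<in> g ` carrier KB" by blast
      qed
    qed (use mod_homD(1)[OF gB] in blast)
    have "right_almost_split \<Lambda> \<E> KB g W"
      unfolding right_almost_split_def
    proof (intro conjI W ballI)
      show "g \<in> cat_radical \<Lambda> KB W"
        using cat_radical_precomp[OF fg(1) E_fg[OF d(2)] E_fg[OF d(3)] b(1) gr] by simp
      fix V h assume V: "V \<in> \<E>" "h \<in> cat_radical \<Lambda> V W"
      obtain k where k: "k \<in> mod_hom \<Lambda> V K" "\<And>v. v \<in> carrier V \<Longrightarrow> h v = g (k v)"
        by (rule right_almost_splitD[OF ras V]) (rule that; assumption)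
      have "(\<lambda>v. (\<beta> ^^ n) (k v)) \<in> mod_hom \<Lambda> V KB"
        unfolding KB_def
        by (rule mod_hom_into_submod[OF mod_hom_comp[OF k(1) endo_pow[OF \<beta>(1)]]])
          (use F(2) mod_homD(1)[OF k(1)] in auto)
      moreover have "\<forall>v \<in> carrier V. h v = g ((\<beta> ^^ n) (k v))"
        using k(2) gpow[OF mod_homD(1)[OF k(1)]] by simp
      ultimately show "\<exists>k\<in>mod_hom \<Lambda> V KB. \<forall>w\<in>carrier V. h w = g (k w)" by (intro bexI)
    qed
    moreover note kc = kernel_conflation[OF BE d(3) gB gsurj]
    moreover have "len KB < len K"
    proof -
      have "carrier KN \<noteq> {\<zero>\<^bsub>KN\<^esub>}" using zN z(3) cB by (auto simp: KN_def)
      then show ?thesis using len_bisum[OF E_fg[OF d(2)] bl nl bis] len_pos[OF fg(2)] by simp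
    qed
    moreover define A where "A = submod KB {y \<in> carrier KB. g y = \<zero>\<^bsub>W\<^esub>}"
    ultimately have IH: "relation A KB W \<in> AR_group \<Lambda> \<E>" using less.hyps[OF _ _ \<open>right_almost_split \<Lambda> \<E> KB g W\<close>] by simp
    have AE: "A \<in> \<E>" using conflationD(1)[OF kc] by (simp add: A_def)
    note al = E_lm[OF AE]
    have cA: "x \<in> carrier A \<longleftrightarrow> x \<in> B \<and> g x = \<zero>\<^bsub>W\<^esub>" for x by (simp add: A_def KB_def)
    have Ak: "(\<lambda>x. x) \<in> mod_hom \<Lambda> A K"
      using mod_hom_comp[OF conflationD(4)[OF kc] b(1)] by (simp add: A_def)
    have "(\<lambda>x. x) ` carrier A \<subseteq> f ` carrier X" unfolding d(7) using cA BK by auto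
    then obtain i where i: "i \<in> mod_hom \<Lambda> A X" "\<And>x. x \<in> carrier A \<Longrightarrow> f (i x) = x"
      by (rule factor_through_inj[OF xl d(4,6) al Ak]) (rule that; assumption)
    have "(\<lambda>x. x) ` carrier KN \<subseteq> f ` carrier X" unfolding d(7) using cB BK gN by auto
    then obtain j where j: "j \<in> mod_hom \<Lambda> KN X" "\<And>x. x \<in> carrier KN \<Longrightarrow> f (j x) = x"
      by (rule factor_through_inj[OF xl d(4,6) nl b(2)]) (rule that; assumption)
    have fc: "f x \<in> carrier K" "g (f x) = \<zero>\<^bsub>W\<^esub>" if "x \<in> carrier X" for x using d(7) that by blast+
    have pc: "p y \<in> carrier KB" "q y \<in> carrier KN" if "y \<in> carrier K" for y
      using mod_homD(1)[OF b(3) that] mod_homD(1)[OF b(4) that] by auto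
    have pA: "p (f x) \<in> carrier A" if x: "x \<in> carrier X" for x
    proof -
      have "g (p (f x)) \<oplus>\<^bsub>W\<^esub> g (q (f x)) = g (f x)"
        using mod_homD(2)[OF d(5), of "p (f x)" "q (f x)"] b(9)[OF fc(1)[OF x]] pc[OF fc(1)[OF x]] BK cB by simp
      then have "g (p (f x)) = \<zero>\<^bsub>W\<^esub>"
        using fc(2)[OF x] gN pc[OF fc(1)[OF x]] cB mod_homD(1)[OF gB] by simp
      then show ?thesis using cA cB pc(1)[OF fc(1)[OF x]] by simp
    qed
    have "bisum \<Lambda> X A KN i j (\<lambda>x. p (f x)) (\<lambda>x. q (f x))"
      unfolding bisum_def
    proof (intro conjI ballI)
      show "(\<lambda>x. p (f x)) \<in> mod_hom \<Lambda> X A"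
        unfolding A_def by (rule mod_hom_into_submod[OF mod_hom_comp[OF d(4) b(3)]]) (use pA in \<open>auto simp: A_def\<close>)
      show "(\<lambda>x. q (f x)) \<in> mod_hom \<Lambda> X KN" by (rule mod_hom_comp[OF d(4) b(4)])
      show "p (f (i x)) = x" "q (f (i x)) = \<zero>\<^bsub>KN\<^esub>" if x: "x \<in> carrier A" for x
        using i(2)[OF x] b(5,6)[of x] x cA cB by auto
      show "p (f (j x)) = \<zero>\<^bsub>A\<^esub>" "q (f (j x)) = x" if x: "x \<in> carrier KN" for x
        using j(2)[OF x] b(7,8)[OF x] by (auto simp: A_def)
      fix x assume x: "x \<in> carrier X"
      have c: "i (p (f x)) \<in> carrier X" "j (q (f x)) \<in> carrier X"
        using mod_homD(1)[OF i(1) pA[OF x]] mod_homD(1)[OF j(1) pc(2)[OF fc(1)[OF x]]] by auto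
      show "i (p (f x)) \<oplus>\<^bsub>X\<^esub> j (q (f x)) = x"
      proof (rule inj_onD[OF d(6)])
        show "f (i (p (f x)) \<oplus>\<^bsub>X\<^esub> j (q (f x))) = f x"
          using mod_homD(2)[OF d(4) c] i(2)[OF pA[OF x]] j(2)[OF pc(2)[OF fc(1)[OF x]]] b(9)[OF fc(1)[OF x]] by simp
      qed (use c x in auto)
    qed (use i(1) j(1) in auto)
    then have "K0_class \<Lambda> \<E> X = K0_class \<Lambda> \<E> A + K0_class \<Lambda> \<E> KN"
      by (rule K0_class_bisum[OF d(1) AE NE])
    moreover have "K0_class \<Lambda> \<E> K = K0_class \<Lambda> \<E> KB + K0_class \<Lambda> \<E> KN"
      by (rule K0_class_bisum[OF d(2) BE NE bis])
    ultimately have "relation X K W = relation A KB W" by simp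
    then show ?thesis using IH by simp
  qed
qed


section \<open>Finite type forces equality of the two groups\<close>

text \<open>
  A family of factorisations of the maps \<open>h s\<close> for all \<open>s : G \<rightarrow> V\<close> assembles to a factorisation of \<open>h\<close>
  when \<open>V\<close> is a power of \<open>G\<close>. Two maps \<open>g\<close> and \<open>g'\<close> are treated at once in order to describe the
  maps that factor through \<open>(g, g') : Y \<oplus> Y' \<rightarrow> Z\<close> without forming the direct sum.
\<close>

lemma factor_from_power:
  assumes G: "left_module \<Lambda> G" and Y: "left_module \<Lambda> Y" "left_module \<Lambda> Y'" and Z: "left_module \<Lambda> Z"
    and g: "g \<in> mod_hom \<Lambda> Y Z" "g' \<in> mod_hom \<Lambda> Y' Z"
    and h: "h \<in> mod_hom \<Lambda> (mod_sum (replicate n G)) Z"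
    and G_factor: "\<And>s. s \<in> mod_hom \<Lambda> G (mod_sum (replicate n G)) \<Longrightarrow>
      \<exists>u \<in> mod_hom \<Lambda> G Y. \<exists>u' \<in> mod_hom \<Lambda> G Y'. \<forall>x \<in> carrier G. h (s x) = g (u x) \<oplus>\<^bsub>Z\<^esub> g' (u' x)"
  shows "\<exists>u \<in> mod_hom \<Lambda> (mod_sum (replicate n G)) Y. \<exists>u' \<in> mod_hom \<Lambda> (mod_sum (replicate n G)) Y'.
    \<forall>v \<in> carrier (mod_sum (replicate n G)). h v = g (u v) \<oplus>\<^bsub>Z\<^esub> g' (u' v)"
  using h G_factor
proof (induction n arbitrary: h)
  case 0
  interpret Z: left_module \<Lambda> Z by (rule Z)
  define S where "S = mod_sum (replicate 0 G)"
  have Sl: "left_module \<Lambda> S" unfolding S_def by (rule left_module_mod_sum[OF Lambda_ring]) simp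
  have "v = \<zero>\<^bsub>S\<^esub>" if "v \<in> carrier S" for v using that by (simp add: S_def mod_sum_Nil)
  then have "\<forall>v \<in> carrier S. h v = g \<zero>\<^bsub>Y\<^esub> \<oplus>\<^bsub>Z\<^esub> g' \<zero>\<^bsub>Y'\<^esub>"
    using mod_hom_group(1)[OF Sl Z, of h] 0(1) mod_hom_group(1)[OF Y(1) Z g(1)] mod_hom_group(1)[OF Y(2) Z g(2)]
    by (auto simp: S_def)
  then show ?case
    unfolding S_def[symmetric]
    by (intro bexI[OF _ mod_hom_const_zero[OF Y(1)]] bexI[OF _ mod_hom_const_zero[OF Y(2)]])
next
  case (Suc n)
  interpret Z: left_module \<Lambda> Z by (rule Z)
  define S where "S = mod_sum (replicate n G)"
  define S' where "S' = mod_sum (replicate (Suc n) G)"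
  have Sl: "left_module \<Lambda> S" "left_module \<Lambda> S'"
    unfolding S_def S'_def by (rule left_module_mod_sum[OF Lambda_ring]; use G in auto)+
  have "\<exists>i j p q. bisum \<Lambda> S' G S i j p q"
    using bisum_Cons[OF G, of "replicate n G"] G by (auto simp: S_def S'_def)
  then obtain i j p q where bs: "bisum \<Lambda> S' G S i j p q" by blast
  note b = bisumD[OF bs] and h = Suc.prems(1)[folded S'_def] and fac = Suc.prems(2)[folded S'_def]
  have "\<exists>u \<in> mod_hom \<Lambda> S Y. \<exists>u' \<in> mod_hom \<Lambda> S Y'. \<forall>v \<in> carrier S. h (j v) = g (u v) \<oplus>\<^bsub>Z\<^esub> g' (u' v)"
    using Suc.IH[folded S_def, OF mod_hom_comp[OF b(2) h]] fac[OF mod_hom_comp[OF _ b(2)]] by blast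
  then obtain u2 u2' where u2: "u2 \<in> mod_hom \<Lambda> S Y" "u2' \<in> mod_hom \<Lambda> S Y'"
    "\<And>v. v \<in> carrier S \<Longrightarrow> h (j v) = g (u2 v) \<oplus>\<^bsub>Z\<^esub> g' (u2' v)" by blast
  obtain u1 u1' where u1: "u1 \<in> mod_hom \<Lambda> G Y" "u1' \<in> mod_hom \<Lambda> G Y'"
    "\<And>v. v \<in> carrier G \<Longrightarrow> h (i v) = g (u1 v) \<oplus>\<^bsub>Z\<^esub> g' (u1' v)" using fac[OF b(1)] by blast
  note [simp] = mod_homD(1)[OF b(1)] mod_homD(1)[OF b(2)] mod_homD(1)[OF b(3)] mod_homD(1)[OF b(4)]
    mod_homD(1)[OF u1(1)] mod_homD(1)[OF u1(2)] mod_homD(1)[OF u2(1)] mod_homD(1)[OF u2(2)]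
    mod_homD(1)[OF g(1)] mod_homD(1)[OF g(2)]
  have eq: "h v = g (u1 (p v) \<oplus>\<^bsub>Y\<^esub> u2 (q v)) \<oplus>\<^bsub>Z\<^esub> g' (u1' (p v) \<oplus>\<^bsub>Y'\<^esub> u2' (q v))"
    if v: "v \<in> carrier S'" for v
  proof -
    have "h v = h (i (p v)) \<oplus>\<^bsub>Z\<^esub> h (j (q v))"
      using mod_homD(2)[OF h, of "i (p v)" "j (q v)"] b(9)[OF v] v by simp
    then show ?thesis
      using v by (simp add: u1(3) u2(3) mod_homD(2)[OF g(1)] mod_homD(2)[OF g(2)] Z.a_ac)
  qed
  have "(\<lambda>v. u1 (p v) \<oplus>\<^bsub>Y\<^esub> u2 (q v)) \<in> mod_hom \<Lambda> S' Y"
    by (rule mod_hom_add[OF Y(1) mod_hom_comp[OF b(3) u1(1)] mod_hom_comp[OF b(4) u2(1)]])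
  moreover have "(\<lambda>v. u1' (p v) \<oplus>\<^bsub>Y'\<^esub> u2' (q v)) \<in> mod_hom \<Lambda> S' Y'"
    by (rule mod_hom_add[OF Y(2) mod_hom_comp[OF b(3) u1(2)] mod_hom_comp[OF b(4) u2(2)]])
  ultimately show ?case unfolding S'_def[symmetric] using eq by (intro bexI ballI)
qed

lemma factor_from_generator:
  assumes r: "retract V (mod_sum (replicate n G))"
    and G: "left_module \<Lambda> G" and Y: "left_module \<Lambda> Y" "left_module \<Lambda> Y'" and Z: "left_module \<Lambda> Z"
    and g: "g \<in> mod_hom \<Lambda> Y Z" "g' \<in> mod_hom \<Lambda> Y' Z" and h: "h \<in> mod_hom \<Lambda> V Z"
    and G_factor: "\<And>s. s \<in> mod_hom \<Lambda> G V \<Longrightarrow>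
      \<exists>u \<in> mod_hom \<Lambda> G Y. \<exists>u' \<in> mod_hom \<Lambda> G Y'. \<forall>x \<in> carrier G. h (s x) = g (u x) \<oplus>\<^bsub>Z\<^esub> g' (u' x)"
  obtains u u' where "u \<in> mod_hom \<Lambda> V Y" "u' \<in> mod_hom \<Lambda> V Y'"
    "\<And>v. v \<in> carrier V \<Longrightarrow> h v = g (u v) \<oplus>\<^bsub>Z\<^esub> g' (u' v)"
proof -
  define P where "P = mod_sum (replicate n G)"
  obtain s t where st: "s \<in> mod_hom \<Lambda> V P" "t \<in> mod_hom \<Lambda> P V" "\<And>x. x \<in> carrier V \<Longrightarrow> t (s x) = x"
    by (rule retractE[OF r[folded P_def]]) (rule that; assumption)
  have "\<exists>u \<in> mod_hom \<Lambda> P Y. \<exists>u' \<in> mod_hom \<Lambda> P Y'. \<forall>v \<in> carrier P. h (t v) = g (u v) \<oplus>\<^bsub>Z\<^esub> g' (u' v)"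
    unfolding P_def
    by (rule factor_from_power[OF G Y Z g mod_hom_comp[OF st(2)[unfolded P_def] h]])
      (rule G_factor[OF mod_hom_comp[OF _ st(2)[unfolded P_def]]])
  then obtain u u' where u: "u \<in> mod_hom \<Lambda> P Y" "u' \<in> mod_hom \<Lambda> P Y'"
    "\<And>v. v \<in> carrier P \<Longrightarrow> h (t v) = g (u v) \<oplus>\<^bsub>Z\<^esub> g' (u' v)" by blast
  show thesis
  proof (rule that[OF mod_hom_comp[OF st(1) u(1)] mod_hom_comp[OF st(1) u(2)]])
    show "h v = g (u (s v)) \<oplus>\<^bsub>Z\<^esub> g' (u' (s v))" if "v \<in> carrier V" for v
      using u(3)[OF mod_homD(1)[OF st(1) that]] st(3)[OF that] by simp
  qed
qed

text \<open>
  The submodule of \<open>Hom(G, Z)\<close> of the maps that factor through \<open>g : Y \<rightarrow> Z\<close>. For a generator \<open>G\<close> these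
  submodules stand for the images of \<open>Hom(-, Y)\<close> in the functor \<open>Hom(-, Z)\<close>, by
  \<open>factors_iff_maps_through\<close>.
\<close>

definition maps_through :: "('a, 'm) module \<Rightarrow> ('a, 'm) module \<Rightarrow> ('m \<Rightarrow> 'm) \<Rightarrow> ('m \<Rightarrow> 'm) set" where
  "maps_through G Y g = post G g ` carrier (hom_module G Y)"

lemma submodule_maps_through:
  assumes "left_module \<Lambda> G" "left_module \<Lambda> Y" "left_module \<Lambda> Z" "g \<in> mod_hom \<Lambda> Y Z"
  shows "submodule (maps_through G Y g) R (hom_module G Z)"
  unfolding maps_through_def
  by (rule submodule_image[OF left_module_hom_module[OF assms(1,2)] left_module_hom_module[OF assms(1,3)]
        mod_hom_postcomp[OF assms(1,4)]
        left_module.submodule_carrier[OF left_module_hom_module[OF assms(1,2)]]])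

lemma maps_throughI:
  assumes "left_module \<Lambda> G" "u \<in> mod_hom \<Lambda> G Y"
  shows "restrict (\<lambda>x. g (u x)) (carrier G) \<in> maps_through G Y g"
proof -
  have "post G g (restrict u (carrier G)) = restrict (\<lambda>x. g (u x)) (carrier G)"
    by (rule restrict_ext) simp
  then show ?thesis unfolding maps_through_def using restrict_mod_hom(2)[OF assms] by (metis imageI)
qed

lemma maps_through_mono:
  assumes G: "left_module \<Lambda> G" and u: "u \<in> mod_hom \<Lambda> V Y" and hu: "\<And>v. v \<in> carrier V \<Longrightarrow> h v = g (u v)"
  shows "maps_through G V h \<subseteq> maps_through G Y g"
proof
  fix a assume "a \<in> maps_through G V h"
  then obtain k where k: "k \<in> carrier (hom_module G V)" "a = post G h k" unfolding maps_through_def by blast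
  note kk = hom_moduleD[OF k(1)]
  have "a = restrict (\<lambda>x. g (u (k x))) (carrier G)"
    unfolding k(2) by (rule restrict_ext) (simp add: hu kk(3))
  then show "a \<in> maps_through G Y g" using maps_throughI[OF G mod_hom_comp[OF kk(1) u], of g] by simp
qed

lemma factor_if_maps_through:
  assumes r: "retract V (mod_sum (replicate n G))"
    and G: "left_module \<Lambda> G" and Y: "left_module \<Lambda> Y" "left_module \<Lambda> Y'" and Z: "left_module \<Lambda> Z"
    and g: "g \<in> mod_hom \<Lambda> Y Z" "g' \<in> mod_hom \<Lambda> Y' Z" and h: "h \<in> mod_hom \<Lambda> V Z"
    and sub: "maps_through G V h \<subseteq>
      left_module.sub_sum (hom_module G Z) (maps_through G Y g) (maps_through G Y' g')"
  obtains u u' where "u \<in> mod_hom \<Lambda> V Y" "u' \<in> mod_hom \<Lambda> V Y'"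
    "\<And>v. v \<in> carrier V \<Longrightarrow> h v = g (u v) \<oplus>\<^bsub>Z\<^esub> g' (u' v)"
proof -
  interpret H: left_module R "hom_module G Z" by (rule left_module_hom_module[OF G Z])
  have "\<exists>u \<in> mod_hom \<Lambda> G Y. \<exists>u' \<in> mod_hom \<Lambda> G Y'. \<forall>x \<in> carrier G. h (s x) = g (u x) \<oplus>\<^bsub>Z\<^esub> g' (u' x)"
    if s: "s \<in> mod_hom \<Lambda> G V" for s
  proof -
    have "restrict (\<lambda>x. h (s x)) (carrier G) \<in> H.sub_sum (maps_through G Y g) (maps_through G Y' g')"
      using sub maps_throughI[OF G s, of h] by blast
    then obtain a b where ab: "a \<in> maps_through G Y g" "b \<in> maps_through G Y' g'"
      "restrict (\<lambda>x. h (s x)) (carrier G) = a \<oplus>\<^bsub>hom_module G Z\<^esub> b" unfolding H.sub_sum_def by blast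
    obtain u where u: "u \<in> carrier (hom_module G Y)" "a = post G g u" using ab(1) unfolding maps_through_def by blast
    obtain u' where u': "u' \<in> carrier (hom_module G Y')" "b = post G g' u'"
      using ab(2) unfolding maps_through_def by blast
    have "h (s x) = g (u x) \<oplus>\<^bsub>Z\<^esub> g' (u' x)" if "x \<in> carrier G" for x
      using fun_cong[OF ab(3), of x] that u(2) u'(2) by (simp add: hom_module_simps(3))
    then show ?thesis using hom_moduleD(1)[OF u(1)] hom_moduleD(1)[OF u'(1)] by (intro bexI ballI)
  qed
  then show thesis by (rule factor_from_generator[OF r G Y Z g h]) ((rule that; assumption) | assumption)+
qed

definition factors :: "('a, 'm) module \<Rightarrow> ('m \<Rightarrow> 'm) \<Rightarrow> ('a, 'm) module \<Rightarrow> ('m \<Rightarrow> 'm) \<Rightarrow> bool" where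
  "factors V h Y g \<longleftrightarrow> (\<exists>u \<in> mod_hom \<Lambda> V Y. \<forall>v \<in> carrier V. h v = g (u v))"

lemma factorsI:
  assumes "u \<in> mod_hom \<Lambda> V Y" "\<And>v. v \<in> carrier V \<Longrightarrow> h v = g (u v)"
  shows "factors V h Y g"
  unfolding factors_def using assms(2) by (intro bexI[OF _ assms(1)]) simp

lemma factors_iff_maps_through:
  assumes r: "retract V (mod_sum (replicate n G))"
    and G: "left_module \<Lambda> G" and Y: "left_module \<Lambda> Y" and Z: "left_module \<Lambda> Z"
    and g: "g \<in> mod_hom \<Lambda> Y Z" and h: "h \<in> mod_hom \<Lambda> V Z"
  shows "factors V h Y g \<longleftrightarrow> maps_through G V h \<subseteq> maps_through G Y g"
proof
  assume "factors V h Y g"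
  then show "maps_through G V h \<subseteq> maps_through G Y g"
    unfolding factors_def using maps_through_mono[OF G, of _ V Y h g] by blast
next
  assume sub: "maps_through G V h \<subseteq> maps_through G Y g"
  interpret H: left_module R "hom_module G Z" by (rule left_module_hom_module[OF G Z])
  note s = submodule_maps_through[OF G Y Z g]
  have "maps_through G V h \<subseteq> H.sub_sum (maps_through G Y g) (maps_through G Y g)"
    using sub H.sub_sum_upper(1)[OF s s] by blast
  then obtain u u' where u: "u \<in> mod_hom \<Lambda> V Y" "u' \<in> mod_hom \<Lambda> V Y"
    "\<And>v. v \<in> carrier V \<Longrightarrow> h v = g (u v) \<oplus>\<^bsub>Z\<^esub> g (u' v)"
    by (rule factor_if_maps_through[OF r G Y Y Z g g h]) (rule that; assumption)
  show "factors V h Y g"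
    by (rule factorsI[OF mod_hom_add[OF Y u(1,2)]])
      (simp add: u(3) mod_homD(1)[OF u(1)] mod_homD(1)[OF u(2)] mod_homD(2)[OF g])
qed

text \<open>
  Factorisations of all components of \<open>h\<close> would add up to a factorisation of \<open>h\<close>.
\<close>

lemma nonfactoring_component:
  fixes P :: "('a, 'm) module"
  assumes "P \<in> fg_mod \<Lambda>" "\<And>X. X \<in> set Xs \<Longrightarrow> X \<in> fg_mod \<Lambda>" "mod_isomorphic \<Lambda> P (mod_sum Xs)"
    and Y: "left_module \<Lambda> Y" and Z: "left_module \<Lambda> Z" and g: "g \<in> mod_hom \<Lambda> Y Z"
    and "h \<in> mod_hom \<Lambda> P Z" "\<not> factors P h Y g"
  shows "\<exists>X \<in> set Xs. \<exists>s \<in> mod_hom \<Lambda> X P. \<not> factors X (\<lambda>x. h (s x)) Y g"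
  using assms(1-3,7,8)
proof (induction Xs arbitrary: P h)
  case Nil
  have z: "carrier P = {\<zero>\<^bsub>P\<^esub>}" using Nil mod_isomorphic_Nil_iff[OF fg_modD] by blast
  have "factors P h Y g" unfolding factors_def
    by (rule bexI[OF _ mod_hom_const_zero[OF Y]])
      (use z mod_hom_group(1)[OF fg_modD[OF Nil(1)] Z Nil(4)] mod_hom_group(1)[OF Y Z g] in auto)
  then show ?case using Nil(5) by contradiction
next
  case (Cons V Vs)
  have V: "V \<in> fg_mod \<Lambda>" "\<And>Z. Z \<in> set Vs \<Longrightarrow> Z \<in> fg_mod \<Lambda>" using Cons.prems(2) by auto
  obtain X' :: "('a, 'm) module" and i j p q
    where X': "X' \<in> fg_mod \<Lambda>" "bisum \<Lambda> P V X' i j p q" "mod_isomorphic \<Lambda> X' (mod_sum Vs)"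
    by (rule iso_ConsE[OF Cons.prems(1) V Cons.prems(3)]) ((rule that; assumption) | assumption)+
  note b = bisumD[OF X'(2)] and h = Cons.prems(4)
  show ?case
  proof (cases "factors V (\<lambda>x. h (i x)) Y g")
    case False
    then show ?thesis using b(1) by (intro bexI[of _ V] bexI[of _ i]) auto
  next
    case True
    then obtain u where u: "u \<in> mod_hom \<Lambda> V Y" "\<And>v. v \<in> carrier V \<Longrightarrow> h (i v) = g (u v)"
      unfolding factors_def by blast
    have "\<not> factors X' (\<lambda>x. h (j x)) Y g"
    proof
      assume "factors X' (\<lambda>x. h (j x)) Y g"
      then obtain u' where u': "u' \<in> mod_hom \<Lambda> X' Y" "\<And>v. v \<in> carrier X' \<Longrightarrow> h (j v) = g (u' v)"
        unfolding factors_def by blast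
      note pc = mod_homD(1)[OF b(3)] mod_homD(1)[OF b(4)]
      have "h d = g (u (p d) \<oplus>\<^bsub>Y\<^esub> u' (q d))" if d: "d \<in> carrier P" for d
      proof -
        have "h d = h (i (p d)) \<oplus>\<^bsub>Z\<^esub> h (j (q d))"
          using mod_homD(2)[OF h mod_homD(1)[OF b(1) pc(1)[OF d]] mod_homD(1)[OF b(2) pc(2)[OF d]]] b(9)[OF d]
          by simp
        also have "\<dots> = g (u (p d) \<oplus>\<^bsub>Y\<^esub> u' (q d))"
          using u(2)[OF pc(1)[OF d]] u'(2)[OF pc(2)[OF d]]
            mod_homD(2)[OF g mod_homD(1)[OF u(1) pc(1)[OF d]] mod_homD(1)[OF u'(1) pc(2)[OF d]]] by simp
        finally show ?thesis .
      qed
      then have "factors P h Y g"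
        by (rule factorsI[OF mod_hom_add[OF Y mod_hom_comp[OF b(3) u(1)] mod_hom_comp[OF b(4) u'(1)]]])
      then show False using Cons.prems(5) by contradiction
    qed
    from Cons.IH[OF X'(1) V(2) X'(3) mod_hom_comp[OF b(2) h] this]
    obtain X s where X: "X \<in> set Vs" "s \<in> mod_hom \<Lambda> X X'" "\<not> factors X (\<lambda>x. h (j (s x))) Y g" by blast
    then show ?thesis using mod_hom_comp[OF X(2) b(2)] by (intro bexI[of _ X] bexI[of _ "\<lambda>x. j (s x)"]) auto
  qed
qed

text \<open>
  The map \<open>h\<close> generates a simple subfunctor of the cokernel of \<open>Hom(-, Y) \<rightarrow> Hom(-, Z)\<close>. It is found by
  minimising the submodule \<open>J W h\<close> of \<open>Hom(G, Z)\<close> generated by the maps through \<open>g\<close> and those through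
  \<open>h\<close>; passing to an indecomposable component of \<open>W\<close> keeps it minimal. If \<open>h r\<close> did not factor through
  \<open>g\<close> for some radical \<open>r\<close>, minimality would give \<open>h = g u + h r b\<close>.
\<close>

lemma ex_simple_subfunctor:
  assumes G: "G \<in> \<E>" "\<And>V. V \<in> \<E> \<Longrightarrow> \<exists>n. retract V (mod_sum (replicate n G))"
    and c: "conflation \<Lambda> \<E> X f Y g Z" and ns: "\<not> factors Z (\<lambda>z. z) Y g"
  obtains W h where "indec W" "h \<in> mod_hom \<Lambda> W Z" "\<not> factors W h Y g"
    "\<And>V r. V \<in> \<E> \<Longrightarrow> r \<in> cat_radical \<Lambda> V W \<Longrightarrow> factors V (\<lambda>v. h (r v)) Y g"
proof -
  note d = conflationD[OF c]
  note yl = E_lm[OF d(2)] and zl = E_lm[OF d(3)] and gl = E_lm[OF G(1)]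
  interpret Z: left_module \<Lambda> Z by (rule zl)
  let ?H = "hom_module G Z"
  interpret H: left_module R ?H by (rule left_module_hom_module[OF gl zl])
  let ?L = "submods R ?H {\<zero>\<^bsub>?H\<^esub>} (carrier ?H)"
  have bd: "bounded_flags ?L" by (rule finite_length_hom_module[OF E_fg[OF G(1)] E_fg[OF d(3)]])
  define I where "I = maps_through G Y g"
  define J where "J = (\<lambda>V h. H.sub_sum I (maps_through G V h))"
  have I: "submodule I R ?H" unfolding I_def by (rule submodule_maps_through[OF gl yl zl d(5)])
  have J: "submodule (J V h) R ?H" if "V \<in> \<E>" "h \<in> mod_hom \<Lambda> V Z" for V h
    unfolding J_def by (rule H.submodule_sub_sum[OF I submodule_maps_through[OF gl E_lm[OF that(1)] zl that(2)]])
  have Jmono: "J V h \<subseteq> J V' h'" if "maps_through G V h \<subseteq> maps_through G V' h'" for V h V' h'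
    unfolding J_def H.sub_sum_def using that by blast
  define \<K> where "\<K> = {J V h | V h. V \<in> \<E> \<and> h \<in> mod_hom \<Lambda> V Z \<and> \<not> factors V h Y g}"
  have ne: "\<K> \<noteq> {}" unfolding \<K>_def using d(3) mod_hom_id[of \<Lambda> Z] ns by blast
  have sub: "\<K> \<subseteq> ?L"
  proof
    fix A assume "A \<in> \<K>"
    then have "submodule A R ?H" unfolding \<K>_def using J by blast
    then show "A \<in> ?L" using H.is_submoduleD(1,2) by (auto simp: submods_def)
  qed
  obtain J0 where J0: "J0 \<in> \<K>" and min: "\<And>B. B \<in> \<K> \<Longrightarrow> B \<subseteq> J0 \<Longrightarrow> B = J0"
    by (rule ex_minimal_member[OF bd ne sub]) (rule that; assumption)
  obtain P h0 where P: "P \<in> \<E>" "h0 \<in> mod_hom \<Lambda> P Z" "\<not> factors P h0 Y g" "J0 = J P h0"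
    using J0 unfolding \<K>_def by blast
  obtain Xs where Xs: "\<And>Y. Y \<in> set Xs \<Longrightarrow> indec Y" "mod_isomorphic \<Lambda> P (mod_sum Xs)"
    by (rule ex_decomposition[OF P(1)]) (rule that; assumption)
  from nonfactoring_component[OF E_fg[OF P(1)] indecD(2)[OF Xs(1)] Xs(2) yl zl d(5) P(2,3)]
  obtain W s where W: "W \<in> set Xs" "s \<in> mod_hom \<Lambda> W P" "\<not> factors W (\<lambda>x. h0 (s x)) Y g" by blast
  note Wi = Xs(1)[OF W(1)]
  note w = indecD[OF Wi]
  define h where "h = (\<lambda>x. h0 (s x))"
  have h: "h \<in> mod_hom \<Lambda> W Z" unfolding h_def by (rule mod_hom_comp[OF W(2) P(2)])
  have nf: "\<not> factors W h Y g" using W(3) by (simp add: h_def)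
  have "maps_through G W h \<subseteq> maps_through G P h0" by (rule maps_through_mono[OF gl W(2)]) (simp add: h_def)
  then have "J W h \<subseteq> J0" using Jmono P(4) by simp
  moreover have "J W h \<in> \<K>" unfolding \<K>_def using w(1) h nf by blast
  ultimately have JW: "J W h = J0" using min by blast
  interpret W: left_module \<Lambda> W by (rule w(3))
  have "factors V (\<lambda>v. h (r v)) Y g" if V: "V \<in> \<E>" and r: "r \<in> cat_radical \<Lambda> V W" for V r
  proof (rule ccontr)
    assume nfr: "\<not> factors V (\<lambda>v. h (r v)) Y g"
    note rh = cat_radical_hom[OF r] and vl = E_lm[OF V]
    note hr = mod_hom_comp[OF rh h]
    have "maps_through G V (\<lambda>v. h (r v)) \<subseteq> maps_through G W h" by (rule maps_through_mono[OF gl rh refl])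
    then have "J V (\<lambda>v. h (r v)) \<subseteq> J0" using Jmono JW by blast
    moreover have "J V (\<lambda>v. h (r v)) \<in> \<K>" unfolding \<K>_def using V hr nfr by blast
    ultimately have "J V (\<lambda>v. h (r v)) = J0" using min by blast
    then have "maps_through G W h \<subseteq> H.sub_sum (maps_through G Y g) (maps_through G V (\<lambda>v. h (r v)))"
      using H.sub_sum_upper(2)[OF I submodule_maps_through[OF gl w(3) zl h]] JW unfolding J_def I_def by simp
    moreover obtain n where "retract W (mod_sum (replicate n G))" using G(2)[OF w(1)] by blast
    ultimately obtain u b where ub: "u \<in> mod_hom \<Lambda> W Y" "b \<in> mod_hom \<Lambda> W V"
      "\<And>x. x \<in> carrier W \<Longrightarrow> h x = g (u x) \<oplus>\<^bsub>Z\<^esub> h (r (b x))"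
      using factor_if_maps_through[of W n G Y V Z g "\<lambda>v. h (r v)" h] gl yl vl zl d(5) hr h by metis
    \<comment> \<open>\<open>h (1 - r b) = g u\<close> with \<open>1 - r b\<close> invertible, because \<open>r\<close> is radical\<close>
    define \<phi> where "\<phi> = (\<lambda>x. x \<ominus>\<^bsub>W\<^esub> r (b x))"
    have rb: "r (b x) \<in> carrier W" if "x \<in> carrier W" for x
      using mod_homD(1)[OF rh mod_homD(1)[OF ub(2) that]] .
    have \<phi>: "\<phi> \<in> mod_hom \<Lambda> W W"
      unfolding \<phi>_def by (rule mod_hom_minus[OF w(3) mod_hom_id mod_hom_comp[OF ub(2) rh]])
    have "x = \<zero>\<^bsub>W\<^esub>" if x: "x \<in> carrier W" "\<phi> x = \<zero>\<^bsub>W\<^esub>" for x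
    proof -
      have "x = r (b x)" using x(2) W.minus_eq_zeroD[OF x(1) rb[OF x(1)]] by (simp add: \<phi>_def)
      then show ?thesis
        using bspec[OF r[unfolded cat_radical_iff'[OF E_fg[OF V] w(2) rh]] ub(2)] x(1) by simp
    qed
    then have "\<phi> \<in> mod_iso \<Lambda> W W" by (rule inj_endo_iso[OF w(2) \<phi>])
    then obtain \<psi> where \<psi>: "\<psi> \<in> mod_hom \<Lambda> W W" "\<And>x. x \<in> carrier W \<Longrightarrow> \<phi> (\<psi> x) = x"
      by (rule mod_isoE[OF w(3,3)]) (rule that; assumption)
    have h\<phi>: "h (\<phi> x) = g (u x)" if x: "x \<in> carrier W" for x
    proof -
      have c: "g (u x) \<in> carrier Z" "h (r (b x)) \<in> carrier Z"
        using mod_homD(1)[OF d(5) mod_homD(1)[OF ub(1) x]] mod_homD(1)[OF h rb[OF x]] by auto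
      have "h (\<phi> x) = h x \<ominus>\<^bsub>Z\<^esub> h (r (b x))"
        unfolding \<phi>_def using mod_hom_group(3)[OF w(3) zl h x rb[OF x]] .
      then show ?thesis using ub(3)[OF x] c by (simp add: a_minus_def Z.a_assoc Z.r_neg)
    qed
    have "factors W h Y g"
      by (rule factorsI[OF mod_hom_comp[OF \<psi>(1) ub(1)]])
        (simp add: \<psi>(2) mod_homD(1)[OF \<psi>(1)] flip: h\<phi>)
    then show False using nf by contradiction
  qed
  then show thesis by (rule that[OF Wi h nf])
qed

lemma split_relation:
  assumes c: "conflation \<Lambda> \<E> X f Y g Z" and s: "factors Z (\<lambda>z. z) Y g"
  shows "relation X Y Z = 0"
proof -
  note d = conflationD[OF c]
  obtain s where s: "s \<in> mod_hom \<Lambda> Z Y" "\<And>z. z \<in> carrier Z \<Longrightarrow> g (s z) = z"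
    using s unfolding factors_def by (metis (mono_tags))
  obtain r where "bisum \<Lambda> Y X Z f s r g" by (rule split_epi_bisum[OF c s])
  then show ?thesis using K0_class_bisum[OF d(2,1,3)] by simp
qed

text \<open>
  Induction on the corank in \<open>Hom(G, Z)\<close> of the maps that factor through \<open>g\<close>. With \<open>h : W \<rightarrow> Z\<close> from
  \<open>ex_simple_subfunctor\<close> and the pullback \<open>K\<close> of \<open>g\<close> and \<open>h\<close>, the projection \<open>K \<rightarrow> W\<close> is right almost
  split: it has no section because \<open>h\<close> does not factor through \<open>g\<close>, and a radical \<open>r\<close> lifts to \<open>K\<close>
  because \<open>h r\<close> does. The deflation \<open>Y \<oplus> W \<rightarrow> Z\<close> with kernel \<open>K\<close> admits more maps, namely \<open>h\<close>.
\<close>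

theorem relation_in_AR:
  assumes G: "G \<in> \<E>" "\<And>V. V \<in> \<E> \<Longrightarrow> \<exists>n. retract V (mod_sum (replicate n G))"
    and c: "conflation \<Lambda> \<E> X f Y g Z"
  shows "relation X Y Z \<in> AR_group \<Lambda> \<E>"
proof -
  note zE = conflationD(3)[OF c]
  note zl = E_lm[OF zE] and gl = E_lm[OF G(1)]
  let ?H = "hom_module G Z"
  interpret H: left_module R ?H by (rule left_module_hom_module[OF gl zl])
  interpret Z: left_module \<Lambda> Z by (rule zl)
  let ?L = "submods R ?H {\<zero>\<^bsub>?H\<^esub>} (carrier ?H)"
  have bd: "bounded_flags ?L" by (rule finite_length_hom_module[OF E_fg[OF G(1)] E_fg[OF zE]])
  have inL: "maps_through G Y g \<in> ?L" if c: "conflation \<Lambda> \<E> X f Y g Z" for X f Y g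
    using H.is_submoduleD(1,2)[OF submodule_maps_through[OF gl E_lm[OF conflationD(2)[OF c]] zl conflationD(5)[OF c]]]
      submodule_maps_through[OF gl E_lm[OF conflationD(2)[OF c]] zl conflationD(5)[OF c]]
    by (simp add: submods_def)
  show ?thesis
    using c
  proof (induction "height ?L - rank ?L (maps_through G Y g)" arbitrary: X f Y g rule: less_induct)
    case less
    note c = less.prems
    note d = conflationD[OF c]
    note xl = E_lm[OF d(1)] and yl = E_lm[OF d(2)]
    interpret Y: left_module \<Lambda> Y by (rule yl)
    interpret X: left_module \<Lambda> X by (rule xl)
    show ?case
    proof (cases "factors Z (\<lambda>z. z) Y g")
      case True
      then show ?thesis using split_relation[OF c True] AR_group_zero by simp
    next
      case False
      obtain W h where W: "indec W" and h: "h \<in> mod_hom \<Lambda> W Z" and nf: "\<not> factors W h Y g"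
        and rf: "\<And>V r. V \<in> \<E> \<Longrightarrow> r \<in> cat_radical \<Lambda> V W \<Longrightarrow> factors V (\<lambda>v. h (r v)) Y g"
        by (rule ex_simple_subfunctor[OF G c False]) ((rule that; assumption) | assumption)+
      note w = indecD[OF W]
      interpret W: left_module \<Lambda> W by (rule w(3))
      obtain D :: "('a, 'm) module" and i j p q where D: "D \<in> fg_mod \<Lambda>" "bisum \<Lambda> D Y W i j p q"
        by (rule ex_bisum[OF E_fg[OF d(2)] w(2)])
      note dl = fg_modD[OF D(1)]
      interpret D: left_module \<Lambda> D by (rule dl)
      note b = bisumD[OF D(2)]
      have DE: "D \<in> \<E>" by (rule E_bisum[OF d(2) w(1) D])
      note ii = mod_homD[OF b(1)] mod_hom_group[OF yl dl b(1)] and jj = mod_homD[OF b(2)] mod_hom_group[OF w(3) dl b(2)]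
        and pp = mod_homD[OF b(3)] mod_hom_group[OF dl yl b(3)] and qq = mod_homD[OF b(4)] mod_hom_group[OF dl w(3) b(4)]
        and gg = mod_homD[OF d(5)] mod_hom_group[OF yl zl d(5)] and hh = mod_homD[OF h] mod_hom_group[OF w(3) zl h]
      \<comment> \<open>The deflation \<open>(g, - h) : Y \<oplus> W \<rightarrow> Z\<close>, whose kernel is the pullback of \<open>g\<close> and \<open>h\<close>.\<close>
      define \<gamma> where "\<gamma> = (\<lambda>x. g (p x) \<ominus>\<^bsub>Z\<^esub> h (q x))"
      have \<gamma>: "\<gamma> \<in> mod_hom \<Lambda> D Z"
        unfolding \<gamma>_def by (rule mod_hom_minus[OF zl mod_hom_comp[OF b(3) d(5)] mod_hom_comp[OF b(4) h]])
      have \<gamma>i: "\<gamma> (i y) = g y" if "y \<in> carrier Y" for y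
        unfolding \<gamma>_def using that b(5,6) gg(1) hh(4) Z.add.inv_one[folded a_inv_def] by (simp add: a_minus_def)
      have \<gamma>surj: "\<gamma> ` carrier D = carrier Z"
      proof
        show "carrier Z \<subseteq> \<gamma> ` carrier D"
        proof
          fix z assume "z \<in> carrier Z"
          then obtain y where "y \<in> carrier Y" "z = g y" using d(8) by (metis imageE)
          then show "z \<in> \<gamma> ` carrier D" using \<gamma>i ii(1) by (metis imageI)
        qed
      qed (use mod_homD(1)[OF \<gamma>] in blast)
      define K where "K = submod D {x \<in> carrier D. \<gamma> x = \<zero>\<^bsub>Z\<^esub>}"
      have kc: "conflation \<Lambda> \<E> K (\<lambda>x. x) D \<gamma> Z" unfolding K_def by (rule kernel_conflation[OF DE zE \<gamma> \<gamma>surj])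
      have KE: "K \<in> \<E>" by (rule conflationD(1)[OF kc])
      note kl = E_lm[OF KE]
      have cK: "x \<in> carrier K \<longleftrightarrow> x \<in> carrier D \<and> g (p x) = h (q x)" for x
        unfolding K_def \<gamma>_def
        using Z.minus_eq_zeroD[of "g (p x)" "h (q x)"] pp(1) qq(1) gg(1) hh(1) by (auto simp: a_minus_def Z.r_neg)
      have gf: "g (f x) = \<zero>\<^bsub>Z\<^esub>" if "x \<in> carrier X" for x using d(7) that by blast
      have fc: "f x \<in> carrier Y" if "x \<in> carrier X" for x using mod_homD(1)[OF d(4) that] .
      have fK: "(\<lambda>x. i (f x)) \<in> mod_hom \<Lambda> X K"
        unfolding K_def
        by (rule mod_hom_into_submod[OF mod_hom_comp[OF d(4) b(1)]]) (use fc ii(1) \<gamma>i gf in auto)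
      have qK: "q \<in> mod_hom \<Lambda> K W" using mod_hom_comp[OF conflationD(4)[OF kc] b(4)] by simp
      have KW: "conflation \<Lambda> \<E> X (\<lambda>x. i (f x)) K q W"
      proof (rule conflationI[OF d(1) KE w(1) fK qK])
        show "inj_on (\<lambda>x. i (f x)) (carrier X)"
          using d(6) b(5) fc by (intro inj_onI) (metis inj_onD)
        show "(\<lambda>x. i (f x)) ` carrier X = {y \<in> carrier K. q y = \<zero>\<^bsub>W\<^esub>}"
        proof (intro equalityI subsetI)
          fix y assume "y \<in> (\<lambda>x. i (f x)) ` carrier X"
          then show "y \<in> {y \<in> carrier K. q y = \<zero>\<^bsub>W\<^esub>}" using mod_homD(1)[OF fK] b(6) fc by auto
        next
          fix y assume "y \<in> {y \<in> carrier K. q y = \<zero>\<^bsub>W\<^esub>}"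
          then have y: "y \<in> carrier D" "g (p y) = h (q y)" "q y = \<zero>\<^bsub>W\<^esub>" using cK by auto
          then have "p y \<in> f ` carrier X" unfolding d(7) using pp(1) hh(4) by simp
          then obtain x where x: "x \<in> carrier X" "p y = f x" by blast
          have "y = i (f x)" using b(9)[OF y(1)] y(3) x jj(4) ii(1) fc by simp
          then show "y \<in> (\<lambda>x. i (f x)) ` carrier X" using x(1) by blast
        qed
        show "q ` carrier K = carrier W"
        proof
          show "carrier W \<subseteq> q ` carrier K"
          proof
            fix v assume v: "v \<in> carrier W"
            have "h v \<in> g ` carrier Y" using d(8) hh(1)[OF v] by simp
            then obtain y where y: "y \<in> carrier Y" "h v = g y" by blast
            have "p (i y \<oplus>\<^bsub>D\<^esub> j v) = y" "q (i y \<oplus>\<^bsub>D\<^esub> j v) = v"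
              using y v by (simp_all add: pp qq ii(1) jj(1) b(5-8))
            moreover from this have "i y \<oplus>\<^bsub>D\<^esub> j v \<in> carrier K" using cK y v ii(1) jj(1) by simp
            ultimately show "v \<in> q ` carrier K" by (metis imageI)
          qed
        qed (use mod_homD(1)[OF qK] in blast)
      qed
      have "right_almost_split \<Lambda> \<E> K q W"
        unfolding right_almost_split_def
      proof (intro conjI W ballI)
        show "q \<in> cat_radical \<Lambda> K W"
          unfolding cat_radical_indec_target[OF W E_fg[OF KE] qK]
        proof
          assume "\<exists>s \<in> mod_hom \<Lambda> W K. \<forall>z \<in> carrier W. q (s z) = z"
          then obtain s where s: "s \<in> mod_hom \<Lambda> W K" "\<forall>z \<in> carrier W. q (s z) = z" by blast
          have eq: "h v = g (p (s v))" if "v \<in> carrier W" for v using mod_homD(1)[OF s(1)] cK s(2) that by simp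
          have "factors W h Y g"
            by (rule factorsI[OF mod_hom_comp[OF mod_hom_comp[OF s(1) conflationD(4)[OF kc]] b(3)]]) (rule eq)
          then show False using nf by contradiction
        qed
        fix V r assume V: "V \<in> \<E>" and r: "r \<in> cat_radical \<Lambda> V W"
        note rh = cat_radical_hom[OF r]
        obtain u where u: "u \<in> mod_hom \<Lambda> V Y" "\<And>v. v \<in> carrier V \<Longrightarrow> h (r v) = g (u v)"
          using rf[OF V r] unfolding factors_def by blast
        have uc: "u v \<in> carrier Y" "r v \<in> carrier W" if "v \<in> carrier V" for v
          using mod_homD(1)[OF u(1) that] mod_homD(1)[OF rh that] by auto
        have pq: "p (i (u v) \<oplus>\<^bsub>D\<^esub> j (r v)) = u v" "q (i (u v) \<oplus>\<^bsub>D\<^esub> j (r v)) = r v" if "v \<in> carrier V" for v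
          using uc[OF that] by (simp_all add: pp qq ii(1) jj(1) b(5-8))
        have "(\<lambda>v. i (u v) \<oplus>\<^bsub>D\<^esub> j (r v)) \<in> mod_hom \<Lambda> V D"
          by (rule mod_hom_add[OF dl mod_hom_comp[OF u(1) b(1)] mod_hom_comp[OF rh b(2)]])
        moreover have "i (u v) \<oplus>\<^bsub>D\<^esub> j (r v) \<in> carrier K" if "v \<in> carrier V" for v
          unfolding cK using pq[OF that] uc[OF that] u(2)[OF that] ii(1) jj(1) by simp
        ultimately have "(\<lambda>v. i (u v) \<oplus>\<^bsub>D\<^esub> j (r v)) \<in> mod_hom \<Lambda> V K"
          unfolding K_def by (intro mod_hom_into_submod) auto
        moreover have "\<forall>v \<in> carrier V. r v = q (i (u v) \<oplus>\<^bsub>D\<^esub> j (r v))" using pq(2) by simp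
        ultimately show "\<exists>k\<in>mod_hom \<Lambda> V K. \<forall>w\<in>carrier V. r w = q (k w)" by (intro bexI)
      qed
      then have AR: "relation X K W \<in> AR_group \<Lambda> \<E>" by (rule right_almost_split_relation_in_AR[OF KW])
      have le: "maps_through G Y g \<subseteq> maps_through G D \<gamma>"
        by (rule maps_through_mono[OF gl b(1)]) (simp add: \<gamma>i)
      have "maps_through G Y g \<noteq> maps_through G D \<gamma>"
      proof
        assume eq: "maps_through G Y g = maps_through G D \<gamma>"
        have "maps_through G W h \<subseteq> maps_through G D \<gamma>"
        proof (rule maps_through_mono[OF gl mod_hom_neg[OF dl b(2)]])
          fix v assume v: "v \<in> carrier W"
          show "h v = \<gamma> (\<ominus>\<^bsub>D\<^esub> j v)"
            unfolding \<gamma>_def using v Z.add.inv_one[folded a_inv_def] Y.add.inv_one[folded a_inv_def]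
            by (simp add: pp qq jj(1) b(7,8) gg(4,5) hh(1,5) a_minus_def)
        qed
        then have sub: "maps_through G W h \<subseteq> maps_through G Y g" using eq by simp
        obtain n where "retract W (mod_sum (replicate n G))" using G(2)[OF w(1)] by blast
        then show False using factors_iff_maps_through[OF _ gl yl zl d(5) h] sub nf by blast
      qed
      then have lt: "rank ?L (maps_through G Y g) < rank ?L (maps_through G D \<gamma>)"
        using rank_strict_mono[OF bd inL[OF c] inL[OF kc]] le by blast
      have "height ?L - rank ?L (maps_through G D \<gamma>) < height ?L - rank ?L (maps_through G Y g)"
        using lt rank_le_height[OF bd inL[OF kc]] by linarith
      then have IH: "relation K D Z \<in> AR_group \<Lambda> \<E>" by (rule less.hyps[OF _ kc])
      have "K0_class \<Lambda> \<E> D = K0_class \<Lambda> \<E> Y + K0_class \<Lambda> \<E> W" by (rule K0_class_bisum[OF DE d(2) w(1) D(2)])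
      then have eq: "relation X Y Z = relation X K W + relation K D Z" by simp
      show ?thesis unfolding eq by (rule AR_group_add[OF AR IH])
    qed
  qed
qed

lemma ex_retract_of_power:
  assumes G: "G \<in> \<E>" and V: "V \<in> add_closure \<Lambda> G"
  shows "\<exists>n. retract V (mod_sum (replicate n G))"
proof -
  obtain Y :: "('a, 'm) module" and n where Y: "V \<in> fg_mod \<Lambda>" "Y \<in> fg_mod \<Lambda>"
    "mod_isomorphic \<Lambda> (mod_sum (replicate n G)) (mod_sum [V, Y])"
    using V by (auto simp: add_closure_def)
  have l: "left_module \<Lambda> (mod_sum (replicate n G))"
    by (rule left_module_mod_sum[OF Lambda_ring]) (use E_lm[OF G] in auto)
  obtain i j p q where b: "bisum \<Lambda> (mod_sum (replicate n G)) V Y i j p q"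
    using bisum_iff_isomorphic[OF l fg_modD[OF Y(1)] fg_modD[OF Y(2)]] Y(3) by blast
  show ?thesis using retractI[OF bisumD(1,3,5)[OF b]] by blast
qed

theorem AR_eq_Ex_if_finite_type:
  assumes "finite_type \<Lambda> \<E>"
  shows "AR_group \<Lambda> \<E> = Ex_group \<Lambda> \<E>"
proof
  interpret F: group "K0_split \<Lambda> \<E>" by (simp add: K0_split_def)
  let ?AR = "{relation X Y Z | X f Y g Z. AR_conflation \<Lambda> \<E> X f Y g Z}"
    and ?Ex = "{relation X Y Z | X f Y g Z. conflation \<Lambda> \<E> X f Y g Z}"
  have sub: "?AR \<subseteq> ?Ex" unfolding AR_conflation_def by blast
  then show "AR_group \<Lambda> \<E> \<subseteq> Ex_group \<Lambda> \<E>"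
    unfolding AR_group_def Ex_group_def by (rule F.mono_generate)
  have "c \<in> carrier (K0_split \<Lambda> \<E>)" if c: "c \<in> ?AR" for c
  proof -
    obtain X f Y g Z where "c = relation X Y Z" "conflation \<Lambda> \<E> X f Y g Z" using c sub by blast
    then have "Poly_Mapping.keys c \<subseteq> ind \<Lambda> \<E>" using keys_relation by metis
    then show ?thesis by (simp add: K0_split_def)
  qed
  then have sg: "subgroup (AR_group \<Lambda> \<E>) (K0_split \<Lambda> \<E>)"
    unfolding AR_group_def by (intro F.generate_is_subgroup subsetI)
  obtain G where G: "G \<in> \<E>" "\<E> = add_closure \<Lambda> G" using assms unfolding finite_type_def by blast
  have "\<exists>n. retract V (mod_sum (replicate n G))" if "V \<in> \<E>" for V
    by (rule ex_retract_of_power[OF G(1)]) (use that G(2) in simp)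
  then have "?Ex \<subseteq> AR_group \<Lambda> \<E>" using relation_in_AR[OF G(1)] by blast
  then show "Ex_group \<Lambda> \<E> \<subseteq> AR_group \<Lambda> \<E>"
    unfolding Ex_group_def by (rule F.generate_subgroup_incl[OF _ sg])
qed

end

theorem theorem1:
  fixes R :: "('r, 'k) ring_scheme" and \<Lambda> :: "('r, 'a) module"
    and \<iota> :: "'a list \<Rightarrow> 'm" and \<E> :: "('a, 'm) module set"
  assumes "artin_algebra R \<Lambda>"
    and "inj \<iota>"
    and "resolving \<Lambda> \<E>"
    and "contravariantly_finite \<Lambda> \<E>"
  shows "finite_type \<Lambda> \<E> \<longleftrightarrow> AR_group \<Lambda> \<E> = Ex_group \<Lambda> \<E>"
proof -
  interpret artin_algebra R \<Lambda> by fact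
  interpret resolving_category R \<Lambda> \<iota> \<E>
    by unfold_locales (fact assms)+
  show ?thesis
    using AR_eq_Ex_if_finite_type finite_type_if_AR_eq_Ex assms(4) by blast
qed

end
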